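(* For a positive integer $n$ let $s(n)$ be the number of isomorphism classes of skew braces of size $n$. Let $p$ and $q$ be prime numbers. If $q\geq 5$, then $$s(4q)=\begin{cases} 29, & \text{if } q\equiv 3 \pmod 4,\\ 43, & \text{if } q\equiv 1 \pmod 4,\end{cases}$$ and if $q>p+1>3$, then $$s(p^2q)=\begin{cases} 4, & \text{if } q\not\equiv 1 \pmod p,\\ 2p^2+7p+8, & \text{if } q\equiv 1\pmod p \text{ and } q\not\equiv 1\pmod{p^2},\\ 6p^2+6p+8, & \text{if } q\equiv 1\pmod{p^2}.\end{cases}$$
   Context: A skew (left) brace is a triple $(B,+,\circ)$ where $(B,+)$ and $(B,\circ)$ are groups (not necessarily abelian, although the first is written additively) such that $a\circ(b+c)=a\circ b-a+a\circ c$ for all $a,b,c\in B$. An isomorphism of skew braces is a bijection that is a homomorphism for both operations. The size of a skew brace is the cardinality of $B$. *)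

theory Defs
  imports "HOL-Number_Theory.Cong" "HOL-Algebra.Ring"
begin

text \<open>
  The record type of rings serves as the signature of a skew brace: \<open>\<oplus>\<close> is the additive operation
  (not assumed commutative) and \<open>\<otimes>\<close> is the circle operation. Neither \<open>\<zero> = \<one>\<close> nor any
  ring law is assumed.
\<close>

locale skew_brace =
  fixes B (structure)
  assumes add_group: "group (add_monoid B)"
    and circ_group: "group B"
    and brace_distrib:
      "\<lbrakk>a \<in> carrier B; b \<in> carrier B; c \<in> carrier B\<rbrakk>
        \<Longrightarrow> a \<otimes> (b \<oplus> c) = a \<otimes> b \<ominus> a \<oplus> a \<otimes> c"

definition brace_iso :: "('a, 'm) ring_scheme \<Rightarrow> ('b, 'n) ring_scheme \<Rightarrow> ('a \<Rightarrow> 'b) set"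
  where "brace_iso B C = iso (add_monoid B) (add_monoid C) \<inter> iso B C"

definition brace_isomorphic :: "('a, 'm) ring_scheme \<Rightarrow> ('b, 'n) ring_scheme \<Rightarrow> bool"
  where "brace_isomorphic B C \<longleftrightarrow> brace_iso B C \<noteq> {}"

text \<open>
  Every skew brace of size \<open>n\<close>, over any type, is isomorphic to one with carrier \<open>{..<n}\<close> (see
  \<open>skew_brace_representative\<close> below), so counting the isomorphism classes of the latter suffices.
  The operations are not constrained outside the carrier; as isomorphism does not depend on their
  values there, this does not change the number of classes.
\<close>

definition skew_braces_of_size :: "nat \<Rightarrow> nat ring set"
  where "skew_braces_of_size n = {B. skew_brace B \<and> carrier B = {..<n}}"

definition brace_iso_rel :: "nat \<Rightarrow> nat ring rel"
  where "brace_iso_rel n =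
    {(B, C) \<in> skew_braces_of_size n \<times> skew_braces_of_size n. brace_isomorphic B C}"

definition num_skew_braces :: "nat \<Rightarrow> nat"
  where "num_skew_braces n = card (skew_braces_of_size n // brace_iso_rel n)"

lemma equiv_brace_iso_rel: "equiv (skew_braces_of_size n) (brace_iso_rel n)"
proof (rule equivI)
  show "brace_iso_rel n \<subseteq> skew_braces_of_size n \<times> skew_braces_of_size n"
    by (auto simp: brace_iso_rel_def)
  show "refl_on (skew_braces_of_size n) (brace_iso_rel n)"
  proof (rule refl_onI)
    fix B assume "B \<in> skew_braces_of_size n"
    moreover have "(\<lambda>x. x) \<in> brace_iso B B"
      by (auto simp: brace_iso_def iso_def hom_def bij_betw_def)
    ultimately show "(B, B) \<in> brace_iso_rel n"
      by (auto simp: brace_iso_rel_def brace_isomorphic_def)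
  qed
  show "sym (brace_iso_rel n)"
  proof (rule symI)
    fix B C assume r: "(B, C) \<in> brace_iso_rel n"
    then obtain h where h: "h \<in> iso (add_monoid B) (add_monoid C)" "h \<in> iso B C"
      and sb: "skew_brace B"
      by (auto simp: brace_iso_rel_def brace_isomorphic_def brace_iso_def skew_braces_of_size_def)
    have "inv_into (carrier B) h \<in> brace_iso C B"
      using group.iso_set_sym[OF skew_brace.add_group[OF sb] h(1)]
        group.iso_set_sym[OF skew_brace.circ_group[OF sb] h(2)]
      by (simp add: brace_iso_def)
    then show "(C, B) \<in> brace_iso_rel n"
      using r by (auto simp: brace_iso_rel_def brace_isomorphic_def)
  qed
  show "trans (brace_iso_rel n)"
  proof (rule transI)
    fix B C D assume r: "(B, C) \<in> brace_iso_rel n" "(C, D) \<in> brace_iso_rel n"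
    then obtain h k where "h \<in> brace_iso B C" "k \<in> brace_iso C D"
      by (auto simp: brace_iso_rel_def brace_isomorphic_def)
    then have "k \<circ> h \<in> brace_iso B D"
      by (auto simp: brace_iso_def intro: iso_set_trans)
    then show "(B, D) \<in> brace_iso_rel n"
      using r by (auto simp: brace_iso_rel_def brace_isomorphic_def)
  qed
qed

lemma group_transfer:
  assumes G: "group G" and h: "h \<in> hom G H" and b: "bij_betw h (carrier G) (carrier H)"
    and o: "\<one>\<^bsub>H\<^esub> = h \<one>\<^bsub>G\<^esub>"
  shows "group H"
proof -
  interpret G: group G by (rule G)
  have img: "carrier H = h ` carrier G" using b by (simp add: bij_betw_def)
  have m: "h x \<otimes>\<^bsub>H\<^esub> h y = h (x \<otimes>\<^bsub>G\<^esub> y)" if "x \<in> carrier G" "y \<in> carrier G" for x y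
    using h that by (simp add: hom_mult)
  show ?thesis
  proof (rule groupI)
    fix x assume "x \<in> carrier H"
    then obtain a where a: "x = h a" "a \<in> carrier G" using img by auto
    show "\<exists>y\<in>carrier H. y \<otimes>\<^bsub>H\<^esub> x = \<one>\<^bsub>H\<^esub>"
      by (rule bexI[of _ "h (inv\<^bsub>G\<^esub> a)"]) (use a in \<open>auto simp: img m o\<close>)
  qed (auto simp: img m o G.m_assoc)
qed

lemma skew_brace_representative:
  fixes B (structure)
  assumes B: "skew_brace B" and fin: "finite (carrier B)"
  shows "\<exists>C \<in> skew_braces_of_size (card (carrier B)). brace_isomorphic B C"
proof -
  interpret skew_brace B by (rule B)
  interpret A: group "add_monoid B" by (rule add_group)
  interpret M: group B by (rule circ_group)
  define n where "n = card (carrier B)"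
  obtain h where h: "bij_betw h (carrier B) {..<n}"
    using ex_bij_betw_finite_nat[OF fin] by (auto simp: n_def lessThan_atLeast0)
  define g where "g = inv_into (carrier B) h"
  have gh: "g (h x) = x" if "x \<in> carrier B" for x
    using h that by (simp add: g_def bij_betw_inv_into_left)
  define C :: "nat ring" where
    "C = \<lparr>carrier = {..<n}, mult = (\<lambda>x y. h (g x \<otimes> g y)), one = h \<one>,
          zero = h \<zero>, add = (\<lambda>x y. h (g x \<oplus> g y))\<rparr>"
  have img: "{..<n} = h ` carrier B" using h by (simp add: bij_betw_def)
  have hB: "h x \<in> {..<n}" if "x \<in> carrier B" for x using that img by blast
  have hadd: "h \<in> hom (add_monoid B) (add_monoid C)"
    using hB by (auto simp: hom_def C_def gh)
  have hmult: "h \<in> hom B C"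
    using hB by (auto simp: hom_def C_def gh)
  have gA: "group (add_monoid C)"
    by (rule group_transfer[OF add_group hadd]) (use h in \<open>auto simp: C_def\<close>)
  have gM: "group C"
    by (rule group_transfer[OF circ_group hmult]) (use h in \<open>auto simp: C_def\<close>)
  have acl: "x \<oplus> y \<in> carrier B" if "x \<in> carrier B" "y \<in> carrier B" for x y
    using A.m_closed[of x y] that by simp
  have icl: "\<ominus> x \<in> carrier B" if "x \<in> carrier B" for x
    using A.inv_closed[of x] that by (simp add: a_inv_def)
  have hinv: "\<ominus>\<^bsub>C\<^esub> h x = h (\<ominus> x)" if "x \<in> carrier B" for x
  proof -
    interpret group_hom "add_monoid B" "add_monoid C" h
      using add_group gA hadd by (simp add: group_hom_def group_hom_axioms_def)
    show ?thesis using hom_inv[of x] that by (simp add: a_inv_def)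
  qed
  have addC: "h x \<oplus>\<^bsub>C\<^esub> h y = h (x \<oplus> y)" if "x \<in> carrier B" "y \<in> carrier B" for x y
    using that by (simp add: C_def gh)
  have mulC: "h x \<otimes>\<^bsub>C\<^esub> h y = h (x \<otimes> y)" if "x \<in> carrier B" "y \<in> carrier B" for x y
    using that by (simp add: C_def gh)
  have cC: "carrier C = h ` carrier B" using img by (simp add: C_def)
  have "skew_brace C"
  proof (rule skew_brace.intro[OF gA gM])
    fix a b c assume "a \<in> carrier C" "b \<in> carrier C" "c \<in> carrier C"
    then obtain x y z where "a = h x" "b = h y" "c = h z"
      "x \<in> carrier B" "y \<in> carrier B" "z \<in> carrier B"
      by (auto simp: cC)
    then show "a \<otimes>\<^bsub>C\<^esub> (b \<oplus>\<^bsub>C\<^esub> c) = a \<otimes>\<^bsub>C\<^esub> b \<ominus>\<^bsub>C\<^esub> a \<oplus>\<^bsub>C\<^esub> a \<otimes>\<^bsub>C\<^esub> c"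
      using brace_distrib[of x y z] by (simp add: a_minus_def addC mulC hinv acl icl)
  qed
  moreover have "h \<in> brace_iso B C"
    using hadd hmult h by (simp add: brace_iso_def iso_def C_def)
  ultimately show ?thesis
    by (auto simp: skew_braces_of_size_def brace_isomorphic_def n_def C_def)
qed

end

theory Submission imports Defs "HOL-Algebra.Group_Action" "HOL-Algebra.Sylow"
  "HOL-Algebra.Multiplicative_Group" "HOL-Number_Theory.Number_Theory"
begin

text \<open>
  Let \<open>B\<close> have size \<open>p\<^sup>2 q\<close> with \<open>q > p + 1\<close>. The Sylow \<open>q\<close>-subgroup \<open>Q\<close> of the additive group is
  normal and characteristic, hence an ideal. The number of two-sided additive translates of a Sylow
  \<open>p\<close>-subgroup is prime to \<open>p\<close>, so a multiplicative Sylow \<open>p\<close>-subgroup acting on them by left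
  multiplication has a fixed point; thus some Sylow \<open>p\<close>-subgroup \<open>P\<close> is a sub skew brace, and \<open>B\<close> is
  determined by \<open>P\<close> together with characters \<open>\<tau>, \<delta>, \<gamma>\<close> of \<open>P\<close> with values in the units modulo \<open>q\<close>,
  where \<open>\<gamma>\<close> is either trivial or equal to \<open>\<tau>\<close>.

  The brace \<open>P\<close> is one of four, presented by \<open>p z = 0\<close>, \<open>p e = \<kappa> z\<close> and \<open>e \<circ> e = \<epsilon> z + 2 e\<close> with
  \<open>\<kappa>, \<epsilon> \<in> {0, 1}\<close>. The characters are given by exponents modulo \<open>gcd (p\<^sup>2) (q - 1)\<close>, and the
  isomorphism classes are the orbits of the automorphisms of \<open>P\<close> on these exponents; every orbit with
  \<open>\<tau>\<close> nontrivial counts twice, once for each choice of \<open>\<gamma>\<close>.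
\<close>

text \<open>An additive Sylow \<open>p\<close>-subgroup need not be closed under the circle
  operation, nor a multiplicative one under addition. Left circle multiplication by \<open>h\<close>
  is the automorphism \<open>lam h\<close> followed by a translation, and \<open>lam h\<close> may
  replace \<open>P\<close> by a conjugate. Two-sided translates are what it permutes, and a fixed
  one, moved back through the identity, is closed under both operations.

  The dichotomy for \<open>\<gamma>\<close> comes from the brace law, which makes
  \<open>\<gamma> - 1\<close> a crossed homomorphism over \<open>\<tau>\<close>. As \<open>P\<close>
  is abelian, it is proportional to \<open>1 - \<tau>\<close> when \<open>\<tau>\<close> is
  nontrivial, and multiplicativity of \<open>\<gamma>\<close> leaves only two factors.

  The prime \<open>q\<close> enters the count only through \<open>gcd (p^2) (q - 1)\<close>, which
  is 1, \<open>p\<close> or \<open>p^2\<close>: hence three cases. The prime 2 stands apart because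
  the \<open>p\<close>-th circle power of \<open>e\<close> is
  \<open>(\<kappa> + \<epsilon> p (p - 1) / 2) z\<close>, and \<open>p\<close> divides
  \<open>p (p - 1) / 2\<close> only if \<open>p\<close> is odd. For \<open>\<epsilon> = 1\<close>
  the circle group of \<open>P\<close> is therefore cyclic at \<open>\<kappa> = 1\<close> when
  \<open>p\<close> is odd, but at \<open>\<kappa> = 0\<close> when \<open>p = 2\<close>.\<close>

lemma elementary_group_action:
  fixes G (structure)
  assumes G: "group G"
    and closed: "\<And>g x. g \<in> carrier G \<Longrightarrow> x \<in> E \<Longrightarrow> \<phi> g x \<in> E"
    and one: "\<And>x. x \<in> E \<Longrightarrow> \<phi> \<one> x = x"
    and mult: "\<And>g h x. g \<in> carrier G \<Longrightarrow> h \<in> carrier G \<Longrightarrow> x \<in> E \<Longrightarrow> \<phi> (g \<otimes> h) x = \<phi> g (\<phi> h x)"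
  shows "group_action G E (\<lambda>g. \<lambda>x\<in>E. \<phi> g x)"
proof -
  interpret group G by (rule G)
  have bij: "(\<lambda>x\<in>E. \<phi> g x) \<in> Bij E" if g: "g \<in> carrier G" for g
  proof -
    have "bij_betw (\<phi> g) E E"
    proof (rule bij_betw_byWitness[where f' = "\<phi> (inv g)"])
      show "\<forall>a\<in>E. \<phi> (inv g) (\<phi> g a) = a" "\<forall>a\<in>E. \<phi> g (\<phi> (inv g) a) = a"
        using g one mult by (metis l_inv r_inv inv_closed)+
    qed (use g closed in auto)
    then show ?thesis
      by (simp add: Bij_def bij_betw_def inj_on_def)
  qed
  show ?thesis
    unfolding group_action_def group_hom_def group_hom_axioms_def
  proof (intro conjI G group_BijGroup homI)
    show "(\<lambda>x\<in>E. \<phi> g x) \<in> carrier (BijGroup E)" if "g \<in> carrier G" for g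
      using bij[OF that] by (simp add: BijGroup_def)
    show "(\<lambda>x\<in>E. \<phi> (g \<otimes> h) x) = (\<lambda>x\<in>E. \<phi> g x) \<otimes>\<^bsub>BijGroup E\<^esub> (\<lambda>x\<in>E. \<phi> h x)"
      if "g \<in> carrier G" "h \<in> carrier G" for g h
      using bij[OF that(1)] bij[OF that(2)] that
      by (auto simp: BijGroup_def compose_def fun_eq_iff closed mult)
  qed
qed

text \<open>Transitivity makes \<open>E\<close> a single orbit, so orbit-stabilizer applies
  directly. Needed to see that the translates of a Sylow subgroup are counted by a divisor of
  \<open>q * q\<close>.\<close>

lemma transitive_action_card_dvd:
  fixes G (structure)
  assumes G: "group G"
    and closed: "\<And>g x. g \<in> carrier G \<Longrightarrow> x \<in> E \<Longrightarrow> \<phi> g x \<in> E"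
    and one: "\<And>x. x \<in> E \<Longrightarrow> \<phi> \<one> x = x"
    and mult: "\<And>g h x. g \<in> carrier G \<Longrightarrow> h \<in> carrier G \<Longrightarrow> x \<in> E \<Longrightarrow> \<phi> (g \<otimes> h) x = \<phi> g (\<phi> h x)"
    and x: "x \<in> E" and trans: "\<And>y. y \<in> E \<Longrightarrow> \<exists>g\<in>carrier G. y = \<phi> g x"
  shows "card E dvd order G"
proof -
  interpret group_action G E "\<lambda>g. \<lambda>x\<in>E. \<phi> g x"
    by (rule elementary_group_action[OF G]) (use closed one mult in auto)
  have "orbit G (\<lambda>g. \<lambda>x\<in>E. \<phi> g x) x = E"
    using x trans closed by (auto simp: orbit_def)
  then show ?thesis
    using orbit_stabilizer_theorem[OF x] by (metis dvd_triv_left)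
qed

text \<open>Orbits have \<open>p\<close>-power size, so all but the singletons vanish modulo
  \<open>p\<close>, and the singletons are the fixed points. This congruence yields the nontrivial
  centre, the conjugacy of Sylow subgroups, the fixed translate in \<open>ex_sub_brace\<close> and
  the basis vector fixed by \<open>lam\<close>.\<close>

lemma prime_power_group_fixed_points:
  fixes G (structure)
  assumes G: "group G" and p: "Factorial_Ring.prime p" and ord: "order G = p ^ k" and fin: "finite E"
    and closed: "\<And>g x. g \<in> carrier G \<Longrightarrow> x \<in> E \<Longrightarrow> \<phi> g x \<in> E"
    and one: "\<And>x. x \<in> E \<Longrightarrow> \<phi> \<one> x = x"
    and mult: "\<And>g h x. g \<in> carrier G \<Longrightarrow> h \<in> carrier G \<Longrightarrow> x \<in> E \<Longrightarrow> \<phi> (g \<otimes> h) x = \<phi> g (\<phi> h x)"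
  shows "[card E = card {x \<in> E. \<forall>g\<in>carrier G. \<phi> g x = x}] (mod p)"
proof -
  define \<psi> where "\<psi> = (\<lambda>g. \<lambda>x\<in>E. \<phi> g x)"
  interpret group_action G E \<psi>
    unfolding \<psi>_def by (rule elementary_group_action[OF G]) (use closed one mult in auto)
  let ?F = "{x \<in> E. \<forall>g\<in>carrier G. \<phi> g x = x}"
  let ?O = "orbits G E \<psi>"
  have part: "partition E ?O" by (rule orbit_partition)
  have un: "\<Union>?O = E" using partition.partition_coverture[OF part] .
  have finO: "finite ?O" using un fin by (metis finite_UnionD)
  have disj: "pairwise disjnt ?O"
    using partition.disjoint_union[OF part] by (auto simp: pairwise_def disjnt_def)
  have cE: "card E = (\<Sum>A\<in>?O. card A)"
    using card_Union_disjoint[OF disj] un fin finite_subset by (metis Sup_upper)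
  have orb: "card A = 1 \<or> p dvd card A" if A: "A \<in> ?O" for A
  proof -
    obtain x where "x \<in> E" "A = orbit G \<psi> x" using A by (auto simp: Group_Action.orbits_def)
    then have "card A dvd p ^ k" using orbit_stabilizer_theorem[of x] ord by (metis dvd_triv_left)
    then obtain i where "card A = p ^ i" using divides_primepow_nat[OF p] by blast
    then show ?thesis by (cases i) auto
  qed
  have one_iff: "{A \<in> ?O. card A = 1} = (\<lambda>x. {x}) ` ?F"
  proof (intro equalityI subsetI)
    fix A assume "A \<in> {A \<in> ?O. card A = 1}"
    then obtain x where x: "x \<in> E" "A = orbit G \<psi> x" "card A = 1" by (auto simp: Group_Action.orbits_def)
    have "x \<in> A" using orbit_refl[OF x(1)] x(2) by simp
    then have A: "A = {x}" using x(3) by (metis card_1_singletonE singletonD)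
    have "\<phi> g x = x" if "g \<in> carrier G" for g
    proof -
      have "\<psi> g x \<in> A" using that x(2) by (auto simp: orbit_def)
      then show ?thesis using A x(1) by (simp add: \<psi>_def)
    qed
    then show "A \<in> (\<lambda>x. {x}) ` ?F" using A x(1) by auto
  next
    fix A assume "A \<in> (\<lambda>x. {x}) ` ?F"
    then obtain x where x: "A = {x}" "x \<in> E" "\<And>g. g \<in> carrier G \<Longrightarrow> \<phi> g x = x" by auto
    interpret Gr: group G by (rule G)
    have "orbit G \<psi> x = (\<lambda>g. \<phi> g x) ` carrier G" using x(2) by (auto simp: orbit_def \<psi>_def)
    also have "\<dots> = (\<lambda>g. x) ` carrier G" by (rule image_cong) (use x(3) in auto)
    also have "\<dots> = {x}" using Gr.one_closed by blast
    finally have "orbit G \<psi> x = {x}" .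
    then show "A \<in> {A \<in> ?O. card A = 1}" using x(1,2) by (auto simp: Group_Action.orbits_def)
  qed
  have split: "(\<Sum>A\<in>?O. card A) = (\<Sum>A\<in>?O - {A \<in> ?O. card A = 1}. card A) + (\<Sum>A\<in>{A \<in> ?O. card A = 1}. card A)"
    by (rule sum.subset_diff[OF _ finO]) blast
  have ones: "(\<Sum>A\<in>{A \<in> ?O. card A = 1}. card A) = card ?F"
  proof -
    have "(\<Sum>A\<in>{A \<in> ?O. card A = 1}. card A) = (\<Sum>A\<in>{A \<in> ?O. card A = 1}. 1)"
      by (rule sum.cong) auto
    also have "\<dots> = card {A \<in> ?O. card A = 1}" by simp
    also have "\<dots> = card ?F" unfolding one_iff by (rule card_image) (auto simp: inj_on_def)
    finally show ?thesis .
  qed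
  have "p dvd (\<Sum>A\<in>?O - {A \<in> ?O. card A = 1}. card A)"
    by (rule dvd_sum) (use orb in auto)
  then obtain k where k: "(\<Sum>A\<in>?O - {A \<in> ?O. card A = 1}. card A) = p * k" by (rule dvdE)
  have "card E = p * k + card ?F"
    unfolding cE split ones k ..
  then show ?thesis unfolding cong_def by simp
qed

lemma (in group) inv_commutes:
  assumes "a \<in> carrier G" "g \<in> carrier G" "a \<otimes> g = g \<otimes> a"
  shows "inv a \<otimes> g = g \<otimes> inv a"
proof -
  have "inv a \<otimes> g = inv a \<otimes> (g \<otimes> a) \<otimes> inv a"
    using assms(1,2) by (simp add: m_assoc)
  also have "\<dots> = inv a \<otimes> (a \<otimes> g) \<otimes> inv a"
    using assms(3) by simp
  also have "\<dots> = g \<otimes> inv a"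
    using assms(1,2) by (simp add: m_assoc[symmetric])
  finally show ?thesis .
qed

lemma (in monoid) mult_commutes:
  assumes c: "a \<in> carrier G" "b \<in> carrier G" "g \<in> carrier G"
    and a: "a \<otimes> g = g \<otimes> a" and b: "b \<otimes> g = g \<otimes> b"
  shows "a \<otimes> b \<otimes> g = g \<otimes> (a \<otimes> b)"
proof -
  have "a \<otimes> b \<otimes> g = a \<otimes> (g \<otimes> b)" using c by (simp add: m_assoc b)
  also have "\<dots> = g \<otimes> a \<otimes> b" using c by (simp add: m_assoc[symmetric] a)
  also have "\<dots> = g \<otimes> (a \<otimes> b)" using c by (simp add: m_assoc)
  finally show ?thesis .
qed

text \<open>Conjugation has a nontrivial set \<open>Z\<close> of fixed points, the centre. The
  centralizer of a noncentral \<open>x\<close> would contain \<open>Z\<close> and \<open>x\<close>,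
  hence have order above \<open>p\<close>, hence be the whole group, which makes \<open>x\<close>
  central after all.\<close>

lemma (in group) card_order_prime_square_comm:
  assumes p: "Factorial_Ring.prime p" and ord: "order G = p ^ 2"
    and xy: "x \<in> carrier G" "y \<in> carrier G"
  shows "x \<otimes> y = y \<otimes> x"
proof -
  have fin: "finite (carrier G)"
    using ord p by (metis card.infinite order_def pos2 power_eq_0_iff prime_gt_0_nat less_numeral_extra(3))
  define Z where "Z = {z \<in> carrier G. \<forall>g\<in>carrier G. g \<otimes> z \<otimes> inv g = z}"
  have Z_iff: "z \<in> Z \<longleftrightarrow> z \<in> carrier G \<and> (\<forall>g\<in>carrier G. g \<otimes> z = z \<otimes> g)" for z
  proof -
    have "g \<otimes> z \<otimes> inv g = z \<longleftrightarrow> g \<otimes> z = z \<otimes> g" if "z \<in> carrier G" "g \<in> carrier G" for g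
      using that inv_solve_right[of z "g \<otimes> z" g] by auto
    then show ?thesis by (auto simp: Z_def)
  qed
  have "[card (carrier G) = card Z] (mod p)"
    unfolding Z_def
    by (rule prime_power_group_fixed_points[OF is_group p ord fin])
      (auto simp: inv_mult_group m_assoc)
  then have pZ: "p dvd card Z"
    using ord cong_dvd_iff[of "p ^ 2" "card Z" p] by (simp add: order_def)
  have subZ: "subgroup Z G"
  proof (rule subgroupI)
    show "Z \<noteq> {}" using Z_iff[of \<one>] by auto
    fix a assume a: "a \<in> Z"
    have ac: "a \<in> carrier G" using a by (simp add: Z_def)
    have "g \<otimes> inv a = inv a \<otimes> g" if "g \<in> carrier G" for g
    proof -
      have "a \<otimes> g = g \<otimes> a" using a that unfolding Z_iff by metis
      then show ?thesis using inv_commutes[OF ac that] by simp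
    qed
    then show "inv a \<in> Z" unfolding Z_iff using ac by blast
  next
    fix a b assume ab: "a \<in> Z" "b \<in> Z"
    then have c: "a \<in> carrier G" "b \<in> carrier G" by (auto simp: Z_def)
    have "g \<otimes> (a \<otimes> b) = a \<otimes> b \<otimes> g" if g: "g \<in> carrier G" for g
    proof (rule mult_commutes[OF c g, symmetric])
      show "a \<otimes> g = g \<otimes> a" "b \<otimes> g = g \<otimes> b"
        using ab g unfolding Z_iff by metis+
    qed
    then show "a \<otimes> b \<in> Z" unfolding Z_iff using c by blast
  qed (auto simp: Z_def)
  have "Z = carrier G"
  proof (rule ccontr)
    assume "Z \<noteq> carrier G"
    then obtain x where x: "x \<in> carrier G" "x \<notin> Z"
      using subgroup.subset[OF subZ] by blast
    define C where "C = {g \<in> carrier G. g \<otimes> x = x \<otimes> g}"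
    have subC: "subgroup C G"
    proof (rule subgroupI)
      show "C \<noteq> {}" using x by (auto simp: C_def)
      fix a assume "a \<in> C"
      then have a: "a \<in> carrier G" "a \<otimes> x = x \<otimes> a" by (auto simp: C_def)
      then show "inv a \<in> C" using inv_commutes[OF _ x(1)] by (simp add: C_def)
    next
      fix a b assume "a \<in> C" "b \<in> C"
      then show "a \<otimes> b \<in> C" using mult_commutes[OF _ _ x(1), of a b] by (simp add: C_def)
    qed (auto simp: C_def)
    have "x \<in> C" using x(1) by (simp add: C_def)
    moreover have "Z \<subseteq> C"
    proof
      fix z assume "z \<in> Z"
      then have "z \<in> carrier G" "x \<otimes> z = z \<otimes> x" unfolding Z_iff using x(1) by blast+
      then show "z \<in> C" by (simp add: C_def)
    qed
    ultimately have ZC: "Z \<subset> C" using x(2) by blast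
    have finC: "finite C" using fin by (auto simp: C_def)
    have "card C dvd p ^ 2" using lagrange[OF subC] ord by (metis dvd_triv_right)
    then obtain i where i: "card C = p ^ i" "i \<le> 2" using divides_primepow_nat[OF p] by blast
    have "card Z < card C" by (rule psubset_card_mono[OF finC ZC])
    moreover have "card Z > 0"
      using subgroup.finite_imp_card_positive[OF subZ fin] .
    then have "card Z \<ge> p" using pZ by (simp add: dvd_imp_le)
    ultimately have "p ^ 1 < p ^ i" using i by simp
    then have "1 < i" using p by (meson power_less_imp_less_exp prime_gt_1_nat)
    then have "i = 2" using i(2) by simp
    then have "card C = card (carrier G)" using i ord by (simp add: order_def)
    then have "C = carrier G" using card_subset_eq[OF fin subgroup.subset[OF subC]] by simp
    then have "x \<in> Z" unfolding Z_iff using x(1) by (auto simp: C_def)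
    then show False using x by simp
  qed
  then have "y \<in> Z" using xy by simp
  then show ?thesis unfolding Z_iff using xy by blast
qed

section \<open>Groups of order $p^2 q$\<close>

locale p2q_group = group +
  fixes p q :: nat
  assumes p: "Factorial_Ring.prime p" and q: "Factorial_Ring.prime q" and qp: "q > p + 1"
    and ord: "order G = p ^ 2 * q"
begin

lemma fin: "finite (carrier G)"
  using ord p q by (metis card.infinite order_def no_zero_divisors power_not_zero not_prime_0)

lemma coprime_pq: "coprime p q"
  using p q qp by (simp add: primes_coprime)

lemma coprime_p2q: "coprime (p ^ 2) q"
  using coprime_pq by simp

text \<open>The inverse turns right multiplication on right cosets into a left action, the form in
  which the fixed point congruence is stated.\<close>

lemma rcos_right_action:
  assumes "H \<subseteq> carrier G" "g \<in> carrier G" "h \<in> carrier G"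
  shows "H #> inv (g \<otimes> h) = H #> inv h #> inv g"
  using assms by (simp add: coset_mult_assoc inv_mult_group)

text \<open>The \<open>r\<close>-group \<open>A\<close> acts on the \<open>m\<close> right cosets of
  \<open>H\<close>. With \<open>A = H\<close> of order \<open>q\<close> this leads to the normalizer
  of \<open>H\<close>, with two subgroups of order \<open>p^2\<close> to their conjugacy.\<close>

lemma fixed_rcosets:
  assumes H: "subgroup H G" and A: "subgroup A G" and r: "Factorial_Ring.prime r"
    and cA: "card A = r ^ k" and cH: "card H * m = order G"
  shows "[m = card {X \<in> rcosets H. \<forall>h\<in>A. X #> inv h = X}] (mod r)"
proof -
  have cR: "card (rcosets H) = m"
  proof -
    have "card (rcosets H) * card H = m * card H"
      using lagrange[OF H] cH by (simp add: mult.commute)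
    moreover have "card H > 0" using subgroup.finite_imp_card_positive[OF H fin] .
    ultimately show ?thesis by simp
  qed
  have sub: "X \<subseteq> carrier G" if "X \<in> rcosets H" for X
    using that H subgroup.rcosets_carrier[OF H is_group] by blast
  have finR: "finite (rcosets H)"
    using fin sub by (meson Pow_iff finite_Pow_iff finite_subset subsetI)
  interpret A: subgroup A G by (rule A)
  have grA: "group (G\<lparr>carrier := A\<rparr>)" by (rule A.subgroup_is_group[OF is_group])
  have "[card (rcosets H) = card {X \<in> rcosets H. \<forall>g\<in>carrier (G\<lparr>carrier := A\<rparr>). X #> inv g = X}] (mod r)"
  proof (rule prime_power_group_fixed_points[OF grA r _ finR])
    show "order (G\<lparr>carrier := A\<rparr>) = r ^ k" using cA by (simp add: order_def)
    fix g X assume gX: "g \<in> carrier (G\<lparr>carrier := A\<rparr>)" "X \<in> rcosets H"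
    then have g: "g \<in> carrier G" by auto
    obtain x where x: "x \<in> carrier G" "X = H #> x" using gX(2) by (auto simp: RCOSETS_def)
    have "X #> inv g = H #> (x \<otimes> inv g)"
      using x g subgroup.subset[OF H] by (simp add: coset_mult_assoc)
    then show "X #> inv g \<in> rcosets H" using x g by (auto simp: RCOSETS_def)
  next
    fix X assume "X \<in> rcosets H"
    then show "X #> inv \<one>\<^bsub>G\<lparr>carrier := A\<rparr>\<^esub> = X" using sub by simp
  next
    fix g h X assume "g \<in> carrier (G\<lparr>carrier := A\<rparr>)" "h \<in> carrier (G\<lparr>carrier := A\<rparr>)" "X \<in> rcosets H"
    then show "X #> inv (g \<otimes>\<^bsub>G\<lparr>carrier := A\<rparr>\<^esub> h) = X #> inv h #> inv g"
      using sub rcos_right_action by auto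
  qed
  then show ?thesis using cR by simp
qed

text \<open>\<open>H b h = H b\<close> means that \<open>b h b^-1\<close> lies in \<open>H\<close>;
  quantification over the whole subgroup \<open>A\<close> absorbs the inverse that occurs in the
  action.\<close>

lemma fixed_rcos_iff:
  assumes H: "subgroup H G" and A: "subgroup A G" and b: "b \<in> carrier G"
  shows "(\<forall>h\<in>A. H #> b #> inv h = H #> b) \<longleftrightarrow> (\<forall>h\<in>A. b \<otimes> h \<otimes> inv b \<in> H)"
proof -
  have *: "H #> b #> inv h = H #> b \<longleftrightarrow> b \<otimes> inv h \<otimes> inv b \<in> H" if "h \<in> carrier G" for h
  proof -
    have "H #> b #> inv h = H #> (b \<otimes> inv h)"
      using b that subgroup.subset[OF H] by (simp add: coset_mult_assoc)
    moreover have "H #> (b \<otimes> inv h) = H #> b \<longleftrightarrow> b \<otimes> inv h \<in> H #> b"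
      using b that repr_independence[OF _ b H] rcos_self[of "b \<otimes> inv h" H] H by auto
    moreover have "b \<otimes> inv h \<in> H #> b \<longleftrightarrow> b \<otimes> inv h \<otimes> inv b \<in> H"
      using subgroup.rcos_module[OF H is_group b, of "b \<otimes> inv h"] b that by auto
    ultimately show ?thesis by simp
  qed
  show ?thesis
  proof
    assume L: "\<forall>h\<in>A. H #> b #> inv h = H #> b"
    show "\<forall>h\<in>A. b \<otimes> h \<otimes> inv b \<in> H"
    proof
      fix h assume h: "h \<in> A"
      then have "inv h \<in> A" "h \<in> carrier G" using A by (auto intro: subgroup.m_inv_closed subgroup.mem_carrier)
      then show "b \<otimes> h \<otimes> inv b \<in> H" using L *[of "inv h"] by auto
    qed
  next
    assume R: "\<forall>h\<in>A. b \<otimes> h \<otimes> inv b \<in> H"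
    show "\<forall>h\<in>A. H #> b #> inv h = H #> b"
    proof
      fix h assume h: "h \<in> A"
      then have "inv h \<in> A" "h \<in> carrier G" using A by (auto intro: subgroup.m_inv_closed subgroup.mem_carrier)
      then show "H #> b #> inv h = H #> b" using R *[of "h"] by auto
    qed
  qed
qed

lemma conj_image_eq:
  assumes H: "H \<subseteq> carrier G" and A: "A \<subseteq> carrier G" and c: "card H = card A"
    and b: "b \<in> carrier G" and sub: "\<And>h. h \<in> A \<Longrightarrow> b \<otimes> h \<otimes> inv b \<in> H"
  shows "(\<lambda>h. b \<otimes> h \<otimes> inv b) ` A = H"
proof (rule card_subset_eq)
  show "finite H" using H fin finite_subset by auto
  have "inj_on (\<lambda>h. b \<otimes> h \<otimes> inv b) A"
    using b A by (auto simp: inj_on_def subset_iff)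
  then show "card ((\<lambda>h. b \<otimes> h \<otimes> inv b) ` A) = card H" using c by (simp add: card_image)
qed (use sub in auto)

text \<open>
  With \<open>N\<close> the normalizer of \<open>H\<close>, the group \<open>H\<close> fixes \<open>card N div q\<close> of the \<open>p\<^sup>2\<close> cosets of \<open>H\<close>. This
  number divides \<open>p\<^sup>2\<close> and is congruent to \<open>p\<^sup>2\<close> modulo \<open>q\<close>; it is \<open>p\<^sup>2\<close>, because \<open>q > p + 1\<close>.
\<close>
lemma order_q_normal:
  assumes H: "subgroup H G" and cH: "card H = q"
  shows "H \<lhd> G"
proof -
  have HG: "H \<subseteq> carrier G" using subgroup.subset[OF H] .
  define N where "N = {x \<in> carrier G. \<forall>h\<in>H. x \<otimes> h \<otimes> inv x \<in> H}"
  have Nimg: "(\<lambda>h. x \<otimes> h \<otimes> inv x) ` H = H" if "x \<in> N" for x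
    using that conj_image_eq[OF HG HG] by (auto simp: N_def)
  have subN: "subgroup N G"
  proof (rule subgroupI)
    show "N \<noteq> {}" using HG by (auto simp: N_def intro!: exI[of _ \<one>])
    fix a assume a: "a \<in> N"
    then have ac: "a \<in> carrier G" by (simp add: N_def)
    have "inv a \<otimes> h \<otimes> inv (inv a) \<in> H" if "h \<in> H" for h
    proof -
      obtain h' where h': "h' \<in> H" "h = a \<otimes> h' \<otimes> inv a" using Nimg[OF a] \<open>h \<in> H\<close> by auto
      have "h' \<in> carrier G" using h' HG by auto
      then have "inv a \<otimes> h \<otimes> inv (inv a) = inv a \<otimes> (a \<otimes> h')"
        using ac h'(2) by (simp add: m_assoc)
      also have "\<dots> = h'" using ac \<open>h' \<in> carrier G\<close> by (simp add: m_assoc[symmetric])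
      finally have "inv a \<otimes> h \<otimes> inv (inv a) = h'" .
      then show ?thesis using h' by simp
    qed
    then show "inv a \<in> N" using ac by (simp add: N_def)
  next
    fix a b assume ab: "a \<in> N" "b \<in> N"
    then have c: "a \<in> carrier G" "b \<in> carrier G" by (auto simp: N_def)
    have "a \<otimes> b \<otimes> h \<otimes> inv (a \<otimes> b) \<in> H" if "h \<in> H" for h
    proof -
      have "a \<otimes> b \<otimes> h \<otimes> inv (a \<otimes> b) = a \<otimes> (b \<otimes> h \<otimes> inv b) \<otimes> inv a"
        using c that HG by (auto simp: m_assoc inv_mult_group)
      moreover have "b \<otimes> h \<otimes> inv b \<in> H" using ab that by (auto simp: N_def)
      ultimately show ?thesis using ab by (auto simp: N_def)
    qed
    then show "a \<otimes> b \<in> N" using c by (simp add: N_def)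
  qed (auto simp: N_def)
  have HN: "H \<subseteq> N" using H HG by (auto simp: N_def subgroup.m_closed subgroup.m_inv_closed)
  let ?F = "{X \<in> rcosets H. \<forall>h\<in>H. X #> inv h = X}"
  \<comment> \<open>By \<open>fixed_rcos_iff\<close> with \<open>A = H\<close>, the coset
    \<open>H b\<close> is fixed exactly when \<open>b\<close> normalizes \<open>H\<close>: the fixed
    cosets are the cosets of \<open>H\<close> inside \<open>N\<close>.\<close>
  have F: "?F = rcosets\<^bsub>G\<lparr>carrier := N\<rparr>\<^esub> H"
    using fixed_rcos_iff[OF H H] by (auto simp: RCOSETS_def N_def)
  have "subgroup H (G\<lparr>carrier := N\<rparr>)" using subgroup_incl[OF H subN HN] .
  then have "card (rcosets\<^bsub>G\<lparr>carrier := N\<rparr>\<^esub> H) * card H = order (G\<lparr>carrier := N\<rparr>)"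
    using group.lagrange[OF subgroup.subgroup_is_group[OF subN is_group]] by blast
  then have cN: "card ?F * q = card N" unfolding F cH by (simp add: order_def)
  have "card N dvd p ^ 2 * q" using lagrange[OF subN] ord by (metis dvd_triv_right)
  then have "card ?F * q dvd p ^ 2 * q" unfolding cN .
  moreover have "q \<noteq> 0" using q by auto
  ultimately have "card ?F dvd p ^ 2" by simp
  then obtain i where i: "card ?F = p ^ i" "i \<le> 2" using divides_primepow_nat[OF p] by blast
  have "[p ^ 2 = card ?F] (mod q)"
    by (rule fixed_rcosets[OF H H q, of 1]) (use cH ord in auto)
  then have cong: "[p ^ 2 = p ^ i] (mod q)" using i by simp
  have p1: "p > 1" by (rule prime_gt_1_nat[OF p])
  \<comment> \<open>Otherwise \<open>q\<close> divides \<open>p^2 - 1\<close> or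
    \<open>p^2 - p\<close>, but the factors \<open>p - 1\<close>, \<open>p\<close> and
    \<open>p + 1\<close> are all positive and smaller than \<open>q\<close>.\<close>
  have "i = 2"
  proof (rule ccontr)
    assume "i \<noteq> 2"
    then have "i = 0 \<or> i = 1" using i by auto
    then have "q dvd (p - 1) * (p + 1) * p"
    proof
      assume "i = 0"
      then have "q dvd p ^ 2 - 1" using cong p1 by (simp add: cong_altdef_nat)
      moreover have "p ^ 2 - 1 = (p - 1) * (p + 1)" by (simp add: power2_eq_square algebra_simps)
      ultimately show ?thesis by simp
    next
      assume "i = 1"
      then have "q dvd p ^ 2 - p" using cong p1 by (simp add: cong_altdef_nat power2_eq_square)
      moreover have "p ^ 2 - p = (p - 1) * p" by (simp add: power2_eq_square algebra_simps)
      ultimately show ?thesis by (metis dvd_mult2 mult.assoc mult.commute)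
    qed
    then have "q dvd p - 1 \<or> q dvd p + 1 \<or> q dvd p" using q by (metis prime_dvd_mult_iff)
    then show False using qp p1 by (auto dest!: dvd_imp_le)
  qed
  then have "card N = card (carrier G)" using cN i ord by (simp add: order_def)
  then have "N = carrier G" using fin subgroup.subset[OF subN] by (simp add: card_subset_eq)
  then show ?thesis using H by (auto simp: normal_inv_iff N_def)
qed

text \<open>As a set of torsion elements, \<open>Q\<close> is preserved by every endomorphism. This
  is how \<open>lam_Q\<close> obtains invariance under \<open>lam\<close>, and it makes the subgroup
  of order \<open>q\<close> visibly unique.\<close>

definition Q where "Q = {x \<in> carrier G. x [^] q = \<one>}"

text \<open>For the harder inclusion, the quotient by \<open>H\<close> has order \<open>p^2\<close>,
  so \<open>x ^ (p^2)\<close> lies in \<open>H\<close> for every \<open>x\<close>. If also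
  \<open>x ^ q = 1\<close>, then \<open>p^2 i = q j + 1\<close> recovers \<open>x\<close> as a power
  of \<open>x ^ (p^2)\<close>.\<close>

lemma subgroup_order_q_eq:
  assumes H: "subgroup H G" and cH: "card H = q"
  shows "H = Q"
proof (intro equalityI subsetI)
  fix x assume x: "x \<in> H"
  have gr: "group (G\<lparr>carrier := H\<rparr>)" by (rule subgroup.subgroup_is_group[OF H is_group])
  have "x [^]\<^bsub>G\<lparr>carrier := H\<rparr>\<^esub> order (G\<lparr>carrier := H\<rparr>) = \<one>\<^bsub>G\<lparr>carrier := H\<rparr>\<^esub>"
    by (rule group.pow_order_eq_1[OF gr]) (use x in auto)
  then have "x [^] q = \<one>" by (simp add: order_def cH flip: nat_pow_consistent)
  then show "x \<in> Q" using x subgroup.subset[OF H] by (auto simp: Q_def)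
next
  fix x assume x: "x \<in> Q"
  then have xc: "x \<in> carrier G" "x [^] q = \<one>" by (auto simp: Q_def)
  interpret N: normal H G by (rule order_q_normal[OF H cH])
  have "order (G Mod H) * q = p ^ 2 * q"
    using lagrange[OF H] cH ord by (simp add: order_def FactGroup_def)
  then have o: "order (G Mod H) = p ^ 2" using prime_gt_0_nat[OF q] by simp
  have "(H #> x) [^]\<^bsub>G Mod H\<^esub> order (G Mod H) = \<one>\<^bsub>G Mod H\<^esub>"
    by (rule group.pow_order_eq_1[OF N.factorgroup_is_group])
      (use xc in \<open>auto simp: carrier_FactGroup\<close>)
  then have "H #> (x [^] (p ^ 2)) = H" using N.FactGroup_pow[OF xc(1)] o by simp
  then have xH: "x [^] (p ^ 2) \<in> H" using coset_join1[of H "x [^] (p ^ 2)"] xc N.subset H by auto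
  obtain i where "[p ^ 2 * i = 1] (mod q)" using cong_solve_coprime_nat[OF coprime_p2q] by auto
  then have "p ^ 2 * i mod q = 1" using q by (metis cong_def mod_less prime_gt_1_nat)
  then obtain j where j: "p ^ 2 * i = q * j + 1" by (metis mult_div_mod_eq)
  have "x [^] (p ^ 2 * i) = x" unfolding j using xc by (simp add: nat_pow_pow[symmetric] nat_pow_mult[symmetric])
  moreover have "(x [^] (p ^ 2)) [^] n \<in> H" for n :: nat
    by (induction n) (use xH N.one_closed N.m_closed in auto)
  then have "x [^] (p ^ 2 * i) \<in> H" using xc by (simp add: nat_pow_pow[symmetric])
  ultimately show "x \<in> H" by simp
qed

lemma Q_subgroup: "subgroup Q G" and card_Q: "card Q = q"
proof -
  obtain H where H: "subgroup H G" "card H = q ^ 1"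
    using sylow_thm[OF q is_group, of 1 "p ^ 2"] ord fin by (auto simp: mult.commute)
  then show "subgroup Q G" "card Q = q" using subgroup_order_q_eq[of H] by auto
qed

lemma Q_normal: "Q \<lhd> G"
  by (rule order_q_normal[OF Q_subgroup card_Q])

lemma ex_subgroup_p2: "\<exists>P. subgroup P G \<and> card P = p ^ 2"
  using sylow_thm[OF p is_group, of 2 q] ord fin by auto

text \<open>\<open>P\<close> acts on the \<open>q\<close> cosets of \<open>P'\<close>. As
  \<open>p\<close> does not divide \<open>q\<close>, some coset \<open>P' b\<close> is fixed, which
  says that \<open>b\<close> conjugates \<open>P\<close> into \<open>P'\<close>.\<close>

lemma p2_subgroups_conj:
  assumes P: "subgroup P G" "card P = p ^ 2" and P': "subgroup P' G" "card P' = p ^ 2"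
  obtains b where "b \<in> carrier G" "P' = (\<lambda>x. b \<otimes> x \<otimes> inv b) ` P"
proof -
  have "[q = card {X \<in> rcosets P'. \<forall>h\<in>P. X #> inv h = X}] (mod p)"
    by (rule fixed_rcosets[OF P'(1) P(1) p P(2)]) (use P' ord in simp)
  moreover have "\<not> p dvd q" using coprime_pq p by (metis coprime_absorb_left not_prime_unit)
  ultimately have "{X \<in> rcosets P'. \<forall>h\<in>P. X #> inv h = X} \<noteq> {}"
    using cong_dvd_iff by (metis card.empty dvd_0_right)
  then obtain b where b: "b \<in> carrier G" "\<forall>h\<in>P. P' #> b #> inv h = P' #> b"
    by (auto simp: RCOSETS_def)
  then have "\<forall>h\<in>P. b \<otimes> h \<otimes> inv b \<in> P'" using fixed_rcos_iff[OF P'(1) P(1)] by blast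
  then have "(\<lambda>x. b \<otimes> x \<otimes> inv b) ` P = P'"
    using conj_image_eq[OF subgroup.subset[OF P'(1)] subgroup.subset[OF P(1)] _ b(1)] P(2) P'(2) by simp
  then show thesis using that b by metis
qed

lemma Q_P_inter:
  assumes P: "subgroup P G" "card P = p ^ 2" and x: "x \<in> Q" "x \<in> P"
  shows "x = \<one>"
proof -
  have xc: "x \<in> carrier G" "x [^] q = \<one>" using x by (auto simp: Q_def)
  have gr: "group (G\<lparr>carrier := P\<rparr>)" by (rule subgroup.subgroup_is_group[OF P(1) is_group])
  have "x [^]\<^bsub>G\<lparr>carrier := P\<rparr>\<^esub> order (G\<lparr>carrier := P\<rparr>) = \<one>\<^bsub>G\<lparr>carrier := P\<rparr>\<^esub>"
    by (rule group.pow_order_eq_1[OF gr]) (use x in auto)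
  then have "x [^] (p ^ 2) = \<one>" by (simp add: order_def P flip: nat_pow_consistent)
  then have "ord x dvd p ^ 2" "ord x dvd q" using xc by (auto simp: pow_eq_id)
  then have "ord x = 1" using coprime_p2q by (metis coprime_common_divisor_nat nat_dvd_1_iff_1)
  then show ?thesis using xc ord_eq_1 by blast
qed

lemma Q_P_bij:
  assumes P: "subgroup P G" "card P = p ^ 2"
  shows "bij_betw (\<lambda>(x, y). x \<otimes> y) (Q \<times> P) (carrier G)"
proof -
  have sub: "Q \<subseteq> carrier G" "P \<subseteq> carrier G"
    using subgroup.subset[OF Q_subgroup] subgroup.subset[OF P(1)] by auto
  have inj: "inj_on (\<lambda>(x, y). x \<otimes> y) (Q \<times> P)"
  proof (rule inj_onI, clarify)
    fix x y x' y' assume h: "x \<in> Q" "y \<in> P" "x' \<in> Q" "y' \<in> P" "x \<otimes> y = x' \<otimes> y'"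
    have c: "x \<in> carrier G" "y \<in> carrier G" "x' \<in> carrier G" "y' \<in> carrier G" using h sub by auto
    have "inv x' \<otimes> (x \<otimes> y) \<otimes> inv y = inv x' \<otimes> (x' \<otimes> y') \<otimes> inv y" using h by simp
    then have e: "inv x' \<otimes> x = y' \<otimes> inv y" using c by (simp add: m_assoc) (simp add: m_assoc[symmetric])
    have "inv x' \<otimes> x \<in> Q" "y' \<otimes> inv y \<in> P"
      using h P(1) Q_subgroup by (auto simp: subgroup.m_closed subgroup.m_inv_closed)
    then have "inv x' \<otimes> x = \<one>" "y' \<otimes> inv y = \<one>" using Q_P_inter[OF P] e by auto
    then show "x = x' \<and> y = y'" using c by (metis inv_equality inv_inv inv_closed)
  qed
  have "card ((\<lambda>(x, y). x \<otimes> y) ` (Q \<times> P)) = card (carrier G)"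
    using card_image[OF inj] ord P card_Q by (simp add: order_def card_cartesian_product)
  moreover have "(\<lambda>(x, y). x \<otimes> y) ` (Q \<times> P) \<subseteq> carrier G" using sub by auto
  ultimately have "(\<lambda>(x, y). x \<otimes> y) ` (Q \<times> P) = carrier G" using fin by (simp add: card_subset_eq)
  then show ?thesis using inj by (simp add: bij_betw_def)
qed

lemma Q_P_decomp:
  assumes P: "subgroup P G" "card P = p ^ 2" and g: "g \<in> carrier G"
  obtains x y where "x \<in> Q" "y \<in> P" "g = x \<otimes> y"
proof -
  have "g \<in> (\<lambda>(x, y). x \<otimes> y) ` (Q \<times> P)" using Q_P_bij[OF P] g by (simp add: bij_betw_def)
  then show thesis using that by auto
qed

text \<open>The group \<open>Q \<times> Q\<close> acts transitively on these translates, so their number is a power of \<open>q\<close>.\<close>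
lemma translates_card_not_dvd:
  assumes P: "subgroup P G" "card P = p ^ 2"
  shows "\<not> p dvd card {a <# P #> b | a b. a \<in> carrier G \<and> b \<in> carrier G}"
proof -
  let ?X = "{a <# P #> b | a b. a \<in> carrier G \<and> b \<in> carrier G}"
  have PG: "P \<subseteq> carrier G" using subgroup.subset[OF P(1)] .
  have QG: "Q \<subseteq> carrier G" using subgroup.subset[OF Q_subgroup] .
  define QQ where "QQ = G\<lparr>carrier := Q\<rparr> \<times>\<times> G\<lparr>carrier := Q\<rparr>"
  have grQ: "group (G\<lparr>carrier := Q\<rparr>)" by (rule subgroup.subgroup_is_group[OF Q_subgroup is_group])
  have gr: "group QQ" unfolding QQ_def by (rule DirProd_group[OF grQ grQ])
  have mm: "a <# (c <# P #> d) #> b = (a \<otimes> c) <# P #> (d \<otimes> b)"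
    if "a \<in> carrier G" "b \<in> carrier G" "c \<in> carrier G" "d \<in> carrier G" for a b c d
    using that PG by (simp add: coset_assoc[symmetric] l_coset_subset_G lcos_m_assoc r_coset_subset_G coset_mult_assoc)
  have "card ?X dvd order QQ"
  proof (rule transitive_action_card_dvd[OF gr, where \<phi> = "\<lambda>g X. fst g <# X #> inv (snd g)"])
    fix g X assume "g \<in> carrier QQ" "X \<in> ?X"
    then obtain a b c d where gX: "g = (a, b)" "X = c <# P #> d" "a \<in> Q" "b \<in> Q"
      and c: "c \<in> carrier G" "d \<in> carrier G" by (auto simp: QQ_def)
    then have "a \<in> carrier G" "b \<in> carrier G" using QG by auto
    with gX c
    show "fst g <# X #> inv (snd g) \<in> ?X" using mm[of a "inv b" c d] by auto
  next
    fix X assume "X \<in> ?X"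
    then obtain c d where X: "X = c <# P #> d" "c \<in> carrier G" "d \<in> carrier G" by auto
    then show "fst \<one>\<^bsub>QQ\<^esub> <# X #> inv (snd \<one>\<^bsub>QQ\<^esub>) = X"
      using mm[of \<one> \<one> c d] by (simp add: QQ_def)
  next
    fix g h X assume "g \<in> carrier QQ" "h \<in> carrier QQ" "X \<in> ?X"
    then obtain a b a' b' c d where gX: "g = (a, b)" "h = (a', b')" "X = c <# P #> d"
      "c \<in> carrier G" "d \<in> carrier G" and Q: "a \<in> Q" "b \<in> Q" "a' \<in> Q" "b' \<in> Q"
      by (auto simp: QQ_def)
    then have "a \<in> carrier G" "b \<in> carrier G" "a' \<in> carrier G" "b' \<in> carrier G" using QG by auto
    with gX show "fst (g \<otimes>\<^bsub>QQ\<^esub> h) <# X #> inv (snd (g \<otimes>\<^bsub>QQ\<^esub> h)) =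
        fst g <# (fst h <# X #> inv (snd h)) #> inv (snd g)"
      by (simp add: QQ_def mm m_assoc inv_mult_group)
  next
    show "P \<in> ?X" using PG by (auto intro!: exI[of _ \<one>] simp: lcos_mult_one)
    fix Y assume "Y \<in> ?X"
    then obtain a b where Y: "Y = a <# P #> b" "a \<in> carrier G" "b \<in> carrier G" by auto
    obtain a1 a2 where a: "a1 \<in> Q" "a2 \<in> P" "a = a1 \<otimes> a2"
      using Q_P_decomp[OF P Y(2)] .
    \<comment> \<open>The inverse of \<open>b\<close> is decomposed, not \<open>b\<close>, so that
      the \<open>P\<close> factor of \<open>b\<close> comes first and is absorbed by
      \<open>P\<close>; only the \<open>Q\<close> factors on both sides remain.\<close>
    obtain b1 b2 where b: "b1 \<in> Q" "b2 \<in> P" "inv b = b1 \<otimes> b2"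
      using Q_P_decomp[OF P inv_closed[OF Y(3)]] .
    have c: "a1 \<in> carrier G" "a2 \<in> carrier G" "b1 \<in> carrier G" "b2 \<in> carrier G"
      using a b PG QG by auto
    have "inv (inv b) = inv b2 \<otimes> inv b1" unfolding b(3) using c by (simp add: inv_mult_group)
    then have b': "b = inv b2 \<otimes> inv b1" using Y(3) by simp
    have "a <# P = a1 <# (a2 <# P)"
      unfolding a(3) by (rule lcos_m_assoc[OF PG c(1,2), symmetric])
    also have "a2 <# P = P" by (rule coset_join3[OF c(2) P(1) a(2)])
    finally have aP: "a <# P = a1 <# P" .
    have "P #> b = P #> inv b2 #> inv b1"
      unfolding b' using c PG by (simp add: coset_mult_assoc)
    also have "P #> inv b2 = P"
      by (rule coset_join2[OF _ P(1)]) (use c b P(1) in \<open>auto intro: subgroup.m_inv_closed\<close>)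
    finally have Pb: "P #> b = P #> inv b1" .
    have "Y = a1 <# P #> b" unfolding Y(1) aP ..
    also have "\<dots> = a1 <# (P #> b)" using coset_assoc[OF c(1) Y(3) PG] by simp
    also have "\<dots> = a1 <# P #> inv b1" unfolding Pb using coset_assoc[OF c(1) inv_closed[OF c(3)] PG] by simp
    finally have "Y = a1 <# P #> inv b1" .
    then show "\<exists>g\<in>carrier QQ. Y = fst g <# P #> inv (snd g)"
      using a b by (auto simp: QQ_def)
  qed
  then have "card ?X dvd q * q" using card_Q by (simp add: QQ_def order_def DirProd_def card_cartesian_product)
  moreover have "coprime p (q * q)" using coprime_pq by simp
  ultimately show ?thesis using p not_prime_unit
    by (meson coprime_common_divisor dvd_refl dvd_trans)
qed

lemma translates_card_not_dvd':
  assumes P: "subgroup P G" "card P = p ^ 2"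
  shows "\<not> p dvd card {(\<lambda>x. a \<otimes> x \<otimes> b) ` P | a b. a \<in> carrier G \<and> b \<in> carrier G}"
proof -
  have "a <# P #> b = (\<lambda>x. a \<otimes> x \<otimes> b) ` P" for a b
    by (auto simp: l_coset_def r_coset_def)
  then show ?thesis using translates_card_not_dvd[OF P] by simp
qed

end

section \<open>Sub skew braces of order $p^2$\<close>

context skew_brace
begin

sublocale circ: group B by (rule circ_group)

sublocale add: group "add_monoid B"
  rewrites "carrier (add_monoid B) = carrier B"
    and "mult (add_monoid B) = add B"
    and "one (add_monoid B) = zero B"
    and "m_inv (add_monoid B) = a_inv B"
    and "pow (add_monoid B) = (\<lambda>a k. add_pow B k a)"
  by (rule add_group) (auto simp: m_inv_def a_inv_def add_pow_def)

text \<open>The usual lambda map of a skew brace. By \<open>lam_add\<close> and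
  \<open>lam_circ\<close> it is an action of the circle group by automorphisms of the additive
  group.\<close>

definition lam where "lam a b = \<ominus> a \<oplus> a \<otimes> b"

text \<open>The brace law at \<open>\<one> \<otimes> (\<zero> \<oplus> \<zero>)\<close> reads
  \<open>\<zero> = \<zero> \<ominus> \<one> \<oplus> \<zero>\<close>.\<close>

lemma zero_eq_one: "\<zero> = \<one>"
proof -
  have "\<one> \<otimes> (\<zero> \<oplus> \<zero>) = \<one> \<otimes> \<zero> \<ominus> \<one> \<oplus> \<one> \<otimes> \<zero>" by (rule brace_distrib) auto
  then have "\<ominus> \<one> = \<zero>" by (simp add: a_minus_def)
  then have "\<ominus> (\<ominus> \<one>) = \<ominus> \<zero>" by simp
  then show ?thesis by simp
qed

lemma lam_closed [simp]: "a \<in> carrier B \<Longrightarrow> b \<in> carrier B \<Longrightarrow> lam a b \<in> carrier B"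
  by (simp add: lam_def)

lemma circ_eq_lam: "a \<in> carrier B \<Longrightarrow> b \<in> carrier B \<Longrightarrow> a \<otimes> b = a \<oplus> lam a b"
  by (simp add: lam_def add.m_assoc[symmetric])

lemma lam_add:
  "a \<in> carrier B \<Longrightarrow> b \<in> carrier B \<Longrightarrow> c \<in> carrier B \<Longrightarrow> lam a (b \<oplus> c) = lam a b \<oplus> lam a c"
  by (simp add: lam_def brace_distrib a_minus_def add.m_assoc)

lemma lam_hom: "a \<in> carrier B \<Longrightarrow> lam a \<in> hom (add_monoid B) (add_monoid B)"
  by (auto simp: hom_def lam_add)

lemma lam_group_hom: "a \<in> carrier B \<Longrightarrow> group_hom (add_monoid B) (add_monoid B) (lam a)"
  by (simp add: group_hom_def group_hom_axioms_def add_group lam_hom)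

lemma lam_zero [simp]: "a \<in> carrier B \<Longrightarrow> lam a \<zero> = \<zero>"
  using group_hom.hom_one[OF lam_group_hom] by simp

lemma lam_minus: "a \<in> carrier B \<Longrightarrow> b \<in> carrier B \<Longrightarrow> lam a (\<ominus> b) = \<ominus> lam a b"
  using group_hom.hom_inv[OF lam_group_hom, of a b] by (simp add: a_inv_def)

lemma lam_pow: "a \<in> carrier B \<Longrightarrow> b \<in> carrier B \<Longrightarrow> lam a ([(k::nat)] \<cdot> b) = [k] \<cdot> lam a b"
  using group_hom.hom_nat_pow[OF lam_group_hom, of a b k] by (simp add: add_pow_def)

lemma lam_int_pow: "a \<in> carrier B \<Longrightarrow> b \<in> carrier B \<Longrightarrow> lam a ([(k::int)] \<cdot> b) = [k] \<cdot> lam a b"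
  using group_hom.hom_int_pow[OF lam_group_hom, of a b k] by (simp add: add_pow_def)

lemma lam_one [simp]: "b \<in> carrier B \<Longrightarrow> lam \<one> b = b"
  by (simp add: lam_def zero_eq_one[symmetric])

lemma lam_circ:
  assumes "a \<in> carrier B" "b \<in> carrier B" "c \<in> carrier B"
  shows "lam (a \<otimes> b) c = lam a (lam b c)"
proof -
  have "lam a (lam b c) = \<ominus> lam a b \<oplus> lam a (b \<otimes> c)"
    using assms by (simp add: lam_def[of b] lam_add lam_minus)
  also have "\<dots> = lam (a \<otimes> b) c"
    using assms by (simp add: lam_def add.inv_mult_group add.m_assoc circ.m_assoc)
      (simp add: add.m_assoc[symmetric])
  finally show ?thesis ..
qed

lemma lam_inv_lam: "a \<in> carrier B \<Longrightarrow> b \<in> carrier B \<Longrightarrow> lam (inv a) (lam a b) = b"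
  by (simp add: lam_circ[symmetric])

lemma inj_lam: "a \<in> carrier B \<Longrightarrow> inj_on (lam a) (carrier B)"
  by (metis inj_onI lam_inv_lam)

lemma inv_eq_minus_lam: "a \<in> carrier B \<Longrightarrow> inv a = \<ominus> lam (inv a) a"
  using circ_eq_lam[of "inv a" a] by (simp add: zero_eq_one[symmetric] add.inv_equality)

text \<open>Left circle multiplication by \<open>inv a\<close> is an affine map of the additive
  group with linear part \<open>lam (inv a)\<close> that sends \<open>a\<close> to zero. It is used
  to move a translate back through the origin.\<close>

lemma inv_circ_eq_lam:
  assumes "a \<in> carrier B" "b \<in> carrier B"
  shows "inv a \<otimes> b = lam (inv a) (\<ominus> a \<oplus> b)"
  using assms inv_eq_minus_lam[of a] circ_eq_lam[of "inv a" b] by (simp add: lam_add lam_minus)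

end

locale p2q_brace = skew_brace +
  fixes p q :: nat
  assumes p: "Factorial_Ring.prime p" and q: "Factorial_Ring.prime q" and qp: "q > p + 1"
    and card_B: "card (carrier B) = p ^ 2 * q"
begin

lemma fin_B: "finite (carrier B)"
  using card_B p q by (metis card.infinite no_zero_divisors power_not_zero not_prime_0)

lemma p2q_add: "p2q_group (add_monoid B) p q"
  by (simp add: p2q_group_def p2q_group_axioms_def add_group p q qp[simplified] order_def card_B)

lemma p2q_circ: "p2q_group B p q"
  by (simp add: p2q_group_def p2q_group_axioms_def circ_group p q qp[simplified] order_def card_B)

definition Q where "Q = {x \<in> carrier B. [q] \<cdot> x = \<zero>}"

lemma Q_add: "Q = p2q_group.Q (add_monoid B) q"
  by (simp add: Q_def p2q_group.Q_def[OF p2q_add] add_pow_def)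

lemma Q_add_subgroup: "subgroup Q (add_monoid B)" and card_Q: "card Q = q"
  and Q_add_normal: "Q \<lhd> add_monoid B"
  unfolding Q_add using p2q_group.Q_subgroup p2q_group.card_Q p2q_group.Q_normal p2q_add by blast+

lemma Q_carrier: "x \<in> Q \<Longrightarrow> x \<in> carrier B" by (simp add: Q_def)

lemma lam_Q: "a \<in> carrier B \<Longrightarrow> x \<in> Q \<Longrightarrow> lam a x \<in> Q"
  by (auto simp: Q_def lam_pow[symmetric])

text \<open>Circle products and inverses differ from sums and negatives only by an application of
  \<open>lam\<close>, which preserves \<open>Q\<close>.\<close>

lemma Q_circ_subgroup: "subgroup Q B"
proof (rule circ.subgroupI)
  show "Q \<subseteq> carrier B" by (auto simp: Q_def)
  show "Q \<noteq> {}" using subgroup.one_closed[OF Q_add_subgroup] by auto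
  fix a assume a: "a \<in> Q"
  then show "inv a \<in> Q"
    using inv_eq_minus_lam[of a] lam_Q[of "inv a" a] subgroup.m_inv_closed[OF Q_add_subgroup, folded a_inv_def]
    by (metis Q_carrier circ.inv_closed)
next
  fix a b assume "a \<in> Q" "b \<in> Q"
  then show "a \<otimes> b \<in> Q"
    using circ_eq_lam[of a b] lam_Q[of a b] subgroup.m_closed[OF Q_add_subgroup] by (simp add: Q_carrier)
qed

lemma Q_circ_normal: "Q \<lhd> B"
  using p2q_group.order_q_normal[OF p2q_circ Q_circ_subgroup card_Q] .

lemma ex_sub_brace:
  "\<exists>K. subgroup K B \<and> subgroup K (add_monoid B) \<and> card K = p ^ 2"
proof -
  interpret A: p2q_group "add_monoid B" p q
    rewrites "carrier (add_monoid B) = carrier B"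
      and "mult (add_monoid B) = add B"
      and "one (add_monoid B) = zero B"
      and "m_inv (add_monoid B) = a_inv B"
      and "pow (add_monoid B) = (\<lambda>a k. add_pow B k a)"
    by (rule p2q_add) (auto simp: m_inv_def a_inv_def add_pow_def)
  obtain P where P: "subgroup P (add_monoid B)" "card P = p ^ 2" using A.ex_subgroup_p2 by auto
  obtain H where H: "subgroup H B" "card H = p ^ 2"
    using p2q_group.ex_subgroup_p2[OF p2q_circ] by auto
  have PB: "P \<subseteq> carrier B" using subgroup.subset[OF P(1)] by simp
  have HB: "H \<subseteq> carrier B" using subgroup.subset[OF H(1)] .
  define X where "X = {(\<lambda>x. a \<oplus> x \<oplus> b) ` P | a b. a \<in> carrier B \<and> b \<in> carrier B}"
  have XI: "(\<lambda>x. a \<oplus> x \<oplus> b) ` P \<in> X" if "a \<in> carrier B" "b \<in> carrier B" for a b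
    using that by (auto simp: X_def)
  have nX: "\<not> p dvd card X" unfolding X_def by (rule A.translates_card_not_dvd'[OF P])
  have XB: "S \<subseteq> carrier B" if "S \<in> X" for S using that PB by (auto simp: X_def)
  have finX: "finite X"
    by (rule finite_subset[of _ "Pow (carrier B)"]) (use XB fin_B in auto)
  \<comment> \<open>Here the translates must be two-sided:
    \<open>h \<otimes> (a \<oplus> x \<oplus> b)\<close> equals
    \<open>h \<oplus> lam h a \<oplus> lam h x \<oplus> lam h b\<close>, and \<open>lam h\<close>
    maps \<open>P\<close> onto a Sylow subgroup that is only conjugate to \<open>P\<close>. The
    conjugating element \<open>c\<close> is absorbed on both sides.\<close>
  have closed: "(\<lambda>s. h \<otimes> s) ` S \<in> X" if h: "h \<in> carrier B" and S: "S \<in> X" for h S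
  proof -
    obtain a b where ab: "S = (\<lambda>x. a \<oplus> x \<oplus> b) ` P" "a \<in> carrier B" "b \<in> carrier B"
      using S by (auto simp: X_def)
    have "subgroup (lam h ` P) (add_monoid B)"
      by (rule group_hom.subgroup_img_is_subgroup[OF lam_group_hom[OF h] P(1)])
    moreover have "card (lam h ` P) = p ^ 2"
      using P(2) inj_on_subset[OF inj_lam[OF h] PB] by (simp add: card_image)
    ultimately obtain c where c: "c \<in> carrier B" "lam h ` P = (\<lambda>x. c \<oplus> x \<oplus> \<ominus> c) ` P"
      using A.p2_subgroups_conj[OF P] by metis
    have "(\<lambda>s. h \<otimes> s) ` S = (\<lambda>y. h \<oplus> lam h a \<oplus> y \<oplus> lam h b) ` (lam h ` P)"
      unfolding ab(1) image_image
      by (rule image_cong) (use h ab PB in \<open>auto simp: circ_eq_lam lam_add add.m_assoc subset_iff\<close>)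
    also have "\<dots> = (\<lambda>x. (h \<oplus> lam h a \<oplus> c) \<oplus> x \<oplus> (\<ominus> c \<oplus> lam h b)) ` P"
      unfolding c(2) image_image
      by (rule image_cong) (use h ab PB c in \<open>auto simp: add.m_assoc subset_iff\<close>)
    finally show ?thesis using XI h ab c by simp
  qed
  have grH: "group (B\<lparr>carrier := H\<rparr>)" by (rule subgroup.subgroup_is_group[OF H(1) circ_group])
  have fix_cong: "[card X = card {S \<in> X. \<forall>h\<in>carrier (B\<lparr>carrier := H\<rparr>). (\<lambda>s. h \<otimes> s) ` S = S}] (mod p)"
  proof (rule prime_power_group_fixed_points[OF grH p _ finX])
    show "order (B\<lparr>carrier := H\<rparr>) = p ^ 2" by (simp add: order_def H)
    fix h S assume "h \<in> carrier (B\<lparr>carrier := H\<rparr>)" "S \<in> X"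
    then show "(\<lambda>s. h \<otimes> s) ` S \<in> X" using closed HB by auto
  next
    fix S assume "S \<in> X"
    then have "\<And>s. s \<in> S \<Longrightarrow> \<one> \<otimes> s = s" using XB circ.l_one by blast
    then show "(\<lambda>s. \<one>\<^bsub>B\<lparr>carrier := H\<rparr>\<^esub> \<otimes> s) ` S = S" by simp
  next
    fix g h S assume "g \<in> carrier (B\<lparr>carrier := H\<rparr>)" "h \<in> carrier (B\<lparr>carrier := H\<rparr>)" "S \<in> X"
    then show "(\<lambda>s. g \<otimes>\<^bsub>B\<lparr>carrier := H\<rparr>\<^esub> h \<otimes> s) ` S = (\<lambda>s. g \<otimes> s) ` (\<lambda>s. h \<otimes> s) ` S"
      unfolding image_image
      by (intro image_cong) (use XB HB in \<open>auto simp: circ.m_assoc subset_iff\<close>)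
  qed
  have "\<not> p dvd card {S \<in> X. \<forall>h\<in>H. (\<lambda>s. h \<otimes> s) ` S = S}"
    using nX cong_dvd_iff[OF fix_cong] by simp
  then have "card {S \<in> X. \<forall>h\<in>H. (\<lambda>s. h \<otimes> s) ` S = S} \<noteq> 0" by (metis dvd_0_right)
  then have "{S \<in> X. \<forall>h\<in>H. (\<lambda>s. h \<otimes> s) ` S = S} \<noteq> {}" by (metis card.empty)
  then obtain S where S: "S \<in> X" "\<And>h. h \<in> H \<Longrightarrow> (\<lambda>s. h \<otimes> s) ` S = S" by blast
  obtain a b where ab: "S = (\<lambda>x. a \<oplus> x \<oplus> b) ` P" "a \<in> carrier B" "b \<in> carrier B"
    using S(1) by (auto simp: X_def)
  obtain x0 where x0: "x0 \<in> P" using subgroup.one_closed[OF P(1)] by auto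
  define s0 where "s0 = a \<oplus> x0 \<oplus> b"
  have s0: "s0 \<in> carrier B" "s0 \<in> S" using ab x0 PB by (auto simp: s0_def)
  \<comment> \<open>The \<open>p^2\<close> distinct products of elements of \<open>H\<close> with
    \<open>s0\<close> lie in the fixed translate \<open>S\<close>, which has no more elements than
    that; so \<open>S\<close> is a single circle coset of \<open>H\<close>.\<close>
  have "card S \<le> p ^ 2" unfolding ab(1) using P(2) card_image_le[of P] PB fin_B finite_subset by metis
  moreover have "card ((\<lambda>h. h \<otimes> s0) ` H) = p ^ 2"
    using H(2) HB s0(1) by (subst card_image) (auto simp: inj_on_def subset_iff)
  moreover have "(\<lambda>h. h \<otimes> s0) ` H \<subseteq> S" using S(2) s0(2) by blast
  moreover have "finite S" using XB[OF S(1)] fin_B finite_subset by auto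
  ultimately have HS: "(\<lambda>h. h \<otimes> s0) ` H = S" by (metis card_seteq)
  \<comment> \<open>Conjugation by \<open>s0\<close> gives a circle subgroup. It also equals
    \<open>inv s0 \<otimes> S\<close>, which \<open>inv_circ_eq_lam\<close> turns into a
    \<open>lam\<close> image of an additive conjugate of \<open>P\<close>; hence it is an additive
    subgroup as well.\<close>
  define K where "K = (\<lambda>h. inv s0 \<otimes> h \<otimes> s0) ` H"
  have K1: "subgroup K B"
    unfolding K_def
  proof (rule group_hom.subgroup_img_is_subgroup[OF _ H(1)])
    have "(\<lambda>h. inv s0 \<otimes> h \<otimes> s0) \<in> hom B B"
    proof (rule homI)
      fix x y assume xy: "x \<in> carrier B" "y \<in> carrier B"
      have "s0 \<otimes> (inv s0 \<otimes> (y \<otimes> s0)) = y \<otimes> s0" using s0(1) xy by (simp add: circ.m_assoc[symmetric])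
      then show "inv s0 \<otimes> (x \<otimes> y) \<otimes> s0 = inv s0 \<otimes> x \<otimes> s0 \<otimes> (inv s0 \<otimes> y \<otimes> s0)"
        using s0(1) xy by (simp add: circ.m_assoc)
    qed (use s0 in auto)
    then show "group_hom B B (\<lambda>h. inv s0 \<otimes> h \<otimes> s0)"
      by (simp add: group_hom_def group_hom_axioms_def circ_group)
  qed
  have "K = (\<lambda>s. inv s0 \<otimes> s) ` S"
    unfolding HS[symmetric] K_def image_image
    by (rule image_cong) (use s0 HB in \<open>auto simp: circ.m_assoc subset_iff\<close>)
  also have "\<dots> = (\<lambda>x. lam (inv s0) (\<ominus> b \<oplus> x \<oplus> b)) ` ((\<lambda>x. \<ominus> x0 \<oplus> x) ` P)"
    unfolding ab(1) image_image
  proof (rule image_cong)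
    fix x assume "x \<in> P"
    then have xc: "x \<in> carrier B" "x0 \<in> carrier B" using PB x0 by auto
    have "\<ominus> a \<oplus> (a \<oplus> (x \<oplus> b)) = x \<oplus> b" using ab xc by (simp add: add.m_assoc[symmetric])
    then have "\<ominus> s0 \<oplus> (a \<oplus> x \<oplus> b) = \<ominus> b \<oplus> (\<ominus> x0 \<oplus> x) \<oplus> b"
      using ab xc by (simp add: s0_def add.inv_mult_group add.m_assoc)
    then show "inv s0 \<otimes> (a \<oplus> x \<oplus> b) = lam (inv s0) (\<ominus> b \<oplus> (\<ominus> x0 \<oplus> x) \<oplus> b)"
      using inv_circ_eq_lam[of s0 "a \<oplus> x \<oplus> b"] s0 ab xc by simp
  qed auto
  also have "(\<lambda>x. \<ominus> x0 \<oplus> x) ` P = P"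
  proof -
    have "\<ominus> x0 \<in> P" using subgroup.m_inv_closed[OF P(1) x0] by (simp add: a_inv_def)
    then have "(\<lambda>x. \<ominus> x0 \<oplus> x) ` P \<subseteq> P" using subgroup.m_closed[OF P(1)] by auto
    moreover have "x \<in> (\<lambda>x. \<ominus> x0 \<oplus> x) ` P" if "x \<in> P" for x
    proof (rule image_eqI)
      show "x = \<ominus> x0 \<oplus> (x0 \<oplus> x)" using that x0 PB by (simp add: add.m_assoc[symmetric] subset_iff)
      show "x0 \<oplus> x \<in> P" using subgroup.m_closed[OF P(1) x0 that] by simp
    qed
    ultimately show ?thesis by blast
  qed
  finally have K: "K = lam (inv s0) ` ((\<lambda>x. \<ominus> b \<oplus> x \<oplus> b) ` P)" by (simp add: image_image)
  have K2: "subgroup K (add_monoid B)"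
    unfolding K
  proof (rule group_hom.subgroup_img_is_subgroup[OF lam_group_hom])
    show "subgroup ((\<lambda>x. \<ominus> b \<oplus> x \<oplus> b) ` P) (add_monoid B)"
    proof (rule group_hom.subgroup_img_is_subgroup[OF _ P(1)])
      have "(\<lambda>x. \<ominus> b \<oplus> x \<oplus> b) \<in> hom (add_monoid B) (add_monoid B)"
      proof (rule homI, simp_all add: ab)
        fix x y assume xy: "x \<in> carrier B" "y \<in> carrier B"
        have "b \<oplus> (\<ominus> b \<oplus> (y \<oplus> b)) = y \<oplus> b" using ab xy by (simp add: add.m_assoc[symmetric])
        then show "\<ominus> b \<oplus> (x \<oplus> y) \<oplus> b = \<ominus> b \<oplus> x \<oplus> b \<oplus> (\<ominus> b \<oplus> y \<oplus> b)"
          using ab xy by (simp add: add.m_assoc)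
      qed
      then show "group_hom (add_monoid B) (add_monoid B) (\<lambda>x. \<ominus> b \<oplus> x \<oplus> b)"
        by (simp add: group_hom_def group_hom_axioms_def add_group)
    qed
  qed (use s0 in auto)
  have "inj_on (\<lambda>h. inv s0 \<otimes> h \<otimes> s0) H"
    using s0(1) HB by (auto simp: inj_on_def subset_iff)
  then have "card K = p ^ 2" unfolding K_def using H(2) by (simp add: card_image)
  with K1 K2 show ?thesis by blast
qed

end

section \<open>Normal forms for skew braces of order p^2\<close>

lemma (in group) card_range_int_pow:
  assumes "a \<in> carrier G"
  shows "card (range (\<lambda>u::int. a [^] u)) = ord a"
proof -
  have "range (\<lambda>u::int. a [^] u) = generate G {a}" using generate_pow[OF assms] by auto
  then show ?thesis using generate_pow_card[OF assms] by simp
qed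

lemma (in skew_brace) add_pow_int_0 [simp]: "[(0::int)] \<cdot> x = \<zero>"
  by (simp add: add_pow_def)

locale p2_brace = skew_brace +
  fixes p :: nat
  assumes p: "Factorial_Ring.prime p" and card_B: "card (carrier B) = p ^ 2"
begin

lemma fin_B: "finite (carrier B)"
  using card_B p by (metis card.infinite power_not_zero not_prime_0)

lemma circ_comm: "x \<in> carrier B \<Longrightarrow> y \<in> carrier B \<Longrightarrow> x \<otimes> y = y \<otimes> x"
  by (rule circ.card_order_prime_square_comm[OF p]) (simp_all add: order_def card_B)

lemma add_comm: "x \<in> carrier B \<Longrightarrow> y \<in> carrier B \<Longrightarrow> x \<oplus> y = y \<oplus> x"
  by (rule add.card_order_prime_square_comm[OF p]) (simp_all add: order_def card_B)

lemma comm_add: "comm_group (add_monoid B)"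
  by (rule group.group_comm_groupI[OF add_group]) (simp add: add_comm)

lemma add_lcomm:
  assumes "x \<in> carrier B" "y \<in> carrier B" "w \<in> carrier B"
  shows "x \<oplus> (y \<oplus> w) = y \<oplus> (x \<oplus> w)"
  using assms by (simp add: add.m_assoc[symmetric] add_comm[of x y])

lemmas add_ac = add.m_assoc add_comm add_lcomm

text \<open>The circle group is a \<open>p\<close>-group acting through \<open>lam\<close>, so its
  fixed points are a multiple of \<open>p\<close> in number and zero is not the only one. A fixed
  \<open>w\<close> of order \<open>p^2\<close> is replaced by \<open>[p] \<cdot> w\<close>, which is
  fixed as well.\<close>

lemma ex_fixed:
  obtains z where "z \<in> carrier B" "z \<noteq> \<zero>" "[p] \<cdot> z = \<zero>" "\<And>y. y \<in> carrier B \<Longrightarrow> lam y z = z"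
proof -
  let ?F = "{x \<in> carrier B. \<forall>g\<in>carrier B. lam g x = x}"
  have "[card (carrier B) = card ?F] (mod p)"
    by (rule prime_power_group_fixed_points[OF circ_group p _ fin_B, of 2])
      (simp_all add: order_def card_B lam_circ)
  then have "p dvd card ?F" using card_B cong_dvd_iff[of "card (carrier B)" "card ?F" p] by simp
  moreover have z0: "\<zero> \<in> ?F" by simp
  moreover have "finite ?F" using fin_B by simp
  ultimately have "?F \<noteq> {\<zero>}" using p not_prime_unit by (metis card_1_singleton_iff One_nat_def)
  then obtain w where w: "w \<in> ?F" "w \<noteq> \<zero>" using z0 by blast
  have "[(p ^ 2)] \<cdot> w = \<zero>" using add.pow_order_eq_1[of w] w card_B by (simp add: order_def)
  show thesis
  proof (cases "[p] \<cdot> w = \<zero>")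
    case True
    then show thesis using that[of w] w by auto
  next
    case False
    have "[p] \<cdot> ([p] \<cdot> w) = \<zero>"
      using \<open>[(p ^ 2)] \<cdot> w = \<zero>\<close> w add.nat_pow_pow[of w p p] by (simp add: power2_eq_square)
    then show thesis using that[of "[p] \<cdot> w"] w False by (auto simp: lam_pow)
  qed
qed

text \<open>Take \<open>z\<close> fixed by \<open>lam\<close> and of order \<open>p\<close>, and any
  \<open>e\<close> outside the subgroup \<open>Z\<close> of its multiples. The action
  \<open>lam\<close> is trivial on \<open>Z\<close> and on the quotient by \<open>Z\<close>, so
  \<open>lam y e\<close> is \<open>e\<close> plus a multiple of \<open>z\<close>; commutativity of
  the circle group, which has order \<open>p^2\<close>, makes this multiple linear in the
  coordinates of \<open>y\<close>.\<close>

lemma standard_basis0: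
  obtains z e and f k :: int where "z \<in> carrier B" "e \<in> carrier B" "z \<noteq> \<zero>" "[int p] \<cdot> z = \<zero>"
    "[int p] \<cdot> e = [k] \<cdot> z"
    "\<And>y. y \<in> carrier B \<Longrightarrow> \<exists>(u::int) (v::int). y = [u] \<cdot> z \<oplus> [v] \<cdot> e"
    "\<And>u v u' v' :: int. ([u] \<cdot> z \<oplus> [v] \<cdot> e) \<otimes> ([u'] \<cdot> z \<oplus> [v'] \<cdot> e) =
       [(u + u' + f * v * v')] \<cdot> z \<oplus> [(v + v')] \<cdot> e"
proof -
  obtain z where z: "z \<in> carrier B" "z \<noteq> \<zero>" "[p] \<cdot> z = \<zero>" "\<And>y. y \<in> carrier B \<Longrightarrow> lam y z = z"
    using ex_fixed by blast
  interpret A: comm_group "add_monoid B"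
    rewrites "carrier (add_monoid B) = carrier B"
      and "mult (add_monoid B) = add B"
      and "one (add_monoid B) = zero B"
      and "m_inv (add_monoid B) = a_inv B"
      and "pow (add_monoid B) = (\<lambda>a k. add_pow B k a)"
    by (rule comm_add) (auto simp: m_inv_def a_inv_def add_pow_def)
  have pz: "[int p] \<cdot> z = \<zero>" using z(3) by (simp add: add_pow_def int_pow_int)
  define Z where "Z = (\<lambda>u::int. [u] \<cdot> z) ` UNIV"
  have ZB: "Z \<subseteq> carrier B" using z(1) by (auto simp: Z_def)
  have sZ: "subgroup Z (add_monoid B)"
  proof (rule group.subgroupI[OF add_group])
    fix a assume "a \<in> Z"
    then obtain u where "a = [(u::int)] \<cdot> z" by (auto simp: Z_def)
    then have "\<ominus> a = [(- u)] \<cdot> z" using z(1) by (simp add: add.int_pow_neg)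
    then show "inv\<^bsub>add_monoid B\<^esub> a \<in> Z" by (auto simp: Z_def a_inv_def)
  next
    fix a b assume "a \<in> Z" "b \<in> Z"
    then obtain u v where "a = [(u::int)] \<cdot> z" "b = [(v::int)] \<cdot> z" by (auto simp: Z_def)
    then have "a \<oplus> b = [(u + v)] \<cdot> z" using z(1) by (simp add: add.int_pow_mult)
    then show "a \<otimes>\<^bsub>add_monoid B\<^esub> b \<in> Z" by (auto simp: Z_def)
  qed (use ZB in \<open>auto simp: Z_def\<close>)
  have ordz: "add.ord z = p"
  proof -
    have "add.ord z dvd p" using z by (simp add: add.pow_eq_id)
    then show ?thesis using p z add.ord_eq_1[of z] by (auto simp: prime_nat_iff)
  qed
  have cZ: "card Z = p"
    unfolding Z_def using add.card_range_int_pow[OF z(1)] ordz by simp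
  have p1: "p > 1" by (rule prime_gt_1_nat[OF p])
  have "card Z < card (carrier B)" using cZ card_B p1 by (simp add: power2_eq_square)
  then obtain e where e: "e \<in> carrier B" "e \<notin> Z" using ZB by (metis less_irrefl subsetI subset_antisym)
  define S where "S = (\<lambda>(u::int, v::int). [u] \<cdot> z \<oplus> [v] \<cdot> e) ` UNIV"
  have SI: "[u] \<cdot> z \<oplus> [v] \<cdot> e \<in> S" for u v :: int by (auto simp: S_def)
  have add_ev: "([u] \<cdot> z \<oplus> [v] \<cdot> e) \<oplus> ([u'] \<cdot> z \<oplus> [v'] \<cdot> e) = [(u + u')] \<cdot> z \<oplus> [(v + v')] \<cdot> e"
    for u v u' v' :: int
    using z(1) e(1) by (simp add: add.int_pow_mult add_ac)
  have sS: "subgroup S (add_monoid B)"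
  proof (rule group.subgroupI[OF add_group])
    fix a assume "a \<in> S"
    then obtain u v where a: "a = [(u::int)] \<cdot> z \<oplus> [(v::int)] \<cdot> e" by (auto simp: S_def)
    have "a \<oplus> ([(- u)] \<cdot> z \<oplus> [(- v)] \<cdot> e) = \<zero>"
      unfolding a using add_ev[of u v "- u" "- v"] z(1) e(1) by simp
    then have "\<ominus> a = [(- u)] \<cdot> z \<oplus> [(- v)] \<cdot> e"
      using a z(1) e(1) by (metis add.inv_unique' add.int_pow_closed add.m_closed add_comm)
    then show "inv\<^bsub>add_monoid B\<^esub> a \<in> S" using SI by (simp add: a_inv_def)
  next
    fix a b assume "a \<in> S" "b \<in> S"
    then obtain u v u' v' where "a = [(u::int)] \<cdot> z \<oplus> [(v::int)] \<cdot> e" "b = [(u'::int)] \<cdot> z \<oplus> [(v'::int)] \<cdot> e"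
      by (auto simp: S_def)
    then show "a \<otimes>\<^bsub>add_monoid B\<^esub> b \<in> S" using SI add_ev by simp
  qed (use z(1) e(1) in \<open>auto simp: S_def\<close>)
  have "Z \<subset> S"
  proof
    show "Z \<subseteq> S"
    proof
      fix a assume "a \<in> Z"
      then obtain u where "a = [(u::int)] \<cdot> z" by (auto simp: Z_def)
      then show "a \<in> S" using SI[of u 0] z(1) by simp
    qed
    have "e \<in> S" using SI[of 0 1] e(1) by simp
    then show "Z \<noteq> S" using e(2) by auto
  qed
  moreover have SB: "S \<subseteq> carrier B" using z(1) e(1) by (auto simp: S_def)
  ultimately have "card Z < card S" using fin_B finite_subset by (metis psubset_card_mono)
  moreover have "card S dvd p ^ 2" using add.lagrange[OF sS] card_B by (metis dvd_triv_right order_def partial_object.simps(1))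
  then obtain i where i: "card S = p ^ i" "i \<le> 2" using divides_primepow_nat[OF p] by blast
  ultimately have "p ^ 1 < p ^ i" using cZ by simp
  then have "1 < i" using p1 by (meson power_less_imp_less_exp)
  then have "i = 2" using i by simp
  then have S: "S = carrier B" using card_subset_eq[OF fin_B SB] i card_B by simp
  have norm: "Z \<lhd> add_monoid B" by (rule comm_group.subgroup_imp_normal[OF comm_add sZ])
  interpret N: normal Z "add_monoid B" by (rule norm)
  have cR: "card (rcosets\<^bsub>add_monoid B\<^esub> Z) = p"
    using add.lagrange[OF sZ] cZ card_B p1 by (simp add: order_def power2_eq_square)
  have "[p] \<cdot> e \<in> Z"
  proof -
    have "(Z #>\<^bsub>add_monoid B\<^esub> e) [^]\<^bsub>add_monoid B Mod Z\<^esub> order (add_monoid B Mod Z) = \<one>\<^bsub>add_monoid B Mod Z\<^esub>"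
      by (rule group.pow_order_eq_1[OF N.factorgroup_is_group]) (use e in \<open>auto simp: carrier_FactGroup\<close>)
    moreover have "order (add_monoid B Mod Z) = p" using cR by (simp add: order_def FactGroup_def)
    ultimately have "Z #>\<^bsub>add_monoid B\<^esub> ([p] \<cdot> e) = Z"
      using N.FactGroup_pow[of e p] e by (simp add: add_pow_def)
    then show ?thesis using group.coset_join1[OF add_group _ _ sZ, of "[p] \<cdot> e"] ZB e by simp
  qed
  then obtain k where k: "[p] \<cdot> e = [(k::int)] \<cdot> z" by (auto simp: Z_def)
  \<comment> \<open>The fixed point congruence for the action of \<open>lam\<close> on the
    \<open>p\<close> cosets of \<open>Z\<close>: the number of fixed cosets is divisible by
    \<open>p\<close> and positive, since \<open>Z\<close> itself is fixed, so all cosets are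
    fixed.\<close>
  have "\<exists>u::int. lam y x = [u] \<cdot> z \<oplus> x" if xy: "x \<in> carrier B" "y \<in> carrier B" for x y
  proof -
    let ?R = "rcosets\<^bsub>add_monoid B\<^esub> Z"
    have lamZ: "lam g a = a" if "a \<in> Z" "g \<in> carrier B" for a g
      using that z by (auto simp: Z_def lam_int_pow)
    have img: "lam g ` (Z #>\<^bsub>add_monoid B\<^esub> x) = Z #>\<^bsub>add_monoid B\<^esub> lam g x"
      if "g \<in> carrier B" "x \<in> carrier B" for g x
    proof -
      have "lam g ` (Z #>\<^bsub>add_monoid B\<^esub> x) = (\<lambda>a. lam g (a \<oplus> x)) ` Z"
        by (auto simp: r_coset_def)
      also have "\<dots> = (\<lambda>a. a \<oplus> lam g x) ` Z"
        by (rule image_cong) (use that lamZ ZB in \<open>auto simp: lam_add\<close>)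
      finally show ?thesis by (auto simp: r_coset_def)
    qed
    have RB: "X \<subseteq> carrier B" if "X \<in> ?R" for X
      using subgroup.rcosets_carrier[OF sZ add_group that] by simp
    have finR: "finite ?R"
      by (rule finite_subset[of _ "Pow (carrier B)"]) (use RB fin_B in auto)
    have fc: "[card ?R = card {X \<in> ?R. \<forall>g\<in>carrier B. lam g ` X = X}] (mod p)"
    proof (rule prime_power_group_fixed_points[OF circ_group p _ finR, of 2])
      fix g X assume "g \<in> carrier B" "X \<in> ?R"
      then obtain x where x: "x \<in> carrier B" "X = Z #>\<^bsub>add_monoid B\<^esub> x" by (auto simp: RCOSETS_def)
      have "lam g ` X = Z #>\<^bsub>add_monoid B\<^esub> lam g x" unfolding x(2) by (rule img) fact+
      moreover have "lam g x \<in> carrier B" using x \<open>g \<in> carrier B\<close> by simp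
      ultimately show "lam g ` X \<in> ?R" by (auto simp: RCOSETS_def)
    next
      fix X assume "X \<in> ?R"
      then show "lam \<one> ` X = X" using RB by (auto simp: subset_iff image_iff)
    next
      fix g h X assume "g \<in> carrier B" "h \<in> carrier B" "X \<in> ?R"
      then show "lam (g \<otimes> h) ` X = lam g ` lam h ` X"
        unfolding image_image by (intro image_cong) (use RB in \<open>auto simp: lam_circ subset_iff\<close>)
    qed (simp add: order_def card_B)
    have pF: "p dvd card {X \<in> ?R. \<forall>g\<in>carrier B. lam g ` X = X}"
      using cong_dvd_iff[OF fc] unfolding cR by simp
    have "lam g ` Z = Z" if "g \<in> carrier B" for g
    proof -
      have "lam g ` Z = (\<lambda>a. a) ` Z" by (rule image_cong[OF refl]) (rule lamZ[OF _ that])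
      then show ?thesis by simp
    qed
    then have "Z \<in> {X \<in> ?R. \<forall>g\<in>carrier B. lam g ` X = X}"
      using N.subgroup_in_rcosets[OF add_group] by simp
    moreover have "finite {X \<in> ?R. \<forall>g\<in>carrier B. lam g ` X = X}" using finR by simp
    ultimately have "card {X \<in> ?R. \<forall>g\<in>carrier B. lam g ` X = X} > 0"
      by (subst card_gt_0_iff) blast
    then have "p \<le> card {X \<in> ?R. \<forall>g\<in>carrier B. lam g ` X = X}"
      by (rule dvd_imp_le[OF pF])
    then have "{X \<in> ?R. \<forall>g\<in>carrier B. lam g ` X = X} = ?R"
      by (intro card_seteq finR) (auto simp: cR)
    moreover have "Z #>\<^bsub>add_monoid B\<^esub> x \<in> ?R" using xy by (auto simp: RCOSETS_def)
    ultimately have "lam y ` (Z #>\<^bsub>add_monoid B\<^esub> x) = Z #>\<^bsub>add_monoid B\<^esub> x" using xy by blast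
    then have "lam y x \<in> Z #>\<^bsub>add_monoid B\<^esub> x"
      using xy group.rcos_self[OF add_group _ sZ, of x] by auto
    then show ?thesis by (auto simp: r_coset_def Z_def)
  qed
  then obtain F where F: "\<And>y. y \<in> carrier B \<Longrightarrow> lam y e = [(F y :: int)] \<cdot> z \<oplus> e" using e(1) by metis
  have circ0: "y \<otimes> ([u'] \<cdot> z \<oplus> [v'] \<cdot> e) = y \<oplus> ([(u' + v' * F y)] \<cdot> z \<oplus> [v'] \<cdot> e)"
    if y: "y \<in> carrier B" for y and u' v' :: int
  proof -
    have "y \<otimes> ([u'] \<cdot> z \<oplus> [v'] \<cdot> e) = y \<oplus> ([u'] \<cdot> z \<oplus> [v'] \<cdot> ([(F y)] \<cdot> z \<oplus> e))"
      using y z e(1) by (simp add: circ_eq_lam lam_add lam_int_pow F)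
    also have "[v'] \<cdot> ([(F y)] \<cdot> z \<oplus> e) = [(v' * F y)] \<cdot> z \<oplus> [v'] \<cdot> e"
      using z(1) e(1) A.int_pow_distrib[of "[(F y)] \<cdot> z" e v'] by (simp add: add.int_pow_pow mult.commute)
    finally show ?thesis using y z(1) e(1) by (simp add: add.int_pow_mult add.m_assoc)
  qed
  \<comment> \<open>Comparing \<open>y \<otimes> e\<close> with \<open>e \<otimes> y\<close>
    expresses \<open>F y\<close> through \<open>F e\<close>. The equation is between multiples of
    \<open>z\<close>, since the values of \<open>F\<close> matter only modulo
    \<open>p\<close>.\<close>
  have Fy: "[F ([u] \<cdot> z \<oplus> [v] \<cdot> e)] \<cdot> z = [(v * F e)] \<cdot> z" for u v :: int
  proof -
    let ?y = "[u] \<cdot> z \<oplus> [v] \<cdot> e"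
    have y: "?y \<in> carrier B" using z(1) e(1) by simp
    have "?y \<otimes> e = ?y \<oplus> ([(F ?y)] \<cdot> z \<oplus> e)" using circ0[OF y, of 0 1] z(1) e(1) by simp
    moreover have "e \<otimes> ?y = e \<oplus> ([(u + v * F e)] \<cdot> z \<oplus> [v] \<cdot> e)" by (rule circ0[OF e(1)])
    moreover have "\<dots> = ?y \<oplus> ([(v * F e)] \<cdot> z \<oplus> e)"
      using z(1) e(1) by (simp add: add.int_pow_mult add_ac)
    ultimately have "?y \<oplus> ([(F ?y)] \<cdot> z \<oplus> e) = ?y \<oplus> ([(v * F e)] \<cdot> z \<oplus> e)"
      using circ_comm[OF y e(1)] by simp
    then show ?thesis using y z(1) e(1) by simp
  qed
  show thesis
  proof (rule that[OF z(1) e(1) z(2) pz, of k "F e"])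
    show "[int p] \<cdot> e = [k] \<cdot> z" using k by (simp add: add_pow_def int_pow_int)
    show "\<exists>(u::int) (v::int). y = [u] \<cdot> z \<oplus> [v] \<cdot> e" if "y \<in> carrier B" for y
      using that unfolding S[symmetric] by (auto simp: S_def)
    fix u v u' v' :: int
    let ?y = "[u] \<cdot> z \<oplus> [v] \<cdot> e"
    have y: "?y \<in> carrier B" using z(1) e(1) by simp
    have "[(v' * F ?y)] \<cdot> z = [v'] \<cdot> ([(F ?y)] \<cdot> z)" using z(1) by (simp add: add.int_pow_pow mult.commute)
    also have "\<dots> = [(F e * v * v')] \<cdot> z" unfolding Fy using z(1) by (simp add: add.int_pow_pow mult_ac)
    finally have *: "[(v' * F ?y)] \<cdot> z = [(F e * v * v')] \<cdot> z" .
    have "?y \<otimes> ([u'] \<cdot> z \<oplus> [v'] \<cdot> e) = ?y \<oplus> ([u'] \<cdot> z \<oplus> [(v' * F ?y)] \<cdot> z \<oplus> [v'] \<cdot> e)"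
      unfolding circ0[OF y] using z(1) by (simp add: add.int_pow_mult)
    also have "\<dots> = [(u + u' + F e * v * v')] \<cdot> z \<oplus> [(v + v')] \<cdot> e"
      unfolding * using z(1) e(1) by (simp add: add.int_pow_mult add_ac)
    finally show "?y \<otimes> ([u'] \<cdot> z \<oplus> [v'] \<cdot> e) = [(u + u' + F e * v * v')] \<cdot> z \<oplus> [(v + v')] \<cdot> e" .
  qed
qed

text \<open>Passing to \<open>c z\<close> and \<open>a e\<close> changes \<open>k\<close> into
  \<open>a k / c\<close> and \<open>f\<close> into \<open>f a^2 / c\<close> modulo \<open>p\<close>.
  A nonzero scalar can therefore be normalized to 1, and both can be at once, which leaves four
  braces.\<close>

lemma standard_basis:
  obtains z e and \<kappa> \<epsilon> :: int where "\<kappa> \<in> {0, 1}" "\<epsilon> \<in> {0, 1}" "z \<in> carrier B" "e \<in> carrier B"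
    "[int p] \<cdot> z = \<zero>" "[int p] \<cdot> e = [\<kappa>] \<cdot> z"
    "\<And>y. y \<in> carrier B \<Longrightarrow> \<exists>(u::int) (v::int). y = [u] \<cdot> z \<oplus> [v] \<cdot> e"
    "\<And>u v u' v' :: int. ([u] \<cdot> z \<oplus> [v] \<cdot> e) \<otimes> ([u'] \<cdot> z \<oplus> [v'] \<cdot> e) =
       [(u + u' + \<epsilon> * v * v')] \<cdot> z \<oplus> [(v + v')] \<cdot> e"
proof -
  obtain z e f k where ze: "z \<in> carrier B" "e \<in> carrier B" and pz: "[int p] \<cdot> z = \<zero>"
    and pe: "[int p] \<cdot> e = [(k::int)] \<cdot> z"
    and surj: "\<And>y. y \<in> carrier B \<Longrightarrow> \<exists>(u::int) (v::int). y = [u] \<cdot> z \<oplus> [v] \<cdot> e"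
    and circ: "\<And>u v u' v' :: int. ([u] \<cdot> z \<oplus> [v] \<cdot> e) \<otimes> ([u'] \<cdot> z \<oplus> [v'] \<cdot> e) =
       [(u + u' + f * v * v')] \<cdot> z \<oplus> [(v + v')] \<cdot> e"
    using standard_basis0 by metis
  have zcong: "[u] \<cdot> z = [u'] \<cdot> z" if uu: "[u = u'] (mod int p)" for u u' :: int
  proof -
    obtain d where d: "u = u' + int p * d"
      using uu by (metis cong_iff_lin cong_sym)
    have "[(int p * d)] \<cdot> z = \<zero>"
      using add.int_pow_pow[OF ze(1), of d "int p"] pz by (simp add: mult.commute)
    then show ?thesis unfolding d using ze by (simp add: add.int_pow_mult)
  qed
  note result = that
  have main: thesis if ca: "coprime a (int p)" and cc: "coprime c (int p)"
    and \<kappa>: "\<kappa> \<in> {0, 1}" and \<epsilon>: "\<epsilon> \<in> {0, 1}"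
    and c1: "[f * a ^ 2 = \<epsilon> * c] (mod int p)" and c2: "[a * k = \<kappa> * c] (mod int p)" for a c \<kappa> \<epsilon> :: int
  proof (rule result[OF \<kappa> \<epsilon>, of "[c] \<cdot> z" "[a] \<cdot> e"])
    have powz: "[n] \<cdot> ([c] \<cdot> z) = [(c * n)] \<cdot> z" for n :: int using ze by (simp add: add.int_pow_pow mult.commute)
    have powe: "[n] \<cdot> ([a] \<cdot> e) = [(a * n)] \<cdot> e" for n :: int using ze by (simp add: add.int_pow_pow mult.commute)
    show "[c] \<cdot> z \<in> carrier B" "[a] \<cdot> e \<in> carrier B" using ze by auto
    have "[(c * int p)] \<cdot> z = [(0::int)] \<cdot> z" by (rule zcong) (simp add: cong_def)
    then show "[int p] \<cdot> ([c] \<cdot> z) = \<zero>" unfolding powz using ze by simp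
    have "[(a * int p)] \<cdot> e = [a] \<cdot> ([int p] \<cdot> e)" using ze by (simp add: add.int_pow_pow mult.commute)
    also have "\<dots> = [(a * k)] \<cdot> z" unfolding pe using ze by (simp add: add.int_pow_pow mult.commute)
    also have "\<dots> = [(c * \<kappa>)] \<cdot> z" by (rule zcong) (use c2 in \<open>simp add: mult.commute\<close>)
    finally show "[int p] \<cdot> ([a] \<cdot> e) = [\<kappa>] \<cdot> ([c] \<cdot> z)" unfolding powz powe .
    show "\<exists>(u::int) (v::int). y = [u] \<cdot> ([c] \<cdot> z) \<oplus> [v] \<cdot> ([a] \<cdot> e)" if y: "y \<in> carrier B" for y
    proof -
      obtain u v where uv: "y = [(u::int)] \<cdot> z \<oplus> [(v::int)] \<cdot> e" using surj[OF y] by blast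
      \<comment> \<open>An inverse modulo \<open>p\<close> only gives \<open>a a' = 1 + p m\<close>.
        Since \<open>p e = k z\<close>, the excess \<open>m v (p e)\<close> is a multiple of
        \<open>z\<close> and is compensated in the first coordinate.\<close>
      obtain a' where "[a * a' = 1] (mod int p)" using cong_solve_coprime_int[OF ca] by auto
      then obtain m where m: "a * a' = 1 + int p * m" by (metis cong_iff_lin cong_sym)
      obtain c' where c': "[c * c' = 1] (mod int p)" using cong_solve_coprime_int[OF cc] by auto
      have ev: "a * (a' * v) = v + int p * (m * v)" 
      proof -
        have "a * (a' * v) = (a * a') * v" by simp
        then show ?thesis unfolding m by (simp add: distrib_right mult.assoc)
      qed
      have "[(a * (a' * v))] \<cdot> e = [v] \<cdot> e \<oplus> [(m * v)] \<cdot> ([int p] \<cdot> e)"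
        unfolding ev using ze by (simp add: add.int_pow_mult add.int_pow_pow mult.commute)
      also have "\<dots> = [v] \<cdot> e \<oplus> [(k * (m * v))] \<cdot> z"
        unfolding pe using ze by (simp add: add.int_pow_pow mult.commute)
      finally have e1: "[(a * (a' * v))] \<cdot> e = [v] \<cdot> e \<oplus> [(k * (m * v))] \<cdot> z" .
      have "[c * c' * (u - k * (m * v)) = 1 * (u - k * (m * v))] (mod int p)"
        by (rule cong_scalar_right[OF c'])
      then have "[(c * (c' * (u - k * (m * v))))] \<cdot> z = [(u - k * (m * v))] \<cdot> z"
        by (intro zcong) (simp add: mult.assoc)
      then have "[(c' * (u - k * (m * v)))] \<cdot> ([c] \<cdot> z) \<oplus> [(a' * v)] \<cdot> ([a] \<cdot> e) =
          [(u - k * (m * v))] \<cdot> z \<oplus> [(k * (m * v))] \<cdot> z \<oplus> [v] \<cdot> e"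
        unfolding powz powe e1 using ze by (simp add: add_ac)
      also have "\<dots> = y" unfolding uv using ze by (simp add: add.int_pow_mult[symmetric])
      finally show ?thesis by metis
    qed
    fix u v u' v' :: int
    have "[f * a ^ 2 * (v * v') = \<epsilon> * c * (v * v')] (mod int p)" by (rule cong_scalar_right[OF c1])
    then have "[(c * u + c * u') + f * a ^ 2 * (v * v') = (c * u + c * u') + \<epsilon> * c * (v * v')] (mod int p)"
      by (rule cong_add[OF cong_refl])
    moreover have "(c * u + c * u') + f * a ^ 2 * (v * v') = c * u + c * u' + f * (a * v) * (a * v')"
      by (simp add: power2_eq_square)
    moreover have "(c * u + c * u') + \<epsilon> * c * (v * v') = c * (u + u' + \<epsilon> * v * v')"
      by (simp add: algebra_simps)
    ultimately have "[c * u + c * u' + f * (a * v) * (a * v') = c * (u + u' + \<epsilon> * v * v')] (mod int p)"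
      by (simp only:)
    from zcong[OF this]
    show "([u] \<cdot> ([c] \<cdot> z) \<oplus> [v] \<cdot> ([a] \<cdot> e)) \<otimes> ([u'] \<cdot> ([c] \<cdot> z) \<oplus> [v'] \<cdot> ([a] \<cdot> e)) =
       [(u + u' + \<epsilon> * v * v')] \<cdot> ([c] \<cdot> z) \<oplus> [(v + v')] \<cdot> ([a] \<cdot> e)"
      unfolding powz powe circ by (simp add: distrib_left)
  qed
  have cop: "coprime x (int p)" if "\<not> [x = 0] (mod int p)" for x :: int
    using that p by (metis cong_0_iff coprime_commute prime_imp_coprime prime_nat_int_transfer)
  consider "[f = 0] (mod int p)" "[k = 0] (mod int p)" | "[f = 0] (mod int p)" "\<not> [k = 0] (mod int p)"
    | "\<not> [f = 0] (mod int p)" "[k = 0] (mod int p)" | "\<not> [f = 0] (mod int p)" "\<not> [k = 0] (mod int p)"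
    by blast
  then show thesis
  proof cases
    case 1
    then show thesis using main[of 1 1 0 0] by simp
  next
    case 2
    then show thesis using main[of 1 k 1 0] cop[of k] by simp
  next
    case 3
    then show thesis using main[of 1 f 0 1] cop[of f] by simp
  next
    case 4
    \<comment> \<open>The equations \<open>f a^2 = c\<close> and \<open>a k = c\<close> are solved
      by \<open>a = k / f\<close> and \<open>c = k^2 / f\<close>.\<close>
    obtain f' where f': "[f * f' = 1] (mod int p)" using cong_solve_coprime_int[OF cop[OF 4(1)]] by auto
    have "coprime f' (int p)" using f' by (metis coprime_iff_invertible_int mult.commute)
    then have "coprime (k * f') (int p)" using cop[OF 4(2)] by simp
    moreover from this have "coprime (k * f' * k) (int p)" using cop[OF 4(2)] by simp
    moreover have "[f * (k * f') ^ 2 = 1 * (k * f' * k)] (mod int p)"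
    proof -
      have "[f * f' * (k * f' * k) = 1 * (k * f' * k)] (mod int p)" by (rule cong_scalar_right[OF f'])
      then show ?thesis by (simp add: power2_eq_square mult_ac)
    qed
    ultimately show thesis using main[of "k * f'" "k * f' * k" 1 1] by simp
  qed
qed

end

section \<open>Integer coordinates on a brace of order p^2 q\<close>

lemma (in skew_brace) restrict_skew_brace:
  assumes K1: "subgroup K B" and K2: "subgroup K (add_monoid B)"
  shows "skew_brace (B\<lparr>carrier := K\<rparr>)"
proof -
  have am: "add_monoid (B\<lparr>carrier := K\<rparr>) = (add_monoid B)\<lparr>carrier := K\<rparr>" by simp
  have inv: "\<ominus>\<^bsub>B\<lparr>carrier := K\<rparr>\<^esub> x = \<ominus> x" if "x \<in> K" for x
    using group.m_inv_consistent[OF add_group K2 that] by (simp add: a_inv_def)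
  show ?thesis
  proof (rule skew_brace.intro)
    show "group (add_monoid (B\<lparr>carrier := K\<rparr>))"
      unfolding am by (rule subgroup.subgroup_is_group[OF K2 add_group])
    show "group (B\<lparr>carrier := K\<rparr>)" by (rule subgroup.subgroup_is_group[OF K1 circ_group])
    fix a b c assume "a \<in> carrier (B\<lparr>carrier := K\<rparr>)" "b \<in> carrier (B\<lparr>carrier := K\<rparr>)" "c \<in> carrier (B\<lparr>carrier := K\<rparr>)"
    then show "a \<otimes>\<^bsub>B\<lparr>carrier := K\<rparr>\<^esub> (b \<oplus>\<^bsub>B\<lparr>carrier := K\<rparr>\<^esub> c) =
       a \<otimes>\<^bsub>B\<lparr>carrier := K\<rparr>\<^esub> b \<ominus>\<^bsub>B\<lparr>carrier := K\<rparr>\<^esub> a \<oplus>\<^bsub>B\<lparr>carrier := K\<rparr>\<^esub> a \<otimes>\<^bsub>B\<lparr>carrier := K\<rparr>\<^esub> c"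
      using brace_distrib[of a b c] inv subgroup.subset[OF K1] by (simp add: a_minus_def subset_iff)
  qed
qed

lemma ex_nat_cong:
  fixes n :: int
  assumes "q > 0"
  shows "\<exists>m. [int m = n] (mod int q)"
  using assms by (intro exI[of _ "nat (n mod int q)"]) (simp add: cong_def)

text \<open>By Fermat \<open>r ^ q\<close> is congruent to \<open>r\<close>. Thus an element whose
  \<open>q\<close>-th power is trivial can only act trivially on a group of order
  \<open>q\<close>.\<close>

lemma fermat_one:
  fixes r :: int
  assumes q: "Factorial_Ring.prime q" and r: "[r ^ q = 1] (mod int q)"
  shows "[r = 1] (mod int q)"
proof -
  have "q > 0" using prime_gt_0_nat[OF q] .
  define n where "n = nat (r mod int q)"
  have rn: "[r = int n] (mod int q)" using \<open>q > 0\<close> by (simp add: n_def cong_def)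
  then have "[int n ^ q = 1] (mod int q)" using r by (meson cong_pow cong_sym cong_trans)
  then have nq: "[n ^ q = 1] (mod q)" by (metis cong_int_iff of_nat_1 of_nat_power)
  have "\<not> q dvd n"
  proof
    assume "q dvd n"
    then have "q dvd n ^ q" using \<open>q > 0\<close> by (simp add: dvd_power_same dvd_trans)
    then have "q dvd 1" using nq cong_dvd_iff by blast
    then show False using q by simp
  qed
  then have "[n ^ (q - 1) = 1] (mod q)" by (rule fermat_theorem[OF q])
  then have "[n * n ^ (q - 1) = n * 1] (mod q)" by (rule cong_scalar_left)
  moreover have "n * n ^ (q - 1) = n ^ q" using \<open>q > 0\<close> by (metis power_eq_if less_numeral_extra(3))
  ultimately have "[n = 1] (mod q)" using nq by (metis cong_sym cong_trans mult.right_neutral)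
  then have "[int n = 1] (mod int q)" by (metis cong_int_iff of_nat_1)
  then show ?thesis using rn cong_trans by blast
qed

text \<open>Coordinates are integers rather than residues, so that the formulas need no reductions;
  the periods are separate equations. \<open>T\<close> records how the complement conjugates
  \<open>Q\<close> additively, \<open>D\<close> and \<open>G\<close> how it acts on \<open>Q\<close>
  by circle multiplication from the left and from the right. That these are multiplicative is
  extracted only later, from the axioms.\<close>

lemma (in p2q_brace) presentation:
  obtains \<kappa> \<epsilon> :: int and ev :: "int \<Rightarrow> int \<Rightarrow> int \<Rightarrow> 'a" and T D G :: "int \<Rightarrow> int \<Rightarrow> int"
  where "\<kappa> \<in> {0, 1}" "\<epsilon> \<in> {0, 1}" "\<And>x u v. ev x u v \<in> carrier B"
    "\<And>b. b \<in> carrier B \<Longrightarrow> \<exists>x u v. b = ev x u v" "ev 0 0 0 = \<zero>"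
    "\<And>x u v x' u' v'. ev x u v \<oplus> ev x' u' v' = ev (x + T u v * x') (u + u') (v + v')"
    "\<And>x u v x' u' v'. ev x u v \<otimes> ev x' u' v' =
       ev (G u' v' * x + D u v * x') (u + u' + \<epsilon> * v * v') (v + v')"
    "\<And>x u v. ev (x + int q) u v = ev x u v" "\<And>x u v. ev x (u + int p) v = ev x u v"
    "\<And>x u v. ev x u (v + int p) = ev x (u + \<kappa>) v"
proof -
  obtain K where K: "subgroup K B" "subgroup K (add_monoid B)" "card K = p ^ 2"
    using ex_sub_brace by blast
  have KB: "K \<subseteq> carrier B" using subgroup.subset[OF K(1)] .
  interpret K: p2_brace "B\<lparr>carrier := K\<rparr>" p
    using restrict_skew_brace[OF K(1,2)] p K(3) by (simp add: p2_brace_def p2_brace_axioms_def)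
  have Kpow: "[n] \<cdot>\<^bsub>B\<lparr>carrier := K\<rparr>\<^esub> x = [n] \<cdot> x" if "x \<in> K" for x and n :: int
    using group.int_pow_consistent[OF add_group K(2) that, of n] by (simp add: add_pow_def)
  obtain z e and \<kappa> \<epsilon> :: int where \<kappa>: "\<kappa> \<in> {0, 1}" and \<epsilon>: "\<epsilon> \<in> {0, 1}" and ze: "z \<in> K" "e \<in> K"
    and pz: "[int p] \<cdot>\<^bsub>B\<lparr>carrier := K\<rparr>\<^esub> z = \<zero>" and pe: "[int p] \<cdot>\<^bsub>B\<lparr>carrier := K\<rparr>\<^esub> e = [\<kappa>] \<cdot>\<^bsub>B\<lparr>carrier := K\<rparr>\<^esub> z"
    and surj: "\<And>y. y \<in> K \<Longrightarrow> \<exists>(u::int) (v::int). y = [u] \<cdot>\<^bsub>B\<lparr>carrier := K\<rparr>\<^esub> z \<oplus> [v] \<cdot>\<^bsub>B\<lparr>carrier := K\<rparr>\<^esub> e"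
    and circ: "\<And>u v u' v' :: int. ([u] \<cdot>\<^bsub>B\<lparr>carrier := K\<rparr>\<^esub> z \<oplus> [v] \<cdot>\<^bsub>B\<lparr>carrier := K\<rparr>\<^esub> e) \<otimes> ([u'] \<cdot>\<^bsub>B\<lparr>carrier := K\<rparr>\<^esub> z \<oplus> [v'] \<cdot>\<^bsub>B\<lparr>carrier := K\<rparr>\<^esub> e) =
       [(u + u' + \<epsilon> * v * v')] \<cdot>\<^bsub>B\<lparr>carrier := K\<rparr>\<^esub> z \<oplus> [(v + v')] \<cdot>\<^bsub>B\<lparr>carrier := K\<rparr>\<^esub> e"
    by (rule K.standard_basis) simp
  have zeB: "z \<in> carrier B" "e \<in> carrier B" using ze KB by auto
  define k where "k u v = [u] \<cdot> z \<oplus> [v] \<cdot> e" for u v :: int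
  have kK: "k u v \<in> K" for u v
  proof -
    have "[u] \<cdot>\<^bsub>B\<lparr>carrier := K\<rparr>\<^esub> z \<oplus>\<^bsub>B\<lparr>carrier := K\<rparr>\<^esub> [v] \<cdot>\<^bsub>B\<lparr>carrier := K\<rparr>\<^esub> e \<in> carrier (B\<lparr>carrier := K\<rparr>)"
      by (intro K.add.m_closed K.add.int_pow_closed) (use ze in auto)
    then show ?thesis by (simp add: k_def Kpow ze)
  qed
  have kB: "k u v \<in> carrier B" for u v using kK KB by auto
  have k_circ: "k u v \<otimes> k u' v' = k (u + u' + \<epsilon> * v * v') (v + v')" for u v u' v'
    using circ[of u v u' v'] by (simp add: k_def Kpow ze)
  have Kcomm: "x \<oplus> y = y \<oplus> x" if "x \<in> K" "y \<in> K" for x y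
    using K.add_comm[of x y] that by simp
  have powK: "[u] \<cdot> z \<in> K" "[u] \<cdot> e \<in> K" for u :: int
    using kK[of u 0] kK[of 0 u] zeB by (simp_all add: k_def)
  have k_add: "k u v \<oplus> k u' v' = k (u + u') (v + v')" for u v u' v'
  proof -
    have "k u v \<oplus> k u' v' = [u] \<cdot> z \<oplus> ([v] \<cdot> e \<oplus> [u'] \<cdot> z) \<oplus> [v'] \<cdot> e"
      using zeB by (simp add: k_def add.m_assoc)
    also have "[v] \<cdot> e \<oplus> [u'] \<cdot> z = [u'] \<cdot> z \<oplus> [v] \<cdot> e" using Kcomm powK by blast
    finally show ?thesis using zeB by (simp add: k_def add.int_pow_mult add.m_assoc)
  qed
  have k_surj: "\<exists>u v. y = k u v" if "y \<in> K" for y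
    using surj[OF that] by (simp add: k_def Kpow ze)
  have k0: "k 0 0 = \<zero>" by (simp add: k_def)
  have kp: "k (u + int p) v = k u v" for u v
  proof -
    have "[int p] \<cdot> z = \<zero>" using pz by (simp add: Kpow ze)
    then show ?thesis using zeB by (simp add: k_def add.int_pow_mult)
  qed
  have kp': "k u (v + int p) = k (u + \<kappa>) v" for u v
  proof -
    have "[int p] \<cdot> e = [\<kappa>] \<cdot> z" using pe by (simp add: Kpow ze)
    then have "k u (v + int p) = k u v \<oplus> k \<kappa> 0"
      using zeB by (simp add: k_def add.int_pow_mult add.m_assoc)
    then show ?thesis by (simp add: k_add)
  qed
  obtain g where g: "g \<in> Q" "g \<noteq> \<zero>"
  proof -
    have "card Q > 1" using card_Q prime_gt_1_nat[OF q] by simp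
    then have "\<not> Q \<subseteq> {\<zero>}" by (metis card_mono card.insert card.empty finite.emptyI finite.insertI insert_absorb empty_iff leD One_nat_def)
    then show thesis using that by auto
  qed
  have gB: "g \<in> carrier B" using g Q_carrier by blast
  have ordg: "add.ord g = q"
  proof -
    have "add.ord g dvd q" using g gB by (simp add: add.pow_eq_id[symmetric] Q_def)
    then show ?thesis using q g gB add.ord_eq_1[of g] by (auto simp: prime_nat_iff)
  qed
  have Qg: "Q = range (\<lambda>n::int. [n] \<cdot> g)"
  proof (rule card_seteq[symmetric])
    show "finite Q" using fin_B by (auto simp: Q_def)
    show "range (\<lambda>n::int. [n] \<cdot> g) \<subseteq> Q"
      using group.subgroup_int_pow_closed[OF add_group Q_add_subgroup g(1)] by (auto simp: add_pow_def)
    show "card Q \<le> card (range (\<lambda>n::int. [n] \<cdot> g))"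
      using add.card_range_int_pow[OF gB] ordg card_Q by simp
  qed
  have gcong: "[n] \<cdot> g = [m] \<cdot> g \<longleftrightarrow> [n = m] (mod int q)" for n m :: int
    using add.int_pow_eq[OF gB, of n m] ordg by (simp add: cong_iff_dvd_diff dvd_diff_commute)
  have gmul: "[n] \<cdot> ([m] \<cdot> g) = [(m * n)] \<cdot> g" for n m :: int using gB by (simp add: add.int_pow_pow)
  have gadd: "[n] \<cdot> g \<oplus> [m] \<cdot> g = [(n + m)] \<cdot> g" for n m :: int using gB by (simp add: add.int_pow_mult)
  have nB [simp]: "[n] \<cdot> g \<in> carrier B" for n :: int using gB by simp
  have nQ: "[n] \<cdot> g \<in> Q" for n :: int using Qg by blast
  have QE: "\<exists>n::int. x = [n] \<cdot> g" if "x \<in> Q" for x using that Qg by blast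
  have lam_int: "lam y ([n] \<cdot> g) = [n] \<cdot> lam y g" if "y \<in> carrier B" for y and n :: int
    using lam_int_pow[OF that gB] .
  have "\<forall>y\<in>carrier B. \<exists>n::int. lam y g = [n] \<cdot> g" using QE lam_Q[OF _ g(1)] by blast
  from bchoice[OF this] obtain r where r: "\<And>y. y \<in> carrier B \<Longrightarrow> lam y g = [(r y :: int)] \<cdot> g"
    by blast
  have lam_g: "lam y ([n] \<cdot> g) = [(r y * n)] \<cdot> g" if "y \<in> carrier B" for y n
    using that by (simp add: lam_int r gmul)
  \<comment> \<open>The \<open>n\<close>-th circle power of \<open>w\<close> scales \<open>g\<close>
    by \<open>r w ^ n\<close>. As the \<open>q\<close>-th power of \<open>w\<close> is trivial,
    \<open>fermat_one\<close> gives \<open>r w = 1\<close> modulo \<open>q\<close>; so sum and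
    circle product agree on \<open>Q\<close>.\<close>
  have lamQ_id: "lam w x = x" if w: "w \<in> Q" and x: "x \<in> Q" for w x
  proof -
    have wB: "w \<in> carrier B" using w Q_carrier by blast
    have "w [^] n \<in> carrier B \<and> lam (w [^] n) g = [(r w ^ n)] \<cdot> g" for n :: nat
    proof (induction n)
      case 0
      then show ?case using gB by simp
    next
      case (Suc n)
      then have c: "w [^] n \<in> carrier B" and IH: "lam (w [^] n) g = [(r w ^ n)] \<cdot> g" by auto
      have "lam (w [^] n \<otimes> w) g = lam (w [^] n) (lam w g)" by (rule lam_circ[OF c wB gB])
      also have "\<dots> = [(r w)] \<cdot> ([(r w ^ n)] \<cdot> g)" unfolding r[OF wB] lam_int[OF c] IH ..
      finally show ?case using c wB by (simp add: gmul mult.commute)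
    qed
    moreover have "w [^] q = \<one>"
      using w p2q_group.subgroup_order_q_eq[OF p2q_circ Q_circ_subgroup card_Q] by (auto simp: p2q_group.Q_def[OF p2q_circ])
    ultimately have "[(r w ^ q)] \<cdot> g = [(1::int)] \<cdot> g" using gB by (metis lam_one add.int_pow_1)
    then have "[r w = 1] (mod int q)" unfolding gcong by (rule fermat_one[OF q])
    moreover obtain n where n: "x = [(n::int)] \<cdot> g" using QE[OF x] by blast
    ultimately have "[(r w * n)] \<cdot> g = [n] \<cdot> g" unfolding gcong using cong_scalar_right[of "r w" 1 "int q" n] by simp
    then show ?thesis using lam_g[OF wB] n by simp
  qed
  have "\<exists>n::int. y \<oplus> g = [n] \<cdot> g \<oplus> y" if y: "y \<in> carrier B" for y
  proof -
    have "y \<oplus> g \<oplus> \<ominus> y \<in> Q"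
      using normal.inv_op_closed2[OF Q_add_normal, of y g] y g by (simp add: a_inv_def)
    then obtain n where "y \<oplus> g \<oplus> \<ominus> y = [(n::int)] \<cdot> g" using QE by blast
    then have "[n] \<cdot> g \<oplus> y = y \<oplus> g \<oplus> \<ominus> y \<oplus> y" by simp
    also have "\<dots> = y \<oplus> g" using y gB by (simp add: add.m_assoc)
    finally show ?thesis by metis
  qed
  then have "\<forall>y\<in>carrier B. \<exists>n::int. y \<oplus> g = [n] \<cdot> g \<oplus> y" by blast
  from bchoice[OF this] obtain \<tau> where \<tau>: "\<And>y. y \<in> carrier B \<Longrightarrow> y \<oplus> g = [(\<tau> y :: int)] \<cdot> g \<oplus> y" by blast
  have conj_g: "y \<oplus> [n] \<cdot> g = [(\<tau> y * n)] \<cdot> g \<oplus> y" if y: "y \<in> carrier B" for y and n :: int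
  proof -
    have nat: "y \<oplus> [int n] \<cdot> g = [(\<tau> y * int n)] \<cdot> g \<oplus> y" for n :: nat
    proof (induction n)
      case (Suc n)
      have "y \<oplus> [(int (Suc n))] \<cdot> g = y \<oplus> [int n] \<cdot> g \<oplus> g"
        using y gB gadd[of "int n" 1] by (simp add: add.m_assoc add.commute)
      also have "\<dots> = [(\<tau> y * int n)] \<cdot> g \<oplus> (y \<oplus> g)" using y gB Suc by (simp add: add.m_assoc)
      also have "\<dots> = [(\<tau> y * int n)] \<cdot> g \<oplus> [\<tau> y] \<cdot> g \<oplus> y" using y gB by (simp add: \<tau> add.m_assoc)
      finally show ?case by (simp add: gadd algebra_simps)
    qed (use y in simp)
    \<comment> \<open>Multiples of \<open>g\<close> depend only on residues modulo \<open>q\<close>,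
      so the statement for natural multiples covers all integers.\<close>
    obtain m where m: "[int m = n] (mod int q)" using ex_nat_cong[OF prime_gt_0_nat[OF q]] by blast
    then have "[int m] \<cdot> g = [n] \<cdot> g" "[(\<tau> y * int m)] \<cdot> g = [(\<tau> y * n)] \<cdot> g"
      unfolding gcong by (auto intro: cong_scalar_left)
    then show ?thesis using nat[of m] by simp
  qed
  \<comment> \<open>\<open>y \<otimes> x\<close> is \<open>y \<oplus> lam y x\<close>; the factor
    \<open>\<tau> y\<close> arises on moving the multiple of \<open>g\<close> to the left of
    \<open>y\<close>.\<close>
  define \<delta> where "\<delta> y = \<tau> y * r y" for y
  have circ_g: "y \<otimes> [n] \<cdot> g = [(\<delta> y * n)] \<cdot> g \<oplus> y" if y: "y \<in> carrier B" for y and n :: int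
    using y by (simp add: circ_eq_lam lam_g conj_g \<delta>_def mult.assoc)
  have "\<exists>n::int. g \<otimes> y = [n] \<cdot> g \<oplus> y" if y: "y \<in> carrier B" for y
  proof -
    have "inv y \<otimes> g \<otimes> y \<in> Q" using normal.inv_op_closed1[OF Q_circ_normal, of y g] y g by simp
    then obtain n where n: "inv y \<otimes> g \<otimes> y = [(n::int)] \<cdot> g" using QE by blast
    have "y \<otimes> (inv y \<otimes> g \<otimes> y) = g \<otimes> y" using y gB by (simp add: circ.m_assoc[symmetric])
    then have "g \<otimes> y = [(\<delta> y * n)] \<cdot> g \<oplus> y" unfolding n using circ_g[OF y] by simp
    then show ?thesis by metis
  qed
  then have "\<forall>y\<in>carrier B. \<exists>n::int. g \<otimes> y = [n] \<cdot> g \<oplus> y" by blast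
  from bchoice[OF this] obtain \<gamma> where \<gamma>: "\<And>y. y \<in> carrier B \<Longrightarrow> g \<otimes> y = [(\<gamma> y :: int)] \<cdot> g \<oplus> y" by blast
  \<comment> \<open>\<open>\<delta> y\<close> is a unit modulo \<open>q\<close>, since otherwise
    \<open>y \<otimes> g = y\<close>. Hence the additive coset of \<open>Q\<close> through
    \<open>y\<close> is also the circle coset, and \<open>x g + y\<close> can be rewritten as
    \<open>y\<close> times an element of \<open>Q\<close>.\<close>
  have coset: "\<exists>n. [x] \<cdot> g \<oplus> y = y \<otimes> [int n] \<cdot> g \<and> [\<delta> y * int n = x] (mod int q)" if y: "y \<in> carrier B" for y and x :: int
  proof -
    have "\<not> int q dvd \<delta> y"
    proof
      assume "int q dvd \<delta> y"
      then have "[(\<delta> y * 1)] \<cdot> g = [(0::int)] \<cdot> g" unfolding gcong by (simp add: cong_0_iff)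
      then have "y \<otimes> g = y" using circ_g[OF y, of 1] y gB by simp
      then have "inv y \<otimes> (y \<otimes> g) = \<one>" using y by simp
      then have "g = \<one>" using y gB by (simp add: circ.m_assoc[symmetric])
      then show False using g zero_eq_one by simp
    qed
    then have "coprime (\<delta> y) (int q)"
      using q by (metis coprime_commute prime_imp_coprime prime_nat_int_transfer)
    then obtain c where c: "[\<delta> y * c = 1] (mod int q)" using cong_solve_coprime_int by blast
    have "[\<delta> y * c * x = 1 * x] (mod int q)" by (rule cong_scalar_right[OF c])
    moreover obtain n where n: "[int n = c * x] (mod int q)" using ex_nat_cong[OF prime_gt_0_nat[OF q]] by blast
    have "[\<delta> y * int n = \<delta> y * (c * x)] (mod int q)" by (rule cong_scalar_left[OF n])
    ultimately have d: "[\<delta> y * int n = x] (mod int q)" using cong_trans by (simp add: mult.assoc)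
    then have "[(\<delta> y * int n)] \<cdot> g = [x] \<cdot> g" unfolding gcong .
    then have "[x] \<cdot> g \<oplus> y = y \<otimes> [int n] \<cdot> g" unfolding circ_g[OF y] by simp
    with d show ?thesis by blast
  qed
  \<comment> \<open>An element of \<open>Q\<close> in front does not change how \<open>y\<close>
    scales \<open>Q\<close>, because \<open>lam\<close> of \<open>Q\<close> is trivial on
    \<open>Q\<close>. The brace law then splits the \<open>Q\<close> component off the right
    factor.\<close>
  have left: "([x] \<cdot> g \<oplus> y) \<otimes> ([x'] \<cdot> g \<oplus> y') = [(\<delta> y * x')] \<cdot> g \<oplus> ([x] \<cdot> g \<oplus> y) \<otimes> y'"
    if y: "y \<in> carrier B" "y' \<in> carrier B" for y y' and x x' :: int
  proof -
    let ?a = "[x] \<cdot> g \<oplus> y"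
    obtain n where n: "?a = y \<otimes> [int n] \<cdot> g" using coset[OF y(1)] by blast
    have "lam ?a ([x'] \<cdot> g) = lam y (lam ([int n] \<cdot> g) ([x'] \<cdot> g))"
      unfolding n using y by (simp add: lam_circ)
    also have "\<dots> = [(r y * x')] \<cdot> g" using lamQ_id nQ y by (simp add: lam_g)
    finally have "?a \<otimes> [x'] \<cdot> g = ?a \<oplus> [(r y * x')] \<cdot> g" using y by (simp add: circ_eq_lam)
    also have "\<dots> = [x] \<cdot> g \<oplus> [(\<delta> y * x')] \<cdot> g \<oplus> y"
      using y by (simp add: add.m_assoc conj_g[OF y(1)] \<delta>_def mult.assoc)
    also have "\<dots> = [(\<delta> y * x')] \<cdot> g \<oplus> ?a" using y by (simp add: gadd add.m_assoc[symmetric] add.commute)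
    finally have 1: "?a \<otimes> [x'] \<cdot> g = [(\<delta> y * x')] \<cdot> g \<oplus> ?a" .
    have aB: "?a \<in> carrier B" using y by simp
    have "?a \<otimes> ([x'] \<cdot> g \<oplus> y') = ?a \<otimes> [x'] \<cdot> g \<ominus> ?a \<oplus> ?a \<otimes> y'"
      by (rule brace_distrib[OF aB nB y(2)])
    also have "?a \<otimes> [x'] \<cdot> g \<ominus> ?a = [(\<delta> y * x')] \<cdot> g \<oplus> (?a \<ominus> ?a)"
      unfolding 1 a_minus_def using add.m_assoc[OF nB aB add.inv_closed[OF aB]] by simp
    also have "?a \<ominus> ?a = \<zero>" unfolding a_minus_def by (rule add.r_inv[OF aB])
    finally show ?thesis by simp
  qed
  have \<delta>0: "[(\<delta> \<zero> * n)] \<cdot> g = [n] \<cdot> g" for n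
    using circ_g[of \<zero> n] circ.l_one[OF nB, of n] by (simp add: zero_eq_one[symmetric])
  have ng: "[int n] \<cdot> g \<otimes> y = [(\<gamma> y * int n)] \<cdot> g \<oplus> y" if y: "y \<in> carrier B" for y and n :: nat
  proof (induction n)
    case 0
    show ?case using y circ.l_one[OF y] by (simp add: zero_eq_one[symmetric])
  next
    case (Suc n)
    have "[(int (Suc n))] \<cdot> g = g \<otimes> [int n] \<cdot> g"
      using gB lamQ_id[OF g(1) nQ] gadd[of 1 "int n"] by (simp add: circ_eq_lam)
    then have "[(int (Suc n))] \<cdot> g \<otimes> y = g \<otimes> ([(\<gamma> y * int n)] \<cdot> g \<oplus> y)"
      using y gB Suc by (simp add: circ.m_assoc)
    also have "\<dots> = [(\<gamma> y * int n)] \<cdot> g \<oplus> g \<otimes> y"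
      using left[of \<zero> y 1 "\<gamma> y * int n"] gB y by (simp add: \<delta>0)
    also have "\<dots> = [(\<gamma> y * int n)] \<cdot> g \<oplus> [\<gamma> y] \<cdot> g \<oplus> y" using y by (simp add: \<gamma> add.m_assoc)
    finally show ?case by (simp add: gadd algebra_simps)
  qed
  \<comment> \<open>Write the left factor as \<open>y\<close> times \<open>n g\<close>, move
    \<open>n g\<close> past \<open>y'\<close> at the cost of \<open>\<gamma> y'\<close>, then past
    \<open>y\<close> at the cost of \<open>\<delta> y\<close>; by the choice of \<open>n\<close>,
    the product \<open>\<delta> y * n\<close> is \<open>x\<close> again.\<close>
  have right: "([x] \<cdot> g \<oplus> y) \<otimes> y' = [(\<gamma> y' * x)] \<cdot> g \<oplus> y \<otimes> y'"
    if y: "y \<in> carrier B" "y' \<in> carrier B" for y y' and x :: int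
  proof -
    obtain n where n: "[x] \<cdot> g \<oplus> y = y \<otimes> [int n] \<cdot> g" "[\<delta> y * int n = x] (mod int q)"
      using coset[OF y(1)] by blast
    have "([x] \<cdot> g \<oplus> y) \<otimes> y' = y \<otimes> ([(\<gamma> y' * int n)] \<cdot> g \<oplus> y')"
      unfolding n(1) using y by (simp add: circ.m_assoc ng)
    also have "\<dots> = [(\<delta> y * (\<gamma> y' * int n))] \<cdot> g \<oplus> y \<otimes> y'"
      using left[OF y, of 0 "\<gamma> y' * int n"] y by simp
    also have "[(\<delta> y * (\<gamma> y' * int n))] \<cdot> g = [(\<gamma> y' * x)] \<cdot> g"
      unfolding gcong using cong_scalar_left[OF n(2), of "\<gamma> y'"] by (simp add: mult_ac)
    finally show ?thesis .
  qed
  define ev where "ev x u v = [x] \<cdot> g \<oplus> k u v" for x u v :: int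
  show thesis
  proof (rule that[OF \<kappa> \<epsilon>, of ev "\<lambda>u v. \<tau> (k u v)" "\<lambda>u v. \<gamma> (k u v)" "\<lambda>u v. \<delta> (k u v)"])
    fix x u v x' u' v' :: int
    show "ev x u v \<in> carrier B" using kB by (simp add: ev_def)
    show "ev 0 0 0 = \<zero>" by (simp add: ev_def k0)
    show "ev x u v \<oplus> ev x' u' v' = ev (x + \<tau> (k u v) * x') (u + u') (v + v')"
    proof -
      have "ev x u v \<oplus> ev x' u' v' = [x] \<cdot> g \<oplus> (k u v \<oplus> [x'] \<cdot> g) \<oplus> k u' v'"
        using kB by (simp add: ev_def add.m_assoc)
      also have "\<dots> = [x] \<cdot> g \<oplus> [(\<tau> (k u v) * x')] \<cdot> g \<oplus> (k u v \<oplus> k u' v')"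
        using kB unfolding conj_g[OF kB] by (simp add: add.m_assoc)
      finally show ?thesis by (simp add: gadd k_add ev_def)
    qed
    show "ev x u v \<otimes> ev x' u' v' = ev (\<gamma> (k u' v') * x + \<delta> (k u v) * x') (u + u' + \<epsilon> * v * v') (v + v')"
    proof -
      have "ev x u v \<otimes> ev x' u' v' = [(\<delta> (k u v) * x')] \<cdot> g \<oplus> ([(\<gamma> (k u' v') * x)] \<cdot> g \<oplus> k u v \<otimes> k u' v')"
        unfolding ev_def using left[OF kB kB] right[OF kB kB] by simp
      also have "\<dots> = [(\<delta> (k u v) * x')] \<cdot> g \<oplus> [(\<gamma> (k u' v') * x)] \<cdot> g \<oplus> k u v \<otimes> k u' v'"
        using kB by (simp add: add.m_assoc)
      finally show ?thesis by (simp add: gadd ev_def k_circ add.commute)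
    qed
    have "[(x + int q)] \<cdot> g = [x] \<cdot> g" unfolding gcong by (simp add: cong_def)
    then show "ev (x + int q) u v = ev x u v" by (simp add: ev_def)
    show "ev x (u + int p) v = ev x u v" by (simp add: ev_def kp)
    show "ev x u (v + int p) = ev x (u + \<kappa>) v" by (simp add: ev_def kp')
  next
    fix b assume b: "b \<in> carrier B"
    obtain w y where wy: "w \<in> Q" "y \<in> K" "b = w \<oplus> y"
      using p2q_group.Q_P_decomp[OF p2q_add K(2,3), of b] b by (auto simp: Q_add)
    obtain x where "w = [(x::int)] \<cdot> g" using QE[OF wy(1)] by blast
    moreover obtain u v where "y = k u v" using k_surj[OF wy(2)] by blast
    ultimately have "b = ev x u v" using wy by (simp add: ev_def)
    then show "\<exists>x u v. b = ev x u v" by blast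
  qed
qed

text \<open>The binomial coefficient of \<open>v\<close> over 2, extended to negative
  \<open>v\<close>. Its additive defect \<open>a * b\<close> is the cocycle in the circle product of
  \<open>P\<close>, so subtracting \<open>\<epsilon> * tri v\<close> from \<open>u\<close>
  linearizes that product.\<close>

definition tri :: "int \<Rightarrow> int" where "tri v = v * (v - 1) div 2"

lemma two_tri: "2 * tri v = v * (v - 1)"
  by (simp add: tri_def)

lemma tri_0 [simp]: "tri 0 = 0" and tri_1 [simp]: "tri 1 = 0"
  by (simp_all add: tri_def)

lemma tri_add: "tri (a + b) = tri a + tri b + a * b"
proof -
  have "2 * tri (a + b) = 2 * (tri a + tri b + a * b)"
    unfolding distrib_left two_tri by (simp add: algebra_simps)
  then show ?thesis by simp
qed

lemma tri_mult: "tri (a * b) = b * tri a + a ^ 2 * tri b"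
proof -
  have "2 * tri (a * b) = a * b * (a * b - 1)" by (rule two_tri)
  also have "\<dots> = b * (2 * tri a) + a ^ 2 * (2 * tri b)"
    unfolding two_tri by (simp add: algebra_simps power2_eq_square)
  finally have "2 * tri (a * b) = 2 * (b * tri a + a ^ 2 * tri b)" by simp
  then show ?thesis by simp
qed

lemma cong_ex_lin:
  fixes x x' m :: int
  assumes "[x = x'] (mod m)" "\<And>n. x = x' + m * n \<Longrightarrow> thesis"
  shows thesis
proof -
  have "m dvd x - x'" using assms(1) by (simp add: cong_iff_dvd_diff)
  then obtain n where "x - x' = m * n" by (rule dvdE)
  then have "x = x' + m * n" by simp
  then show thesis by (rule assms(2))
qed

lemma int_shift_invariant:
  fixes f :: "int \<Rightarrow> 'b"
  assumes "\<And>x. f (x + c) = f x"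
  shows "f (x + c * n) = f x"
proof (induction n rule: int_induct[where k = 0])
  case (step1 i)
  then show ?case using assms[of "x + c * i"] by (simp add: algebra_simps)
next
  case (step2 i)
  then show ?case using assms[of "x + c * (i - 1)"] by (simp add: algebra_simps)
qed simp

section \<open>Presentations by exponents\<close>

text \<open>The entries are \<open>(\<kappa>, \<epsilon>, s, t1, t2, d1, d2)\<close>, with \<open>\<gamma> = \<tau>\<^sup>s\<close>.\<close>
type_synonym brace_data = "int \<times> int \<times> int \<times> int \<times> int \<times> int \<times> int"

text \<open>\<open>\<zeta>\<close> has multiplicative order \<open>M\<close> modulo
  \<open>q\<close>, and its powers exhaust the solutions of \<open>x ^ (p^2) = 1\<close>. Characters
  of a group of order \<open>p^2\<close> into the units modulo \<open>q\<close> thus become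
  exponents modulo \<open>M\<close>.\<close>

locale brace_params =
  fixes p q M :: nat and \<zeta> :: int
  assumes p: "Factorial_Ring.prime p" and q: "Factorial_Ring.prime q" and qp: "q > p + 1"
    and M: "M > 0" and M_dvd: "M dvd p ^ 2"
    and zeta_eq: "\<And>k l::nat. [\<zeta> ^ k = \<zeta> ^ l] (mod int q) \<longleftrightarrow> [k = l] (mod M)"
    and zeta_root: "\<And>x::int. [x ^ (p ^ 2) = 1] (mod int q) \<Longrightarrow> \<exists>k::nat. [x = \<zeta> ^ k] (mod int q)"
begin

text \<open>
  \<open>Z k\<close> is the power \<open>\<zeta>\<^sup>k\<close> modulo \<open>q\<close>; reducing the exponent keeps negative \<open>k\<close> meaningful.
\<close>
definition Z :: "int \<Rightarrow> int" where "Z k = \<zeta> ^ nat (k mod int M)"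

lemma Z_add: "[Z (k + l) = Z k * Z l] (mod int q)"
proof -
  have "int (nat ((k + l) mod int M)) = (k + l) mod int M"
    "int (nat (k mod int M) + nat (l mod int M)) = k mod int M + l mod int M"
    using M by simp_all
  then have "[int (nat ((k + l) mod int M)) = int (nat (k mod int M) + nat (l mod int M))] (mod int M)"
    by (simp only:) (simp add: cong_def mod_simps)
  then have "[nat ((k + l) mod int M) = nat (k mod int M) + nat (l mod int M)] (mod M)"
    by (simp only: cong_int_iff)
  then show ?thesis unfolding Z_def power_add[symmetric] zeta_eq .
qed

lemma Z_eq_iff: "[Z k = Z l] (mod int q) \<longleftrightarrow> [k = l] (mod int M)"
proof -
  have "[nat (k mod int M) = nat (l mod int M)] (mod M) \<longleftrightarrow> [int (nat (k mod int M)) = int (nat (l mod int M))] (mod int M)"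
    by (simp only: cong_int_iff)
  also have "\<dots> \<longleftrightarrow> [k = l] (mod int M)" using M by (simp add: cong_def)
  finally show ?thesis unfolding Z_def zeta_eq .
qed

lemma Z_cong: "[k = l] (mod int M) \<Longrightarrow> Z k = Z l"
  by (simp add: Z_def cong_def)

lemma Z_0: "Z 0 = 1"
  by (simp add: Z_def)

lemma Z_pow_nat: "Z (int k) = \<zeta> ^ (k mod M)"
  by (simp add: Z_def nat_mod_distrib)

lemma zeta_Z: "[\<zeta> ^ k = Z (int k)] (mod int q)"
  unfolding Z_pow_nat zeta_eq by (simp add: cong_def)

lemma root_Z: "[x ^ (p ^ 2) = 1] (mod int q) \<Longrightarrow> \<exists>k. [x = Z k] (mod int q)"
  using zeta_root[of x] zeta_Z cong_trans by blast

lemma q_gt: "int q > 1" using prime_gt_1_nat[OF q] by simp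

lemma p_gt: "int p > 1" using prime_gt_1_nat[OF p] by simp

lemma prime_int_q: "Factorial_Ring.prime (int q)" using q by simp

lemma prime_int_p: "Factorial_Ring.prime (int p)" using p by simp

lemma coprime_q_pp: "coprime (int q) (int p ^ 2)"
  using primes_coprime[OF prime_int_q prime_int_p] qp by simp

lemma cong_mult_eq_0_q: "[x * y = 0] (mod int q) \<Longrightarrow> [x = 0] (mod int q) \<or> [y = 0] (mod int q)" for x y :: int
  using prime_dvd_multD[OF prime_int_q] by (simp add: cong_0_iff)

lemma not_one_cong_0: "\<not> [1 = (0::int)] (mod int q)"
  using q_gt by (simp add: cong_def)

lemma Z_not_0: "\<not> [Z k = 0] (mod int q)"
proof
  assume "[Z k = 0] (mod int q)"
  then have "[Z k * Z (- k) = 0 * Z (- k)] (mod int q)" by (rule cong_scalar_right)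
  moreover have "[1 = Z k * Z (- k)] (mod int q)" using Z_add[of k "- k"] by (simp add: Z_0)
  ultimately have "[1 = 0 * Z (- k)] (mod int q)" using cong_trans cong_sym by blast
  then show False using not_one_cong_0 by simp
qed

text \<open>A homomorphism from the integers is fixed by its value at 1. The downward half of the
  induction divides by \<open>Z t\<close>, a unit modulo \<open>q\<close>.\<close>

lemma Z_hom_unique:
  assumes add: "\<And>a b. [f (a + b) = f a * f b] (mod int q)" and f0: "[f 0 = 1] (mod int q)"
    and f1: "[f 1 = Z t] (mod int q)"
  shows "[f n = Z (t * n)] (mod int q)"
proof (induction n rule: int_induct[where k = 0])
  case base
  then show ?case using f0 by (simp add: Z_0)
next
  case (step1 i)
  have "[f (i + 1) = Z (t * i) * Z t] (mod int q)"
    by (rule cong_trans[OF add cong_mult[OF step1(2) f1]])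
  also have "[Z (t * i) * Z t = Z (t * (i + 1))] (mod int q)"
    using Z_add[of "t * i" t] by (simp add: algebra_simps cong_sym)
  finally (cong_trans) show ?case .
next
  case (step2 i)
  have "[f (i - 1) * Z t = f (i - 1) * f 1] (mod int q)" by (rule cong_scalar_left[OF cong_sym[OF f1]])
  also have "[f (i - 1) * f 1 = f i] (mod int q)" using add[of "i - 1" 1] by (simp add: cong_sym)
  also have "[f i = Z (t * i)] (mod int q)" by (rule step2(2))
  also have "[Z (t * i) = Z (t * (i - 1)) * Z t] (mod int q)"
    using Z_add[of "t * (i - 1)" t] by (simp add: algebra_simps)
  finally (cong_trans) have "[f (i - 1) * Z t = Z (t * (i - 1)) * Z t] (mod int q)" .
  moreover have "coprime (Z t) (int q)"
    using Z_not_0[of t] prime_imp_coprime[OF prime_int_q, of "Z t"] by (simp add: cong_0_iff coprime_commute)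
  ultimately show ?case by (simp add: cong_mult_rcancel)
qed

text \<open>\<open>lat \<kappa> i j\<close> states that \<open>i z + j e = 0\<close> follows from \<open>p z = 0\<close> and \<open>p e = \<kappa> z\<close>.\<close>
definition lat :: "int \<Rightarrow> int \<Rightarrow> int \<Rightarrow> bool"
  where "lat \<kappa> i j \<longleftrightarrow> (\<exists>m. j = int p * m \<and> int p dvd i + \<kappa> * m)"

definition tau :: "int \<Rightarrow> int \<Rightarrow> int \<Rightarrow> int \<Rightarrow> int"
  where "tau t1 t2 u v = Z (t1 * u + t2 * v)"

text \<open>
  The \<open>v\<close>-th circle power of \<open>e\<close> is \<open>\<epsilon> (tri v) z + v e\<close>, so \<open>u z + v e\<close> is the circle product of
  \<open>(u - \<epsilon> (tri v)) z\<close> with this power.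
\<close>
definition del :: "int \<Rightarrow> int \<Rightarrow> int \<Rightarrow> int \<Rightarrow> int \<Rightarrow> int"
  where "del \<epsilon> d1 d2 u v = Z (d1 * (u - \<epsilon> * tri v) + d2 * v)"

definition gam :: "int \<Rightarrow> int \<Rightarrow> int \<Rightarrow> int \<Rightarrow> int \<Rightarrow> int"
  where "gam s t1 t2 u v = Z (s * (t1 * u + t2 * v))"

text \<open>
  \<open>ev x u v\<close> stands for \<open>x g + u z + v e\<close>, where \<open>g\<close> generates \<open>Q\<close>.
\<close>
fun realizes :: "('a, 'm) ring_scheme \<Rightarrow> brace_data \<Rightarrow> (int \<Rightarrow> int \<Rightarrow> int \<Rightarrow> 'a) \<Rightarrow> bool"
  where "realizes B (\<kappa>, \<epsilon>, s, t1, t2, d1, d2) ev \<longleftrightarrow>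
    (\<forall>x u v. ev x u v \<in> carrier B) \<and> (\<forall>b\<in>carrier B. \<exists>x u v. b = ev x u v) \<and>
    (\<forall>x u v x' u' v'. ev x u v = ev x' u' v' \<longleftrightarrow> [x = x'] (mod int q) \<and> lat \<kappa> (u - u') (v - v')) \<and>
    (\<forall>x u v x' u' v'. ev x u v \<oplus>\<^bsub>B\<^esub> ev x' u' v' = ev (x + tau t1 t2 u v * x') (u + u') (v + v')) \<and>
    (\<forall>x u v x' u' v'. ev x u v \<otimes>\<^bsub>B\<^esub> ev x' u' v' =
       ev (gam s t1 t2 u' v' * x + del \<epsilon> d1 d2 u v * x') (u + u' + \<epsilon> * v * v') (v + v'))"

text \<open>The conditions on \<open>t1\<close>, \<open>t2\<close> say that \<open>\<tau>\<close>
  respects \<open>p z = 0\<close> and \<open>p e = \<kappa> z\<close> and kills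
  \<open>\<epsilon> z\<close>, as the brace law demands. Those on \<open>d1\<close>,
  \<open>d2\<close> say the same for \<open>\<delta>\<close> in the circle group, where the
  \<open>p\<close>-th power of \<open>e\<close> is \<open>(\<kappa> + \<epsilon> tri p) z\<close>.
  The last clause prevents a trivial \<open>\<tau>\<close> from being listed with both values of
  \<open>s\<close>.\<close>

fun valid :: "brace_data \<Rightarrow> bool"
  where "valid (\<kappa>, \<epsilon>, s, t1, t2, d1, d2) \<longleftrightarrow> \<kappa> \<in> {0, 1} \<and> \<epsilon> \<in> {0, 1} \<and> s \<in> {0, 1} \<and>
    [int p * t1 = 0] (mod int M) \<and> [int p * t2 = \<kappa> * t1] (mod int M) \<and> [\<epsilon> * t1 = 0] (mod int M) \<and>
    [int p * d1 = 0] (mod int M) \<and> [int p * d2 = (\<kappa> + \<epsilon> * tri (int p)) * d1] (mod int M) \<and>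
    (s = 1 \<longrightarrow> \<not> ([t1 = 0] (mod int M) \<and> [t2 = 0] (mod int M)))"

section \<open>From a brace to its exponents\<close>

lemma Z_plus_scale:
  assumes "[k = a + b] (mod int M)"
  shows "[Z k = Z a * Z b] (mod int q)"
  using Z_cong[OF assms] Z_add[of a b] by simp

lemma power_cong_hom:
  fixes f :: "int \<Rightarrow> int"
  assumes add: "\<And>a b. [f (a + b) = f a * f b] (mod int q)" and f0: "[f 0 = 1] (mod int q)"
  shows "[f (int n * a) = f a ^ n] (mod int q)"
proof (induction n)
  case 0
  then show ?case using f0 by simp
next
  case (Suc n)
  have "[f (int (Suc n) * a) = f a * f (int n * a)] (mod int q)"
    using add[of a "int n * a"] by (simp add: algebra_simps)
  then show ?case using cong_scalar_left[OF Suc, of "f a"] cong_trans by auto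
qed

text \<open>A count shows that coordinates are unique up to \<open>lat\<close>. From then on an
  equality of elements with the same \<open>u\<close> and \<open>v\<close> is a congruence of
  scalars modulo \<open>q\<close>, and the axioms evaluated at suitable elements determine
  \<open>T\<close>, \<open>D\<close> and \<open>G\<close>.\<close>

lemma realizes_presentation:
  fixes B (structure)
  assumes B: "skew_brace B" and card: "card (carrier B) = p ^ 2 * q"
  obtains d ev where "valid d" "realizes B d ev"
proof -
  interpret p2q_brace B p q
    by (simp add: p2q_brace_def p2q_brace_axioms_def B p q qp[simplified] card)
  obtain \<kappa> \<epsilon> ev T D G where \<kappa>: "\<kappa> \<in> {0, 1}" and \<epsilon>: "\<epsilon> \<in> {0, 1}" and evB: "\<And>x u v. ev x u v \<in> carrier B"
    and surj: "\<And>b. b \<in> carrier B \<Longrightarrow> \<exists>x u v. b = ev x u v" and ev0: "ev 0 0 0 = \<zero>"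
    and ev_add: "\<And>x u v x' u' v'. ev x u v \<oplus> ev x' u' v' = ev (x + T u v * x') (u + u') (v + v')"
    and ev_mult: "\<And>x u v x' u' v'. ev x u v \<otimes> ev x' u' v' =
       ev (G u' v' * x + D u v * x') (u + u' + \<epsilon> * v * v') (v + v')"
    and per1: "\<And>x u v. ev (x + int q) u v = ev x u v" and per2: "\<And>x u v. ev x (u + int p) v = ev x u v"
    and per3: "\<And>x u v. ev x u (v + int p) = ev x (u + \<kappa>) v"
    by (rule presentation) (rule that; assumption)
  have per: "ev x u v = ev x' u' v'" if x: "[x = x'] (mod int q)" and l: "lat \<kappa> (u - u') (v - v')" for x u v x' u' v'
  proof -
    obtain n where n: "x = x' + int q * n" by (rule cong_ex_lin[OF x])
    obtain m where m: "v - v' = int p * m" "int p dvd u - u' + \<kappa> * m" using l by (auto simp: lat_def)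
    obtain l where l: "u - u' + \<kappa> * m = int p * l" using m(2) by (rule dvdE)
    have e3: "ev x (u0 - \<kappa> * m) (v0 + int p * m) = ev x u0 v0" for x u0 v0
    proof -
      have "ev x (u0 - \<kappa> * (m' + 1)) (v0 + int p * (m' + 1)) = ev x (u0 - \<kappa> * m') (v0 + int p * m')" for m'
        using per3[of x "u0 - \<kappa> * (m' + 1)" "v0 + int p * m'"] by (simp add: algebra_simps)
      from int_shift_invariant[where f = "\<lambda>m. ev x (u0 - \<kappa> * m) (v0 + int p * m)", OF this, of 0 m]
      show ?thesis by simp
    qed
    have "u = u' + int p * l - \<kappa> * m" "v = v' + int p * m" using l m by auto
    then have "ev x u v = ev x (u' + int p * l) v'" using e3 by simp
    also have "\<dots> = ev x u' v'" using int_shift_invariant[where f = "\<lambda>u. ev x u v'", OF per2] .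
    also have "\<dots> = ev x' u' v'" unfolding n using int_shift_invariant[where f = "\<lambda>x. ev x u' v'", OF per1] .
    finally show ?thesis .
  qed
  \<comment> \<open>A box of \<open>q p^2\<close> coordinate triples. It maps onto the carrier,
    which has the same number of elements, so it maps injectively; this excludes identifications
    beyond \<open>lat\<close>.\<close>
  define R where "R = {0..<int q} \<times> {0..<int p} \<times> {0..<int p}"
  define evt where "evt = (\<lambda>(x, u, v). ev x u v)"
  have rep: "\<exists>r\<in>R. evt r = ev x u v \<and> [fst r = x] (mod int q) \<and> lat \<kappa> (fst (snd r) - u) (snd (snd r) - v)" for x u v
  proof -
    define r where "r = (x mod int q, (u + \<kappa> * (v div int p)) mod int p, v mod int p)"
    have r1: "r \<in> R" using q_gt p_gt by (simp add: r_def R_def)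
    have "v mod int p - v = int p * (- (v div int p))" by (simp add: minus_mult_div_eq_mod[symmetric])
    moreover have "(u + \<kappa> * (v div int p)) mod int p - u + \<kappa> * (- (v div int p)) =
        int p * (- ((u + \<kappa> * (v div int p)) div int p))"
      by (simp add: minus_mult_div_eq_mod[symmetric])
    then have "int p dvd (u + \<kappa> * (v div int p)) mod int p - u + \<kappa> * (- (v div int p))"
      by (metis dvd_triv_left)
    ultimately have l: "lat \<kappa> (fst (snd r) - u) (snd (snd r) - v)"
      unfolding lat_def r_def fst_conv snd_conv by blast
    have c: "[fst r = x] (mod int q)" by (simp add: r_def cong_def)
    have "evt r = ev x u v" using per[OF c l] by (simp add: evt_def split_beta)
    then show ?thesis using r1 l c by blast
  qed
  have "evt ` R = carrier B"
  proof (intro equalityI subsetI)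
    fix b assume "b \<in> carrier B"
    then obtain x u v where "b = ev x u v" using surj by blast
    then show "b \<in> evt ` R" using rep[of x u v] by force
  qed (use evB in \<open>auto simp: evt_def\<close>)
  moreover have "card R = card (carrier B)"
    unfolding R_def card by (simp add: card_cartesian_product power2_eq_square)
  moreover have "finite R" by (simp add: R_def)
  ultimately have inj: "inj_on evt R" by (simp add: eq_card_imp_inj_on)
  have lat_tr: "lat \<kappa> (a - c) (b - d)" if l1: "lat \<kappa> (a' - a) (b' - b)" and l2: "lat \<kappa> (a' - c) (b' - d)" for a b c d a' b'
  proof -
    obtain m1 m2 where m: "b' - b = int p * m1" "int p dvd a' - a + \<kappa> * m1"
      "b' - d = int p * m2" "int p dvd a' - c + \<kappa> * m2" using l1 l2 unfolding lat_def by blast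
    have "b - d = int p * (m2 - m1)" using m by (simp add: algebra_simps)
    moreover have "int p dvd (a' - c + \<kappa> * m2) - (a' - a + \<kappa> * m1)" using m by (intro dvd_diff)
    then have "int p dvd a - c + \<kappa> * (m2 - m1)" by (simp add: algebra_simps)
    ultimately show ?thesis unfolding lat_def by blast
  qed
  have ker: "ev x u v = ev x' u' v' \<longleftrightarrow> [x = x'] (mod int q) \<and> lat \<kappa> (u - u') (v - v')" for x u v x' u' v'
  proof
    assume e: "ev x u v = ev x' u' v'"
    obtain r where r: "r \<in> R" "evt r = ev x u v" "[fst r = x] (mod int q)" "lat \<kappa> (fst (snd r) - u) (snd (snd r) - v)"
      using rep by blast
    obtain r' where r': "r' \<in> R" "evt r' = ev x' u' v'" "[fst r' = x'] (mod int q)" "lat \<kappa> (fst (snd r') - u') (snd (snd r') - v')"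
      using rep by blast
    have "r = r'" using inj r r' e by (metis inj_onD)
    then have "[x = x'] (mod int q)" using r(3) r'(3) unfolding cong_def by simp
    moreover have "lat \<kappa> (u - u') (v - v')" using lat_tr[OF r(4)] r'(4) \<open>r = r'\<close> by simp
    ultimately show "[x = x'] (mod int q) \<and> lat \<kappa> (u - u') (v - v')" by blast
  qed (use per in blast)
  have eqx: "[x = x'] (mod int q)" if "ev x u v = ev x' u v" for x x' u v using that ker by blast
  have T0: "[T 0 0 = 1] (mod int q)"
  proof -
    have "ev 0 0 0 \<oplus> ev 1 0 0 = ev 1 0 0" using evB by (simp add: ev0)
    then show ?thesis using eqx[of "T 0 0" 0 0 1] by (simp add: ev_add)
  qed
  have one: "\<one> = ev 0 0 0" using ev0 zero_eq_one by simp
  have D0: "[D 0 0 = 1] (mod int q)"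
  proof -
    have "ev 0 0 0 \<otimes> ev 1 0 0 = ev 1 0 0" unfolding one[symmetric] using evB by simp
    then show ?thesis using eqx[of "D 0 0" 0 0 1] by (simp add: ev_mult)
  qed
  have G0: "[G 0 0 = 1] (mod int q)"
  proof -
    have "ev 1 0 0 \<otimes> ev 0 0 0 = ev 1 0 0" unfolding one[symmetric] using evB by simp
    then show ?thesis using eqx[of "G 0 0" 0 0 1] by (simp add: ev_mult)
  qed
  have T_add: "[T (u + u') (v + v') = T u v * T u' v'] (mod int q)" for u v u' v'
  proof -
    have "(ev 0 u v \<oplus> ev 0 u' v') \<oplus> ev 1 0 0 = ev 0 u v \<oplus> (ev 0 u' v' \<oplus> ev 1 0 0)"
      using evB by (simp add: add.m_assoc)
    then show ?thesis by (intro eqx[of _ "u + u'" "v + v'"]) (simp add: ev_add)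
  qed
  have D_mult: "[D (u + u' + \<epsilon> * v * v') (v + v') = D u v * D u' v'] (mod int q)" for u v u' v'
  proof -
    have "(ev 0 u v \<otimes> ev 0 u' v') \<otimes> ev 1 0 0 = ev 0 u v \<otimes> (ev 0 u' v' \<otimes> ev 1 0 0)"
      using evB by (simp add: circ.m_assoc)
    then show ?thesis by (intro eqx[of _ "u + u' + \<epsilon> * v * v'" "v + v'"]) (simp add: ev_mult)
  qed
  have G_mult: "[G (u + u' + \<epsilon> * v * v') (v + v') = G u v * G u' v'] (mod int q)" for u v u' v'
  proof -
    have "ev 1 0 0 \<otimes> (ev 0 u v \<otimes> ev 0 u' v') = (ev 1 0 0 \<otimes> ev 0 u v) \<otimes> ev 0 u' v'"
      using evB by (simp add: circ.m_assoc)
    then show ?thesis by (intro eqx[of _ "u + u' + \<epsilon> * v * v'" "v + v'"]) (simp add: ev_mult mult.commute)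
  qed
  have T_lat: "[T u v = T u' v'] (mod int q)" if l: "lat \<kappa> (u - u') (v - v')" for u v u' v'
  proof -
    have "ev 0 u v \<oplus> ev 1 0 0 = ev 0 u' v' \<oplus> ev 1 0 0" using per[OF cong_refl l] by simp
    then show ?thesis using ker by (simp add: ev_add)
  qed
  have D_lat: "[D u v = D u' v'] (mod int q)" if l: "lat \<kappa> (u - u') (v - v')" for u v u' v'
  proof -
    have "ev 0 u v \<otimes> ev 1 0 0 = ev 0 u' v' \<otimes> ev 1 0 0" using per[OF cong_refl l] by simp
    then show ?thesis using ker by (simp add: ev_mult)
  qed
  have G_lat: "[G u v = G u' v'] (mod int q)" if l: "lat \<kappa> (u - u') (v - v')" for u v u' v'
  proof -
    have "ev 1 0 0 \<otimes> ev 0 u v = ev 1 0 0 \<otimes> ev 0 u' v'" using per[OF cong_refl l] by simp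
    then show ?thesis using ker by (simp add: ev_mult)
  qed
  have T_inv: "[T u v * T (- u) (- v) = 1] (mod int q)" for u v
    using T_add[of u "- u" v "- v"] T0 by (simp add: cong_def)
  have neg: "\<ominus> ev x u v = ev (- (T (- u) (- v) * x)) (- u) (- v)" for x u v
  proof (rule add.inv_equality)
    have "[- (T (- u) (- v) * x) + T (- u) (- v) * x = 0] (mod int q)" by simp
    then show "ev (- (T (- u) (- v) * x)) (- u) (- v) \<oplus> ev x u v = \<zero>" by (simp add: ev_add ev0)
  qed (use evB in auto)
  \<comment> \<open>The brace law for three general elements, read off in the coordinate of
    \<open>g\<close>. The special cases that follow are substitutions into it.\<close>
  have brace: "[G (c + e) (d + f) * x + D a b * (y + T c d * w) =
      G c d * x + D a b * y - T (a + c + \<epsilon> * b * d) (b + d) * (T (- a) (- b) * x) +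
      T (c + \<epsilon> * b * d) d * (G e f * x + D a b * w)] (mod int q)"
    for x a b y c d w e f
  proof -
    have "ev x a b \<otimes> (ev y c d \<oplus> ev w e f) =
       ev x a b \<otimes> ev y c d \<oplus> \<ominus> ev x a b \<oplus> ev x a b \<otimes> ev w e f"
      using brace_distrib[of "ev x a b" "ev y c d" "ev w e f"] evB by (simp add: a_minus_def)
    then show ?thesis
      by (intro eqx[of _ "a + (c + e) + \<epsilon> * b * (d + f)" "b + (d + f)"])
        (simp add: ev_add ev_mult neg algebra_simps)
  qed
  \<comment> \<open>The brace law with both \<open>e\<close> as the first two elements and
    \<open>g\<close> as the third.\<close>
  have DT: "[D 0 1 * T 0 1 = D 0 1 * T \<epsilon> 1] (mod int q)"
    using brace[of 0 0 1 0 0 0 1 0 1]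
    by (simp add: mult.commute)
  have D_inv: "[D u v * D (- u + \<epsilon> * v * v) (- v) = 1] (mod int q)" for u v
    using D_mult[of u "- u + \<epsilon> * v * v" v "- v"] D0 by (simp add: algebra_simps cong_def)
  have D_cop: "coprime (D u v) (int q)" for u v
    using D_inv coprime_iff_invertible_int by blast
  have T_cop: "coprime (T u v) (int q)" for u v
    using T_inv coprime_iff_invertible_int by blast
  \<comment> \<open>So \<open>\<tau>\<close> is trivial on \<open>\<epsilon> z\<close>, the
    difference between \<open>e \<otimes> e\<close> and \<open>2 e\<close>. In consequence
    \<open>\<tau>\<close> is a character of the circle group too.\<close>
  have Teps: "[T \<epsilon> 0 = 1] (mod int q)"
  proof -
    have "[T 0 1 = T \<epsilon> 1] (mod int q)"
      using DT D_cop by (simp add: cong_mult_lcancel)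
    also have "[T \<epsilon> 1 = T \<epsilon> 0 * T 0 1] (mod int q)" using T_add[of \<epsilon> 0 0 1] by simp
    finally (cong_trans) have "[1 * T 0 1 = T \<epsilon> 0 * T 0 1] (mod int q)" by simp
    then show ?thesis using T_cop[of 0 1] cong_mult_rcancel cong_sym by blast
  qed
  \<comment> \<open>The brace law with \<open>g\<close> as the first element and two elements of the
    complement. It is the crossed homomorphism law over \<open>T\<close> for
    \<open>G - 1\<close>.\<close>
  have G_add: "[G (u2 + u3) (v2 + v3) = G u2 v2 - T u2 v2 + T u2 v2 * G u3 v3] (mod int q)" for u2 v2 u3 v3
  proof -
    have "[G (u2 + u3) (v2 + v3) = G u2 v2 - T u2 v2 * T 0 0 + T u2 v2 * G u3 v3] (mod int q)"
      using brace[of u2 u3 v2 v3 1 0 0 0 0]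
      by simp
    also have "[G u2 v2 - T u2 v2 * T 0 0 + T u2 v2 * G u3 v3 = G u2 v2 - T u2 v2 * 1 + T u2 v2 * G u3 v3] (mod int q)"
      by (intro cong_add cong_diff cong_mult cong_refl T0)
    finally (cong_trans) show ?thesis by simp
  qed
  have latp: "lat \<kappa> (int p * i) 0" for i unfolding lat_def by (auto intro!: exI[of _ 0])
  have latp2: "lat \<kappa> (\<epsilon>' * tri (int p ^ 2)) (int p ^ 2)" for \<epsilon>'
  proof -
    have "tri (int p ^ 2) = int p * (tri (int p) + int p * tri (int p))"
      unfolding power2_eq_square tri_mult by (simp add: algebra_simps power2_eq_square)
    then show ?thesis unfolding lat_def by (intro exI[of _ "int p"]) (simp add: power2_eq_square)
  qed
  have latk: "lat \<kappa> (- \<kappa>) (int p)" unfolding lat_def by (auto intro!: exI[of _ 1])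
  \<comment> \<open>Multiples by \<open>p^2\<close> vanish in the complement, so the scalar is a
    root of \<open>x ^ (p^2) = 1\<close> and hence a power of \<open>\<zeta>\<close>; the exponents
    \<open>t2\<close>, \<open>d1\<close> and \<open>d2\<close> arise in the same way.\<close>
  obtain t1 where t1: "[T 1 0 = Z t1] (mod int q)"
  proof -
    have "[T (int (p ^ 2) * 1) 0 = T 1 0 ^ (p ^ 2)] (mod int q)"
      by (rule power_cong_hom) (use T_add[of _ _ 0 0] T0 in auto)
    moreover have "[T (int (p ^ 2) * 1) 0 = 1] (mod int q)"
      using T_lat[of "int (p ^ 2)" 0 0 0] latp[of "int p"] T0 by (simp add: power2_eq_square cong_def)
    ultimately have "[T 1 0 ^ (p ^ 2) = 1] (mod int q)" unfolding cong_def by metis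
    then show thesis using root_Z that by blast
  qed
  obtain t2 where t2: "[T 0 1 = Z t2] (mod int q)"
  proof -
    have "[T 0 (int (p ^ 2) * 1) = T 0 1 ^ (p ^ 2)] (mod int q)"
      by (rule power_cong_hom) (use T_add[of 0 0] T0 in auto)
    moreover have "[T 0 (int (p ^ 2) * 1) = 1] (mod int q)"
      using T_lat[of 0 0 "int (p ^ 2)" 0] latp2[of 0] T0 by (simp add: cong_def)
    ultimately have "[T 0 1 ^ (p ^ 2) = 1] (mod int q)" unfolding cong_def by metis
    then show thesis using root_Z that by blast
  qed
  have T_tau: "[T u v = tau t1 t2 u v] (mod int q)" for u v
  proof -
    have "[T u 0 = Z (t1 * u)] (mod int q)"
      by (rule Z_hom_unique) (use T_add[of _ _ 0 0] T0 t1 in auto)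
    moreover have "[T 0 v = Z (t2 * v)] (mod int q)"
      by (rule Z_hom_unique) (use T_add[of 0 0] T0 t2 in auto)
    ultimately have "[T u 0 * T 0 v = Z (t1 * u) * Z (t2 * v)] (mod int q)" by (rule cong_mult)
    moreover have "[T u v = T u 0 * T 0 v] (mod int q)" using T_add[of u 0 0 v] by simp
    ultimately show ?thesis unfolding tau_def using Z_add unfolding cong_def by metis
  qed
  have D_hom1: "[D (a + b) 0 = D a 0 * D b 0] (mod int q)" for a b using D_mult[of a b 0 0] by simp
  \<comment> \<open>In the circle group \<open>e\<close> times \<open>v e\<close> equals
    \<open>\<epsilon> v z\<close> times \<open>(v + 1) e\<close>. Run upwards and downwards from 0,
    this recursion produces the term with \<open>tri\<close> in \<open>D2\<close>.\<close>
  have D_step: "[D 0 1 * D 0 v = D (\<epsilon> * v) 0 * D 0 (v + 1)] (mod int q)" for v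
    using D_mult[of 0 0 1 v] D_mult[of "\<epsilon> * v" 0 0 "v + 1"]
    by (simp add: add.commute cong_def)
  have Dpow: "[D 0 1 ^ n = D (\<epsilon> * tri (int n)) (int n)] (mod int q)" for n
  proof (induction n)
    case 0
    then show ?case using D0 by (simp add: cong_sym)
  next
    case (Suc n)
    have "[D 0 1 * D 0 1 ^ n = D 0 1 * D (\<epsilon> * tri (int n)) (int n)] (mod int q)"
      by (rule cong_scalar_left[OF Suc])
    also have "[D 0 1 * D (\<epsilon> * tri (int n)) (int n) = D (\<epsilon> * tri (int n) + \<epsilon> * int n) (1 + int n)] (mod int q)"
      using D_mult[of 0 "\<epsilon> * tri (int n)" 1 "int n"] by (simp add: cong_sym)
    finally (cong_trans) show ?case using tri_add[of 1 "int n"] by (simp add: algebra_simps)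
  qed
  obtain d1 where d1: "[D 1 0 = Z d1] (mod int q)"
  proof -
    have "[D (int (p ^ 2) * 1) 0 = D 1 0 ^ (p ^ 2)] (mod int q)"
      by (rule power_cong_hom) (use D_hom1 D0 in auto)
    moreover have "[D (int (p ^ 2) * 1) 0 = 1] (mod int q)"
      using D_lat[of "int (p ^ 2)" 0 0 0] latp[of "int p"] D0 by (simp add: power2_eq_square cong_def)
    ultimately have "[D 1 0 ^ (p ^ 2) = 1] (mod int q)" unfolding cong_def by metis
    then show thesis using root_Z that by blast
  qed
  obtain d2 where d2: "[D 0 1 = Z d2] (mod int q)"
  proof -
    have "[D (\<epsilon> * tri (int (p ^ 2))) (int (p ^ 2)) = D 0 0] (mod int q)"
      using D_lat[of "\<epsilon> * tri (int (p ^ 2))" 0 "int (p ^ 2)" 0] latp2[of \<epsilon>] by simp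
    then have "[D 0 1 ^ (p ^ 2) = 1] (mod int q)" using Dpow[of "p ^ 2"] D0 unfolding cong_def by metis
    then show thesis using root_Z that by blast
  qed
  have D1: "[D u 0 = Z (d1 * u)] (mod int q)" for u
    by (rule Z_hom_unique) (use D_hom1 D0 d1 in auto)
  have D2: "[D 0 v = Z (d2 * v - d1 * \<epsilon> * tri v)] (mod int q)" for v
  proof -
    have step: "[Z d2 * D 0 v = Z (d1 * \<epsilon> * v) * D 0 (v + 1)] (mod int q)" for v
    proof -
      have "[Z d2 * D 0 v = D 0 1 * D 0 v] (mod int q)" by (intro cong_mult cong_refl cong_sym[OF d2])
      also have "[D 0 1 * D 0 v = D (\<epsilon> * v) 0 * D 0 (v + 1)] (mod int q)" by (rule D_step)
      also have "[D (\<epsilon> * v) 0 * D 0 (v + 1) = Z (d1 * \<epsilon> * v) * D 0 (v + 1)] (mod int q)"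
        using D1[of "\<epsilon> * v"] by (intro cong_mult cong_refl) (simp add: mult.assoc)
      finally (cong_trans) show ?thesis .
    qed
    have Zmul: "[Z d2 * Z (d2 * v - d1 * \<epsilon> * tri v) = Z (d1 * \<epsilon> * v) * Z (d2 * (v + 1) - d1 * \<epsilon> * tri (v + 1))] (mod int q)" for v
    proof -
      have "d2 + (d2 * v - d1 * \<epsilon> * tri v) = d1 * \<epsilon> * v + (d2 * (v + 1) - d1 * \<epsilon> * tri (v + 1))"
        using tri_add[of v 1] by (simp add: algebra_simps)
      then show ?thesis
        using Z_add[of d2 "d2 * v - d1 * \<epsilon> * tri v"] Z_add[of "d1 * \<epsilon> * v" "d2 * (v + 1) - d1 * \<epsilon> * tri (v + 1)"]
        unfolding cong_def by metis
    qed
    have Zcop: "coprime (Z k) (int q)" for k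
      using Z_not_0[of k] prime_imp_coprime[OF prime_int_q, of "Z k"] by (simp add: cong_0_iff coprime_commute)
    show ?thesis
    proof (induction v rule: int_induct[where k = 0])
      case base
      then show ?case using D0 by (simp add: Z_0)
    next
      case (step1 i)
      have "[Z (d1 * \<epsilon> * i) * D 0 (i + 1) = Z (d1 * \<epsilon> * i) * Z (d2 * (i + 1) - d1 * \<epsilon> * tri (i + 1))] (mod int q)"
        using step[of i] Zmul[of i] cong_scalar_left[OF step1(2), of "Z d2"] unfolding cong_def by metis
      then show ?case using Zcop by (simp add: cong_mult_lcancel)
    next
      case (step2 i)
      have "[Z (d1 * \<epsilon> * (i - 1)) * D 0 i = Z (d1 * \<epsilon> * (i - 1)) * Z (d2 * i - d1 * \<epsilon> * tri i)] (mod int q)"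
        by (rule cong_scalar_left[OF step2(2)])
      then have "[Z d2 * D 0 (i - 1) = Z d2 * Z (d2 * (i - 1) - d1 * \<epsilon> * tri (i - 1))] (mod int q)"
        using step[of "i - 1"] Zmul[of "i - 1"] by (simp add: cong_def)
      then show ?case using Zcop by (simp add: cong_mult_lcancel)
    qed
  qed
  have D_del: "[D u v = del \<epsilon> d1 d2 u v] (mod int q)" for u v
  proof -
    have "[D u v = D u 0 * D 0 v] (mod int q)" using D_mult[of u 0 0 v] by simp
    also have "[D u 0 * D 0 v = Z (d1 * u) * Z (d2 * v - d1 * \<epsilon> * tri v)] (mod int q)"
      by (intro cong_mult D1 D2)
    also have "[Z (d1 * u) * Z (d2 * v - d1 * \<epsilon> * tri v) = del \<epsilon> d1 d2 u v] (mod int q)"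
      unfolding del_def using Z_add[of "d1 * u" "d2 * v - d1 * \<epsilon> * tri v"] by (simp add: algebra_simps cong_sym)
    finally (cong_trans) show ?thesis .
  qed
  have "\<exists>s\<in>{0, 1}. (\<forall>u v. [G u v = gam s t1 t2 u v] (mod int q)) \<and>
      (s = 1 \<longrightarrow> \<not> ([t1 = 0] (mod int M) \<and> [t2 = 0] (mod int M)))"
  proof (cases "[t1 = 0] (mod int M) \<and> [t2 = 0] (mod int M)")
    case True
    have tau1: "[T u v = 1] (mod int q)" for u v
    proof -
      have "[t1 * u + t2 * v = 0 * u + 0 * v] (mod int M)" using True by (intro cong_add cong_mult cong_refl) auto
      then have "Z (t1 * u + t2 * v) = Z (0 * u + 0 * v)" by (rule Z_cong)
      then have "tau t1 t2 u v = 1" by (simp add: tau_def Z_0)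
      then show ?thesis using T_tau[of u v] by simp
    qed
    \<comment> \<open>For trivial \<open>\<tau>\<close> the crossed law makes \<open>G - 1\<close>
      additive. It vanishes on multiples by \<open>p^2\<close>, and \<open>p^2\<close> is invertible
      modulo \<open>q\<close>, so \<open>G\<close> is 1 throughout.\<close>
    have Gp: "[G (u + u') (v + v') = G u v + G u' v' - 1] (mod int q)" for u v u' v'
    proof -
      have "[G u v - T u v + T u v * G u' v' = G u v - 1 + 1 * G u' v'] (mod int q)"
        by (intro cong_add cong_diff cong_mult cong_refl tau1)
      then show ?thesis using G_add[of u u' v v'] by (simp add: algebra_simps cong_def)
    qed
    have Gn: "[G (int n * u) (int n * v) = int n * (G u v - 1) + 1] (mod int q)" for u v n
    proof (induction n)
      case 0
      then show ?case using G0 by simp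
    next
      case (Suc n)
      have "[G (int (Suc n) * u) (int (Suc n) * v) = G u v + G (int n * u) (int n * v) - 1] (mod int q)"
        using Gp[of u "int n * u" v "int n * v"] by (simp add: algebra_simps)
      also have "[G u v + G (int n * u) (int n * v) - 1 = G u v + (int n * (G u v - 1) + 1) - 1] (mod int q)"
        by (intro cong_add cong_diff cong_refl Suc)
      finally (cong_trans) show ?case by (simp add: algebra_simps)
    qed
    have "[G u v = 1] (mod int q)" for u v
    proof -
      have "lat \<kappa> (int (p ^ 2) * u - 0) (int (p ^ 2) * v - 0)"
        unfolding lat_def by (intro exI[of _ "int p * v"]) (simp add: power2_eq_square)
      then have "[int (p ^ 2) * (G u v - 1) + 1 = 1] (mod int q)"
        using G_lat[of "int (p ^ 2) * u" 0 "int (p ^ 2) * v" 0] Gn[of "p ^ 2" u v] G0 unfolding cong_def by metis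
      then have "int q dvd int (p ^ 2) * (G u v - 1)" by (simp add: cong_iff_dvd_diff)
      then have "int q dvd G u v - 1" using coprime_q_pp by (simp add: coprime_dvd_mult_right_iff)
      then show ?thesis by (simp add: cong_iff_dvd_diff)
    qed
    then show ?thesis by (intro bexI[of _ 0]) (auto simp: gam_def Z_0)
  next
    case False
    obtain u0 v0 where c0: "\<not> [T u0 v0 = 1] (mod int q)"
    proof -
      have "\<not> [T 1 0 = 1] (mod int q) \<or> \<not> [T 0 1 = 1] (mod int q)"
        using False t1 t2 Z_eq_iff[of t1 0] Z_eq_iff[of t2 0] unfolding Z_0 unfolding cong_def by metis
      then show thesis using that by blast
    qed
    define t where "t = T u0 v0"
    define c where "c = G u0 v0"
    \<comment> \<open>The crossed law is applied with both orders of the arguments. Since addition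
      in the complement commutes, \<open>G - 1\<close> is proportional to
      \<open>1 - T\<close>.\<close>
    have sym: "[(G u v - 1) * (1 - t) = (c - 1) * (1 - T u v)] (mod int q)" for u v
    proof -
      have "[G u v - T u v + T u v * c = c - t + t * G u v] (mod int q)"
        using G_add[of u u0 v v0] G_add[of u0 u v0 v] by (simp add: t_def c_def add.commute cong_def)
      then have "int q dvd (G u v - T u v + T u v * c) - (c - t + t * G u v)" by (simp add: cong_iff_dvd_diff)
      moreover have "(G u v - T u v + T u v * c) - (c - t + t * G u v) = (G u v - 1) * (1 - t) - (c - 1) * (1 - T u v)"
        by (simp add: algebra_simps)
      ultimately show ?thesis by (simp add: cong_iff_dvd_diff)
    qed
    have nt: "\<not> int q dvd 1 - t" using c0 by (simp add: t_def cong_iff_dvd_diff dvd_diff_commute)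
    have canc: "int q dvd y" if "int q dvd y * (1 - t)" for y
      using that nt prime_dvd_multD[OF prime_int_q] by blast
    \<comment> \<open>The point is the circle square of the base point. \<open>G\<close> is
      multiplicative there by associativity, and \<open>T\<close> is too because multiples of
      \<open>\<epsilon> z\<close> lie in its kernel.\<close>
    have Tc: "[T (u0 + u0 + \<epsilon> * v0 * v0) (v0 + v0) = t * t] (mod int q)"
    proof -
      have "[T (\<epsilon> * n) 0 = 1] (mod int q)" for n
      proof -
        have "[T (\<epsilon> * n) 0 = Z (t1 * (\<epsilon> * n))] (mod int q)" using T_tau[of "\<epsilon> * n" 0] by (simp add: tau_def)
        moreover have "[Z (t1 * \<epsilon>) = Z 0] (mod int q)"
          using T_tau[of \<epsilon> 0] Teps by (simp add: tau_def Z_0 cong_def)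
        then have "[t1 * \<epsilon> = 0] (mod int M)" by (simp only: Z_eq_iff)
        then have "[t1 * \<epsilon> * n = 0 * n] (mod int M)" by (rule cong_scalar_right)
        then have "Z (t1 * (\<epsilon> * n)) = 1" using Z_cong[of "t1 * \<epsilon> * n" 0] by (simp add: mult.assoc Z_0)
        ultimately show ?thesis by simp
      qed
      then have "[T (u0 + u0) (v0 + v0) * T (\<epsilon> * (v0 * v0)) 0 = t * t * 1] (mod int q)"
        unfolding t_def by (intro cong_mult T_add)
      moreover have "[T (u0 + u0 + \<epsilon> * v0 * v0) (v0 + v0) = T (u0 + u0) (v0 + v0) * T (\<epsilon> * (v0 * v0)) 0] (mod int q)"
        using T_add[of "u0 + u0" "\<epsilon> * (v0 * v0)" "v0 + v0" 0] by (simp add: mult.assoc)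
      ultimately show ?thesis by (simp add: cong_trans cong_def)
    qed
    have Gc: "[G (u0 + u0 + \<epsilon> * v0 * v0) (v0 + v0) = c * c] (mod int q)"
      unfolding c_def by (rule G_mult)
    have "[(c * c - 1) * (1 - t) = (c - 1) * (1 - t * t)] (mod int q)"
    proof -
      let ?u = "u0 + u0 + \<epsilon> * v0 * v0" and ?v = "v0 + v0"
      have "[(c * c - 1) * (1 - t) = (G ?u ?v - 1) * (1 - t)] (mod int q)"
        by (intro cong_mult cong_diff cong_refl cong_sym[OF Gc])
      also have "[(G ?u ?v - 1) * (1 - t) = (c - 1) * (1 - T ?u ?v)] (mod int q)" by (rule sym)
      also have "[(c - 1) * (1 - T ?u ?v) = (c - 1) * (1 - t * t)] (mod int q)"
        by (intro cong_mult cong_diff cong_refl Tc)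
      finally (cong_trans) show ?thesis .
    qed
    \<comment> \<open>Cancelling \<open>1 - t\<close> leaves \<open>(c - 1) * (c - t)\<close>. So
      \<open>\<gamma>\<close> is 1 or \<open>\<tau>\<close> at the base point, and proportionality
      spreads the alternative to all arguments.\<close>
    then have "int q dvd (c * c - 1) * (1 - t) - (c - 1) * (1 - t * t)" by (simp add: cong_iff_dvd_diff)
    moreover have "(c * c - 1) * (1 - t) - (c - 1) * (1 - t * t) = ((c - 1) * (c - t)) * (1 - t)"
      by (simp add: algebra_simps)
    ultimately have "int q dvd ((c - 1) * (c - t)) * (1 - t)" by (simp only:)
    then have "int q dvd (c - 1) * (c - t)" by (rule canc)
    then consider "int q dvd c - 1" | "int q dvd c - t" using prime_dvd_multD[OF prime_int_q] by blast
    then show ?thesis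
    proof cases
      case 1
      have "[G u v = 1] (mod int q)" for u v
      proof -
        have "int q dvd (G u v - 1) * (1 - t) - (c - 1) * (1 - T u v)" using sym by (simp add: cong_iff_dvd_diff)
        moreover have "int q dvd (c - 1) * (1 - T u v)" using 1 by (rule dvd_mult2)
        ultimately have "int q dvd ((G u v - 1) * (1 - t) - (c - 1) * (1 - T u v)) + (c - 1) * (1 - T u v)"
          by (rule dvd_add)
        then have "int q dvd (G u v - 1) * (1 - t)" by simp
        then have "int q dvd G u v - 1" by (rule canc)
        then show ?thesis by (simp add: cong_iff_dvd_diff)
      qed
      then show ?thesis by (intro bexI[of _ 0]) (auto simp: gam_def Z_0)
    next
      case 2
      have "[G u v = T u v] (mod int q)" for u v
      proof -
        have "int q dvd (G u v - 1) * (1 - t) - (c - 1) * (1 - T u v)" using sym by (simp add: cong_iff_dvd_diff)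
        moreover have "int q dvd (c - t) * (1 - T u v)" using 2 by (rule dvd_mult2)
        ultimately have "int q dvd ((G u v - 1) * (1 - t) - (c - 1) * (1 - T u v)) + (c - t) * (1 - T u v)" by (rule dvd_add)
        also have "((G u v - 1) * (1 - t) - (c - 1) * (1 - T u v)) + (c - t) * (1 - T u v) = (G u v - T u v) * (1 - t)"
          by (simp add: algebra_simps)
        finally have "int q dvd G u v - T u v" by (rule canc)
        then show ?thesis by (simp add: cong_iff_dvd_diff)
      qed
      from this T_tau have "[G u v = gam 1 t1 t2 u v] (mod int q)" for u v
        unfolding gam_def tau_def cong_def by simp
      then show ?thesis using False by (intro bexI[of _ 1]) auto
    qed
  qed
  then obtain s where s: "s \<in> {0, 1}" "\<And>u v. [G u v = gam s t1 t2 u v] (mod int q)"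
    "s = 1 \<longrightarrow> \<not> ([t1 = 0] (mod int M) \<and> [t2 = 0] (mod int M))" by blast
  have lat0: "lat \<kappa> 0 0" unfolding lat_def by (auto intro!: exI[of _ 0])
  have evc: "ev x u v = ev x' u v" if "[x = x'] (mod int q)" for x x' u v using that per lat0 by simp
  have real: "realizes B (\<kappa>, \<epsilon>, s, t1, t2, d1, d2) ev"
    unfolding realizes.simps
  proof (intro conjI allI ballI)
    fix x u v x' u' v'
    show "ev x u v \<oplus> ev x' u' v' = ev (x + tau t1 t2 u v * x') (u + u') (v + v')"
      unfolding ev_add by (intro evc cong_add cong_mult cong_refl T_tau)
    show "ev x u v \<otimes> ev x' u' v' =
       ev (gam s t1 t2 u' v' * x + del \<epsilon> d1 d2 u v * x') (u + u' + \<epsilon> * v * v') (v + v')"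
      unfolding ev_mult by (intro evc cong_add cong_mult cong_refl s(2) D_del)
  qed (use evB surj ker in auto)
  have TZ: "[k = l] (mod int M)" if "[X = Z k] (mod int q)" "[X = Z l] (mod int q)" for X k l
    using that Z_eq_iff[of k l] unfolding cong_def by metis
  \<comment> \<open>Most conditions compare scalars at two coordinate pairs that name the same
    element: \<open>(p, 0)\<close> and \<open>(0, 0)\<close>, or \<open>(0, p)\<close> and
    \<open>(\<kappa>, 0)\<close>. The one on \<open>\<epsilon> * t1\<close> is
    \<open>Teps\<close>.\<close>
  have val: "valid (\<kappa>, \<epsilon>, s, t1, t2, d1, d2)"
    unfolding valid.simps
  proof (intro conjI \<kappa> \<epsilon> s(1) s(3))
    have e1: "[T u v = Z (t1 * u + t2 * v)] (mod int q)" for u v using T_tau[of u v] by (simp add: tau_def)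
    have e2: "[D u v = Z (d1 * (u - \<epsilon> * tri v) + d2 * v)] (mod int q)" for u v using D_del[of u v] by (simp add: del_def)
    have "[T (int p) 0 = T 0 0] (mod int q)" using T_lat[of "int p" 0 0 0] latp[of 1] by simp
    then have "[T 0 0 = Z (t1 * int p)] (mod int q)" using e1[of "int p" 0] unfolding cong_def by simp
    then show "[int p * t1 = 0] (mod int M)" using TZ[OF _ e1[of 0 0]] by (simp add: mult.commute)
    have "[T 0 (int p) = T \<kappa> 0] (mod int q)" using T_lat[of 0 \<kappa> "int p" 0] latk by simp
    then have "[T 0 (int p) = Z (t1 * \<kappa>)] (mod int q)" using e1[of \<kappa> 0] unfolding cong_def by simp
    then show "[int p * t2 = \<kappa> * t1] (mod int M)" using TZ[OF e1[of 0 "int p"]] by (simp add: mult.commute)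
    show "[\<epsilon> * t1 = 0] (mod int M)" using TZ[OF e1[of \<epsilon> 0], of 0] Teps by (simp add: Z_0 mult.commute)
    have "[D (int p) 0 = D 0 0] (mod int q)" using D_lat[of "int p" 0 0 0] latp[of 1] by simp
    then have "[D 0 0 = Z (d1 * int p)] (mod int q)" using e2[of "int p" 0] unfolding cong_def by simp
    then show "[int p * d1 = 0] (mod int M)" using TZ[OF _ e2[of 0 0]] by (simp add: mult.commute)
    have "[D 0 (int p) = D \<kappa> 0] (mod int q)" using D_lat[of 0 \<kappa> "int p" 0] latk by simp
    then have "[D 0 (int p) = Z (d1 * \<kappa>)] (mod int q)" using e2[of \<kappa> 0] unfolding cong_def by simp
    then have "[d1 * (0 - \<epsilon> * tri (int p)) + d2 * int p = d1 * \<kappa>] (mod int M)" by (rule TZ[OF e2[of 0 "int p"]])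
    then show "[int p * d2 = (\<kappa> + \<epsilon> * tri (int p)) * d1] (mod int M)"
      by (simp add: cong_iff_dvd_diff algebra_simps)
  qed
  show thesis by (rule that[OF val real])
qed

end

section \<open>Change of basis, and uniqueness of the exponents up to it\<close>

context brace_params
begin

text \<open>The change of basis is \<open>z' = c z + f e\<close>, \<open>e' = b z + a e\<close>.\<close>
fun rel :: "brace_data \<Rightarrow> brace_data \<Rightarrow> bool"
  where "rel (\<kappa>, \<epsilon>, s, t1, t2, d1, d2) (\<kappa>', \<epsilon>', s', t1', t2', d1', d2') \<longleftrightarrow>
    \<kappa>' = \<kappa> \<and> \<epsilon>' = \<epsilon> \<and> s' = s \<and> (\<exists>a b c f. (\<kappa> = 1 \<or> \<epsilon> = 1 \<longrightarrow> f = 0) \<and>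
      [\<kappa> * a = \<kappa> * c] (mod int p) \<and> [\<epsilon> * a ^ 2 = \<epsilon> * c] (mod int p) \<and> \<not> int p dvd a * c - b * f \<and>
      [t1' = t1 * c + t2 * f] (mod int M) \<and> [t2' = t1 * b + t2 * a] (mod int M) \<and>
      [d1' = d1 * c + d2 * f] (mod int M) \<and> [d2' = d1 * (b - \<epsilon> * tri a) + d2 * a] (mod int M))"

lemma realizes_closed: "realizes B d ev \<Longrightarrow> ev x u v \<in> carrier B"
  and realizes_surj: "realizes B d ev \<Longrightarrow> b \<in> carrier B \<Longrightarrow> \<exists>x u v. b = ev x u v"
  by (cases d; simp)+

lemma realizes_ker: "realizes B (\<kappa>, \<epsilon>, s, t1, t2, d1, d2) ev \<Longrightarrow>
    ev x u v = ev x' u' v' \<longleftrightarrow> [x = x'] (mod int q) \<and> lat \<kappa> (u - u') (v - v')"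
  and realizes_add: "realizes B (\<kappa>, \<epsilon>, s, t1, t2, d1, d2) ev \<Longrightarrow>
    ev x u v \<oplus>\<^bsub>B\<^esub> ev x' u' v' = ev (x + tau t1 t2 u v * x') (u + u') (v + v')"
  and realizes_mult: "realizes B (\<kappa>, \<epsilon>, s, t1, t2, d1, d2) ev \<Longrightarrow>
    ev x u v \<otimes>\<^bsub>B\<^esub> ev x' u' v' =
      ev (gam s t1 t2 u' v' * x + del \<epsilon> d1 d2 u v * x') (u + u' + \<epsilon> * v * v') (v + v')"
  unfolding realizes.simps by blast+

lemma prime_p_dvd_mult: "int p dvd x * y \<longleftrightarrow> int p dvd x \<or> int p dvd y"
  using prime_dvd_mult_iff[OF prime_int_p] .

text \<open>For \<open>\<kappa> = 0\<close> the relations are divisibility of both entries by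
  \<open>p\<close>, which every matrix invertible modulo \<open>p\<close> preserves. For
  \<open>\<kappa> = 1\<close> the matrix is triangular with diagonal entries agreeing modulo
  \<open>p\<close>, and the multiplier \<open>m\<close> of the relation is scaled by
  \<open>a\<close>.\<close>

lemma lat_change:
  assumes \<kappa>: "\<kappa> \<in> {0, 1}" and f: "\<kappa> = 1 \<longrightarrow> f = 0" and ac: "[\<kappa> * a = \<kappa> * c] (mod int p)"
    and det: "\<not> int p dvd a * c - b * f"
  shows "lat \<kappa> (c * i + b * j) (f * i + a * j) \<longleftrightarrow> lat \<kappa> i j"
proof (cases "\<kappa> = 0")
  case True
  have l0: "lat 0 x y \<longleftrightarrow> int p dvd x \<and> int p dvd y" for x y
    by (auto simp: lat_def dvd_def)
  show ?thesis unfolding True l0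
  proof
    assume L: "int p dvd c * i + b * j \<and> int p dvd f * i + a * j"
    then have "int p dvd a * (c * i + b * j) - b * (f * i + a * j)"
      "int p dvd c * (f * i + a * j) - f * (c * i + b * j)"
      by (auto intro!: dvd_diff dvd_mult)
    moreover have "a * (c * i + b * j) - b * (f * i + a * j) = (a * c - b * f) * i"
      "c * (f * i + a * j) - f * (c * i + b * j) = (a * c - b * f) * j" by (simp_all add: algebra_simps)
    ultimately show "int p dvd i \<and> int p dvd j" using det by (simp only: prime_p_dvd_mult) blast
  qed (simp add: dvd_add dvd_mult)
next
  case False
  then have k1: "\<kappa> = 1" and f0: "f = 0" using \<kappa> f by auto
  have pac: "int p dvd a - c" using ac k1 by (simp add: cong_iff_dvd_diff)
  have nd: "\<not> int p dvd a" "\<not> int p dvd c" using det f0 by (auto simp: prime_p_dvd_mult)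
  have key: "int p dvd c * i + b * (int p * m) + a * m \<longleftrightarrow> int p dvd i + m" for m
  proof -
    have "c * i + b * (int p * m) + a * m = c * (i + m) + ((a - c) * m + int p * (b * m))"
      by (simp add: algebra_simps)
    moreover have "int p dvd (a - c) * m + int p * (b * m)" using pac by simp
    ultimately have "int p dvd c * i + b * (int p * m) + a * m \<longleftrightarrow> int p dvd c * (i + m)"
      by (simp only: dvd_add_left_iff)
    then show ?thesis using nd by (simp add: prime_p_dvd_mult)
  qed
  show ?thesis
  proof
    assume "lat \<kappa> (c * i + b * j) (f * i + a * j)"
    then obtain m where m: "a * j = int p * m" "int p dvd c * i + b * j + m"
      unfolding lat_def using k1 f0 by auto
    have "int p dvd j" using m(1) nd prime_p_dvd_mult by (metis dvd_triv_left)
    then obtain m' where m': "j = int p * m'" by (rule dvdE)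
    have "m = a * m'" using m(1) m' p_gt by simp
    then have "int p dvd i + m'" using m(2) m' key[of m'] by simp
    then show "lat \<kappa> i j" unfolding lat_def using m' k1 by auto
  next
    assume "lat \<kappa> i j"
    then obtain m where m: "j = int p * m" "int p dvd i + m" unfolding lat_def using k1 by auto
    then have "int p dvd c * i + b * j + a * m" using key[of m] by simp
    moreover have "f * i + a * j = int p * (a * m)" using m f0 by simp
    ultimately show "lat \<kappa> (c * i + b * j) (f * i + a * j)" unfolding lat_def using k1 by auto
  qed
qed

lemma lat_p2: "lat \<kappa> (int p ^ 2 * k) (int p ^ 2 * l)"
  unfolding lat_def by (intro exI[of _ "int p * l"]) (simp add: power2_eq_square)

lemma M_dvd_of_p: "[int p * d = 0] (mod int M) \<Longrightarrow> int p dvd x \<Longrightarrow> int M dvd d * x"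
  by (auto simp: cong_0_iff dvd_def) (metis mult.assoc mult.commute)

text \<open>\<open>ev'\<close> names the same elements through a linear change of coordinates, so
  only the scalars and the cocycle have to be rewritten. The congruences in \<open>rel\<close> are
  what this rewriting requires.\<close>

lemma realizes_rel:
  assumes r: "realizes B d ev" and v: "valid d" and rel: "rel d d'"
  obtains ev' where "realizes B d' ev'"
proof -
  obtain \<kappa> \<epsilon> s t1 t2 d1 d2 where d: "d = (\<kappa>, \<epsilon>, s, t1, t2, d1, d2)" by (cases d)
  obtain t1' t2' d1' d2' where d': "d' = (\<kappa>, \<epsilon>, s, t1', t2', d1', d2')"
    using rel unfolding d by (cases d') auto
  obtain a b c f where f: "\<kappa> = 1 \<or> \<epsilon> = 1 \<longrightarrow> f = 0" and ka: "[\<kappa> * a = \<kappa> * c] (mod int p)"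
    and ea: "[\<epsilon> * a ^ 2 = \<epsilon> * c] (mod int p)" and det: "\<not> int p dvd a * c - b * f"
    and t1': "[t1' = t1 * c + t2 * f] (mod int M)" and t2': "[t2' = t1 * b + t2 * a] (mod int M)"
    and d1': "[d1' = d1 * c + d2 * f] (mod int M)" and d2': "[d2' = d1 * (b - \<epsilon> * tri a) + d2 * a] (mod int M)"
    using rel unfolding d d' rel.simps by blast
  have \<kappa>: "\<kappa> \<in> {0, 1}" and \<epsilon>: "\<epsilon> \<in> {0, 1}" and pd1: "[int p * d1 = 0] (mod int M)"
    using v unfolding d valid.simps by blast+
  note r = r[unfolded d]
  note ker = realizes_ker[OF r]
  define ev' where "ev' x u v = ev x (c * u + b * v) (f * u + a * v)" for x u v
  have tau: "tau t1' t2' u v = tau t1 t2 (c * u + b * v) (f * u + a * v)" for u v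
  proof -
    have "[t1' * u + t2' * v = (t1 * c + t2 * f) * u + (t1 * b + t2 * a) * v] (mod int M)"
      by (intro cong_add cong_mult cong_refl t1' t2')
    also have "(t1 * c + t2 * f) * u + (t1 * b + t2 * a) * v = t1 * (c * u + b * v) + t2 * (f * u + a * v)"
      by (simp add: algebra_simps)
    finally show ?thesis unfolding tau_def by (rule Z_cong)
  qed
  have gam: "gam s t1' t2' u v = gam s t1 t2 (c * u + b * v) (f * u + a * v)" for u v
  proof -
    have "[s * (t1' * u + t2' * v) = s * ((t1 * c + t2 * f) * u + (t1 * b + t2 * a) * v)] (mod int M)"
      by (intro cong_add cong_mult cong_refl t1' t2')
    also have "(t1 * c + t2 * f) * u + (t1 * b + t2 * a) * v = t1 * (c * u + b * v) + t2 * (f * u + a * v)"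
      by (simp add: algebra_simps)
    finally show ?thesis unfolding gam_def by (rule Z_cong)
  qed
  have del: "del \<epsilon> d1' d2' u v = del \<epsilon> d1 d2 (c * u + b * v) (f * u + a * v)" for u v
  proof -
    have "[d1' * (u - \<epsilon> * tri v) + d2' * v = (d1 * c + d2 * f) * (u - \<epsilon> * tri v) + (d1 * (b - \<epsilon> * tri a) + d2 * a) * v] (mod int M)"
      by (intro cong_add cong_mult cong_refl d1' d2')
    \<comment> \<open>For \<open>\<epsilon> = 1\<close>, \<open>tri_mult\<close> leaves the
      difference \<open>d1 (a^2 - c) tri v\<close>. It vanishes modulo \<open>M\<close> since
      \<open>p\<close> divides \<open>a^2 - c\<close> and \<open>p d1 = 0\<close>.\<close>
    also have "[(d1 * c + d2 * f) * (u - \<epsilon> * tri v) + (d1 * (b - \<epsilon> * tri a) + d2 * a) * v =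
        d1 * ((c * u + b * v) - \<epsilon> * tri (f * u + a * v)) + d2 * (f * u + a * v)] (mod int M)"
    proof (cases "\<epsilon> = 0")
      case True
      then show ?thesis by (simp add: algebra_simps)
    next
      case False
      then have e1: "\<epsilon> = 1" and f0: "f = 0" using \<epsilon> f by auto
      have "int p dvd a ^ 2 - c" using ea e1 by (simp add: cong_iff_dvd_diff)
      then have "int M dvd d1 * (a ^ 2 - c)" by (rule M_dvd_of_p[OF pd1])
      then have "int M dvd d1 * (a ^ 2 - c) * tri v" by (rule dvd_mult2)
      moreover have "(d1 * c + d2 * f) * (u - \<epsilon> * tri v) + (d1 * (b - \<epsilon> * tri a) + d2 * a) * v -
          (d1 * ((c * u + b * v) - \<epsilon> * tri (f * u + a * v)) + d2 * (f * u + a * v)) = d1 * (a ^ 2 - c) * tri v"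
        unfolding e1 f0 using tri_mult[of a v] by (simp add: algebra_simps)
      ultimately show ?thesis by (simp only: cong_iff_dvd_diff)
    qed
    finally (cong_trans) show ?thesis unfolding del_def by (rule Z_cong)
  qed
  have latc: "lat \<kappa> (c * i + b * j) (f * i + a * j) \<longleftrightarrow> lat \<kappa> i j" for i j
    by (rule lat_change[OF \<kappa> _ ka det]) (use f in simp)
  have "realizes B d' ev'"
    unfolding d' realizes.simps
  proof (intro conjI allI ballI)
    fix x u v x' u' v'
    show "ev' x u v \<in> carrier B" using realizes_closed[OF r] by (simp add: ev'_def)
    have "c * u + b * v - (c * u' + b * v') = c * (u - u') + b * (v - v')"
      "f * u + a * v - (f * u' + a * v') = f * (u - u') + a * (v - v')" by (simp_all add: algebra_simps)
    then show "ev' x u v = ev' x' u' v' \<longleftrightarrow> [x = x'] (mod int q) \<and> lat \<kappa> (u - u') (v - v')"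
      unfolding ev'_def ker by (simp only: latc)
    show "ev' x u v \<oplus>\<^bsub>B\<^esub> ev' x' u' v' = ev' (x + tau t1' t2' u v * x') (u + u') (v + v')"
      unfolding ev'_def realizes_add[OF r] tau by (simp add: algebra_simps)
    have j: "f * u + a * v + (f * u' + a * v') = f * (u + u' + \<epsilon> * v * v') + a * (v + v')"
      using f \<epsilon> by (auto simp: algebra_simps)
    have "int p dvd (c * u + b * v + (c * u' + b * v') + \<epsilon> * (f * u + a * v) * (f * u' + a * v')) -
        (c * (u + u' + \<epsilon> * v * v') + b * (v + v'))"
    proof (cases "\<epsilon> = 0")
      case True
      then show ?thesis by (simp add: algebra_simps)
    next
      case False
      then have e1: "\<epsilon> = 1" and f0: "f = 0" using \<epsilon> f by auto
      have "int p dvd a ^ 2 - c" using ea e1 by (simp add: cong_iff_dvd_diff)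
      then have "int p dvd (a ^ 2 - c) * (v * v')" by (rule dvd_mult2)
      then show ?thesis unfolding e1 f0 by (simp add: algebra_simps power2_eq_square)
    qed
    then have l: "lat \<kappa> ((c * u + b * v + (c * u' + b * v') + \<epsilon> * (f * u + a * v) * (f * u' + a * v')) -
        (c * (u + u' + \<epsilon> * v * v') + b * (v + v'))) 0"
      unfolding lat_def by (auto intro!: exI[of _ 0])
    show "ev' x u v \<otimes>\<^bsub>B\<^esub> ev' x' u' v' =
       ev' (gam s t1' t2' u' v' * x + del \<epsilon> d1' d2' u v * x') (u + u' + \<epsilon> * v * v') (v + v')"
      unfolding ev'_def realizes_mult[OF r] gam del ker j using l by simp
  next
    fix y assume "y \<in> carrier B"
    then obtain x u v where y: "y = ev x u v" using realizes_surj[OF r] by blast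
    \<comment> \<open>Coordinates are inverted by the adjugate matrix times an inverse
      \<open>i\<close> of the determinant modulo \<open>p^2\<close>; the error is a multiple of
      \<open>p^2\<close>, which lies in every \<open>lat\<close>.\<close>
    have "coprime (int p ^ 2) (a * c - b * f)"
      using prime_imp_coprime[OF prime_int_p det] by simp
    then have "coprime (a * c - b * f) (int p ^ 2)" by (simp add: coprime_commute)
    then obtain i where "[(a * c - b * f) * i = 1] (mod int p ^ 2)" using cong_solve_coprime_int by blast
    then have "int p ^ 2 dvd (a * c - b * f) * i - 1" by (simp add: cong_iff_dvd_diff)
    then obtain k where k: "(a * c - b * f) * i - 1 = int p ^ 2 * k" by (rule dvdE)
    let ?u = "i * (a * u - b * v)" and ?v = "i * (c * v - f * u)"
    have "c * ?u + b * ?v - u = ((a * c - b * f) * i - 1) * u" "f * ?u + a * ?v - v = ((a * c - b * f) * i - 1) * v"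
      by (simp_all add: algebra_simps)
    then have "lat \<kappa> (c * ?u + b * ?v - u) (f * ?u + a * ?v - v)"
      unfolding k using lat_p2 by (simp add: mult.assoc)
    then have "ev' x ?u ?v = y" unfolding ev'_def y ker by simp
    then show "\<exists>x u v. y = ev' x u v" by metis
  qed
  then show thesis by (rule that)
qed

lemma tau_00: "tau t1 t2 0 0 = 1" and gam_00: "gam s t1 t2 0 0 = 1" and del_00: "del \<epsilon> d1 d2 0 0 = 1"
  by (simp_all add: tau_def gam_def del_def Z_0)

text \<open>\<open>q\<close> is invertible modulo \<open>p\<close>. This is what forces an element
  killed by \<open>q\<close> to have trivial coordinates outside \<open>Q\<close>.\<close>

lemma lat_q: "lat \<kappa> (int q * u) (int q * v) \<Longrightarrow> lat \<kappa> u v"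
proof -
  assume "lat \<kappa> (int q * u) (int q * v)"
  then obtain m where m: "int q * v = int p * m" "int p dvd int q * u + \<kappa> * m" by (auto simp: lat_def)
  have pq: "\<not> int p dvd int q"
    using primes_dvd_imp_eq[OF p q] qp by (auto simp: int_dvd_int_iff)
  have "int p dvd v" using m(1) pq prime_p_dvd_mult by (metis dvd_triv_left)
  then obtain m' where m': "v = int p * m'" by (rule dvdE)
  then have "m = int q * m'" using m(1) p_gt by simp
  then have "int p dvd int q * (u + \<kappa> * m')" using m(2) by (simp add: algebra_simps)
  then have "int p dvd u + \<kappa> * m'" using pq by (simp add: prime_p_dvd_mult)
  then show ?thesis unfolding lat_def using m' by blast
qed

text \<open>The complements named by \<open>ev\<close> and \<open>ev'\<close> can differ, so the
  comparison takes place modulo \<open>Q\<close>: writing the new \<open>z\<close> and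
  \<open>e\<close> in the old coordinates and dropping the multiples of \<open>g\<close> gives the
  matrix. The characters need no such care, being the scalars by which elements act on
  \<open>Q\<close>.\<close>

lemma realizes_unique:
  assumes r: "realizes B d ev" and v: "valid d" and r': "realizes B d' ev'" and v': "valid d'"
  shows "rel d d'"
proof -
  obtain \<kappa> \<epsilon> s t1 t2 d1 d2 where d: "d = (\<kappa>, \<epsilon>, s, t1, t2, d1, d2)" by (cases d)
  obtain \<kappa>' \<epsilon>' s' t1' t2' d1' d2' where d': "d' = (\<kappa>', \<epsilon>', s', t1', t2', d1', d2')" by (cases d')
  note r = r[unfolded d] and r' = r'[unfolded d']
  note ker = realizes_ker[OF r] and ker' = realizes_ker[OF r']
  note add = realizes_add[OF r] and add' = realizes_add[OF r']
  note mult = realizes_mult[OF r] and mult' = realizes_mult[OF r']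
  have val: "\<kappa> \<in> {0, 1}" "\<epsilon> \<in> {0, 1}" "s \<in> {0, 1}" "s = 1 \<longrightarrow> \<not> ([t1 = 0] (mod int M) \<and> [t2 = 0] (mod int M))"
    using v unfolding d valid.simps by blast+
  have val': "\<kappa>' \<in> {0, 1}" "\<epsilon>' \<in> {0, 1}" "s' \<in> {0, 1}" "s' = 1 \<longrightarrow> \<not> ([t1' = 0] (mod int M) \<and> [t2' = 0] (mod int M))"
    using v' unfolding d' valid.simps by blast+
  have surj': "\<exists>x u v. ev x0 u0 v0 = ev' x u v" for x0 u0 v0
    using realizes_surj[OF r' realizes_closed[OF r]] .
  have surj: "\<exists>x u v. ev' x0 u0 v0 = ev x u v" for x0 u0 v0
    using realizes_surj[OF r realizes_closed[OF r']] .
  have lat0: "lat k 0 0" for k unfolding lat_def by (auto intro!: exI[of _ 0])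
  have zero: "ev' 0 0 0 = ev 0 0 0"
  proof -
    obtain x u v where e: "ev' 0 0 0 = ev x u v" using surj by blast
    have "ev' 0 0 0 \<oplus>\<^bsub>B\<^esub> ev' 0 0 0 = ev' 0 0 0" by (simp add: add')
    then have "[x + tau t1 t2 u v * x = x] (mod int q)" "lat \<kappa> u v" unfolding e add ker by simp_all
    then have "[tau t1 t2 u v * x = 0] (mod int q)" by (simp add: cong_iff_dvd_diff)
    then have "[x = 0] (mod int q)" using cong_mult_eq_0_q Z_not_0 unfolding tau_def by blast
    then show ?thesis unfolding e ker using \<open>lat \<kappa> u v\<close> by simp
  qed
  \<comment> \<open>\<open>ev' 1 0 0\<close> is killed by \<open>q\<close> and so lies in
    \<open>Q\<close>. It may be another generator than \<open>ev 1 0 0\<close>, whence the factor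
    \<open>w\<close>.\<close>
  obtain w where w: "ev' 1 0 0 = ev w 0 0"
  proof -
    obtain x u v where e: "ev' 1 0 0 = ev x u v" using surj by blast
    have "\<exists>y. ev' (int n) 0 0 = ev y (int n * u) (int n * v)" for n
    proof (induction n)
      case 0
      then show ?case using zero by auto
    next
      case (Suc n)
      then obtain y where "ev' (int n) 0 0 = ev y (int n * u) (int n * v)" by blast
      then have "ev' (int n) 0 0 \<oplus>\<^bsub>B\<^esub> ev' 1 0 0 = ev (y + tau t1 t2 (int n * u) (int n * v) * x) (int n * u + u) (int n * v + v)"
        unfolding e by (simp only: add)
      then show ?case by (auto simp: add' tau_00 algebra_simps)
    qed
    then obtain y where "ev' (int q) 0 0 = ev y (int q * u) (int q * v)" by blast
    moreover have "ev' (int q) 0 0 = ev' 0 0 0" unfolding ker' using lat0 by (simp add: cong_def)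
    ultimately have "lat \<kappa> (int q * u) (int q * v)" unfolding zero using ker by (metis diff_zero)
    then have "lat \<kappa> u v" by (rule lat_q)
    then have "ev x u v = ev x 0 0" unfolding ker by simp
    then show thesis using that e by simp
  qed
  have wn: "ev' X 0 0 = ev (X * w) 0 0" for X
  proof -
    have nat: "ev' (int n) 0 0 = ev (int n * w) 0 0" for n
    proof (induction n)
      case (Suc n)
      have "ev' (int (Suc n)) 0 0 = ev' (int n) 0 0 \<oplus>\<^bsub>B\<^esub> ev' 1 0 0" by (simp add: add' tau_00 algebra_simps)
      then show ?case unfolding Suc w by (simp add: add tau_00 algebra_simps)
    qed (simp add: zero)
    obtain n where n: "[int n = X] (mod int q)" using ex_nat_cong[of q X] q_gt by auto
    then have "ev' X 0 0 = ev' (int n) 0 0" unfolding ker' using lat0 by (simp add: cong_sym)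
    also have "\<dots> = ev (X * w) 0 0" unfolding nat ker using lat0 cong_scalar_right[OF n] by simp
    finally show ?thesis .
  qed
  have w0: "\<not> [w = 0] (mod int q)"
  proof
    assume "[w = 0] (mod int q)"
    then have "ev w 0 0 = ev 0 0 0" unfolding ker using lat0 by simp
    then have "ev' 1 0 0 = ev' 0 0 0" using w zero by simp
    then show False unfolding ker' using not_one_cong_0 by simp
  qed
  have canc: "[X = Y] (mod int q)" if "[X * w = Y * w] (mod int q)" for X Y
  proof -
    have "[(X - Y) * w = 0] (mod int q)" using that by (simp add: cong_iff_dvd_diff left_diff_distrib)
    then have "[X - Y = 0] (mod int q)" using cong_mult_eq_0_q w0 by blast
    then show ?thesis by (simp add: cong_iff_dvd_diff)
  qed
  \<comment> \<open>One and the same element is added to, and circle-multiplied on either side with,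
    the common generator \<open>ev w 0 0 = ev' 1 0 0\<close>. Cancelling the unit \<open>w\<close>
    equates the scalars of the two presentations, hence the exponents modulo
    \<open>M\<close>.\<close>
  have inv: "[t1 * u + t2 * v = t1' * u' + t2' * v'] (mod int M)"
      "[s * (t1 * u + t2 * v) = s' * (t1' * u' + t2' * v')] (mod int M)"
      "[d1 * (u - \<epsilon> * tri v) + d2 * v = d1' * (u' - \<epsilon>' * tri v') + d2' * v'] (mod int M)"
    if e: "ev x u v = ev' x' u' v'" for x u v x' u' v'
  proof -
    have shift: "ev' (X + x') u' v' = ev (X * w + x) u v" for X
    proof -
      have "ev' (X + x') u' v' = ev' X 0 0 \<oplus>\<^bsub>B\<^esub> ev' x' u' v'" by (simp add: add' tau_00)
      then show ?thesis unfolding wn e[symmetric] by (simp add: add tau_00)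
    qed
    have "ev x u v \<oplus>\<^bsub>B\<^esub> ev w 0 0 = ev' x' u' v' \<oplus>\<^bsub>B\<^esub> ev' 1 0 0" using e w by simp
    then have "ev (tau t1 t2 u v * w + x) u v = ev (tau t1' t2' u' v' * w + x) u v"
      unfolding add add' using shift[of "tau t1' t2' u' v'"] by (simp add: algebra_simps)
    then have "[tau t1 t2 u v * w = tau t1' t2' u' v' * w] (mod int q)" unfolding ker by (simp add: cong_add_rcancel)
    from canc[OF this] show "[t1 * u + t2 * v = t1' * u' + t2' * v'] (mod int M)"
      unfolding tau_def Z_eq_iff .
    have "ev w 0 0 \<otimes>\<^bsub>B\<^esub> ev x u v = ev' 1 0 0 \<otimes>\<^bsub>B\<^esub> ev' x' u' v'" using e w by simp
    then have "ev (gam s t1 t2 u v * w + x) u v = ev (gam s' t1' t2' u' v' * w + x) u v"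
      unfolding mult mult' using shift[of "gam s' t1' t2' u' v'"] by (simp add: del_00)
    then have "[gam s t1 t2 u v * w = gam s' t1' t2' u' v' * w] (mod int q)" unfolding ker by (simp add: cong_add_rcancel)
    from canc[OF this] show "[s * (t1 * u + t2 * v) = s' * (t1' * u' + t2' * v')] (mod int M)"
      unfolding gam_def Z_eq_iff .
    have "ev x u v \<otimes>\<^bsub>B\<^esub> ev w 0 0 = ev' x' u' v' \<otimes>\<^bsub>B\<^esub> ev' 1 0 0" using e w by simp
    then have "ev (del \<epsilon> d1 d2 u v * w + x) u v = ev (del \<epsilon>' d1' d2' u' v' * w + x) u v"
      unfolding mult mult' using shift[of "del \<epsilon>' d1' d2' u' v'"] by (simp add: gam_00 algebra_simps)
    then have "[del \<epsilon> d1 d2 u v * w = del \<epsilon>' d1' d2' u' v' * w] (mod int q)" unfolding ker by (simp add: cong_add_rcancel)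
    from canc[OF this] show "[d1 * (u - \<epsilon> * tri v) + d2 * v = d1' * (u' - \<epsilon>' * tri v') + d2' * v'] (mod int M)"
      unfolding del_def Z_eq_iff .
  qed
  \<comment> \<open>For \<open>\<kappa> = 1\<close> the relation \<open>p z' = 0\<close> forces
    \<open>p\<close> to divide \<open>f\<close>; for \<open>\<epsilon> = 1\<close> the equality of
    \<open>z' \<otimes> z'\<close> with \<open>z' \<oplus> z'\<close> does, through
    \<open>f * f\<close>. With \<open>f = p f'\<close>, the relation \<open>p e = \<kappa> z\<close>
    then lets \<open>f\<close> be replaced by exactly 0.\<close>
  obtain x1 c f where e1: "ev' 0 1 0 = ev x1 c f" and f0: "\<kappa> = 1 \<or> \<epsilon> = 1 \<longrightarrow> f = 0"
  proof -
    obtain x c f where e: "ev' 0 1 0 = ev x c f" using surj by blast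
    have "int p dvd f" if k: "\<kappa> = 1"
    proof -
      have "\<exists>y. ev' 0 (int n) 0 = ev y (int n * c) (int n * f)" for n
      proof (induction n)
        case 0
        then show ?case using zero by auto
      next
        case (Suc n)
        then obtain y where "ev' 0 (int n) 0 = ev y (int n * c) (int n * f)" by blast
        then have "ev' 0 (int n) 0 \<oplus>\<^bsub>B\<^esub> ev' 0 1 0 = ev (y + tau t1 t2 (int n * c) (int n * f) * x) (int n * c + c) (int n * f + f)"
          unfolding e by (simp only: add)
        then show ?case by (auto simp: add' algebra_simps)
      qed
      then obtain y where "ev' 0 (int p) 0 = ev y (int p * c) (int p * f)" by blast
      moreover have "ev' 0 (int p) 0 = ev' 0 0 0" unfolding ker' lat_def by (auto intro!: exI[of _ 0])
      ultimately have "lat \<kappa> (int p * c) (int p * f)" unfolding zero using ker by (metis diff_zero)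
      then obtain m where "int p * f = int p * m" "int p dvd int p * c + \<kappa> * m" unfolding lat_def by blast
      then show ?thesis using k p_gt by (simp add: dvd_add_right_iff)
    qed
    moreover have "int p dvd f" if k: "\<epsilon> = 1"
    proof -
      have "ev' 0 1 0 \<otimes>\<^bsub>B\<^esub> ev' 0 1 0 = ev' 0 1 0 \<oplus>\<^bsub>B\<^esub> ev' 0 1 0" by (simp add: add' mult')
      then have "lat \<kappa> (f * f) 0" unfolding e add mult ker k by simp
      then obtain m where "0 = int p * m" "int p dvd f * f + \<kappa> * m" unfolding lat_def by blast
      then show ?thesis using p_gt by (simp add: prime_p_dvd_mult)
    qed
    ultimately consider "\<not> (\<kappa> = 1 \<or> \<epsilon> = 1)" | "int p dvd f" by blast
    then show thesis
    proof cases
      case 1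
      then show thesis using that e by blast
    next
      case 2
      then obtain f' where f': "f = int p * f'" by (rule dvdE)
      have "lat \<kappa> (c - (c + \<kappa> * f')) (f - 0)" unfolding lat_def by (intro exI[of _ f']) (simp add: f')
      then have "ev x c f = ev x (c + \<kappa> * f') 0" unfolding ker by simp
      then show thesis using that e by simp
    qed
  qed
  obtain x2 b a where e2: "ev' 0 0 1 = ev x2 b a" using surj by blast
  have lin1: "\<exists>y. ev' 0 (int m) 0 = ev y (c * int m) (f * int m)" for m
  proof (induction m)
    case 0
    then show ?case using zero by auto
  next
    case (Suc m)
    then obtain y where y: "ev' 0 (int m) 0 = ev y (c * int m) (f * int m)" by blast
    have "ev' 0 1 0 \<oplus>\<^bsub>B\<^esub> ev' 0 (int m) 0 = ev (x1 + tau t1 t2 c f * y) (c + c * int m) (f + f * int m)"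
      unfolding e1 y by (simp only: add)
    then show ?case by (auto simp: add' algebra_simps)
  qed
  have lin: "\<exists>y. ev' 0 (int m) (int n) = ev y (c * int m + b * int n) (f * int m + a * int n)" for m n
  proof (induction n)
    case 0
    then show ?case using lin1 by simp
  next
    case (Suc n)
    then obtain y where y: "ev' 0 (int m) (int n) = ev y (c * int m + b * int n) (f * int m + a * int n)" by blast
    have "ev' 0 0 1 \<oplus>\<^bsub>B\<^esub> ev' 0 (int m) (int n) =
        ev (x2 + tau t1 t2 b a * y) (b + (c * int m + b * int n)) (a + (f * int m + a * int n))"
      unfolding e2 y by (simp only: add)
    then show ?case by (auto simp: add' algebra_simps)
  qed
  \<comment> \<open>\<open>R2\<close> and \<open>R3\<close> are the relations
    \<open>p e' = \<kappa>' z'\<close> and \<open>e' \<otimes> e' = \<epsilon>' z' + 2 e'\<close> in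
    the old coordinates. \<open>R5\<close> is surjectivity modulo \<open>Q\<close>, the source of
    the invertibility of the matrix.\<close>
  have R2: "lat \<kappa> (b * int p - c * \<kappa>') (a * int p - f * \<kappa>')"
  proof -
    have "ev' 0 0 (int p) = ev' 0 (int (nat \<kappa>')) 0"
      unfolding ker' lat_def using val'(1) by (auto intro!: exI[of _ 1])
    moreover obtain y y' where "ev' 0 0 (int p) = ev y (b * int p) (a * int p)"
      "ev' 0 (int (nat \<kappa>')) 0 = ev y' (c * int (nat \<kappa>')) (f * int (nat \<kappa>'))"
      using lin[of 0 p] lin1[of "nat \<kappa>'"] by auto
    ultimately show ?thesis using ker val'(1) by auto
  qed
  have R3: "lat \<kappa> (\<epsilon> * a * a - c * \<epsilon>') (- f * \<epsilon>')"
  proof -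
    obtain y where "ev' 0 (int (nat \<epsilon>')) (int 2) = ev y (c * int (nat \<epsilon>') + b * int 2) (f * int (nat \<epsilon>') + a * int 2)"
      using lin by blast
    then have y: "ev' 0 \<epsilon>' 2 = ev y (c * \<epsilon>' + b * 2) (f * \<epsilon>' + a * 2)" using val'(2) by auto
    have "ev' 0 0 1 \<otimes>\<^bsub>B\<^esub> ev' 0 0 1 = ev' 0 \<epsilon>' 2" by (simp add: mult')
    then show ?thesis unfolding y e2 mult ker by simp
  qed
  have R5: "\<exists>m n. lat \<kappa> (c * m + b * n - u) (f * m + a * n - v)" for u v
  proof -
    obtain x u' v' where e: "ev 0 u v = ev' x u' v'" using surj' by blast
    obtain m where m: "[int m = u'] (mod int (p ^ 2))" using ex_nat_cong[of "p ^ 2" u'] p_gt by auto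
    obtain n where n: "[int n = v'] (mod int (p ^ 2))" using ex_nat_cong[of "p ^ 2" v'] p_gt by auto
    obtain k l where "u' - int m = int p ^ 2 * k" "v' - int n = int p ^ 2 * l"
      using m n by (metis cong_iff_dvd_diff cong_sym dvd_def of_nat_power)
    then have "ev' x u' v' = ev' x (int m) (int n)" unfolding ker' using lat_p2 by simp
    also have "\<dots> = ev' x 0 0 \<oplus>\<^bsub>B\<^esub> ev' 0 (int m) (int n)" by (simp add: add')
    finally have e': "ev 0 u v = ev' x 0 0 \<oplus>\<^bsub>B\<^esub> ev' 0 (int m) (int n)" using e by simp
    obtain y where "ev' 0 (int m) (int n) = ev y (c * int m + b * int n) (f * int m + a * int n)" using lin by blast
    then have "ev (x * w + y) (c * int m + b * int n) (f * int m + a * int n) = ev 0 u v"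
      unfolding e' wn by (simp add: add tau_00)
    then show ?thesis unfolding ker by blast
  qed
  have lat_dvd: "int p dvd j" if "lat k i j" for k i j using that by (auto simp: lat_def)
  have l0: "lat 0 x y \<longleftrightarrow> int p dvd x \<and> int p dvd y" for x y by (auto simp: lat_def dvd_def)
  have main: "\<kappa>' = \<kappa> \<and> \<epsilon>' = \<epsilon> \<and> [\<kappa> * a = \<kappa> * c] (mod int p) \<and> [\<epsilon> * a ^ 2 = \<epsilon> * c] (mod int p) \<and> \<not> int p dvd a * c - b * f"
  proof (cases "\<kappa> = 1 \<or> \<epsilon> = 1")
    case True
    then have f: "f = 0" using f0 by blast
    have na: "\<not> int p dvd a"
    proof
      assume "int p dvd a"
      moreover obtain m n where "lat \<kappa> (c * m + b * n - 0) (f * m + a * n - 1)" using R5 by blast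
      then have "int p dvd a * n - 1" using lat_dvd f by simp
      ultimately have "int p dvd a * n - (a * n - 1)" by (meson dvd_diff dvd_mult2)
      then show False using p_gt by simp
    qed
    obtain m where "a * int p - f * \<kappa>' = int p * m" "int p dvd b * int p - c * \<kappa>' + \<kappa> * m" using R2 by (auto simp: lat_def)
    then have "int p dvd b * int p - c * \<kappa>' + \<kappa> * a" using f p_gt by simp
    then have "int p dvd (b * int p - c * \<kappa>' + \<kappa> * a) - b * int p" by (rule dvd_diff) simp
    then have k: "int p dvd \<kappa> * a - c * \<kappa>'" by simp
    obtain m where "- f * \<epsilon>' = int p * m" "int p dvd \<epsilon> * a * a - c * \<epsilon>' + \<kappa> * m" using R3 by (auto simp: lat_def)
    then have e: "int p dvd \<epsilon> * a * a - c * \<epsilon>'" using f p_gt by simp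
    have naa: "\<not> int p dvd a * a" using na by (simp add: prime_p_dvd_mult)
    have k1: "\<kappa>' = 1 \<and> int p dvd a - c" if "\<kappa> = 1" using k val'(1) na that by auto
    have e1: "\<epsilon>' = 1 \<and> int p dvd a * a - c" if "\<epsilon> = 1" using e val'(2) naa that by auto
    have nc: "\<not> int p dvd c"
    proof
      assume c: "int p dvd c"
      show False
        using True k1 e1 c na naa by (metis dvd_add diff_add_cancel)
    qed
    have "\<kappa>' = \<kappa>" using k1 k val(1) val'(1) nc by auto
    moreover have "\<epsilon>' = \<epsilon>" using e1 e val(2) val'(2) nc by auto
    moreover have "[\<kappa> * a = \<kappa> * c] (mod int p)" using k1 val(1) by (auto simp: cong_iff_dvd_diff)
    moreover have "[\<epsilon> * a ^ 2 = \<epsilon> * c] (mod int p)" using e1 val(2) by (auto simp: cong_iff_dvd_diff power2_eq_square)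
    ultimately show ?thesis using na nc f by (simp add: prime_p_dvd_mult)
  next
    case False
    then have ke: "\<kappa> = 0" "\<epsilon> = 0" using val by auto
    have ncf: "\<not> (int p dvd c \<and> int p dvd f)"
    proof
      assume "int p dvd c \<and> int p dvd f"
      then have "ev x1 c f = ev x1 0 0" unfolding ker ke l0 by simp
      then have "ev' 0 1 0 = ev x1 0 0" using e1 by simp
      moreover obtain X where "ev x1 0 0 = ev' X 0 0"
      proof -
        have "coprime w (int q)" using w0 prime_imp_coprime[OF prime_int_q, of w] by (simp add: cong_0_iff coprime_commute)
        then obtain w' where w': "[w * w' = 1] (mod int q)" using cong_solve_coprime_int by blast
        then have "[x1 * w' * w = x1] (mod int q)" using cong_scalar_left[OF w', of x1] by (simp add: mult_ac)
        then have "ev' (x1 * w') 0 0 = ev x1 0 0" unfolding wn ker using lat0 by simp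
        then show thesis using that by metis
      qed
      ultimately have "lat \<kappa>' 1 0" using ker' by (metis diff_zero)
      then obtain m where "0 = int p * m" "int p dvd 1 + \<kappa>' * m" unfolding lat_def by blast
      then show False using p_gt by simp
    qed
    have R2': "int p dvd b * int p - c * \<kappa>'" "int p dvd a * int p - f * \<kappa>'" using R2 unfolding ke l0 by blast+
    have "int p dvd b * int p - (b * int p - c * \<kappa>')" by (rule dvd_diff[OF dvd_triv_right R2'(1)])
    moreover have "int p dvd a * int p - (a * int p - f * \<kappa>')" by (rule dvd_diff[OF dvd_triv_right R2'(2)])
    ultimately have "int p dvd c * \<kappa>'" "int p dvd f * \<kappa>'" by simp_all
    then have k': "\<kappa>' = 0" using ncf val'(1) by auto
    have "int p dvd c * \<epsilon>'" "int p dvd f * \<epsilon>'" using R3 unfolding ke l0 by simp_all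
    then have e': "\<epsilon>' = 0" using ncf val'(2) by auto
    have "\<not> int p dvd a * c - b * f"
    proof
      assume det: "int p dvd a * c - b * f"
      obtain m n where mn: "int p dvd c * m + b * n - 1" "int p dvd f * m + a * n - 0" using R5 unfolding ke l0 by blast
      obtain m' n' where mn': "int p dvd c * m' + b * n' - 0" "int p dvd f * m' + a * n' - 1" using R5 unfolding ke l0 by blast
      have "[(c * m + b * n) * (f * m' + a * n') = 1 * 1] (mod int p)"
        by (intro cong_mult) (use mn mn' in \<open>simp_all add: cong_iff_dvd_diff\<close>)
      moreover have "[(f * m + a * n) * (c * m' + b * n') = 0 * 0] (mod int p)"
        by (intro cong_mult) (use mn mn' in \<open>simp_all add: cong_iff_dvd_diff\<close>)
      ultimately have "[(c * m + b * n) * (f * m' + a * n') - (f * m + a * n) * (c * m' + b * n') = 1 * 1 - 0 * 0] (mod int p)"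
        by (rule cong_diff)
      moreover have "(c * m + b * n) * (f * m' + a * n') - (f * m + a * n) * (c * m' + b * n') = (a * c - b * f) * (m * n' - m' * n)"
        by (simp add: algebra_simps)
      ultimately have "[(a * c - b * f) * (m * n' - m' * n) = 1] (mod int p)" by simp
      moreover have "int p dvd (a * c - b * f) * (m * n' - m' * n)" using det by (rule dvd_mult2)
      ultimately have "int p dvd 1" using cong_dvd_iff by blast
      then show False using p_gt by simp
    qed
    then show ?thesis using k' e' ke by simp
  qed
  have i1: "[t1 * c + t2 * f = t1'] (mod int M)" "[s * (t1 * c + t2 * f) = s' * t1'] (mod int M)"
    "[d1 * (c - \<epsilon> * tri f) + d2 * f = d1'] (mod int M)" using inv[OF e1[symmetric]] by simp_all
  have i2: "[t1 * b + t2 * a = t2'] (mod int M)" "[s * (t1 * b + t2 * a) = s' * t2'] (mod int M)"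
    "[d1 * (b - \<epsilon> * tri a) + d2 * a = d2'] (mod int M)" using inv[OF e2[symmetric]] by simp_all
  \<comment> \<open>If \<open>s\<close> and \<open>s'\<close> differ, the one presentation gives a
    trivial \<open>\<gamma>\<close>. The other, whose \<open>\<gamma>\<close> is its
    \<open>\<tau>\<close>, then has trivial \<open>\<tau>\<close> in spite of \<open>s = 1\<close>,
    which \<open>valid\<close> excludes.\<close>
  have ss: "s' = s"
  proof (rule ccontr)
    assume "s' \<noteq> s"
    then consider "s = 0" "s' = 1" | "s = 1" "s' = 0" using val(3) val'(3) by auto
    then show False
    proof cases
      case 1
      then have "[t1' = 0] (mod int M)" "[t2' = 0] (mod int M)" using i1(2) i2(2) by (simp_all add: cong_sym_eq)
      then show False using val'(4) 1 by blast
    next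
      case 2
      obtain x u v where e: "ev 0 1 0 = ev' x u v" using surj' by blast
      obtain x' u' v' where e': "ev 0 0 1 = ev' x' u' v'" using surj' by blast
      have "[t1 = 0] (mod int M)" "[t2 = 0] (mod int M)" using inv(2)[OF e] inv(2)[OF e'] 2 by simp_all
      then show False using val(4) 2 by blast
    qed
  qed
  have et: "\<epsilon> * tri f = 0" using f0 val(2) by auto
  have j: "[t1' = t1 * c + t2 * f] (mod int M)" "[t2' = t1 * b + t2 * a] (mod int M)"
    "[d2' = d1 * (b - \<epsilon> * tri a) + d2 * a] (mod int M)"
    by (rule cong_sym, rule i1(1) i2(1) i2(3))+
  have j': "[d1' = d1 * c + d2 * f] (mod int M)" using cong_sym[OF i1(3)] unfolding et by simp
  have "\<kappa>' = \<kappa>" "\<epsilon>' = \<epsilon>" "[\<kappa> * a = \<kappa> * c] (mod int p)" "[\<epsilon> * a ^ 2 = \<epsilon> * c] (mod int p)"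
    "\<not> int p dvd a * c - b * f" using main by blast+
  then show ?thesis unfolding d d' rel.simps using ss f0 j j' by blast
qed

end

text \<open>The carrier consists of normal forms and the product normalizes a raw operation
  \<open>m\<close> on representatives. The laws of \<open>m\<close> are required only after
  normalization; \<open>compat\<close> and \<open>idem\<close> remove inner normalizations.\<close>

lemma quotient_groupI:
  fixes H (structure)
  assumes carr: "carrier H = range nf" and mlt: "\<And>a b. a \<otimes> b = nf (m a b)" and one: "\<one> = nf e"
    and idem: "\<And>a. nf (nf a) = nf a"
    and compat: "\<And>a a' b b'. nf a = nf a' \<Longrightarrow> nf b = nf b' \<Longrightarrow> nf (m a b) = nf (m a' b')"
    and assoc: "\<And>a b c. nf (m (m a b) c) = nf (m a (m b c))"
    and unit: "\<And>a. nf (m e a) = nf a" and inv: "\<And>a. \<exists>b. nf (m b a) = nf e"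
  shows "group H"
proof -
  have mm: "nf a \<otimes> nf b = nf (m a b)" for a b unfolding mlt by (rule compat) (rule idem)+
  show ?thesis
  proof (rule groupI)
    fix x assume "x \<in> carrier H"
    then obtain a where a: "x = nf a" using carr by auto
    show "\<one> \<otimes> x = x" unfolding a one mm by (rule unit)
    obtain b where "nf (m b a) = nf e" using inv by blast
    then show "\<exists>y\<in>carrier H. y \<otimes> x = \<one>" unfolding a one carr by (intro bexI[of _ "nf b"]) (auto simp: mm)
  next
    fix x y z assume "x \<in> carrier H" "y \<in> carrier H" "z \<in> carrier H"
    then obtain a b c where "x = nf a" "y = nf b" "z = nf c" using carr by auto
    then show "x \<otimes> y \<otimes> z = x \<otimes> (y \<otimes> z)" by (simp add: mm assoc)
  qed (auto simp: carr mlt one)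
qed

section \<open>Construction of a brace from valid exponents\<close>

context brace_params
begin

declare realizes.simps [simp del] valid.simps [simp del] rel.simps [simp del]

lemma lat_0: "lat \<kappa> 0 0" unfolding lat_def by (auto intro!: exI[of _ 0])

lemma lat_add: "lat \<kappa> i j \<Longrightarrow> lat \<kappa> i' j' \<Longrightarrow> lat \<kappa> (i + i') (j + j')"
proof -
  assume "lat \<kappa> i j" "lat \<kappa> i' j'"
  then obtain m m' where m: "j = int p * m" "int p dvd i + \<kappa> * m" "j' = int p * m'" "int p dvd i' + \<kappa> * m'"
    unfolding lat_def by blast
  have "int p dvd (i + \<kappa> * m) + (i' + \<kappa> * m')" by (rule dvd_add[OF m(2) m(4)])
  then have "int p dvd (i + i') + \<kappa> * (m + m')" by (simp add: algebra_simps)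
  moreover have "j + j' = int p * (m + m')" using m by (simp add: algebra_simps)
  ultimately show ?thesis unfolding lat_def by blast
qed

lemma lat_of_dvd: "int p dvd i \<Longrightarrow> lat \<kappa> i 0" unfolding lat_def by (auto intro!: exI[of _ 0])

text \<open>The quotient \<open>v div int p\<close> is carried into the second coordinate because
  \<open>p e = \<kappa> z\<close>. Triples agree in normal form exactly when the relations identify
  them.\<close>

definition nf :: "int \<Rightarrow> int \<times> int \<times> int \<Rightarrow> int \<times> int \<times> int"
  where "nf \<kappa> = (\<lambda>(x, u, v). (x mod int q, (u + \<kappa> * (v div int p)) mod int p, v mod int p))"

lemma nf_eq_iff: "nf \<kappa> (x, u, v) = nf \<kappa> (x', u', v') \<longleftrightarrow> [x = x'] (mod int q) \<and> lat \<kappa> (u - u') (v - v')"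
proof -
  have "lat \<kappa> (u - u') (v - v') \<longleftrightarrow>
      (u + \<kappa> * (v div int p)) mod int p = (u' + \<kappa> * (v' div int p)) mod int p \<and> v mod int p = v' mod int p"
  proof
    assume "lat \<kappa> (u - u') (v - v')"
    then obtain m where m: "v - v' = int p * m" "int p dvd u - u' + \<kappa> * m" by (auto simp: lat_def)
    then have v: "v = v' + int p * m" by simp
    have "v div int p = v' div int p + m" unfolding v using p_gt by simp
    then have "(u + \<kappa> * (v div int p)) - (u' + \<kappa> * (v' div int p)) = u - u' + \<kappa> * m" by (simp add: algebra_simps)
    then have "int p dvd (u + \<kappa> * (v div int p)) - (u' + \<kappa> * (v' div int p))" using m(2) by (simp only:)
    then show "(u + \<kappa> * (v div int p)) mod int p = (u' + \<kappa> * (v' div int p)) mod int p \<and> v mod int p = v' mod int p"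
      unfolding v by (simp add: mod_eq_dvd_iff)
  next
    assume e: "(u + \<kappa> * (v div int p)) mod int p = (u' + \<kappa> * (v' div int p)) mod int p \<and> v mod int p = v' mod int p"
    have "v - v' = (int p * (v div int p) + v mod int p) - (int p * (v' div int p) + v' mod int p)" by simp
    also have "\<dots> = int p * (v div int p - v' div int p)" using e by (simp only: right_diff_distrib)
    finally have "v - v' = int p * (v div int p - v' div int p)" .
    moreover have "int p dvd (u + \<kappa> * (v div int p)) - (u' + \<kappa> * (v' div int p))" using e by (simp add: mod_eq_dvd_iff)
    then have "int p dvd u - u' + \<kappa> * (v div int p - v' div int p)" by (simp add: algebra_simps)
    ultimately show "lat \<kappa> (u - u') (v - v')" unfolding lat_def by blast
  qed
  then show ?thesis by (auto simp: nf_def cong_def)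
qed

lemma nf_idem: "nf \<kappa> (nf \<kappa> a) = nf \<kappa> a"
  using q_gt p_gt by (cases a) (simp add: nf_def)

lemma range_nf: "range (nf \<kappa>) = {0..<int q} \<times> {0..<int p} \<times> {0..<int p}"
proof (intro equalityI subsetI)
  fix a assume "a \<in> {0..<int q} \<times> {0..<int p} \<times> {0..<int p}"
  then have "nf \<kappa> a = a" by (auto simp: nf_def)
  then show "a \<in> range (nf \<kappa>)" by (metis rangeI)
qed (use q_gt p_gt in \<open>auto simp: nf_def\<close>)

lemma lin_lat:
  assumes "lat \<kappa> i j" and t1: "[int p * t1 = 0] (mod int M)" and t2: "[int p * t2 = \<kappa> * t1] (mod int M)"
  shows "[t1 * i + t2 * j = 0] (mod int M)"
proof -
  obtain m where m: "j = int p * m" "int p dvd i + \<kappa> * m" using assms(1) by (auto simp: lat_def)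
  have "[int p * t2 * m = \<kappa> * t1 * m] (mod int M)" by (rule cong_scalar_right[OF t2])
  then have "[t1 * i + int p * t2 * m = t1 * i + \<kappa> * t1 * m] (mod int M)" by (intro cong_add cong_refl)
  moreover have "[t1 * (i + \<kappa> * m) = 0] (mod int M)" using M_dvd_of_p[OF t1 m(2)] by (simp add: cong_0_iff)
  ultimately show ?thesis unfolding m(1) cong_def by (simp add: algebra_simps)
qed

lemma tri_shift: "int p dvd tri (v + int p * m) - tri v - m * tri (int p)"
  by (simp add: tri_add tri_mult power2_eq_square)

text \<open>Replacing \<open>v\<close> by \<open>v + p m\<close> adds \<open>d2 p m\<close> and, up
  to a multiple of \<open>p d1\<close>, subtracts \<open>d1 \<epsilon> m tri p\<close>; the
  congruence for \<open>p d2\<close> balances these against the change of \<open>u\<close>.\<close>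

lemma del_lat:
  assumes "lat \<kappa> (u - u') (v - v')" and d1: "[int p * d1 = 0] (mod int M)"
    and d2: "[int p * d2 = (\<kappa> + \<epsilon> * tri (int p)) * d1] (mod int M)"
  shows "del \<epsilon> d1 d2 u v = del \<epsilon> d1 d2 u' v'"
proof -
  obtain m where m: "v - v' = int p * m" "int p dvd u - u' + \<kappa> * m" using assms(1) by (auto simp: lat_def)
  have v: "v = v' + int p * m" using m by simp
  have "int p dvd \<epsilon> * (tri v - tri v' - m * tri (int p))" unfolding v by (rule dvd_mult[OF tri_shift])
  then have 1: "int M dvd d1 * ((u - u' + \<kappa> * m) - \<epsilon> * (tri v - tri v' - m * tri (int p)))"
    by (intro M_dvd_of_p[OF d1] dvd_diff m)
  have 2: "int M dvd (int p * d2 - (\<kappa> + \<epsilon> * tri (int p)) * d1) * m"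
    using d2 by (simp add: cong_iff_dvd_diff)
  have "(d1 * (u - \<epsilon> * tri v) + d2 * v) - (d1 * (u' - \<epsilon> * tri v') + d2 * v') =
      d1 * ((u - u' + \<kappa> * m) - \<epsilon> * (tri v - tri v' - m * tri (int p))) + (int p * d2 - (\<kappa> + \<epsilon> * tri (int p)) * d1) * m"
    unfolding v by (simp add: algebra_simps)
  then have "[d1 * (u - \<epsilon> * tri v) + d2 * v = d1 * (u' - \<epsilon> * tri v') + d2 * v'] (mod int M)"
    using dvd_add[OF 1 2] by (simp only: cong_iff_dvd_diff)
  then show ?thesis unfolding del_def by (rule Z_cong)
qed

text \<open>The operations are the formulas of \<open>realizes\<close> on integer triples, followed
  by \<open>nf\<close>. Associativity rests on \<open>T\<close> being multiplicative for sums and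
  \<open>D\<close>, \<open>G\<close> for circle products of the complement; the brace law rests on
  \<open>GT\<close> and on \<open>T\<close> not seeing the cocycle.\<close>

lemma model_exists:
  assumes "valid d"
  obtains C :: "(int \<times> int \<times> int) ring" and ev where "skew_brace C" "card (carrier C) = p ^ 2 * q" "realizes C d ev"
proof -
  obtain \<kappa> \<epsilon> s t1 t2 d1 d2 where d: "d = (\<kappa>, \<epsilon>, s, t1, t2, d1, d2)" by (cases d)
  have \<kappa>: "\<kappa> \<in> {0, 1}" and \<epsilon>: "\<epsilon> \<in> {0, 1}" and s: "s \<in> {0, 1}"
    and pt1: "[int p * t1 = 0] (mod int M)" and pt2: "[int p * t2 = \<kappa> * t1] (mod int M)" and et1: "[\<epsilon> * t1 = 0] (mod int M)"
    and pd1: "[int p * d1 = 0] (mod int M)" and pd2: "[int p * d2 = (\<kappa> + \<epsilon> * tri (int p)) * d1] (mod int M)"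
    using assms unfolding d valid.simps by blast+
  define T where "T = tau t1 t2"
  define D where "D = del \<epsilon> d1 d2"
  define G where "G = gam s t1 t2"
  have T_lat: "T u v = T u' v'" and G_lat: "G u v = G u' v'" if l: "lat \<kappa> (u - u') (v - v')" for u v u' v'
  proof -
    have "[t1 * (u - u') + t2 * (v - v') = 0] (mod int M)" by (rule lin_lat[OF l pt1 pt2])
    then have c: "[t1 * u + t2 * v = t1 * u' + t2 * v'] (mod int M)"
      by (simp add: cong_iff_dvd_diff algebra_simps)
    then show "T u v = T u' v'" unfolding T_def tau_def by (rule Z_cong)
    show "G u v = G u' v'" unfolding G_def gam_def by (rule Z_cong[OF cong_scalar_left[OF c]])
  qed
  have D_lat: "D u v = D u' v'" if l: "lat \<kappa> (u - u') (v - v')" for u v u' v'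
    unfolding D_def by (rule del_lat[OF l pd1 pd2])
  have T_add: "[T (u + u') (v + v') = T u v * T u' v'] (mod int q)" for u v u' v'
    unfolding T_def tau_def by (rule Z_plus_scale) (simp add: algebra_simps)
  have et: "[t1 * (\<epsilon> * n) = 0] (mod int M)" for n
    using cong_scalar_right[OF et1, of n] by (simp add: mult_ac)
  \<comment> \<open>The condition on \<open>\<epsilon> * t1\<close> makes the cocycle term of the
    circle product invisible to \<open>\<tau>\<close>.\<close>
  have T_circ: "T (u + \<epsilon> * v * v') w = T u w" for u v v' w
  proof -
    have "[t1 * (u + \<epsilon> * v * v') + t2 * w = t1 * u + t2 * w] (mod int M)"
      using et[of "v * v'"] by (simp add: cong_iff_dvd_diff algebra_simps)
    then show ?thesis unfolding T_def tau_def by (rule Z_cong)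
  qed
  have G_mult: "[G (u + u' + \<epsilon> * v * v') (v + v') = G u v * G u' v'] (mod int q)" for u v u' v'
    unfolding G_def gam_def
  proof (rule Z_plus_scale)
    have "[s * (t1 * (\<epsilon> * (v * v'))) = s * 0] (mod int M)" by (rule cong_scalar_left[OF et])
    then show "[s * (t1 * (u + u' + \<epsilon> * v * v') + t2 * (v + v')) = s * (t1 * u + t2 * v) + s * (t1 * u' + t2 * v')] (mod int M)"
      by (simp add: cong_iff_dvd_diff algebra_simps)
  qed
  have D_mult: "[D (u + u' + \<epsilon> * v * v') (v + v') = D u v * D u' v'] (mod int q)" for u v u' v'
    unfolding D_def del_def by (rule Z_plus_scale) (simp add: tri_add algebra_simps)
  have T0: "T 0 0 = 1" and G0: "G 0 0 = 1" and D0: "D 0 0 = 1"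
    by (simp_all add: T_def D_def G_def tau_00 gam_00 del_00)
  define A where "A = (\<lambda>(x, u, v) (x', u', v'). (x + T u v * x', u + u', v + v'))"
  define P where "P = (\<lambda>(x, u, v) (x', u', v'). (G u' v' * x + D u v * x', u + u' + \<epsilon> * v * v', v + v'))"
  define C :: "(int \<times> int \<times> int) ring" where
    "C = \<lparr>carrier = range (nf \<kappa>), mult = (\<lambda>a b. nf \<kappa> (P a b)), one = nf \<kappa> (0, 0, 0),
          zero = nf \<kappa> (0, 0, 0), add = (\<lambda>a b. nf \<kappa> (A a b))\<rparr>"
  have A_compat: "nf \<kappa> (A a b) = nf \<kappa> (A a' b')" if "nf \<kappa> a = nf \<kappa> a'" "nf \<kappa> b = nf \<kappa> b'" for a a' b b'
  proof -
    obtain x u v where a: "a = (x, u, v)" by (cases a)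
    obtain x' u' v' where a': "a' = (x', u', v')" by (cases a')
    obtain y w z where b: "b = (y, w, z)" by (cases b)
    obtain y' w' z' where b': "b' = (y', w', z')" by (cases b')
    have 1: "[x = x'] (mod int q)" "lat \<kappa> (u - u') (v - v')" "[y = y'] (mod int q)" "lat \<kappa> (w - w') (z - z')"
      using that unfolding a a' b b' nf_eq_iff by blast+
    have "[x + T u v * y = x' + T u' v' * y'] (mod int q)"
      unfolding T_lat[OF 1(2)] by (intro cong_add cong_mult cong_refl 1)
    moreover have "lat \<kappa> (u + w - (u' + w')) (v + z - (v' + z'))"
      using lat_add[OF 1(2) 1(4)] by (simp add: algebra_simps)
    ultimately show ?thesis unfolding a a' b b' A_def by (simp add: nf_eq_iff)
  qed
  have P_compat: "nf \<kappa> (P a b) = nf \<kappa> (P a' b')" if "nf \<kappa> a = nf \<kappa> a'" "nf \<kappa> b = nf \<kappa> b'" for a a' b b'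
  proof -
    obtain x u v where a: "a = (x, u, v)" by (cases a)
    obtain x' u' v' where a': "a' = (x', u', v')" by (cases a')
    obtain y w z where b: "b = (y, w, z)" by (cases b)
    obtain y' w' z' where b': "b' = (y', w', z')" by (cases b')
    have 1: "[x = x'] (mod int q)" "lat \<kappa> (u - u') (v - v')" "[y = y'] (mod int q)" "lat \<kappa> (w - w') (z - z')"
      using that unfolding a a' b b' nf_eq_iff by blast+
    have "[G w z * x + D u v * y = G w' z' * x' + D u' v' * y'] (mod int q)"
      unfolding D_lat[OF 1(2)] G_lat[OF 1(4)] by (intro cong_add cong_mult cong_refl 1)
    moreover have "lat \<kappa> (u + w + \<epsilon> * v * z - (u' + w' + \<epsilon> * v' * z')) (v + z - (v' + z'))"
    proof -
      have "int p dvd v - v'" "int p dvd z - z'" using 1 by (auto simp: lat_def)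
      then have "int p dvd \<epsilon> * ((v - v') * z + v' * (z - z'))" by (intro dvd_mult dvd_add dvd_mult2) auto
      from lat_add[OF lat_add[OF 1(2) 1(4)] lat_of_dvd[OF this]]
      show ?thesis by (simp add: algebra_simps)
    qed
    ultimately show ?thesis unfolding a a' b b' P_def by (simp add: nf_eq_iff)
  qed
  have gA: "group (add_monoid C)"
  proof (rule quotient_groupI[where nf = "nf \<kappa>" and m = A and e = "(0, 0, 0)", OF _ _ _ nf_idem A_compat])
    fix a b c :: "int \<times> int \<times> int"
    obtain x u v where a: "a = (x, u, v)" by (cases a)
    obtain y w z where b: "b = (y, w, z)" by (cases b)
    obtain k l m where c: "c = (k, l, m)" by (cases c)
    have "[T (u + w) (v + z) * k = T u v * T w z * k] (mod int q)" by (rule cong_scalar_right[OF T_add])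
    then have "[x + T u v * y + T (u + w) (v + z) * k = x + T u v * y + T u v * T w z * k] (mod int q)"
      by (rule cong_add[OF cong_refl])
    moreover have "x + T u v * y + T u v * T w z * k = x + T u v * (y + T w z * k)"
      by (simp add: algebra_simps)
    moreover have "u + w + l - (u + (w + l)) = 0" "v + z + m - (v + (z + m)) = 0" by simp_all
    ultimately show "nf \<kappa> (A (A a b) c) = nf \<kappa> (A a (A b c))"
      unfolding a b c A_def prod.case nf_eq_iff using lat_0 by (simp only:)
    show "nf \<kappa> (A (0, 0, 0) a) = nf \<kappa> a" unfolding a A_def by (simp add: T0)
    show "\<exists>b. nf \<kappa> (A b a) = nf \<kappa> (0, 0, 0)"
      unfolding a A_def by (intro exI[of _ "(- (T (- u) (- v) * x), - u, - v)"]) (simp add: nf_eq_iff lat_0)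
  qed (simp_all add: C_def)
  have gP: "group C"
  proof (rule quotient_groupI[where nf = "nf \<kappa>" and m = P and e = "(0, 0, 0)", OF _ _ _ nf_idem P_compat])
    fix a b c :: "int \<times> int \<times> int"
    obtain x u v where a: "a = (x, u, v)" by (cases a)
    obtain y w z where b: "b = (y, w, z)" by (cases b)
    obtain k l m where c: "c = (k, l, m)" by (cases c)
    have "[D (u + w + \<epsilon> * v * z) (v + z) * k = D u v * D w z * k] (mod int q)"
      "[G (w + l + \<epsilon> * z * m) (z + m) * x = G w z * G l m * x] (mod int q)"
      by (rule cong_scalar_right[OF D_mult] cong_scalar_right[OF G_mult])+
    then have "[G l m * (G w z * x + D u v * y) + D (u + w + \<epsilon> * v * z) (v + z) * k =
        G l m * (G w z * x + D u v * y) + D u v * D w z * k] (mod int q)"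
      "[G w z * G l m * x + D u v * (G l m * y + D w z * k) = G (w + l + \<epsilon> * z * m) (z + m) * x + D u v * (G l m * y + D w z * k)] (mod int q)"
      by (auto intro: cong_add cong_sym)
    moreover have "G l m * (G w z * x + D u v * y) + D u v * D w z * k = G w z * G l m * x + D u v * (G l m * y + D w z * k)"
      by (simp add: algebra_simps)
    ultimately have "[G l m * (G w z * x + D u v * y) + D (u + w + \<epsilon> * v * z) (v + z) * k =
        G (w + l + \<epsilon> * z * m) (z + m) * x + D u v * (G l m * y + D w z * k)] (mod int q)"
      unfolding cong_def by simp
    moreover have "u + w + \<epsilon> * v * z + l + \<epsilon> * (v + z) * m - (u + (w + l + \<epsilon> * z * m) + \<epsilon> * v * (z + m)) = 0"
      by (simp add: algebra_simps)
    ultimately show "nf \<kappa> (P (P a b) c) = nf \<kappa> (P a (P b c))"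
      unfolding a b c P_def prod.case nf_eq_iff using lat_0 by simp
    show "nf \<kappa> (P (0, 0, 0) a) = nf \<kappa> a" unfolding a P_def by (simp add: D0)
    show "\<exists>b. nf \<kappa> (P b a) = nf \<kappa> (0, 0, 0)"
    proof -
      \<comment> \<open>The first coordinate of the circle inverse: besides \<open>- u\<close> it
        cancels the cocycle term coming from \<open>v\<close> and \<open>- v\<close>.\<close>
      let ?u = "- u + \<epsilon> * v * v"
      have "[G u v * G ?u (- v) = 1] (mod int q)"
        using G_mult[of u ?u v "- v"] by (simp add: G0 cong_sym algebra_simps)
      then have "[G u v * G ?u (- v) * (D ?u (- v) * x) = 1 * (D ?u (- v) * x)] (mod int q)"
        by (rule cong_scalar_right)
      then have "int q dvd - (G u v * G ?u (- v) * (D ?u (- v) * x) - 1 * (D ?u (- v) * x))"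
        unfolding cong_iff_dvd_diff dvd_minus_iff .
      also have "- (G u v * G ?u (- v) * (D ?u (- v) * x) - 1 * (D ?u (- v) * x)) =
          G u v * (- (G ?u (- v) * (D ?u (- v) * x))) + D ?u (- v) * x" by (simp only: algebra_simps) simp
      finally have "[G u v * (- (G ?u (- v) * (D ?u (- v) * x))) + D ?u (- v) * x = 0] (mod int q)"
        by (simp add: cong_0_iff)
      then show ?thesis
        unfolding a P_def by (intro exI[of _ "(- (G ?u (- v) * (D ?u (- v) * x)), ?u, - v)"])
          (simp add: nf_eq_iff lat_0)
    qed
  qed (simp_all add: C_def)
  have addC: "nf \<kappa> a \<oplus>\<^bsub>C\<^esub> nf \<kappa> b = nf \<kappa> (A a b)" for a b
    using A_compat[OF nf_idem nf_idem] by (simp add: C_def)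
  have mulC: "nf \<kappa> a \<otimes>\<^bsub>C\<^esub> nf \<kappa> b = nf \<kappa> (P a b)" for a b
    using P_compat[OF nf_idem nf_idem] by (simp add: C_def)
  have negC: "\<ominus>\<^bsub>C\<^esub> nf \<kappa> (x, u, v) = nf \<kappa> (- (T (- u) (- v) * x), - u, - v)" for x u v
  proof -
    have "nf \<kappa> (- (T (- u) (- v) * x), - u, - v) \<oplus>\<^bsub>C\<^esub> nf \<kappa> (x, u, v) = \<zero>\<^bsub>C\<^esub>"
      unfolding addC by (simp add: A_def C_def)
    then show ?thesis unfolding a_inv_def
      by (intro group.inv_equality[OF gA]) (simp_all add: C_def)
  qed
  \<comment> \<open>The crossed law again, now as a sufficient condition: it is trivial for
    \<open>G = 1\<close>, and for \<open>G = T\<close> it is multiplicativity.\<close>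
  have GT: "[G (w + l) (z + m) = G w z - T w z + T w z * G l m] (mod int q)" for w z l m
  proof (cases "s = 0")
    case True
    then show ?thesis by (simp add: G_def gam_def Z_0)
  next
    case False
    then have "G = T" using s by (auto simp: G_def T_def gam_def tau_def fun_eq_iff)
    then show ?thesis using T_add by simp
  qed
  have "skew_brace C"
  proof (rule skew_brace.intro[OF gA gP])
    fix a' b' c' assume "a' \<in> carrier C" "b' \<in> carrier C" "c' \<in> carrier C"
    then obtain a b c where abc: "a' = nf \<kappa> a" "b' = nf \<kappa> b" "c' = nf \<kappa> c" by (auto simp: C_def)
    obtain x u v where a: "a = (x, u, v)" by (cases a)
    obtain y w z where b: "b = (y, w, z)" by (cases b)
    obtain k l m where c: "c = (k, l, m)" by (cases c)
    have TT: "[T (u + w + \<epsilon> * v * z) (v + z) * T (- u) (- v) = T w z] (mod int q)"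
      "T (u + w + \<epsilon> * v * z + - u) (v + z + - v) = T w z"
    proof -
      have "[T (u + w + \<epsilon> * v * z) (v + z) * T (- u) (- v) = T (u + w + \<epsilon> * v * z + - u) (v + z + - v)] (mod int q)"
        by (rule cong_sym[OF T_add])
      moreover show "T (u + w + \<epsilon> * v * z + - u) (v + z + - v) = T w z"
        using T_circ[of w v z z] by (simp add: algebra_simps)
      ultimately show "[T (u + w + \<epsilon> * v * z) (v + z) * T (- u) (- v) = T w z] (mod int q)" by simp
    qed
    have "[G (w + l) (z + m) * x + D u v * (y + T w z * k) = (G w z - T w z + T w z * G l m) * x + D u v * (y + T w z * k)] (mod int q)"
      by (intro cong_add cong_mult cong_refl GT)
    also have "(G w z - T w z + T w z * G l m) * x + D u v * (y + T w z * k) =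
        G w z * x + D u v * y - T w z * x + T w z * (G l m * x + D u v * k)" by (simp add: algebra_simps)
    also have "[\<dots> = G w z * x + D u v * y - T (u + w + \<epsilon> * v * z) (v + z) * T (- u) (- v) * x + T w z * (G l m * x + D u v * k)] (mod int q)"
      by (intro cong_add cong_diff cong_mult cong_refl cong_sym[OF TT(1)])
    finally (cong_trans) have main: "[G (w + l) (z + m) * x + D u v * (y + T w z * k) =
       G w z * x + D u v * y - T (u + w + \<epsilon> * v * z) (v + z) * T (- u) (- v) * x +
       T (u + w + \<epsilon> * v * z + - u) (v + z + - v) * (G l m * x + D u v * k)] (mod int q)" unfolding TT(2) .
    have "P a (A b c) = (G (w + l) (z + m) * x + D u v * (y + T w z * k), u + (w + l) + \<epsilon> * v * (z + m), v + (z + m))"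
      by (simp add: P_def A_def a b c)
    moreover have "A (A (P a b) (- (T (- u) (- v) * x), - u, - v)) (P a c) =
      (G w z * x + D u v * y - T (u + w + \<epsilon> * v * z) (v + z) * T (- u) (- v) * x +
       T (u + w + \<epsilon> * v * z + - u) (v + z + - v) * (G l m * x + D u v * k),
       u + w + \<epsilon> * v * z + - u + (u + l + \<epsilon> * v * m), v + z + - v + (v + m))"
      by (simp add: P_def A_def a b c mult.assoc)
    moreover have "u + (w + l) + \<epsilon> * v * (z + m) - (u + w + \<epsilon> * v * z + - u + (u + l + \<epsilon> * v * m)) = 0"
      "v + (z + m) - (v + z + - v + (v + m)) = 0" by (simp_all add: algebra_simps)
    ultimately have "nf \<kappa> (P a (A b c)) = nf \<kappa> (A (A (P a b) (- (T (- u) (- v) * x), - u, - v)) (P a c))"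
      using main lat_0 by (simp only: nf_eq_iff)
    then show "a' \<otimes>\<^bsub>C\<^esub> (b' \<oplus>\<^bsub>C\<^esub> c') = a' \<otimes>\<^bsub>C\<^esub> b' \<ominus>\<^bsub>C\<^esub> a' \<oplus>\<^bsub>C\<^esub> a' \<otimes>\<^bsub>C\<^esub> c'"
      unfolding abc a_minus_def addC mulC unfolding a negC addC .
  qed
  moreover have "card (carrier C) = p ^ 2 * q"
    by (simp add: C_def range_nf card_cartesian_product power2_eq_square)
  moreover have "realizes C d (\<lambda>x u v. nf \<kappa> (x, u, v))"
    unfolding d realizes.simps
  proof (intro conjI allI ballI nf_eq_iff)
    show "nf \<kappa> (x, u, v) \<in> carrier C" for x u v by (simp add: C_def)
    show "\<exists>x u v. b = nf \<kappa> (x, u, v)" if "b \<in> carrier C" for b using that by (auto simp: C_def)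
  qed (simp_all add: addC mulC A_def P_def T_def D_def G_def)
  ultimately show thesis by (rule that)
qed

section \<open>Isomorphism classes as classes of exponents\<close>

lemma realizes_iso:
  assumes r: "realizes B d ev" and r': "realizes C d ev'"
  shows "brace_isomorphic B C"
proof -
  obtain \<kappa> \<epsilon> s t1 t2 d1 d2 where d: "d = (\<kappa>, \<epsilon>, s, t1, t2, d1, d2)" by (cases d)
  note r = r[unfolded d] and r' = r'[unfolded d]
  \<comment> \<open>An arbitrary choice of coordinates for \<open>b\<close> is harmless, because
    \<open>ev\<close> and \<open>ev'\<close> identify exactly the same triples.\<close>
  define h where "h b = (case SOME t. b = (case t of (x, u, v) \<Rightarrow> ev x u v) of (x, u, v) \<Rightarrow> ev' x u v)" for b
  have h: "h (ev x u v) = ev' x u v" for x u v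
  proof -
    have "\<exists>t. ev x u v = (case t of (x, u, v) \<Rightarrow> ev x u v)" by (intro exI[of _ "(x, u, v)"]) simp
    from someI_ex[OF this] obtain x' u' v' where
      t: "(SOME t. ev x u v = (case t of (x, u, v) \<Rightarrow> ev x u v)) = (x', u', v')" "ev x u v = ev x' u' v'"
      by (cases "SOME t. ev x u v = (case t of (x, u, v) \<Rightarrow> ev x u v)") auto
    have "ev' x u v = ev' x' u' v'" using t(2) unfolding realizes_ker[OF r] realizes_ker[OF r'] .
    then show ?thesis by (simp add: h_def t(1))
  qed
  have bij: "bij_betw h (carrier B) (carrier C)"
    unfolding bij_betw_def
  proof (intro conjI inj_onI equalityI subsetI)
    fix b b' assume "b \<in> carrier B" "b' \<in> carrier B" "h b = h b'"
    then obtain x u v x' u' v' where "b = ev x u v" "b' = ev x' u' v'" "ev' x u v = ev' x' u' v'"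
      using realizes_surj[OF r] h by metis
    then show "b = b'" unfolding realizes_ker[OF r'] by (simp add: realizes_ker[OF r])
  next
    fix c assume "c \<in> carrier C"
    then obtain x u v where "c = ev' x u v" using realizes_surj[OF r'] by blast
    then show "c \<in> h ` carrier B" using h realizes_closed[OF r] by (metis imageI)
  next
    fix c assume "c \<in> h ` carrier B"
    then obtain b where "b \<in> carrier B" "c = h b" by blast
    then obtain x u v where "c = h (ev x u v)" using realizes_surj[OF r] by blast
    then show "c \<in> carrier C" using h realizes_closed[OF r'] by simp
  qed
  have "h (a \<oplus>\<^bsub>B\<^esub> b) = h a \<oplus>\<^bsub>C\<^esub> h b \<and> h (a \<otimes>\<^bsub>B\<^esub> b) = h a \<otimes>\<^bsub>C\<^esub> h b"
    if aB: "a \<in> carrier B" and bB: "b \<in> carrier B" for a b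
  proof -
    obtain x u v where a: "a = ev x u v" using realizes_surj[OF r aB] by blast
    obtain x' u' v' where b: "b = ev x' u' v'" using realizes_surj[OF r bB] by blast
    show ?thesis unfolding a b h
      unfolding realizes_add[OF r] realizes_add[OF r'] realizes_mult[OF r] realizes_mult[OF r'] h by simp
  qed
  then have "h \<in> brace_iso B C"
    using bij by (auto simp: brace_iso_def iso_def hom_def bij_betw_def)
  then show ?thesis by (auto simp: brace_isomorphic_def)
qed

lemma iso_realizes:
  assumes r: "realizes B d ev" and h: "h \<in> brace_iso B C"
  shows "realizes C d (\<lambda>x u v. h (ev x u v))"
proof -
  obtain \<kappa> \<epsilon> s t1 t2 d1 d2 where d: "d = (\<kappa>, \<epsilon>, s, t1, t2, d1, d2)" by (cases d)
  note r = r[unfolded d]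
  have bij: "bij_betw h (carrier B) (carrier C)"
    and ha: "\<And>a b. a \<in> carrier B \<Longrightarrow> b \<in> carrier B \<Longrightarrow> h (a \<oplus>\<^bsub>B\<^esub> b) = h a \<oplus>\<^bsub>C\<^esub> h b"
    and hm: "\<And>a b. a \<in> carrier B \<Longrightarrow> b \<in> carrier B \<Longrightarrow> h (a \<otimes>\<^bsub>B\<^esub> b) = h a \<otimes>\<^bsub>C\<^esub> h b"
    using h by (auto simp: brace_iso_def iso_def hom_def)
  note cl = realizes_closed[OF r]
  show ?thesis unfolding d realizes.simps
  proof (intro conjI allI ballI)
    fix x u v x' u' v'
    show "h (ev x u v) \<in> carrier C" using bij cl by (auto simp: bij_betw_def)
    have "h (ev x u v) = h (ev x' u' v') \<longleftrightarrow> ev x u v = ev x' u' v'"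
      using bij cl by (auto simp: bij_betw_def inj_on_def)
    then show "h (ev x u v) = h (ev x' u' v') \<longleftrightarrow> [x = x'] (mod int q) \<and> lat \<kappa> (u - u') (v - v')"
      unfolding realizes_ker[OF r] .
    show "h (ev x u v) \<oplus>\<^bsub>C\<^esub> h (ev x' u' v') = h (ev (x + tau t1 t2 u v * x') (u + u') (v + v'))"
      unfolding ha[OF cl cl, symmetric] realizes_add[OF r] ..
    show "h (ev x u v) \<otimes>\<^bsub>C\<^esub> h (ev x' u' v') =
      h (ev (gam s t1 t2 u' v' * x + del \<epsilon> d1 d2 u v * x') (u + u' + \<epsilon> * v * v') (v + v'))"
      unfolding hm[OF cl cl, symmetric] realizes_mult[OF r] ..
  next
    fix c assume "c \<in> carrier C"
    then have "c \<in> h ` carrier B" using bij by (simp add: bij_betw_def)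
    then obtain b where "b \<in> carrier B" "c = h b" by blast
    then show "\<exists>x u v. c = h (ev x u v)" using realizes_surj[OF r] by blast
  qed
qed

text \<open>Every brace realizes some valid data, braces realizing the same data are isomorphic, and
  data realized by one brace are related; so \<open>\<phi>\<close> matches representatives with
  isomorphism classes. Its values are nonempty because \<open>skew_brace_representative\<close>
  moves the model from integer triples to the carrier \<open>{..<n}\<close>.\<close>

lemma num_skew_braces_eq_card:
  assumes valid: "\<And>d. d \<in> D \<Longrightarrow> valid d"
    and ex: "\<And>d. valid d \<Longrightarrow> \<exists>d'\<in>D. (\<lambda>d d'. valid d \<and> rel d d')\<^sup>*\<^sup>* d d'"
    and unique: "\<And>d d'. d \<in> D \<Longrightarrow> d' \<in> D \<Longrightarrow> rel d d' \<Longrightarrow> d = d'"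
  shows "num_skew_braces (p ^ 2 * q) = card D"
proof -
  let ?n = "p ^ 2 * q"
  let ?S = "skew_braces_of_size ?n" and ?R = "brace_iso_rel ?n"
  define \<phi> where "\<phi> d = {B \<in> ?S. \<exists>ev. realizes B d ev}" for d
  have reach: "\<exists>ev. realizes B d' ev" if "(\<lambda>d d'. valid d \<and> rel d d')\<^sup>*\<^sup>* d d'" "realizes B d ev" for B :: "nat ring" and d d' ev
    using that(1)
  proof (induction rule: rtranclp_induct)
    case base
    then show ?case using that(2) by blast
  next
    case (step y z)
    then show ?case using realizes_rel by metis
  qed
  have cls: "\<phi> d = ?R `` {B}" if B: "B \<in> \<phi> d" for B d
  proof (intro equalityI subsetI)
    fix C assume C: "C \<in> \<phi> d"
    then obtain ev ev' where "realizes B d ev" "realizes C d ev'" using B unfolding \<phi>_def by blast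
    then have "brace_isomorphic B C" by (rule realizes_iso)
    then show "C \<in> ?R `` {B}" using B C unfolding \<phi>_def brace_iso_rel_def by blast
  next
    fix C assume "C \<in> ?R `` {B}"
    then have C: "C \<in> ?S" "brace_isomorphic B C" by (auto simp: brace_iso_rel_def)
    then obtain h where h: "h \<in> brace_iso B C" by (auto simp: brace_isomorphic_def)
    obtain ev where "realizes B d ev" using B unfolding \<phi>_def by blast
    then have "realizes C d (\<lambda>x u v. h (ev x u v))" using h by (rule iso_realizes)
    then show "C \<in> \<phi> d" using C unfolding \<phi>_def by blast
  qed
  have nonempty: "\<exists>B. B \<in> \<phi> d" if d: "d \<in> D" for d
  proof -
    obtain C :: "(int \<times> int \<times> int) ring" and ev where C: "skew_brace C" "card (carrier C) = ?n" "realizes C d ev"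
      using model_exists[OF valid[OF d]] .
    have "?n > 0" using prime_gt_0_nat[OF p] prime_gt_0_nat[OF q] by simp
    then have "finite (carrier C)" using C(2) by (metis card.infinite less_irrefl)
    from skew_brace_representative[OF C(1) this] obtain B where B: "B \<in> ?S" "brace_isomorphic C B"
      unfolding C(2) by blast
    then obtain h where "h \<in> brace_iso C B" by (auto simp: brace_isomorphic_def)
    then have "realizes B d (\<lambda>x u v. h (ev x u v))" by (rule iso_realizes[OF C(3)])
    then show ?thesis using B unfolding \<phi>_def by blast
  qed
  have "bij_betw \<phi> D (?S // ?R)"
    unfolding bij_betw_def
  proof (intro conjI inj_onI equalityI subsetI)
    fix d d' assume d: "d \<in> D" "d' \<in> D" "\<phi> d = \<phi> d'"
    then obtain B where "B \<in> \<phi> d" "B \<in> \<phi> d'" using nonempty by blast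
    then obtain ev ev' where "realizes B d ev" "realizes B d' ev'" by (auto simp: \<phi>_def)
    then have "rel d d'" by (rule realizes_unique[OF _ valid[OF d(1)] _ valid[OF d(2)]])
    then show "d = d'" by (rule unique[OF d(1,2)])
  next
    fix X assume "X \<in> \<phi> ` D"
    then obtain d where d: "d \<in> D" "X = \<phi> d" by blast
    then obtain B where B: "B \<in> \<phi> d" using nonempty by blast
    then have "B \<in> ?S" by (simp add: \<phi>_def)
    then show "X \<in> ?S // ?R" using cls[OF B] d by (auto simp: quotient_def)
  next
    fix X assume "X \<in> ?S // ?R"
    then obtain B where B: "B \<in> ?S" "X = ?R `` {B}" by (auto simp: quotient_def)
    then have "skew_brace B" "card (carrier B) = ?n" by (auto simp: skew_braces_of_size_def)
    then obtain d0 ev where d0: "valid d0" "realizes B d0 ev" using realizes_presentation by blast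
    obtain d where d: "d \<in> D" "(\<lambda>d d'. valid d \<and> rel d d')\<^sup>*\<^sup>* d0 d" using ex[OF d0(1)] by blast
    then have "B \<in> \<phi> d" using reach[OF d(2) d0(2)] B by (simp add: \<phi>_def)
    then show "X \<in> \<phi> ` D" using cls B d by blast
  qed
  then show ?thesis unfolding num_skew_braces_def by (simp add: bij_betw_same_card)
qed

end

section \<open>Counting orbits\<close>

type_synonym quad = "int \<times> int \<times> int \<times> int"

context brace_params
begin

fun qvalid :: "int \<Rightarrow> int \<Rightarrow> quad \<Rightarrow> bool"
  where "qvalid \<kappa> \<epsilon> (t1, t2, d1, d2) \<longleftrightarrow>
    [int p * t1 = 0] (mod int M) \<and> [int p * t2 = \<kappa> * t1] (mod int M) \<and> [\<epsilon> * t1 = 0] (mod int M) \<and>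
    [int p * d1 = 0] (mod int M) \<and> [int p * d2 = (\<kappa> + \<epsilon> * tri (int p)) * d1] (mod int M)"

fun tau_trivial :: "quad \<Rightarrow> bool"
  where "tau_trivial (t1, t2, d1, d2) \<longleftrightarrow> [t1 = 0] (mod int M) \<and> [t2 = 0] (mod int M)"

text \<open>
  The modulus \<open>m\<close> is \<open>M\<close>, or \<open>p\<close> after dividing \<open>p\<close>-torsion exponents by \<open>M div p\<close>.
\<close>
fun qrel :: "nat \<Rightarrow> int \<Rightarrow> int \<Rightarrow> quad \<Rightarrow> quad \<Rightarrow> bool"
  where "qrel m \<kappa> \<epsilon> (t1, t2, d1, d2) (t1', t2', d1', d2') \<longleftrightarrow>
    (\<exists>a b c f. (\<kappa> = 1 \<or> \<epsilon> = 1 \<longrightarrow> f = 0) \<and>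
      [\<kappa> * a = \<kappa> * c] (mod int p) \<and> [\<epsilon> * a ^ 2 = \<epsilon> * c] (mod int p) \<and> \<not> int p dvd a * c - b * f \<and>
      [t1' = t1 * c + t2 * f] (mod int m) \<and> [t2' = t1 * b + t2 * a] (mod int m) \<and>
      [d1' = d1 * c + d2 * f] (mod int m) \<and> [d2' = d1 * (b - \<epsilon> * tri a) + d2 * a] (mod int m))"

declare qvalid.simps [simp del] tau_trivial.simps [simp del] qrel.simps [simp del]

lemma valid_iff: "valid (\<kappa>, \<epsilon>, s, w) \<longleftrightarrow>
    \<kappa> \<in> {0, 1} \<and> \<epsilon> \<in> {0, 1} \<and> s \<in> {0, 1} \<and> qvalid \<kappa> \<epsilon> w \<and> (s = 1 \<longrightarrow> \<not> tau_trivial w)"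
  by (cases w) (auto simp: valid.simps qvalid.simps tau_trivial.simps)

lemma rel_iff: "rel (\<kappa>, \<epsilon>, s, w) (\<kappa>', \<epsilon>', s', w') \<longleftrightarrow> \<kappa>' = \<kappa> \<and> \<epsilon>' = \<epsilon> \<and> s' = s \<and> qrel M \<kappa> \<epsilon> w w'"
  by (cases w; cases w') (simp add: rel.simps qrel.simps)

lemma dvd_M_of_p: "[int p * d = 0] (mod int M) \<Longrightarrow> int p dvd x \<Longrightarrow> int M dvd x * d"
  using M_dvd_of_p by (simp add: mult.commute)

text \<open>\<open>valid\<close> and \<open>rel\<close> come from one geometric situation, but their
  compatibility is pure arithmetic here: it keeps a whole chain of \<open>qrel\<close> steps valid
  once its start is, with the same answer to whether \<open>\<tau>\<close> is trivial.\<close>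

lemma qvalid_qrel:
  assumes v: "qvalid \<kappa> \<epsilon> w" and r: "qrel M \<kappa> \<epsilon> w w'" and \<kappa>: "\<kappa> \<in> {0, 1}" and \<epsilon>: "\<epsilon> \<in> {0, 1}"
  shows "qvalid \<kappa> \<epsilon> w'" "tau_trivial w' \<longleftrightarrow> tau_trivial w"
proof -
  obtain t1 t2 d1 d2 where w: "w = (t1, t2, d1, d2)" by (cases w)
  obtain t1' t2' d1' d2' where w': "w' = (t1', t2', d1', d2')" by (cases w')
  have v1: "int M dvd int p * t1" and v2: "int M dvd int p * t2 - \<kappa> * t1" and v3: "int M dvd \<epsilon> * t1"
    and v4: "int M dvd int p * d1" and v5: "int M dvd int p * d2 - (\<kappa> + \<epsilon> * tri (int p)) * d1"
    using v unfolding w qvalid.simps by (simp_all add: cong_iff_dvd_diff)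
  obtain a b c f where f: "\<kappa> = 1 \<or> \<epsilon> = 1 \<longrightarrow> f = 0" and ka: "int p dvd \<kappa> * a - \<kappa> * c"
    and ea: "int p dvd \<epsilon> * a ^ 2 - \<epsilon> * c" and det: "\<not> int p dvd a * c - b * f"
    and t1': "int M dvd t1' - (t1 * c + t2 * f)" and t2': "int M dvd t2' - (t1 * b + t2 * a)"
    and d1': "int M dvd d1' - (d1 * c + d2 * f)" and d2': "int M dvd d2' - (d1 * (b - \<epsilon> * tri a) + d2 * a)"
    using r unfolding w w' qrel.simps cong_iff_dvd_diff by blast
  have kf: "\<kappa> * f = 0" and ef: "\<epsilon> * f = 0" using f \<kappa> \<epsilon> by auto
  have pM: "int M dvd x * t1" "int M dvd x * d1" if x: "int p dvd x" for x
  proof -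
    obtain k where k: "x = int p * k" using x by (rule dvdE)
    have "x * t1 = k * (int p * t1)" "x * d1 = k * (int p * d1)" unfolding k by simp_all
    then show "int M dvd x * t1" "int M dvd x * d1" using v1 v4 by (simp_all only: dvd_mult)
  qed
  note kt = pM(1)[OF ka] and ke = pM(2)[OF ka]
  have q1: "int M dvd int p * t1'"
  proof -
    \<comment> \<open>The defect of the new exponents as an explicit integer combination of old
      defects, of the congruences in \<open>qrel\<close>, and of terms containing
      \<open>\<kappa> * f\<close> or \<open>\<epsilon> * f\<close>, which are 0. The next four
      identities have the same shape.\<close>
    have eq: "int p * t1' = int p * (t1' - (t1 * c + t2 * f)) + (int p * t1) * c + (int p * t2 - \<kappa> * t1) * f + \<kappa> * f * t1"
      by (simp add: algebra_simps)
    show ?thesis unfolding eq kf ef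
      by (intro dvd_add dvd_diff; (fact | rule dvd_mult2, fact | rule dvd_mult, fact | simp))
  qed
  have q2: "int M dvd int p * t2' - \<kappa> * t1'"
  proof -
    have eq: "int p * t2' - \<kappa> * t1' = int p * (t2' - (t1 * b + t2 * a)) - \<kappa> * (t1' - (t1 * c + t2 * f))
        + (int p * t1) * b + (int p * t2 - \<kappa> * t1) * a + (\<kappa> * a - \<kappa> * c) * t1 - \<kappa> * f * t2"
      by (simp add: algebra_simps)
    show ?thesis unfolding eq kf ef
      by (intro dvd_add dvd_diff; (fact | rule dvd_mult2, fact | rule dvd_mult, fact | simp))
  qed
  have q3: "int M dvd \<epsilon> * t1'"
  proof -
    have eq: "\<epsilon> * t1' = \<epsilon> * (t1' - (t1 * c + t2 * f)) + (\<epsilon> * t1) * c + \<epsilon> * f * t2" by (simp add: algebra_simps)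
    show ?thesis unfolding eq kf ef
      by (intro dvd_add dvd_diff; (fact | rule dvd_mult2, fact | rule dvd_mult, fact | simp))
  qed
  have q4: "int M dvd int p * d1'"
  proof -
    have eq: "int p * d1' = int p * (d1' - (d1 * c + d2 * f)) + (int p * d1) * c + (int p * d2 - (\<kappa> + \<epsilon> * tri (int p)) * d1) * f
        + (\<kappa> * f) * d1 + (\<epsilon> * f) * (tri (int p) * d1)"
      by (simp add: algebra_simps)
    show ?thesis unfolding eq kf ef
      by (intro dvd_add dvd_diff; (fact | rule dvd_mult2, fact | rule dvd_mult, fact | simp))
  qed
  \<comment> \<open>\<open>\<epsilon> a^2\<close> and \<open>\<epsilon> c\<close> agree modulo
    \<open>p\<close>, so it suffices to treat \<open>a - a^2\<close>, which is
    \<open>- 2 tri a\<close>; multiplied by \<open>tri p\<close> it contains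
    \<open>2 tri p = p (p - 1)\<close>.\<close>
  have etri: "int p dvd \<epsilon> * tri (int p) * (a - c)"
  proof -
    have "tri (int p) * (2 * tri a) = (2 * tri (int p)) * tri a" by simp
    also have "\<dots> = int p * ((int p - 1) * tri a)" unfolding two_tri by simp
    finally have "tri (int p) * (2 * tri a) = int p * ((int p - 1) * tri a)" .
    moreover have "a - a ^ 2 = - (2 * tri a)" unfolding two_tri by (simp add: power2_eq_square algebra_simps)
    ultimately have "tri (int p) * (a - a ^ 2) = int p * (- ((int p - 1) * tri a))"
      by (simp only: mult_minus_right)
    then have e1: "tri (int p) * (a - a ^ 2) = int p * (- ((int p - 1) * tri a))" .
    have "\<epsilon> * tri (int p) * (a - c) = \<epsilon> * (tri (int p) * (a - a ^ 2)) + tri (int p) * (\<epsilon> * a ^ 2 - \<epsilon> * c)"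
      by (simp add: algebra_simps)
    also have "int p dvd \<dots>" unfolding e1 by (rule dvd_add[OF dvd_mult[OF dvd_triv_left] dvd_mult[OF ea]])
    finally show ?thesis .
  qed
  note ketri = pM(2)[OF etri]
  have q5: "int M dvd int p * d2' - (\<kappa> + \<epsilon> * tri (int p)) * d1'"
  proof -
    have eq: "int p * d2' - (\<kappa> + \<epsilon> * tri (int p)) * d1' =
        int p * (d2' - (d1 * (b - \<epsilon> * tri a) + d2 * a)) - (\<kappa> + \<epsilon> * tri (int p)) * (d1' - (d1 * c + d2 * f))
        + (int p * d1) * (b - \<epsilon> * tri a) + (int p * d2 - (\<kappa> + \<epsilon> * tri (int p)) * d1) * a
        + (\<kappa> * a - \<kappa> * c) * d1 + \<epsilon> * tri (int p) * (a - c) * d1 - (\<kappa> * f) * d2 - (\<epsilon> * f) * (tri (int p) * d2)"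
      by (simp add: algebra_simps)
    show ?thesis unfolding eq kf ef
      by (intro dvd_add dvd_diff; (fact | rule dvd_mult2, fact | rule dvd_mult, fact | simp))
  qed
  show "qvalid \<kappa> \<epsilon> w'" unfolding w' qvalid.simps using q1 q2 q3 q4 q5 by (simp add: cong_iff_dvd_diff)
  show "tau_trivial w' \<longleftrightarrow> tau_trivial w"
  proof
    assume "tau_trivial w"
    then have "int M dvd t1" "int M dvd t2" unfolding w tau_trivial.simps cong_0_iff by auto
    then have s: "int M dvd t1 * c + t2 * f" "int M dvd t1 * b + t2 * a" by simp_all
    have "int M dvd (t1' - (t1 * c + t2 * f)) + (t1 * c + t2 * f)" "int M dvd (t2' - (t1 * b + t2 * a)) + (t1 * b + t2 * a)"
      by (rule dvd_add[OF t1' s(1)], rule dvd_add[OF t2' s(2)])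
    then show "tau_trivial w'" unfolding w' tau_trivial.simps cong_0_iff by simp
  next
    assume "tau_trivial w'"
    then have t: "int M dvd t1'" "int M dvd t2'" unfolding w' tau_trivial.simps cong_0_iff by auto
    \<comment> \<open>The adjugate matrix recovers \<open>t1\<close> and \<open>t2\<close> up to the
      determinant, which is prime to \<open>M\<close>.\<close>
    have "int M dvd t1' - (t1' - (t1 * c + t2 * f))" "int M dvd t2' - (t2' - (t1 * b + t2 * a))"
      by (rule dvd_diff[OF t(1) t1'] dvd_diff[OF t(2) t2'])+
    then have s: "int M dvd t1 * c + t2 * f" "int M dvd t1 * b + t2 * a" by simp_all
    have "int M dvd a * (t1 * c + t2 * f) - f * (t1 * b + t2 * a)" "int M dvd c * (t1 * b + t2 * a) - b * (t1 * c + t2 * f)"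
      using s by (auto intro!: dvd_diff dvd_mult)
    then have "int M dvd (a * c - b * f) * t1" "int M dvd (a * c - b * f) * t2" by (simp_all add: algebra_simps)
    moreover have "coprime (int M) (a * c - b * f)"
    proof -
      have "coprime (int p ^ 2) (a * c - b * f)" using prime_imp_coprime[OF prime_int_p det] by simp
      moreover have "int M dvd int p ^ 2" using M_dvd by (metis of_nat_dvd_iff of_nat_power)
      ultimately show ?thesis by (meson coprime_divisors dvd_refl)
    qed
    ultimately show "tau_trivial w" unfolding w tau_trivial.simps cong_0_iff by (simp add: coprime_dvd_mult_right_iff)
  qed
qed

text \<open>
  Existence of representatives only needs chains of \<open>qrel\<close> steps, which lets the normal forms be
  reached by successive reductions; distinctness is only needed for single steps, as isomorphic
  braces are related by one.
\<close>
definition transversal :: "int \<Rightarrow> int \<Rightarrow> quad set \<Rightarrow> quad set \<Rightarrow> bool"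
  where "transversal \<kappa> \<epsilon> N0 N1 \<longleftrightarrow> finite N0 \<and> finite N1 \<and> (\<forall>w\<in>N0 \<union> N1. qvalid \<kappa> \<epsilon> w) \<and>
    (\<forall>w\<in>N0. tau_trivial w) \<and> (\<forall>w\<in>N1. \<not> tau_trivial w) \<and>
    (\<forall>w. qvalid \<kappa> \<epsilon> w \<longrightarrow> (\<exists>w'\<in>N0 \<union> N1. (qrel M \<kappa> \<epsilon>)\<^sup>*\<^sup>* w w')) \<and>
    (\<forall>w\<in>N0 \<union> N1. \<forall>w'\<in>N0 \<union> N1. qrel M \<kappa> \<epsilon> w w' \<longrightarrow> w = w')"

text \<open>The weight \<open>2\<close> accounts for \<open>s \<in> {0, 1}\<close>, as \<open>valid\<close> forces \<open>s = 0\<close> when \<open>\<tau>\<close> is trivial.\<close>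
definition num_classes :: "int \<Rightarrow> int \<Rightarrow> nat \<Rightarrow> bool"
  where "num_classes \<kappa> \<epsilon> n \<longleftrightarrow> (\<exists>N0 N1. transversal \<kappa> \<epsilon> N0 N1 \<and> card N0 + 2 * card N1 = n)"

lemma num_skew_braces_sum:
  assumes "num_classes 0 0 n00" "num_classes 0 1 n01" "num_classes 1 0 n10" "num_classes 1 1 n11"
  shows "num_skew_braces (p ^ 2 * q) = n00 + n01 + n10 + n11"
proof -
  have "\<forall>k\<in>{0, 1} \<times> {0, 1}. \<exists>N. transversal (fst k) (snd k) (fst N) (snd N) \<and>
      card (fst N) + 2 * card (snd N) = (if fst k = 0 then if snd k = 0 then n00 else n01 else if snd k = 0 then n10 else n11)"
    using assms unfolding num_classes_def by auto
  from bchoice[OF this] obtain N where N: "\<And>\<kappa> \<epsilon>. \<kappa> \<in> {0, 1} \<Longrightarrow> \<epsilon> \<in> {0, 1} \<Longrightarrow>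
      transversal \<kappa> \<epsilon> (fst (N (\<kappa>, \<epsilon>))) (snd (N (\<kappa>, \<epsilon>)))"
    and cN: "\<And>\<kappa> \<epsilon>. \<kappa> \<in> {0, 1} \<Longrightarrow> \<epsilon> \<in> {0, 1} \<Longrightarrow> card (fst (N (\<kappa>, \<epsilon>))) + 2 * card (snd (N (\<kappa>, \<epsilon>))) =
      (if \<kappa> = 0 then if \<epsilon> = 0 then n00 else n01 else if \<epsilon> = 0 then n10 else n11)" by force
  define N0 where "N0 \<kappa> \<epsilon> = fst (N (\<kappa>, \<epsilon>))" for \<kappa> \<epsilon>
  define N1 where "N1 \<kappa> \<epsilon> = snd (N (\<kappa>, \<epsilon>))" for \<kappa> \<epsilon>
  have tr: "transversal \<kappa> \<epsilon> (N0 \<kappa> \<epsilon>) (N1 \<kappa> \<epsilon>)" if "\<kappa> \<in> {0, 1}" "\<epsilon> \<in> {0, 1}" for \<kappa> \<epsilon>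
    unfolding N0_def N1_def by (rule N[OF that])
  define E where "E \<kappa> \<epsilon> = ({0::int} \<times> (N0 \<kappa> \<epsilon> \<union> N1 \<kappa> \<epsilon>)) \<union> ({1} \<times> N1 \<kappa> \<epsilon>)" for \<kappa> \<epsilon>
  have cE: "finite (E \<kappa> \<epsilon>)" "card (E \<kappa> \<epsilon>) = card (N0 \<kappa> \<epsilon>) + 2 * card (N1 \<kappa> \<epsilon>)"
    if k: "\<kappa> \<in> {0, 1}" "\<epsilon> \<in> {0, 1}" for \<kappa> \<epsilon>
  proof -
    have f: "finite (N0 \<kappa> \<epsilon>)" "finite (N1 \<kappa> \<epsilon>)" and d: "N0 \<kappa> \<epsilon> \<inter> N1 \<kappa> \<epsilon> = {}"
      using tr[OF k] unfolding transversal_def by auto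
    show "finite (E \<kappa> \<epsilon>)" using f by (simp add: E_def)
    have "card (E \<kappa> \<epsilon>) = card ({0::int} \<times> (N0 \<kappa> \<epsilon> \<union> N1 \<kappa> \<epsilon>)) + card ({1::int} \<times> N1 \<kappa> \<epsilon>)"
      unfolding E_def by (rule card_Un_disjoint) (use f in auto)
    then show "card (E \<kappa> \<epsilon>) = card (N0 \<kappa> \<epsilon>) + 2 * card (N1 \<kappa> \<epsilon>)"
      using card_Un_disjoint[OF f d] by (simp add: card_cartesian_product)
  qed
  define D where "D = (SIGMA \<kappa>:{0::int, 1}. SIGMA \<epsilon>:{0::int, 1}. E \<kappa> \<epsilon>)"
  have "card D = (\<Sum>\<kappa>\<in>{0::int, 1}. \<Sum>\<epsilon>\<in>{0::int, 1}. card (E \<kappa> \<epsilon>))"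
    unfolding D_def using cE(1) by (subst card_SigmaI) (auto intro!: sum.cong card_SigmaI)
  also have "\<dots> = n00 + n01 + n10 + n11"
    using cE(2) cN unfolding N0_def N1_def by simp
  finally have "card D = n00 + n01 + n10 + n11" .
  moreover have "num_skew_braces (p ^ 2 * q) = card D"
  proof (rule num_skew_braces_eq_card)
    fix d assume "d \<in> D"
    then obtain \<kappa> \<epsilon> s w where d: "d = (\<kappa>, \<epsilon>, s, w)" "\<kappa> \<in> {0, 1}" "\<epsilon> \<in> {0, 1}" "(s, w) \<in> E \<kappa> \<epsilon>"
      by (auto simp: D_def)
    then show "valid d" using tr[OF d(2,3)] unfolding transversal_def by (auto simp: valid_iff E_def)
  next
    fix d assume v: "valid d"
    obtain \<kappa> \<epsilon> s w where d: "d = (\<kappa>, \<epsilon>, s, w)" by (cases d)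
    have k: "\<kappa> \<in> {0, 1}" "\<epsilon> \<in> {0, 1}" "s \<in> {0, 1}" and qv: "qvalid \<kappa> \<epsilon> w" and "s = 1 \<Longrightarrow> \<not> tau_trivial w"
      using v unfolding d valid_iff by blast+
    obtain w' where w': "w' \<in> N0 \<kappa> \<epsilon> \<union> N1 \<kappa> \<epsilon>" "(qrel M \<kappa> \<epsilon>)\<^sup>*\<^sup>* w w'"
      using tr[OF k(1,2)] qv unfolding transversal_def by blast
    \<comment> \<open>Validity is carried along the chain by induction, since each step of the
      stronger relation asks for a valid source.\<close>
    have "(\<lambda>d d'. valid d \<and> rel d d')\<^sup>*\<^sup>* (\<kappa>, \<epsilon>, s, w) (\<kappa>, \<epsilon>, s, w') \<and> valid (\<kappa>, \<epsilon>, s, w')"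
      using w'(2)
    proof (induction rule: rtranclp_induct)
      case base
      then show ?case using v d by simp
    next
      case (step y z)
      then have y: "valid (\<kappa>, \<epsilon>, s, y)" "qvalid \<kappa> \<epsilon> y" by (auto simp: valid_iff)
      have "valid (\<kappa>, \<epsilon>, s, z)"
        using y qvalid_qrel[OF y(2) step(2) k(1,2)] by (simp add: valid_iff)
      moreover have "rel (\<kappa>, \<epsilon>, s, y) (\<kappa>, \<epsilon>, s, z)" using step(2) by (simp add: rel_iff)
      ultimately show ?case using step(3) y rtranclp.rtrancl_into_rtrancl[of "\<lambda>d d'. valid d \<and> rel d d'"] by blast
    qed
    moreover from this have "(\<kappa>, \<epsilon>, s, w') \<in> D"
      using w'(1) k tr[OF k(1,2)] unfolding D_def E_def transversal_def valid_iff by auto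
    ultimately show "\<exists>d'\<in>D. (\<lambda>d d'. valid d \<and> rel d d')\<^sup>*\<^sup>* d d'" unfolding d by blast
  next
    fix d d' assume dd: "d \<in> D" "d' \<in> D" and r: "rel d d'"
    obtain \<kappa> \<epsilon> s w where d: "d = (\<kappa>, \<epsilon>, s, w)" "\<kappa> \<in> {0, 1}" "\<epsilon> \<in> {0, 1}" "(s, w) \<in> E \<kappa> \<epsilon>"
      using dd(1) by (auto simp: D_def)
    obtain \<kappa>' \<epsilon>' s' w' where d': "d' = (\<kappa>', \<epsilon>', s', w')" "(s', w') \<in> E \<kappa>' \<epsilon>'"
      using dd(2) by (auto simp: D_def)
    have e: "\<kappa>' = \<kappa>" "\<epsilon>' = \<epsilon>" "s' = s" "qrel M \<kappa> \<epsilon> w w'" using r unfolding d d' rel_iff by blast+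
    have "w \<in> N0 \<kappa> \<epsilon> \<union> N1 \<kappa> \<epsilon>" "w' \<in> N0 \<kappa> \<epsilon> \<union> N1 \<kappa> \<epsilon>" using d(4) d'(2) e by (auto simp: E_def)
    then have "w = w'" using tr[OF d(2,3)] e(4) unfolding transversal_def by blast
    then show "d = d'" using d d' e by simp
  qed
  ultimately show ?thesis by simp
qed

section \<open>Representatives for exponents modulo M\<close>

lemma qrel_of_cong:
  assumes "[t1' = t1] (mod int m)" "[t2' = t2] (mod int m)" "[d1' = d1] (mod int m)" "[d2' = d2] (mod int m)"
  shows "qrel m \<kappa> \<epsilon> (t1, t2, d1, d2) (t1', t2', d1', d2')"
  unfolding qrel.simps
  by (intro exI[of _ 1] exI[of _ 0] exI[of _ 1] exI[of _ 0]) (use assms p_gt in auto)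

lemma num_classes_trivial:
  assumes "M = 1"
  shows "num_classes \<kappa> \<epsilon> 1"
  unfolding num_classes_def
proof (intro exI conjI)
  have one: "[x = y] (mod int M)" for x y using assms by simp
  show "transversal \<kappa> \<epsilon> {(0, 0, 0, 0)} {}"
    unfolding transversal_def
  proof (intro conjI allI impI)
    fix w
    have "qrel M \<kappa> \<epsilon> w (0, 0, 0, 0)" by (cases w) (auto intro!: qrel_of_cong one)
    then show "\<exists>w'\<in>{(0, 0, 0, 0)} \<union> {}. (qrel M \<kappa> \<epsilon>)\<^sup>*\<^sup>* w w'" by auto
  qed (auto simp: qvalid.simps tau_trivial.simps one)
qed simp

lemma not_dvd_range: "x \<in> {1..<int p} \<Longrightarrow> \<not> int p dvd x"
  using zdvd_imp_le[of "int p" x] by auto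

lemma cong_range: "[x = y] (mod int p) \<Longrightarrow> x \<in> {0..<int p} \<Longrightarrow> y \<in> {0..<int p} \<Longrightarrow> x = y"
  by (simp add: cong_def)

lemma mod_range: "x mod int p \<in> {0..<int p}" using p_gt by simp

lemma mod_range_pos:
  assumes "\<not> int p dvd x"
  shows "x mod int p \<in> {1..<int p}"
proof -
  have "x mod int p \<noteq> 0" using assms by (simp add: dvd_eq_mod_eq_0)
  then show ?thesis using mod_range[of x] unfolding atLeastLessThan_iff by linarith
qed

lemma range_split: "{0..<int p} = insert 0 {1..<int p}"
  using p_gt by auto

text \<open>Representatives of the exponents modulo \<open>M\<close> under multiplication by \<open>y\<close> with \<open>y \<equiv> 1\<close> modulo \<open>p\<close>.\<close>
definition unit_reps :: "int set"
  where "unit_reps = (if M = p then {0..<int p} else (\<lambda>k. int p * k) ` {0..<int p} \<union> {1..<int p})"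

lemma unit_reps_1: "M = p \<Longrightarrow> unit_reps = {0..<int p}"
  and unit_reps_2: "M \<noteq> p \<Longrightarrow> unit_reps = (\<lambda>k. int p * k) ` {0..<int p} \<union> {1..<int p}"
  unfolding unit_reps_def by (rule if_P, assumption, rule if_not_P, assumption)

lemma M_eq_cases:
  assumes "M = p * K"
  obtains "K = 1" "M = p" "M \<noteq> p ^ 2" | "K = p" "M = p ^ 2" "M \<noteq> p"
proof -
  have p1: "p > 1" using prime_gt_1_nat[OF p] .
  have "K dvd p" using M_dvd p1 unfolding assms power2_eq_square by simp
  then have "K = 1 \<or> K = p" using p by (simp add: prime_nat_iff)
  then show thesis using that assms p1 by (auto simp: power2_eq_square)
qed

lemma card_unit_reps:
  assumes "M = p * K"
  shows "finite unit_reps" "card unit_reps = (if M = p then p else 2 * p - 1)"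
proof -
  have "card ((\<lambda>k. int p * k) ` {0..<int p} \<union> {1..<int p}) = card ((\<lambda>k. int p * k) ` {0..<int p}) + card {1..<int p}"
  proof (rule card_Un_disjoint)
    show "(\<lambda>k. int p * k) ` {0..<int p} \<inter> {1..<int p} = {}"
      using not_dvd_range dvd_triv_left by blast
  qed auto
  also have "card ((\<lambda>k. int p * k) ` {0..<int p}) = p"
    by (subst card_image) (use p_gt in \<open>auto simp: inj_on_def\<close>)
  finally show "card unit_reps = (if M = p then p else 2 * p - 1)"
    using p_gt by (auto simp: unit_reps_def nat_diff_distrib)
  show "finite unit_reps" by (simp add: unit_reps_def)
qed

text \<open>An inverse modulo \<open>p^2\<close> serves both moduli at once, as \<open>M\<close> and
  \<open>p\<close> divide \<open>p^2\<close>. The congruence modulo \<open>p\<close> does not follow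
  from the one modulo \<open>M\<close> when \<open>M = 1\<close>.\<close>

lemma inverse_mod_M:
  assumes "\<not> int p dvd x"
  obtains y where "[x * y = 1] (mod int M)" "\<not> int p dvd y" "[x * y = 1] (mod int p)"
proof -
  have "coprime (int p ^ 2) x" using prime_imp_coprime[OF prime_int_p assms] by simp
  then have "coprime x (int p ^ 2)" by (simp add: coprime_commute)
  then obtain y where y: "[x * y = 1] (mod int p ^ 2)" using cong_solve_coprime_int by blast
  have "int M dvd int p ^ 2" using M_dvd by (metis of_nat_dvd_iff of_nat_power)
  then have 1: "[x * y = 1] (mod int M)" using y cong_dvd_modulus by blast
  have 2: "[x * y = 1] (mod int p)" using y cong_dvd_modulus[of _ _ "int p ^ 2" "int p"] by simp
  have "\<not> int p dvd y"
  proof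
    assume "int p dvd y"
    then have "int p dvd x * y" by simp
    then have "int p dvd 1" using 2 cong_dvd_iff by blast
    then show False using p_gt by simp
  qed
  then show thesis using that 1 2 by blast
qed

text \<open>If \<open>p\<close> does not divide \<open>D\<close>, the factor \<open>y\<close> is the
  quotient of \<open>D mod p\<close> by \<open>D\<close>, which is 1 modulo \<open>p\<close>. If it
  does, reduction modulo \<open>M\<close> is enough and \<open>y = 1\<close>.\<close>

lemma unit_reps_ex:
  assumes MK: "M = p * K"
  obtains y D' where "D' \<in> unit_reps" "[y = 1] (mod int p)" "[D' = D * y] (mod int M)"
  using MK
proof (cases rule: M_eq_cases)
  case 1
  show thesis
  proof (rule that)
    show "D mod int p \<in> unit_reps" unfolding unit_reps_1[OF 1(2)] by (rule mod_range)
    show "[1 = 1] (mod int p)" by simp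
    show "[D mod int p = D * 1] (mod int M)" unfolding 1(2) by (simp add: cong_def)
  qed
next
  case 2
  show thesis
  proof (cases "int p dvd D")
    case True
    then obtain k where k: "D = int p * k" by (rule dvdE)
    have "[int p * (k mod int p) = D * 1] (mod int M)"
    proof -
      have "int p * (k mod int p) - D * 1 = int p * int p * (- (k div int p))"
        unfolding k by (simp add: minus_mult_div_eq_mod[symmetric] algebra_simps)
      moreover have "int M = int p * int p" unfolding 2(2) by (simp add: power2_eq_square)
      ultimately show ?thesis unfolding cong_iff_dvd_diff by (metis dvd_triv_left)
    qed
    moreover have "int p * (k mod int p) \<in> unit_reps" unfolding unit_reps_2[OF 2(3)] using mod_range by blast
    ultimately show thesis using that[of _ 1] by simp
  next
    case False
    obtain D' where D': "[D * D' = 1] (mod int M)" "[D * D' = 1] (mod int p)" using inverse_mod_M[OF False] by blast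
    have 3: "D mod int p \<in> unit_reps" unfolding unit_reps_2[OF 2(3)] using mod_range_pos[OF False] by blast
    have "[D * D' * (D mod int p) = 1 * (D mod int p)] (mod int M)" by (rule cong_scalar_right[OF D'(1)])
    then have 4: "[D mod int p = D * (D' * (D mod int p))] (mod int M)" by (simp add: mult.assoc cong_sym)
    have "[D' * (D mod int p) = D' * D] (mod int p)" by (intro cong_mult cong_refl) (simp add: cong_def)
    then have "[D' * (D mod int p) = D * D'] (mod int p)" by (simp add: mult.commute)
    then have "[D' * (D mod int p) = 1] (mod int p)" using D'(2) by (rule cong_trans)
    then show thesis using that 3 4 by blast
  qed
qed

text \<open>A factor \<open>1 + p m\<close> preserves residues modulo \<open>p\<close> and preserves
  multiples of \<open>p\<close> modulo \<open>p^2\<close>; these two invariants separate the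
  representatives.\<close>

lemma unit_reps_unique:
  assumes MK: "M = p * K" and D: "D \<in> unit_reps" "D' \<in> unit_reps"
    and y: "[y = 1] (mod int p)" and e: "[D' = D * y] (mod int M)"
  shows "D' = D"
  using MK
proof (cases rule: M_eq_cases)
  case 1
  have "[D * y = D * 1] (mod int p)" by (rule cong_scalar_left[OF y])
  then have "[D' = D] (mod int p)" using e unfolding 1(2) by (simp add: cong_def)
  then show ?thesis using D(2,1) unfolding unit_reps_1[OF 1(2)] by (rule cong_range)
next
  case 2
  have "[D * y = D * 1] (mod int p)" by (rule cong_scalar_left[OF y])
  moreover have "[D' = D * y] (mod int p)"
    using e cong_dvd_modulus[of D' "D * y" "int M" "int p"] MK by simp
  ultimately have c: "[D' = D] (mod int p)" unfolding cong_def by simp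
  have mem: "x \<in> unit_reps \<longleftrightarrow> (\<exists>k\<in>{0..<int p}. x = int p * k) \<or> x \<in> {1..<int p}" for x
    unfolding unit_reps_2[OF 2(3)] by blast
  show ?thesis
  proof (cases "D \<in> {1..<int p}")
    case True
    then have "\<not> int p dvd D" using not_dvd_range by blast
    then have "\<not> int p dvd D'" using c cong_dvd_iff by blast
    then have "D' \<in> {1..<int p}" using D(2) mem by auto
    then show ?thesis using True by (intro cong_range[OF c]) auto
  next
    case False
    then obtain k where k: "k \<in> {0..<int p}" "D = int p * k" using D mem by blast
    have "int p dvd D'" using c k cong_dvd_iff by fastforce
    then have "D' \<notin> {1..<int p}" using not_dvd_range by blast
    then obtain k' where k': "k' \<in> {0..<int p}" "D' = int p * k'" using D mem by blast
    have "int p dvd y - 1" using y by (simp add: cong_iff_dvd_diff)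
    then obtain m where m: "y - 1 = int p * m" by (rule dvdE)
    have "int p * int p dvd int p * (k' - k * y)"
      using e unfolding k k' 2(2) by (simp add: cong_iff_dvd_diff power2_eq_square algebra_simps)
    then have "int p dvd k' - k * y" using p_gt by simp
    then have "int p dvd (k' - k * y) + int p * (k * m)" using dvd_triv_left by (rule dvd_add)
    also have "(k' - k * y) + int p * (k * m) = k' - k + k * (int p * m - (y - 1))" by (simp add: algebra_simps)
    finally have "[k' = k] (mod int p)" unfolding m by (simp add: cong_iff_dvd_diff)
    then have "k' = k" using k'(1) k(1) by (rule cong_range)
    then show ?thesis using k k' by simp
  qed
qed

lemma torsion_multiple:
  assumes MK: "M = p * K" and t: "[int p * t = 0] (mod int M)"
  obtains r where "t = int K * r"
proof -
  have "int p * int K dvd int p * t" using t unfolding MK by (simp add: cong_0_iff)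
  then have "int K dvd t" using p_gt by simp
  then show thesis using that by (auto elim: dvdE)
qed

text \<open>Multiplication by \<open>K\<close> identifies the residues modulo \<open>p\<close> with
  the \<open>p\<close>-torsion of the residues modulo \<open>M\<close>.\<close>

lemma cong_K_iff:
  assumes MK: "M = p * K"
  shows "[int K * x = int K * y] (mod int M) \<longleftrightarrow> [x = y] (mod int p)"
proof -
  have "K > 0" using M MK by (cases K) auto
  have "[int K * x = int K * y] (mod int M) \<longleftrightarrow> int K * int p dvd int K * (x - y)"
    unfolding MK by (simp add: cong_iff_dvd_diff right_diff_distrib mult.commute)
  also have "\<dots> \<longleftrightarrow> [x = y] (mod int p)" using \<open>K > 0\<close> by (simp add: cong_iff_dvd_diff)
  finally show ?thesis .
qed

lemma M_dvd_pp: "int M dvd int p * (int p * x)"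
proof -
  have "int M dvd int p ^ 2" using M_dvd by (metis of_nat_dvd_iff of_nat_power)
  then show ?thesis by (simp add: power2_eq_square mult.assoc[symmetric])
qed

text \<open>The hypothesis on \<open>tri\<close> says that the circle group of \<open>P\<close> is
  cyclic, generated by \<open>e\<close>: this is \<open>\<kappa> = 1\<close> for odd
  \<open>p\<close> and \<open>\<kappa> = 0\<close> for \<open>p = 2\<close>. Then
  \<open>t1 = 0\<close>, \<open>t2 = K T\<close> and \<open>d1 = p d2\<close>. Automorphisms have
  \<open>a\<close> congruent to 1 modulo \<open>p\<close>, so they fix \<open>T\<close> and multiply
  \<open>D\<close> by factors congruent to 1. The weight is 1 for \<open>T = 0\<close> and 2 for the
  other \<open>p - 1\<close> values, which gives the factor \<open>2 * p - 1\<close>.\<close>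

lemma num_classes_1:
  assumes MK: "M = p * K" and \<kappa>: "\<kappa> \<in> {0, 1}" and tri: "[\<kappa> + tri (int p) = 1] (mod int p)" and \<kappa>p: "\<kappa> = 1 \<or> p = 2"
  shows "num_classes \<kappa> 1 (card unit_reps * (2 * p - 1))"
proof -
  define um where "um = (\<lambda>(T, D). (0, int K * T, int p * D, D) :: quad)"
  have p1: "p > 1" using prime_gt_1_nat[OF p] .
  have K0: "K > 0" using M MK by (cases K) auto
  have inj: "inj um" using K0 by (auto simp: inj_on_def um_def)
  define N0 where "N0 = um ` ({0} \<times> unit_reps)"
  define N1 where "N1 = um ` ({1..<int p} \<times> unit_reps)"
  have tri1: "int p dvd (\<kappa> + tri (int p)) - 1" using tri by (simp add: cong_iff_dvd_diff)
  have val: "qvalid \<kappa> 1 (um (T, D))" for T D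
  proof -
    have "int M dvd ((\<kappa> + tri (int p)) - 1) * (int p * D)"
      using tri1 M_dvd_pp by (auto elim!: dvdE simp: mult.assoc) (metis M_dvd_pp mult.assoc mult.commute mult.left_commute)
    then have "[int p * D = (\<kappa> + tri (int p)) * (int p * D)] (mod int M)"
      by (simp add: cong_iff_dvd_diff algebra_simps dvd_diff_commute)
    moreover have "[int p * (int p * D) = 0] (mod int M)" using M_dvd_pp by (simp add: cong_0_iff)
    moreover have "[int p * (int K * T) = 0] (mod int M)" unfolding MK by (simp add: cong_0_iff mult.assoc[symmetric])
    ultimately show ?thesis by (simp add: um_def qvalid.simps)
  qed
  have relI: "qrel M \<kappa> 1 (um (T, D)) (um (T', D'))"
    if T: "[T' = T] (mod int p)" and y: "[y = 1] (mod int p)" and D: "[D' = D * y] (mod int M)" for T T' D D' y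
  proof -
    have "int p dvd y - 1" using y by (simp add: cong_iff_dvd_diff)
    then obtain m where "y - 1 = int p * m" by (rule dvdE)
    then have m: "y = 1 + int p * m" by simp
    have "[int K * T' = int K * T] (mod int M)" unfolding cong_K_iff[OF MK] by (rule T)
    moreover have "[int p * D' = int p * (D * y)] (mod int M)" by (rule cong_scalar_left[OF D])
    then have "[int p * D' = int p * D] (mod int M)"
    proof (rule cong_trans)
      show "[int p * (D * y) = int p * D] (mod int M)"
        using M_dvd_pp[of "D * m"] unfolding m by (simp add: cong_iff_dvd_diff algebra_simps)
    qed
    \<comment> \<open>With \<open>a = c = 1\<close> and \<open>b = m\<close>, the entry
      \<open>D\<close> becomes \<open>D + p D m = D y\<close>, because
      \<open>tri 1 = 0\<close>.\<close>
    ultimately show ?thesis unfolding um_def prod.case qrel.simps using D p_gt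
      by (intro exI[of _ 1] exI[of _ m] exI[of _ 1] exI[of _ 0]) (auto simp: m algebra_simps)
  qed
  have relE: "[T' = T] (mod int p) \<and> (\<exists>y. [y = 1] (mod int p) \<and> [D' = D * y] (mod int M))"
    if r: "qrel M \<kappa> 1 (um (T, D)) (um (T', D'))" for T T' D D'
  proof -
    obtain a b c f where f: "f = 0" and ka: "[\<kappa> * a = \<kappa> * c] (mod int p)" and ea: "[a ^ 2 = c] (mod int p)"
      and det: "\<not> int p dvd a * c - b * f" and t2: "[int K * T' = 0 * b + int K * T * a] (mod int M)"
      and d2: "[D' = int p * D * (b - 1 * tri a) + D * a] (mod int M)"
      using r unfolding um_def prod.case qrel.simps by auto
    have na: "\<not> int p dvd a" using det f by auto
    \<comment> \<open>For \<open>\<kappa> = 1\<close> both \<open>c = a\<close> and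
      \<open>c = a^2\<close> hold modulo \<open>p\<close>, which forces the unit \<open>a\<close> to
      be 1; for \<open>p = 2\<close> there is no other unit.\<close>
    have a1: "[a = 1] (mod int p)"
      using \<kappa>p
    proof
      assume "\<kappa> = 1"
      then have "[a = c] (mod int p)" using ka by simp
      then have "[a ^ 2 = a] (mod int p)" using ea unfolding cong_def by simp
      then have "int p dvd a * (a - 1)" by (simp add: cong_iff_dvd_diff power2_eq_square algebra_simps)
      then show ?thesis using na by (simp add: prime_p_dvd_mult cong_iff_dvd_diff)
    next
      assume p2: "p = 2"
      then have "odd a" using na by simp
      then have "2 dvd a - 1" by simp
      then show ?thesis using p2 by (simp add: cong_iff_dvd_diff)
    qed
    have "[T' = T * a] (mod int p)" using t2 cong_K_iff[OF MK, of T' "T * a"] by (simp add: mult.assoc)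
    moreover have "[T * a = T * 1] (mod int p)" by (rule cong_scalar_left[OF a1])
    ultimately have "[T' = T] (mod int p)" unfolding cong_def by simp
    moreover have "[a + int p * (b - tri a) = 1] (mod int p)" using a1 by (simp add: cong_def)
    moreover have "[D' = D * (a + int p * (b - tri a))] (mod int M)" using d2 by (simp add: algebra_simps)
    ultimately show ?thesis by blast
  qed
  have triv: "tau_trivial (um (T, D)) \<longleftrightarrow> [T = 0] (mod int p)" for T D
    using cong_K_iff[OF MK, of T 0] by (simp add: um_def tau_trivial.simps)
  have NN: "N0 \<union> N1 = um ` ({0..<int p} \<times> unit_reps)"
    unfolding N0_def N1_def range_split by (simp only: image_Un[symmetric] Sigma_Un_distrib1[symmetric] insert_is_Un[symmetric])
  have "transversal \<kappa> 1 N0 N1"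
    unfolding transversal_def
  proof (intro conjI allI impI ballI)
    show "finite N0" "finite N1" using card_unit_reps[OF MK] by (auto simp: N0_def N1_def)
    show "qvalid \<kappa> 1 w" if "w \<in> N0 \<union> N1" for w using that val unfolding NN by auto
    show "tau_trivial w" if "w \<in> N0" for w using that triv unfolding N0_def by auto
    show "\<not> tau_trivial w" if "w \<in> N1" for w
      using that not_dvd_range unfolding N1_def by (auto simp: triv cong_0_iff)
    show "\<exists>w'\<in>N0 \<union> N1. (qrel M \<kappa> 1)\<^sup>*\<^sup>* w w'" if v: "qvalid \<kappa> 1 w" for w
    proof -
      obtain t1 t2 d1 d2 where w: "w = (t1, t2, d1, d2)" by (cases w)
      have v1: "[t1 = 0] (mod int M)" and v2: "[int p * t2 = \<kappa> * t1] (mod int M)" and v4: "[int p * d1 = 0] (mod int M)"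
        and v5: "[int p * d2 = (\<kappa> + tri (int p)) * d1] (mod int M)"
        using v unfolding w qvalid.simps by simp_all
      have "[\<kappa> * t1 = \<kappa> * 0] (mod int M)" by (rule cong_scalar_left[OF v1])
      then have "[int p * t2 = 0] (mod int M)" using v2 unfolding cong_def by simp
      then obtain T where T: "t2 = int K * T" by (rule torsion_multiple[OF MK])
      have "int M dvd d1 * ((\<kappa> + tri (int p)) - 1)" by (rule M_dvd_of_p[OF v4 tri1])
      then have "[(\<kappa> + tri (int p)) * d1 = d1] (mod int M)" by (simp add: cong_iff_dvd_diff algebra_simps)
      then have d1: "[int p * d2 = d1] (mod int M)" using v5 cong_trans by blast
      have 1: "qrel M \<kappa> 1 w (um (T, d2))"
        unfolding w um_def prod.case by (rule qrel_of_cong) (use v1 d1 T in \<open>auto simp: cong_sym\<close>)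
      obtain y D' where D': "D' \<in> unit_reps" "[y = 1] (mod int p)" "[D' = d2 * y] (mod int M)"
        using unit_reps_ex[OF MK] by blast
      have 2: "qrel M \<kappa> 1 (um (T, d2)) (um (T mod int p, D'))"
        by (rule relI[OF _ D'(2,3)]) (simp add: cong_def)
      have "um (T mod int p, D') \<in> N0 \<union> N1" unfolding NN using D'(1) p_gt by auto
      then show ?thesis using 1 2 by (meson converse_rtranclp_into_rtranclp r_into_rtranclp)
    qed
    show "w = w'" if ww: "w \<in> N0 \<union> N1" "w' \<in> N0 \<union> N1" and r: "qrel M \<kappa> 1 w w'" for w w'
    proof -
      obtain T D where w: "w = um (T, D)" "T \<in> {0..<int p}" "D \<in> unit_reps" using ww(1) unfolding NN by auto
      obtain T' D' where w': "w' = um (T', D')" "T' \<in> {0..<int p}" "D' \<in> unit_reps" using ww(2) unfolding NN by auto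
      have e: "[T' = T] (mod int p)" "\<exists>y. [y = 1] (mod int p) \<and> [D' = D * y] (mod int M)"
        using relE[of T D T' D'] r unfolding w w' by blast+
      have "T' = T" using e(1) w'(2) w(2) by (rule cong_range)
      moreover have "D' = D" using e(2) unit_reps_unique[OF MK w(3) w'(3)] by blast
      ultimately show ?thesis using w w' by simp
    qed
  qed
  moreover have "card N0 + 2 * card N1 = card unit_reps * (2 * p - 1)"
  proof -
    have "nat (int p - 1) = p - 1" by simp
    then have "card N0 = card unit_reps" "card N1 = (p - 1) * card unit_reps"
      unfolding N0_def N1_def using inj
      by (simp_all add: card_image inj_on_subset card_cartesian_product)
    then show ?thesis using p1 by (simp add: algebra_simps)
  qed
  ultimately show ?thesis unfolding num_classes_def by blast
qed

end

context brace_params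
begin

text \<open>Sum and circle product of \<open>P\<close> agree, and the group is cyclic of order
  \<open>p^2\<close>, generated by \<open>e\<close>. Hence \<open>t1 = p t2\<close> and
  \<open>d1 = p d2\<close>, and what remains is to count pairs \<open>(T, D)\<close> modulo
  \<open>M\<close> up to a common unit \<open>y\<close>.\<close>

lemma num_classes_1_0:
  assumes MK: "M = p * K"
  shows "num_classes 1 0 (if M = p then 2 + 2 * p else 2 * p ^ 2 + 4 * p + 1)"
proof -
  define vm where "vm = (\<lambda>(T, D). (int p * T, T, int p * D, D) :: quad)"
  have p1: "p > 1" using prime_gt_1_nat[OF p] .
  have inj: "inj vm" by (auto simp: inj_on_def vm_def)
  have val: "qvalid 1 0 (vm (T, D))" for T D
    using M_dvd_pp by (simp add: vm_def qvalid.simps cong_0_iff)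
  have relI: "qrel M 1 0 (vm (T, D)) (vm (T', D'))"
    if y: "\<not> int p dvd y" and T: "[T' = T * y] (mod int M)" and D: "[D' = D * y] (mod int M)" for T T' D D' y
    unfolding vm_def prod.case qrel.simps
    using y T D cong_scalar_left[OF T, of "int p"] cong_scalar_left[OF D, of "int p"]
    by (intro exI[of _ y] exI[of _ 0] exI[of _ y] exI[of _ 0]) (auto simp: prime_p_dvd_mult mult.assoc)
  have relE: "\<exists>y. \<not> int p dvd y \<and> [T' = T * y] (mod int M) \<and> [D' = D * y] (mod int M)"
    if r: "qrel M 1 0 (vm (T, D)) (vm (T', D'))" for T T' D D'
  proof -
    obtain a b c f where f: "f = 0" and det: "\<not> int p dvd a * c - b * f"
      and t2: "[T' = int p * T * b + T * a] (mod int M)"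
      and d2: "[D' = int p * D * (b - 0 * tri a) + D * a] (mod int M)"
      using r unfolding vm_def prod.case qrel.simps by blast
    \<comment> \<open>The common factor is \<open>y = a + p b\<close>, the effect of the
      automorphism on the generator \<open>e\<close>.\<close>
    have "\<not> int p dvd a" using det f by auto
    then have "\<not> int p dvd a + int p * b" by (simp add: dvd_add_left_iff)
    moreover have "int p * T * b + T * a = T * (a + int p * b)" "int p * D * (b - 0 * tri a) + D * a = D * (a + int p * b)"
      by (simp_all add: algebra_simps)
    ultimately show ?thesis using t2 d2 by metis
  qed
  have red: "qrel M 1 0 w (vm (fst (snd w), snd (snd (snd w))))" if v: "qvalid 1 0 w" for w
  proof -
    obtain t1 t2 d1 d2 where w: "w = (t1, t2, d1, d2)" by (cases w)
    have v1: "[int p * t2 = t1] (mod int M)" "[int p * d2 = d1] (mod int M)"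
      using v unfolding w qvalid.simps by simp_all
    show ?thesis unfolding w vm_def fst_conv snd_conv prod.case by (rule qrel_of_cong) (use v1 in simp_all)
  qed
  have triv: "tau_trivial (vm (T, D)) \<longleftrightarrow> [T = 0] (mod int M)" for T D
    using cong_scalar_left[of T 0 "int M" "int p"] by (auto simp: vm_def tau_trivial.simps)
  \<comment> \<open>This removes braces from the problem: \<open>S0\<close> and \<open>S1\<close>
    are to represent the pairs with \<open>T = 0\<close> and \<open>T \<noteq> 0\<close> modulo
    \<open>M\<close> under scaling by units.\<close>
  have main: "num_classes 1 0 (card S0 + 2 * card S1)"
    if fin: "finite S0" "finite S1" and S0: "\<And>T D. (T, D) \<in> S0 \<Longrightarrow> [T = 0] (mod int M)"
      and S1: "\<And>T D. (T, D) \<in> S1 \<Longrightarrow> \<not> [T = 0] (mod int M)"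
      and ex: "\<And>T D. \<exists>T' D' y. (T', D') \<in> S0 \<union> S1 \<and> \<not> int p dvd y \<and> [T' = T * y] (mod int M) \<and> [D' = D * y] (mod int M)"
      and un: "\<And>T D T' D' y. (T, D) \<in> S0 \<union> S1 \<Longrightarrow> (T', D') \<in> S0 \<union> S1 \<Longrightarrow> \<not> int p dvd y \<Longrightarrow>
        [T' = T * y] (mod int M) \<Longrightarrow> [D' = D * y] (mod int M) \<Longrightarrow> T = T' \<and> D = D'" for S0 S1
    unfolding num_classes_def
  proof (intro exI conjI)
    have NN: "vm ` S0 \<union> vm ` S1 = vm ` (S0 \<union> S1)" by auto
    show "transversal 1 0 (vm ` S0) (vm ` S1)"
      unfolding transversal_def
    proof (intro conjI allI impI ballI)
      show "finite (vm ` S0)" "finite (vm ` S1)" using fin by auto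
      show "qvalid 1 0 w" if "w \<in> vm ` S0 \<union> vm ` S1" for w using that val unfolding NN by auto
      show "tau_trivial w" if "w \<in> vm ` S0" for w using that triv S0 by auto
      show "\<not> tau_trivial w" if "w \<in> vm ` S1" for w using that triv S1 by auto
      show "\<exists>w'\<in>vm ` S0 \<union> vm ` S1. (qrel M 1 0)\<^sup>*\<^sup>* w w'" if v: "qvalid 1 0 w" for w
      proof -
        obtain T' D' y where e: "(T', D') \<in> S0 \<union> S1" "\<not> int p dvd y" "[T' = fst (snd w) * y] (mod int M)"
          "[D' = snd (snd (snd w)) * y] (mod int M)" using ex by blast
        have "(qrel M 1 0)\<^sup>*\<^sup>* w (vm (T', D'))"
          using red[OF v] relI[OF e(2-4)] by (meson converse_rtranclp_into_rtranclp r_into_rtranclp)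
        then show ?thesis unfolding NN using e(1) by blast
      qed
      show "w = w'" if ww: "w \<in> vm ` S0 \<union> vm ` S1" "w' \<in> vm ` S0 \<union> vm ` S1" and r: "qrel M 1 0 w w'" for w w'
      proof -
        obtain T D where w: "w = vm (T, D)" "(T, D) \<in> S0 \<union> S1" using ww(1) unfolding NN by auto
        obtain T' D' where w': "w' = vm (T', D')" "(T', D') \<in> S0 \<union> S1" using ww(2) unfolding NN by auto
        obtain y where "\<not> int p dvd y" "[T' = T * y] (mod int M)" "[D' = D * y] (mod int M)"
          using relE r unfolding w w' by blast
        then have "T = T' \<and> D = D'" using un w(2) w'(2) by blast
        then show ?thesis using w w' by simp
      qed
    qed
    show "card (vm ` S0) + 2 * card (vm ` S1) = card S0 + 2 * card S1"
      using inj by (simp add: card_image inj_on_subset)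
  qed
  have modM: "[x mod int M = x] (mod int M)" for x by (simp add: cong_def)
  have Mrange: "x mod int M \<in> {0..<int M}" for x using M by simp
  have Mcong: "x = y" if "[x = y] (mod int M)" "x \<in> {0..<int M}" "y \<in> {0..<int M}" for x y
    using that by (simp add: cong_def)
  have pM: "int p dvd int M" using MK by simp
  have dvd_cong: "int p dvd x \<longleftrightarrow> int p dvd y" if "[x = y] (mod int M)" for x y
    using cong_dvd_iff[OF cong_dvd_modulus[OF that pM]] .
  have n1: "\<not> [1 = 0] (mod int M)" using dvd_cong[of 1 0] p_gt by auto
  have np1: "\<not> int p dvd 1" using p_gt by simp
  show ?thesis
    using MK
  proof (cases rule: M_eq_cases)
    case 1
    \<comment> \<open>For \<open>T = 0\<close> the exponent \<open>D\<close> can be scaled to 0 or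
      1. For a unit \<open>T\<close>, scaling to \<open>T = 1\<close> uses up all freedom and
      \<open>D\<close> is arbitrary.\<close>
    define S0 where "S0 = {(0::int, 0::int), (0, 1)}"
    define S1 where "S1 = {1::int} \<times> {0..<int M}"
    have "num_classes 1 0 (card S0 + 2 * card S1)"
    proof (rule main)
      fix T D
      show "\<exists>T' D' y. (T', D') \<in> S0 \<union> S1 \<and> \<not> int p dvd y \<and> [T' = T * y] (mod int M) \<and> [D' = D * y] (mod int M)"
      proof (cases "int p dvd T")
        case True
        then have T: "[T * y = 0] (mod int M)" for y unfolding 1(2) by (simp add: cong_0_iff)
        show ?thesis
        proof (cases "int p dvd D")
          case True
          then have "[0 = D * 1] (mod int M)" unfolding 1(2) by (simp add: cong_iff_dvd_diff)
          moreover have "(0, 0) \<in> S0 \<union> S1" by (simp add: S0_def)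
          ultimately show ?thesis using T[of 1] np1 cong_sym by blast
        next
          case False
          obtain y where "[D * y = 1] (mod int M)" "\<not> int p dvd y" using inverse_mod_M[OF False] by blast
          moreover have "(0, 1) \<in> S0 \<union> S1" by (simp add: S0_def)
          ultimately show ?thesis using T[of y] cong_sym by blast
        qed
      next
        case False
        obtain y where y: "[T * y = 1] (mod int M)" "\<not> int p dvd y" using inverse_mod_M[OF False] by blast
        have "(1, D * y mod int M) \<in> S0 \<union> S1" using Mrange by (simp add: S1_def)
        then show ?thesis using y modM[of "D * y"] cong_sym by blast
      qed
    next
      fix T D T' D' y
      assume a: "(T, D) \<in> S0 \<union> S1" "(T', D') \<in> S0 \<union> S1" and y: "\<not> int p dvd y"
        and T: "[T' = T * y] (mod int M)" and D: "[D' = D * y] (mod int M)"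
      have TT: "T \<in> {0, 1}" "T' \<in> {0, 1}" using a by (auto simp: S0_def S1_def)
      show "T = T' \<and> D = D'"
      proof (cases "T = 0")
        case True
        then have "T' = 0" using T TT n1 by auto
        then have "D \<in> {0, 1}" "D' \<in> {0, 1}" using a True by (auto simp: S0_def S1_def)
        moreover have "int p dvd D' \<longleftrightarrow> int p dvd D" using dvd_cong[OF D] y by (simp add: prime_p_dvd_mult)
        ultimately show ?thesis using True \<open>T' = 0\<close> np1 by auto
      next
        case False
        then have T1: "T = 1" using TT by simp
        then have "T' = 1" using T TT dvd_cong[OF T] y by auto
        then have "[y = 1] (mod int M)" using T T1 by (simp add: cong_sym)
        then have "[D * y = D * 1] (mod int M)" by (rule cong_scalar_left)
        then have "[D' = D] (mod int M)" using D unfolding cong_def by simp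
        moreover have "D \<in> {0..<int M}" "D' \<in> {0..<int M}" using a T1 \<open>T' = 1\<close> by (auto simp: S0_def S1_def)
        ultimately show ?thesis using Mcong T1 \<open>T' = 1\<close> by auto
      qed
    qed (use n1 in \<open>auto simp: S0_def S1_def\<close>)
    moreover have "card S0 + 2 * card S1 = 2 + 2 * p"
      unfolding S0_def S1_def 1(2) by (simp add: card_cartesian_product)
    ultimately show ?thesis using 1(2) by simp
  next
    case 2
    have Mpp: "int M = int p * int p" unfolding 2(2) by (simp add: power2_eq_square)
    \<comment> \<open>Modulo \<open>p^2\<close> units have three orbits: 0, units and proper
      multiples of \<open>p\<close>. The stabilizer of \<open>T = p\<close> consists of the units
      congruent to 1 modulo \<open>p\<close>, so \<open>D\<close> then runs through
      \<open>unit_reps\<close>; for \<open>T = 1\<close> it runs through all residues.\<close>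
    define S0 where "S0 = {(0::int, 0::int), (0, 1), (0, int p)}"
    define S1 where "S1 = {1::int} \<times> {0..<int M} \<union> {int p} \<times> unit_reps"
    have npM: "\<not> [int p = 0] (mod int M)" unfolding Mpp using p_gt by (simp add: cong_0_iff)
    have ppy: "[int p = int p * r * y] (mod int M)" if "[r * y = 1] (mod int p)" for r y
    proof -
      have "int p dvd 1 - r * y" using that by (simp add: cong_iff_dvd_diff dvd_diff_commute)
      then have "int p * int p dvd int p * (1 - r * y)" by simp
      then show ?thesis unfolding Mpp by (simp add: cong_iff_dvd_diff algebra_simps)
    qed
    have "num_classes 1 0 (card S0 + 2 * card S1)"
    proof (rule main)
      fix T D
      show "\<exists>T' D' y. (T', D') \<in> S0 \<union> S1 \<and> \<not> int p dvd y \<and> [T' = T * y] (mod int M) \<and> [D' = D * y] (mod int M)"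
      proof (cases "int p dvd T")
        case False
        obtain y where y: "[T * y = 1] (mod int M)" "\<not> int p dvd y" using inverse_mod_M[OF False] by blast
        have "(1, D * y mod int M) \<in> S0 \<union> S1" using Mrange by (simp add: S1_def)
        then show ?thesis using y modM[of "D * y"] cong_sym by blast
      next
        case True
        then obtain r where r: "T = int p * r" by (rule dvdE)
        show ?thesis
        proof (cases "int p dvd r")
          case True
          then have T: "[0 = T * y] (mod int M)" for y unfolding Mpp r by (auto simp: cong_iff_dvd_diff elim!: dvdE)
          show ?thesis
          proof (cases "int p dvd D")
            case False
            obtain y where "[D * y = 1] (mod int M)" "\<not> int p dvd y" using inverse_mod_M[OF False] by blast
            moreover have "(0, 1) \<in> S0 \<union> S1" by (simp add: S0_def)
            ultimately show ?thesis using T[of y] cong_sym by blast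
          next
            case True
            then obtain d where d: "D = int p * d" by (rule dvdE)
            show ?thesis
            proof (cases "int p dvd d")
              case True
              then have "[0 = D * 1] (mod int M)" unfolding Mpp d by (auto simp: cong_iff_dvd_diff elim!: dvdE)
              moreover have "(0, 0) \<in> S0 \<union> S1" by (simp add: S0_def)
              ultimately show ?thesis using T[of 1] np1 by blast
            next
              case False
              obtain y where y: "[d * y = 1] (mod int p)" "\<not> int p dvd y" using inverse_mod_M[OF False] by blast
              have "(0, int p) \<in> S0 \<union> S1" by (simp add: S0_def)
              then show ?thesis using T[of y] y(2) ppy[OF y(1)] unfolding d by blast
            qed
          qed
        next
          case False
          obtain y where y: "[r * y = 1] (mod int p)" "\<not> int p dvd y" using inverse_mod_M[OF False] by blast
          \<comment> \<open>The factor \<open>y\<close> has already brought \<open>T\<close> to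
            \<open>p\<close>; the further factor \<open>z\<close>, being 1 modulo \<open>p\<close>,
            keeps it there and normalizes \<open>D\<close>.\<close>
          obtain z D' where z: "D' \<in> unit_reps" "[z = 1] (mod int p)" "[D' = D * y * z] (mod int M)"
            using unit_reps_ex[OF MK, of "D * y"] by blast
          have "[r * y * z = 1 * 1] (mod int p)" by (rule cong_mult[OF y(1) z(2)])
          then have "[r * (y * z) = 1] (mod int p)" by (simp add: mult.assoc)
          then have "[int p = T * (y * z)] (mod int M)" unfolding r by (rule ppy)
          moreover have "\<not> int p dvd z" using cong_dvd_iff[OF z(2)] np1 by simp
          then have "\<not> int p dvd y * z" using y(2) by (simp add: prime_p_dvd_mult)
          moreover have "(int p, D') \<in> S0 \<union> S1" using z(1) by (simp add: S1_def)
          moreover have "[D' = D * (y * z)] (mod int M)" using z(3) by (simp add: mult.assoc)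
          ultimately show ?thesis by blast
        qed
      qed
    next
      fix T D T' D' y
      assume a: "(T, D) \<in> S0 \<union> S1" "(T', D') \<in> S0 \<union> S1" and y: "\<not> int p dvd y"
        and T: "[T' = T * y] (mod int M)" and D: "[D' = D * y] (mod int M)"
      have TT: "T \<in> {0, 1, int p}" "T' \<in> {0, 1, int p}" using a by (auto simp: S0_def S1_def)
      have Tp: "int p dvd T' \<longleftrightarrow> int p dvd T" using dvd_cong[OF T] y by (simp add: prime_p_dvd_mult)
      have Dp: "int p dvd D' \<longleftrightarrow> int p dvd D" using dvd_cong[OF D] y by (simp add: prime_p_dvd_mult)
      have p01: "int p \<noteq> 0" "int p \<noteq> 1" "(1::int) \<noteq> int p" using p_gt by auto
      have py: "\<not> [int p * y = 0] (mod int M)" unfolding Mpp using y p_gt by (simp add: cong_0_iff)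
      consider "T = 0" | "T = 1" | "T = int p" using TT by blast
      then show "T = T' \<and> D = D'"
      proof cases
        case T0: 1
        have "T' = 0" using T T0 TT n1 npM by auto
        then have DD: "D \<in> {0, 1, int p}" "D' \<in> {0, 1, int p}" using a T0 p01 by (auto simp: S0_def S1_def)
        have "D = D'"
        proof (cases "D = 1")
          case True
          then show ?thesis using DD Dp np1 by auto
        next
          case False
          have "D' \<noteq> 1" using DD Dp np1 False by auto
          then show ?thesis using DD False D py npM by (auto simp: cong_sym_eq)
        qed
        then show ?thesis using T0 \<open>T' = 0\<close> by simp
      next
        case T1: 2
        then have T'1: "T' = 1" using TT Tp np1 by auto
        then have "[y = 1] (mod int M)" using T T1 by (simp add: cong_sym)
        then have "[D * y = D * 1] (mod int M)" by (rule cong_scalar_left)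
        then have "[D' = D] (mod int M)" using D unfolding cong_def by simp
        moreover have "D \<in> {0..<int M}" "D' \<in> {0..<int M}" using a T1 T'1 p01 by (auto simp: S0_def S1_def)
        ultimately show ?thesis using Mcong T1 T'1 by auto
      next
        case T2: 3
        have "T' \<noteq> 0" using T T2 py by (auto simp: cong_sym_eq)
        moreover have "T' \<noteq> 1" using Tp T2 np1 by auto
        ultimately have T'2: "T' = int p" using TT by blast
        have "int p * int p dvd int p * (1 - y)" using T unfolding T2 T'2 Mpp by (simp add: cong_iff_dvd_diff algebra_simps)
        then have "int p dvd 1 - y" using p01 by simp
        then have "[y = 1] (mod int p)" by (simp add: cong_iff_dvd_diff dvd_diff_commute)
        moreover have "D \<in> unit_reps" "D' \<in> unit_reps" using a T2 T'2 p01 by (auto simp: S0_def S1_def)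
        ultimately have "D' = D" using unit_reps_unique[OF MK _ _ _ D] by blast
        then show ?thesis using T2 T'2 by simp
      qed
    next
      show "finite S1" using card_unit_reps[OF MK] by (simp add: S1_def)
    qed (use n1 npM in \<open>auto simp: S0_def S1_def\<close>)
    moreover have "card S0 + 2 * card S1 = 2 * p ^ 2 + 4 * p + 1"
    proof -
      have "card S0 = 3" unfolding S0_def using p_gt by simp
      moreover have "card S1 = card ({1::int} \<times> {0..<int M}) + card ({int p} \<times> unit_reps)"
        unfolding S1_def by (rule card_Un_disjoint) (use card_unit_reps[OF MK] p_gt in auto)
      moreover have "card ({1::int} \<times> {0..<int M}) = p ^ 2"
        unfolding 2(2)[symmetric] by (simp add: card_cartesian_product)
      moreover have "card ({int p} \<times> unit_reps) = 2 * p - 1"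
        using card_unit_reps(2)[OF MK] 2(3) by (simp add: card_cartesian_product)
      ultimately show ?thesis using p1 by simp
    qed
    ultimately show ?thesis using 2(3) by simp
  qed
qed

section \<open>Exponents killed by p: linear algebra over the field of p elements\<close>

definition scale_quad :: "nat \<Rightarrow> quad \<Rightarrow> quad"
  where "scale_quad K = (\<lambda>(S, T, A, E). (int K * S, int K * T, int K * A, int K * E))"

lemma qrel_scale_quad:
  assumes MK: "M = p * K"
  shows "qrel M \<kappa> \<epsilon> (scale_quad K w) (scale_quad K w') \<longleftrightarrow> qrel p \<kappa> \<epsilon> w w'"
proof -
  obtain S T A E where w: "w = (S, T, A, E)" by (cases w)
  obtain S' T' A' E' where w': "w' = (S', T', A', E')" by (cases w')
  have e: "[int K * x = int K * X * c + int K * Y * d] (mod int M) \<longleftrightarrow> [x = X * c + Y * d] (mod int p)" for x X Y c d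
    using cong_K_iff[OF MK, of x "X * c + Y * d"] by (simp add: distrib_left mult.assoc)
  show ?thesis unfolding w w' scale_quad_def prod.case qrel.simps e ..
qed

text \<open>Applies where all valid exponents are \<open>p\<close>-torsion. The orbits are then
  those over the field of \<open>p\<close> elements, so the count is the same for
  \<open>M = p\<close> and \<open>M = p^2\<close>. \<open>V\<close> collects the linear constraint
  left over from \<open>qvalid\<close>.\<close>

lemma num_classes_scale_quad:
  assumes MK: "M = p * K" and fin: "finite N0" "finite N1"
    and v: "\<And>w. qvalid \<kappa> \<epsilon> w \<Longrightarrow> \<exists>w0\<in>V. w = scale_quad K w0" and V: "\<And>w0. w0 \<in> V \<Longrightarrow> qvalid \<kappa> \<epsilon> (scale_quad K w0)"
    and sub: "N0 \<union> N1 \<subseteq> V"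
    and N0: "\<And>S T A E. (S, T, A, E) \<in> N0 \<Longrightarrow> [S = 0] (mod int p) \<and> [T = 0] (mod int p)"
    and N1: "\<And>S T A E. (S, T, A, E) \<in> N1 \<Longrightarrow> \<not> ([S = 0] (mod int p) \<and> [T = 0] (mod int p))"
    and ex: "\<And>w0. w0 \<in> V \<Longrightarrow> \<exists>w'\<in>N0 \<union> N1. (qrel p \<kappa> \<epsilon>)\<^sup>*\<^sup>* w0 w'"
    and un: "\<And>w w'. w \<in> N0 \<union> N1 \<Longrightarrow> w' \<in> N0 \<union> N1 \<Longrightarrow> qrel p \<kappa> \<epsilon> w w' \<Longrightarrow> w = w'"
  shows "num_classes \<kappa> \<epsilon> (card N0 + 2 * card N1)"
  unfolding num_classes_def
proof (intro exI conjI)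
  have K0: "K > 0" using M MK by (cases K) auto
  have inj: "inj (scale_quad K)" using K0 by (auto simp: inj_on_def scale_quad_def)
  have NN: "scale_quad K ` N0 \<union> scale_quad K ` N1 = scale_quad K ` (N0 \<union> N1)" by auto
  have triv: "tau_trivial (scale_quad K (S, T, A, E)) \<longleftrightarrow> [S = 0] (mod int p) \<and> [T = 0] (mod int p)" for S T A E
    using cong_K_iff[OF MK, of S 0] cong_K_iff[OF MK, of T 0] by (simp add: scale_quad_def tau_trivial.simps)
  show "transversal \<kappa> \<epsilon> (scale_quad K ` N0) (scale_quad K ` N1)"
    unfolding transversal_def
  proof (intro conjI allI impI ballI)
    show "finite (scale_quad K ` N0)" "finite (scale_quad K ` N1)" using fin by auto
    show "qvalid \<kappa> \<epsilon> w" if "w \<in> scale_quad K ` N0 \<union> scale_quad K ` N1" for w using that V sub unfolding NN by blast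
    show "tau_trivial w" if w: "w \<in> scale_quad K ` N0" for w
    proof -
      obtain S T A E where "w = scale_quad K (S, T, A, E)" "(S, T, A, E) \<in> N0" using w by auto
      then show ?thesis using triv N0 by simp
    qed
    show "\<not> tau_trivial w" if w: "w \<in> scale_quad K ` N1" for w
    proof -
      obtain S T A E where "w = scale_quad K (S, T, A, E)" "(S, T, A, E) \<in> N1" using w by auto
      then show ?thesis using triv N1 by simp
    qed
    show "\<exists>w'\<in>scale_quad K ` N0 \<union> scale_quad K ` N1. (qrel M \<kappa> \<epsilon>)\<^sup>*\<^sup>* w w'" if w: "qvalid \<kappa> \<epsilon> w" for w
    proof -
      obtain w0 where w0: "w0 \<in> V" "w = scale_quad K w0" using v[OF w] by blast
      obtain w' where w': "w' \<in> N0 \<union> N1" "(qrel p \<kappa> \<epsilon>)\<^sup>*\<^sup>* w0 w'" using ex[OF w0(1)] by blast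
      have "(qrel M \<kappa> \<epsilon>)\<^sup>*\<^sup>* (scale_quad K w0) (scale_quad K w')"
        using w'(2)
      proof (induction rule: rtranclp_induct)
        case (step y z)
        then have "qrel M \<kappa> \<epsilon> (scale_quad K y) (scale_quad K z)" unfolding qrel_scale_quad[OF MK] by blast
        then show ?case using step(3) rtranclp.rtrancl_into_rtrancl[of "qrel M \<kappa> \<epsilon>"] by blast
      qed simp
      then show ?thesis unfolding NN w0(2) using w'(1) by blast
    qed
    show "w = w'" if ww: "w \<in> scale_quad K ` N0 \<union> scale_quad K ` N1" "w' \<in> scale_quad K ` N0 \<union> scale_quad K ` N1" and r: "qrel M \<kappa> \<epsilon> w w'" for w w'
    proof -
      obtain x where x: "w = scale_quad K x" "x \<in> N0 \<union> N1" using ww(1) unfolding NN by auto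
      obtain x' where x': "w' = scale_quad K x'" "x' \<in> N0 \<union> N1" using ww(2) unfolding NN by auto
      have "qrel p \<kappa> \<epsilon> x x'" using r unfolding x x' qrel_scale_quad[OF MK] .
      then show ?thesis using un x x' by blast
    qed
  qed
  show "card (scale_quad K ` N0) + 2 * card (scale_quad K ` N1) = card N0 + 2 * card N1"
    using inj by (simp add: card_image inj_on_subset)
qed

lemma inverse_mod_p:
  assumes "\<not> int p dvd x"
  obtains y where "[x * y = 1] (mod int p)" "\<not> int p dvd y"
  using inverse_mod_M[OF assms] by blast

lemma bezout_mod_p:
  assumes "\<not> (int p dvd S \<and> int p dvd T)"
  obtains b a where "[S * b + T * a = 1] (mod int p)"
proof (cases "int p dvd S")
  case True
  then have "\<not> int p dvd T" using assms by blast
  then obtain a where "[T * a = 1] (mod int p)" using inverse_mod_p by blast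
  then show thesis using that[of 0 a] by simp
next
  case False
  then obtain b where "[S * b = 1] (mod int p)" using inverse_mod_p by blast
  then show thesis using that[of b 0] by simp
qed

lemma qrel_0_0_I:
  assumes "\<not> int p dvd a * c - b * f" "[S' = S * c + T * f] (mod int p)" "[T' = S * b + T * a] (mod int p)"
    "[A' = A * c + E * f] (mod int p)" "[E' = A * b + E * a] (mod int p)"
  shows "qrel p 0 0 (S, T, A, E) (S', T', A', E')"
  unfolding qrel.simps using assms by (intro exI[of _ a] exI[of _ b] exI[of _ c] exI[of _ f]) simp

lemma cong_1_not_dvd: "[x = 1] (mod int p) \<Longrightarrow> \<not> int p dvd x"
  using cong_dvd_iff[of x 1 "int p"] p_gt by simp

text \<open>All matrices invertible modulo \<open>p\<close> act on the two vectors
  \<open>(S, T)\<close> and \<open>(A, E)\<close>. If \<open>(S, T)\<close> is zero there are 2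
  orbits. Otherwise \<open>(A, E)\<close> is one of \<open>p\<close> multiples of it or independent
  of it, giving \<open>p + 1\<close> orbits of weight 2.\<close>

lemma num_classes_0_0:
  assumes MK: "M = p * K"
  shows "num_classes 0 0 (2 * p + 4)"
proof -
  define N0 :: "quad set" where "N0 = {(0, 0, 0, 0), (0, 0, 0, 1)}"
  define N1 :: "quad set" where "N1 = insert (0, 1, 1, 0) ((\<lambda>d. (0, 1, 0, d)) ` {0..<int p})"
  have c1: "[1 = X] (mod int p)" if "[X = 1] (mod int p)" for X using that by (rule cong_sym)
  have step1: "\<exists>A' E'. qrel p 0 0 (S, T, A, E) (0, 1, A', E')" if ST: "\<not> (int p dvd S \<and> int p dvd T)" for S T A E
  proof -
    obtain b a where ba: "[S * b + T * a = 1] (mod int p)" using bezout_mod_p[OF ST] .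
    \<comment> \<open>The column \<open>(T, - S)\<close> annihilates the vector
      \<open>(S, T)\<close> and the Bezout column sends it to 1; the determinant of the two is the
      same Bezout sum, hence 1.\<close>
    have "qrel p 0 0 (S, T, A, E) (0, 1, A * T + E * (- S), A * b + E * a)"
    proof (rule qrel_0_0_I)
      show "\<not> int p dvd a * T - b * (- S)" using cong_1_not_dvd[OF ba] by (simp add: algebra_simps)
      show "[0 = S * T + T * - S] (mod int p)" by (simp add: mult.commute)
    qed (use ba in \<open>simp_all add: cong_sym\<close>)
    then show ?thesis by blast
  qed
  have ex0: "\<exists>w'\<in>N0 \<union> N1. (qrel p 0 0)\<^sup>*\<^sup>* w0 w'" for w0
  proof -
    obtain S T A E where w0: "w0 = (S, T, A, E)" by (cases w0)
    show ?thesis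
    proof (cases "int p dvd S \<and> int p dvd T")
      case ST: True
      then have ST0: "[0 = S * x + T * y] (mod int p)" for x y by (simp add: cong_iff_dvd_diff)
      show ?thesis
      proof (cases "int p dvd A \<and> int p dvd E")
        case True
        have "qrel p 0 0 w0 (0, 0, 0, 0)" unfolding w0
          by (rule qrel_of_cong) (use ST True in \<open>simp_all add: cong_iff_dvd_diff\<close>)
        then show ?thesis by (intro bexI[of _ "(0, 0, 0, 0)"]) (auto simp: N0_def)
      next
        case False
        obtain b a where ba: "[A * b + E * a = 1] (mod int p)" using bezout_mod_p[OF False] .
        have "qrel p 0 0 w0 (0, 0, 0, 1)" unfolding w0
        proof (rule qrel_0_0_I[OF _ ST0 ST0])
          show "\<not> int p dvd a * E - b * (- A)" using cong_1_not_dvd[OF ba] by (simp add: algebra_simps)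
          show "[0 = A * E + E * - A] (mod int p)" by (simp add: mult.commute)
          show "[1 = A * b + E * a] (mod int p)" by (rule c1[OF ba])
        qed
        then show ?thesis by (intro bexI[of _ "(0, 0, 0, 1)"]) (auto simp: N0_def)
      qed
    next
      case False
      obtain A' E' where r1: "qrel p 0 0 w0 (0, 1, A', E')" using step1[OF False] unfolding w0 by blast
      have "\<exists>w'\<in>N1. qrel p 0 0 (0, 1, A', E') w'"
      proof (cases "int p dvd A'")
        case True
        have "qrel p 0 0 (0, 1, A', E') (0, 1, 0, E' mod int p)"
        proof (rule qrel_of_cong)
          show "[0 = A'] (mod int p)" using True by (simp add: cong_iff_dvd_diff)
          show "[E' mod int p = E'] (mod int p)" by (simp add: cong_def)
        qed simp_all
        then show ?thesis using mod_range by (intro bexI[of _ "(0, 1, 0, E' mod int p)"]) (auto simp: N1_def)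
      next
        case False
        obtain i where i: "[A' * i = 1] (mod int p)" "\<not> int p dvd i" using inverse_mod_p[OF False] .
        \<comment> \<open>Keeping \<open>(0, 1)\<close> fixed means \<open>f = 0\<close> and
          \<open>a = 1\<close>. The remaining freedom scales \<open>A'\<close> to 1 by
          \<open>c\<close> and clears \<open>E'\<close> by \<open>b\<close>.\<close>
        have "qrel p 0 0 (0, 1, A', E') (0, 1, 1, 0)"
        proof (rule qrel_0_0_I[where a = 1 and b = "- (i * E')" and c = i and f = 0])
          have "[A' * i * E' = 1 * E'] (mod int p)" by (rule cong_scalar_right[OF i(1)])
          then show "[0 = A' * - (i * E') + E' * 1] (mod int p)"
            by (simp add: cong_iff_dvd_diff algebra_simps)
        qed (use i in \<open>simp_all add: cong_sym\<close>)
        then show ?thesis by (intro bexI[of _ "(0, 1, 1, 0)"]) (auto simp: N1_def)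
      qed
      then obtain w' where "w' \<in> N1" "qrel p 0 0 (0, 1, A', E') w'" by blast
      then show ?thesis using r1 by (meson UnI2 converse_rtranclp_into_rtranclp r_into_rtranclp)
    qed
  qed
  have n01: "\<not> [0 = 1] (mod int p)" "\<not> [1 = 0] (mod int p)" using p_gt by (simp_all add: cong_def)
  have un: "w = w'" if w: "w \<in> N0 \<union> N1" "w' \<in> N0 \<union> N1" and r: "qrel p 0 0 w w'" for w w'
  proof -
    obtain S T A E where we: "w = (S, T, A, E)" by (cases w)
    obtain S' T' A' E' where we': "w' = (S', T', A', E')" by (cases w')
    obtain a b c f where det: "\<not> int p dvd a * c - b * f" and S: "[S' = S * c + T * f] (mod int p)"
      and T: "[T' = S * b + T * a] (mod int p)" and A: "[A' = A * c + E * f] (mod int p)" and E: "[E' = A * b + E * a] (mod int p)"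
      using r unfolding we we' qrel.simps by auto
    have nn: "\<not> ([0 = f] (mod int p) \<and> [0 = a] (mod int p))" "\<not> ([0 = c] (mod int p) \<and> [0 = f] (mod int p))"
      using det by (auto simp: cong_iff_dvd_diff)
    have f0: "[E * f = 0] (mod int p)" if "[0 = f] (mod int p)" for E
      using cong_scalar_left[OF that, of E] by (simp add: cong_sym)
    consider "w = (0, 0, 0, 0)" | "w = (0, 0, 0, 1)" | "w = (0, 1, 1, 0)" | d where "w = (0, 1, 0, d)" "d \<in> {0..<int p}"
      using w(1) by (auto simp: N0_def N1_def)
    then show ?thesis
    proof cases
      case 1
      then have "[S' = 0] (mod int p)" "[T' = 0] (mod int p)" "[E' = 0] (mod int p)" using S T E we by simp_all
      then show ?thesis using w(2) n01 unfolding we' 1 by (auto simp: N0_def N1_def)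
    next
      case 2
      then have "[T' = 0] (mod int p)" "[A' = f] (mod int p)" "[E' = a] (mod int p)" using T A E we by simp_all
      then show ?thesis using w(2) n01 nn unfolding we' 2 by (auto simp: N0_def N1_def)
    next
      case 3
      then have e: "[S' = f] (mod int p)" "[T' = a] (mod int p)" "[A' = c] (mod int p)" using S T A we by simp_all
      then show ?thesis using w(2) n01 nn unfolding we' 3 by (auto simp: N0_def N1_def)
    next
      case (4 d)
      then have e: "[S' = f] (mod int p)" "[T' = a] (mod int p)" "[A' = d * f] (mod int p)" "[E' = d * a] (mod int p)"
        using S T A E we by simp_all
      consider "w' \<in> N0" | "w' = (0, 1, 1, 0)" | d' where "w' = (0, 1, 0, d')" "d' \<in> {0..<int p}"
        using w(2) by (auto simp: N1_def)
      then show ?thesis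
      proof cases
        case 1
        then show ?thesis using e nn unfolding we' by (auto simp: N0_def)
      next
        case 2
        then have "[0 = f] (mod int p)" "[1 = d * f] (mod int p)" using e we' by simp_all
        then have "[1 = 0] (mod int p)" using f0[of d] cong_trans by blast
        then show ?thesis using n01 by blast
      next
        case (3 d')
        then have "[1 = a] (mod int p)" "[d' = d * a] (mod int p)" using e we' by simp_all
        moreover from this have "[d * 1 = d * a] (mod int p)" by (intro cong_scalar_left)
        ultimately have "[d' = d] (mod int p)" unfolding cong_def by simp
        then have "d' = d" using 3(2) 4(2) by (rule cong_range)
        then show ?thesis using 3 4 by simp
      qed
    qed
  qed
  have "num_classes 0 0 (card N0 + 2 * card N1)"
  proof (rule num_classes_scale_quad[OF MK, where V = UNIV])
    fix w assume "qvalid 0 0 w"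
    moreover obtain t1 t2 d1 d2 where w: "w = (t1, t2, d1, d2)" by (cases w)
    ultimately have t: "[int p * t1 = 0] (mod int M)" "[int p * t2 = 0] (mod int M)"
      "[int p * d1 = 0] (mod int M)" "[int p * d2 = 0] (mod int M)" by (simp_all add: qvalid.simps)
    obtain a where a: "t1 = int K * a" using torsion_multiple[OF MK t(1)] .
    obtain b where b: "t2 = int K * b" using torsion_multiple[OF MK t(2)] .
    obtain c where c: "d1 = int K * c" using torsion_multiple[OF MK t(3)] .
    obtain d where d: "d2 = int K * d" using torsion_multiple[OF MK t(4)] .
    have "w = scale_quad K (a, b, c, d)" by (simp add: w scale_quad_def a b c d)
    then show "\<exists>w0\<in>UNIV. w = scale_quad K w0" by blast
  next
    fix w0 :: quad
    obtain a b c d where w: "w0 = (a, b, c, d)" by (cases w0)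
    have "[int p * (int K * x) = 0] (mod int M)" for x
      unfolding MK by (simp add: cong_0_iff mult.assoc[symmetric])
    then show "qvalid 0 0 (scale_quad K w0)" unfolding w scale_quad_def prod.case qvalid.simps by simp
  next
    show "w = w'" if "w \<in> N0 \<union> N1" "w' \<in> N0 \<union> N1" "qrel p 0 0 w w'" for w w' using un that .
  qed (use n01 ex0 in \<open>auto simp: N0_def N1_def\<close>)
  moreover have "card N0 + 2 * card N1 = 2 * p + 4"
  proof -
    have "card ((\<lambda>d. (0, 1, 0, d) :: quad) ` {0..<int p}) = p"
      by (subst card_image) (auto simp: inj_on_def)
    then have "card N1 = p + 1" unfolding N1_def by (subst card_insert_disjoint) auto
    then show ?thesis by (simp add: N0_def)
  qed
  ultimately show ?thesis by simp
qed

end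

section \<open>Quadratic residues, needed because the automorphisms with \<epsilon> = 1 scale by
  squares\<close>

lemma nonresidue_product:
  fixes A n :: int
  assumes p: "Factorial_Ring.prime p" "p > 2" and A: "\<not> int p dvd A" "\<not> QuadRes (int p) A"
    and n: "\<not> int p dvd n" "\<not> QuadRes (int p) n"
  shows "QuadRes (int p) (A * n)"
proof (rule ccontr)
  assume nq: "\<not> QuadRes (int p) (A * n)"
  have pn: "\<not> int p dvd A * n" using A(1) n(1) p(1) by (simp add: prime_dvd_mult_iff)
  have L: "Legendre A (int p) = - 1" "Legendre n (int p) = - 1" "Legendre (A * n) (int p) = - 1"
    using A n nq pn by (simp_all add: Legendre_def cong_0_iff)
  \<comment> \<open>Euler's criterion turns the three symbols into powers with a common exponent, so
    multiplying two of them contradicts the third: 1 would equal -1 modulo an odd prime.\<close>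
  let ?e = "(p - 1) div 2"
  have 1: "[- 1 = A ^ ?e] (mod int p)" "[- 1 = n ^ ?e] (mod int p)" "[- 1 = (A * n) ^ ?e] (mod int p)"
    using euler_criterion[OF p, of A] euler_criterion[OF p, of n] euler_criterion[OF p, of "A * n"] unfolding L by blast+
  have "[- 1 * - 1 = A ^ ?e * n ^ ?e] (mod int p)" by (rule cong_mult[OF 1(1,2)])
  then have "[1 = (A * n) ^ ?e] (mod int p)" by (simp add: power_mult_distrib)
  then have "[1 = - 1] (mod int p)" using 1(3) unfolding cong_def by simp
  then have "int p dvd 1 - (- 1)" unfolding cong_iff_dvd_diff .
  then have "int p dvd 2" by simp
  then have "int p \<le> 2" by (rule zdvd_imp_le) simp
  then show False using p(2) by simp
qed

text \<open>If every unit were a square, squaring would be a surjective and so injective self-map of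
  the finite set \<open>{1..<int p}\<close>, but 1 and \<open>p - 1\<close> have the same
  square.\<close>

lemma ex_nonresidue:
  assumes p: "Factorial_Ring.prime p" "p > 2"
  obtains n where "n \<in> {1..<int p}" "\<not> QuadRes (int p) n"
proof (rule ccontr)
  assume "\<not> thesis"
  then have all: "QuadRes (int p) n" if "n \<in> {1..<int p}" for n using that \<open>\<And>n. n \<in> {1..<int p} \<Longrightarrow> \<not> QuadRes (int p) n \<Longrightarrow> thesis\<close> by blast
  define f where "f x = x ^ 2 mod int p" for x :: int
  have "{1..<int p} \<subseteq> f ` {1..<int p}"
  proof
    fix n assume n: "n \<in> {1..<int p}"
    then obtain y where y: "[y ^ 2 = n] (mod int p)" using all unfolding QuadRes_def by blast
    have "f (y mod int p) = y ^ 2 mod int p" by (simp add: f_def power_mod)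
    then have fn: "f (y mod int p) = n" using y n by (simp add: cong_def)
    moreover have "y mod int p \<noteq> 0" using fn n p by (auto simp: f_def)
    moreover have "0 \<le> y mod int p" "y mod int p < int p" using p by simp_all
    ultimately show "n \<in> f ` {1..<int p}" by (intro image_eqI[of _ _ "y mod int p"]) auto
  qed
  then have "inj_on f {1..<int p}" by (intro finite_surj_inj) auto
  moreover have "f 1 = f (int p - 1)"
  proof -
    have "(int p - 1) ^ 2 - 1 ^ 2 = int p * (int p - 2)" by (simp add: power2_eq_square algebra_simps)
    then have "int p dvd (int p - 1) ^ 2 - 1 ^ 2" by simp
    then show ?thesis unfolding f_def by (metis mod_eq_dvd_iff)
  qed
  ultimately have "1 = int p - 1" using p(2) by (auto simp: inj_on_def)
  then show False using p(2) by simp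
qed

context brace_params
begin

text \<open>The factor 2 in \<open>2 * tri p = p * (p - 1)\<close> can be cancelled. This fails for
  \<open>p = 2\<close>, where \<open>tri 2 = 1\<close>, and is why that prime is counted
  separately.\<close>

lemma tri_p_odd:
  assumes "p \<noteq> 2"
  shows "int p dvd tri (int p)"
proof -
  have "int p dvd 2 * tri (int p)" unfolding two_tri by simp
  moreover have "\<not> int p dvd 2" using zdvd_imp_le[of "int p" 2] p_gt assms by auto
  ultimately show ?thesis by (simp only: prime_p_dvd_mult) blast
qed

text \<open>Here \<open>c = a^2\<close>, so \<open>T\<close> is scaled by \<open>a\<close>,
  \<open>A\<close> by \<open>a^2\<close>, and \<open>E\<close> can be cleared by \<open>b\<close> as
  soon as \<open>A\<close> is nonzero. For \<open>T = 0\<close> the orbits are zero,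
  \<open>A = 0\<close> with \<open>E = 1\<close>, and two square classes of \<open>A\<close>: weight
  4. Normalizing \<open>T = 1\<close> forces \<open>a = 1\<close> and leaves \<open>p\<close> values
  of \<open>E\<close> with \<open>A = 0\<close> and \<open>p - 1\<close> nonzero values of
  \<open>A\<close>, each of weight 2.\<close>

lemma num_classes_0_1_odd:
  assumes MK: "M = p * K" and p2: "p \<noteq> 2"
  shows "num_classes 0 1 (4 * p + 2)"
proof -
  have pg: "p > 2" using p2 prime_gt_1_nat[OF p] by linarith
  obtain n where n: "n \<in> {1..<int p}" "\<not> QuadRes (int p) n" using ex_nonresidue[OF p pg] .
  have np: "\<not> int p dvd n" using n(1) by (rule not_dvd_range)
  have tp: "int p dvd tri (int p)" by (rule tri_p_odd[OF p2])
  define V :: "quad set" where "V = {(S, T, A, E). int p dvd S}"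
  define N0 :: "quad set" where "N0 = {(0, 0, 0, 0), (0, 0, 0, 1), (0, 0, 1, 0), (0, 0, n, 0)}"
  define N1 :: "quad set" where "N1 = (\<lambda>E. (0, 1, 0, E)) ` {0..<int p} \<union> (\<lambda>A. (0, 1, A, 0)) ` {1..<int p}"
  have relI: "qrel p 0 1 (S, T, A, E) (0, T', A', E')"
    if "int p dvd S" "\<not> int p dvd a" "[T' = T * a] (mod int p)" "[A' = A * a ^ 2] (mod int p)"
      "[E' = A * (b - tri a) + E * a] (mod int p)" for S T A E T' A' E' a b
  proof -
    have "[0 = S * x] (mod int p)" for x using that(1) by (simp add: cong_iff_dvd_diff)
    moreover have "[T' = S * b + T * a] (mod int p)"
    proof -
      have "int p dvd T' - T * a" using that(3) unfolding cong_iff_dvd_diff .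
      then have "int p dvd (T' - T * a) - S * b" using dvd_mult2[OF that(1)] by (rule dvd_diff)
      then show ?thesis by (simp add: cong_iff_dvd_diff algebra_simps)
    qed
    ultimately show ?thesis unfolding qrel.simps using that(2,4,5)
      by (intro exI[of _ a] exI[of _ b] exI[of _ "a ^ 2"] exI[of _ 0]) (simp add: prime_p_dvd_mult power2_eq_square)
  qed
  have relE: "\<exists>a b. \<not> int p dvd a \<and> [T' = T * a] (mod int p) \<and> [A' = A * a ^ 2] (mod int p) \<and>
      [E' = A * (b - tri a) + E * a] (mod int p)"
    if r: "qrel p 0 1 (0, T, A, E) (0, T', A', E')" for T A E T' A' E'
  proof -
    obtain a b c f where f: "f = 0" and ea: "[a ^ 2 = c] (mod int p)" and det: "\<not> int p dvd a * c - b * f"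
      and T: "[T' = T * a] (mod int p)" and A: "[A' = A * c] (mod int p)"
      and E: "[E' = A * (b - tri a) + E * a] (mod int p)"
      using r unfolding qrel.simps by auto
    have "[A * a ^ 2 = A * c] (mod int p)" by (rule cong_scalar_left[OF ea])
    then have "[A' = A * a ^ 2] (mod int p)" using A unfolding cong_def by simp
    moreover have "\<not> int p dvd a" using det f by auto
    ultimately show ?thesis using T E by blast
  qed
  \<comment> \<open>The offset \<open>tri a\<close> is a mere shift of \<open>b\<close>; for
    invertible \<open>A\<close> the equation is linear in \<open>b\<close>.\<close>
  have solve: "\<exists>b. [0 = A * (b - tri a) + E * a] (mod int p)" if A: "\<not> int p dvd A" for A E a
  proof -
    obtain i where i: "[A * i = 1] (mod int p)" using inverse_mod_p[OF A] by blast
    have "[A * i * (E * a) = 1 * (E * a)] (mod int p)" by (rule cong_scalar_right[OF i])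
    then have "int p dvd 1 * (E * a) - A * i * (E * a)" by (simp add: cong_iff_dvd_diff dvd_diff_commute)
    then have "int p dvd A * ((tri a - i * (E * a)) - tri a) + E * a" by (simp add: algebra_simps)
    then have "[0 = A * ((tri a - i * (E * a)) - tri a) + E * a] (mod int p)"
      by (subst cong_sym_eq) (simp add: cong_0_iff)
    then show ?thesis by blast
  qed
  have square_class: "\<exists>a. \<not> int p dvd a \<and> ([1 = A * a ^ 2] (mod int p) \<or> [n = A * a ^ 2] (mod int p))"
    if A: "\<not> int p dvd A" for A
  proof (cases "QuadRes (int p) A")
    case True
    then obtain y where y: "[y ^ 2 = A] (mod int p)" unfolding QuadRes_def by blast
    have "\<not> int p dvd y"
    proof
      assume "int p dvd y"
      then have "int p dvd y ^ 2" by (simp add: power2_eq_square)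
      then show False using A cong_dvd_iff[OF y] by blast
    qed
    then obtain i where i: "[y * i = 1] (mod int p)" "\<not> int p dvd i" using inverse_mod_p by blast
    have "[A * i ^ 2 = y ^ 2 * i ^ 2] (mod int p)" by (rule cong_scalar_right[OF cong_sym[OF y]])
    moreover have "[(y * i) ^ 2 = 1 ^ 2] (mod int p)" by (rule cong_pow[OF i(1)])
    ultimately have "[1 = A * i ^ 2] (mod int p)" unfolding cong_def by (simp add: power_mult_distrib)
    then show ?thesis using i(2) by blast
  next
    case False
    then obtain y where y: "[y ^ 2 = A * n] (mod int p)"
      using nonresidue_product[OF p pg A _ np n(2)] unfolding QuadRes_def by blast
    obtain i where i: "[A * i = 1] (mod int p)" "\<not> int p dvd i" using inverse_mod_p[OF A] .
    have "\<not> int p dvd y"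
    proof
      assume "int p dvd y"
      then have "int p dvd y ^ 2" by (simp add: power2_eq_square)
      then show False using A np cong_dvd_iff[OF y] by (simp add: prime_p_dvd_mult)
    qed
    then have "\<not> int p dvd y * i" using i(2) by (simp add: prime_p_dvd_mult)
    \<comment> \<open>For a nonresidue \<open>A\<close> the product \<open>A n\<close> is a square
      \<open>y^2\<close>, so the square class of \<open>n\<close> is reached with the factor
      \<open>y / A\<close>.\<close>
    moreover have "[n = A * (y * i) ^ 2] (mod int p)"
    proof -
      have "[y ^ 2 * (A * i * i) = A * n * (A * i * i)] (mod int p)" by (rule cong_scalar_right[OF y])
      moreover have "[(A * i) * (A * i) * n = 1 * 1 * n] (mod int p)" by (intro cong_mult i(1) cong_refl)
      moreover have "A * n * (A * i * i) = (A * i) * (A * i) * n" "y ^ 2 * (A * i * i) = A * (y * i) ^ 2"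
        by (simp_all add: power2_eq_square)
      ultimately show ?thesis unfolding cong_def by simp
    qed
    ultimately show ?thesis by blast
  qed
  have n01: "\<not> [0 = 1] (mod int p)" "\<not> [1 = 0] (mod int p)" "\<not> [n = 0] (mod int p)" "\<not> [0 = n] (mod int p)"
    using p_gt np by (simp_all add: cong_def dvd_eq_mod_eq_0)
  have sq1: "\<not> [n = a ^ 2] (mod int p)" for a using n(2) unfolding QuadRes_def by (metis cong_sym)
  have sq2: "\<not> [1 = n * a ^ 2] (mod int p)" if na: "\<not> int p dvd a" for a
  proof
    assume e: "[1 = n * a ^ 2] (mod int p)"
    obtain i where i: "[a * i = 1] (mod int p)" using inverse_mod_p[OF na] by blast
    have "[1 * i ^ 2 = n * a ^ 2 * i ^ 2] (mod int p)" by (rule cong_scalar_right[OF e])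
    moreover have "[n * (a * i) ^ 2 = n * 1 ^ 2] (mod int p)" by (intro cong_mult cong_pow cong_refl i)
    ultimately have "[n = i ^ 2] (mod int p)" unfolding cong_def by (simp add: power_mult_distrib mult.assoc)
    then show False using sq1 by blast
  qed
  have "num_classes 0 1 (card N0 + 2 * card N1)"
  proof (rule num_classes_scale_quad[OF MK, where V = V])
    fix w assume "qvalid 0 1 w"
    moreover obtain t1 t2 d1 d2 where w: "w = (t1, t2, d1, d2)" by (cases w)
    ultimately have t: "[t1 = 0] (mod int M)" "[int p * t1 = 0] (mod int M)" "[int p * t2 = 0] (mod int M)"
      "[int p * d1 = 0] (mod int M)" "[int p * d2 = tri (int p) * d1] (mod int M)" by (simp_all add: qvalid.simps)
    have "int M dvd tri (int p) * d1" by (rule dvd_M_of_p[OF t(4) tp])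
    then have t5: "[int p * d2 = 0] (mod int M)" using t(5) by (simp add: cong_dvd_iff cong_0_iff)
    obtain a where a: "t1 = int K * a" using torsion_multiple[OF MK t(2)] .
    obtain b where b: "t2 = int K * b" using torsion_multiple[OF MK t(3)] .
    obtain c where c: "d1 = int K * c" using torsion_multiple[OF MK t(4)] .
    obtain d where d: "d2 = int K * d" using torsion_multiple[OF MK t5] .
    have "[a = 0] (mod int p)" using t(1) cong_K_iff[OF MK, of a 0] unfolding a by simp
    then have "(a, b, c, d) \<in> V" by (simp add: V_def cong_0_iff)
    moreover have "w = scale_quad K (a, b, c, d)" by (simp add: w scale_quad_def a b c d)
    ultimately show "\<exists>w0\<in>V. w = scale_quad K w0" by blast
  next
    fix w0 assume "w0 \<in> V"
    then obtain a b c d where w: "w0 = (a, b, c, d)" "int p dvd a" by (auto simp: V_def)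
    have pK: "[int p * (int K * x) = 0] (mod int M)" for x
      unfolding MK by (simp add: cong_0_iff mult.assoc[symmetric])
    have "[int K * a = 0] (mod int M)" using w(2) cong_K_iff[OF MK, of a 0] by (simp add: cong_0_iff)
    moreover have "[tri (int p) * (int K * c) = 0] (mod int M)" using dvd_M_of_p[OF pK tp] by (simp add: cong_0_iff)
    then have "[int p * (int K * d) = tri (int p) * (int K * c)] (mod int M)" using pK[of d] unfolding cong_def by simp
    ultimately show "qvalid 0 1 (scale_quad K w0)" unfolding w scale_quad_def prod.case qvalid.simps using pK by simp
  next
    fix w0 assume "w0 \<in> V"
    then obtain S T A E where w0: "w0 = (S, T, A, E)" and S: "int p dvd S" by (auto simp: V_def)
    have "\<exists>w'\<in>N0 \<union> N1. qrel p 0 1 w0 w'"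
    proof (cases "int p dvd T")
      case True
      then have T: "[0 = T * x] (mod int p)" for x by (simp add: cong_iff_dvd_diff)
      show ?thesis
      proof (cases "int p dvd A")
        case True
        then have A: "[0 = A * x] (mod int p)" for x by (simp add: cong_iff_dvd_diff)
        show ?thesis
        proof (cases "int p dvd E")
          case True
          have "qrel p 0 1 w0 (0, 0, 0, 0)" unfolding w0
            by (rule qrel_of_cong) (use S T[of 1] A[of 1] True in \<open>simp_all add: cong_iff_dvd_diff\<close>)
          then show ?thesis by (intro bexI[of _ "(0, 0, 0, 0)"]) (auto simp: N0_def)
        next
          case False
          obtain i where i: "[E * i = 1] (mod int p)" "\<not> int p dvd i" using inverse_mod_p[OF False] .
          have "[1 = A * (tri i - tri i) + E * i] (mod int p)" using i(1) by (simp add: cong_sym)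
          then have "qrel p 0 1 w0 (0, 0, 0, 1)" unfolding w0 by (rule relI[OF S i(2) T A])
          then show ?thesis by (intro bexI[of _ "(0, 0, 0, 1)"]) (auto simp: N0_def)
        qed
      next
        case False
        obtain a where a: "\<not> int p dvd a" "[1 = A * a ^ 2] (mod int p) \<or> [n = A * a ^ 2] (mod int p)"
          using square_class[OF False] by blast
        obtain b where b: "[0 = A * (b - tri a) + E * a] (mod int p)" using solve[OF False] by blast
        from a(2) show ?thesis
        proof
          assume "[1 = A * a ^ 2] (mod int p)"
          then have "qrel p 0 1 w0 (0, 0, 1, 0)" unfolding w0 using b by (rule relI[OF S a(1) T])
          then show ?thesis by (intro bexI[of _ "(0, 0, 1, 0)"]) (auto simp: N0_def)
        next
          assume "[n = A * a ^ 2] (mod int p)"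
          then have "qrel p 0 1 w0 (0, 0, n, 0)" unfolding w0 using b by (rule relI[OF S a(1) T])
          then show ?thesis by (intro bexI[of _ "(0, 0, n, 0)"]) (auto simp: N0_def)
        qed
      qed
    next
      case False
      obtain a where a: "[T * a = 1] (mod int p)" "\<not> int p dvd a" using inverse_mod_p[OF False] .
      have T1: "[1 = T * a] (mod int p)" using a(1) by (rule cong_sym)
      show ?thesis
      proof (cases "int p dvd A")
        case True
        then have A: "[0 = A * x] (mod int p)" for x by (simp add: cong_iff_dvd_diff)
        have "[(E * a) mod int p = A * (tri a - tri a) + E * a] (mod int p)" by (simp add: cong_def)
        then have "qrel p 0 1 w0 (0, 1, 0, (E * a) mod int p)" unfolding w0 by (rule relI[OF S a(2) T1 A])
        then show ?thesis using mod_range[of "E * a"] by (intro bexI[of _ "(0, 1, 0, (E * a) mod int p)"]) (auto simp: N1_def)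
      next
        case False
        obtain b where b: "[0 = A * (b - tri a) + E * a] (mod int p)" using solve[OF False] by blast
        have "\<not> int p dvd A * a ^ 2" using False a(2) by (simp add: prime_p_dvd_mult power2_eq_square)
        then have r: "(A * a ^ 2) mod int p \<in> {1..<int p}" by (rule mod_range_pos)
        have "[(A * a ^ 2) mod int p = A * a ^ 2] (mod int p)" by (simp add: cong_def)
        then have "qrel p 0 1 w0 (0, 1, (A * a ^ 2) mod int p, 0)" unfolding w0 using b by (rule relI[OF S a(2) T1])
        then show ?thesis using r by (intro bexI[of _ "(0, 1, (A * a ^ 2) mod int p, 0)"]) (auto simp: N1_def)
      qed
    qed
    then show "\<exists>w'\<in>N0 \<union> N1. (qrel p 0 1)\<^sup>*\<^sup>* w0 w'" by blast
  next
    fix w w' assume w: "w \<in> N0 \<union> N1" "w' \<in> N0 \<union> N1" and r: "qrel p 0 1 w w'"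
    obtain T A E where we: "w = (0, T, A, E)" using w(1) by (auto simp: N0_def N1_def)
    obtain T' A' E' where we': "w' = (0, T', A', E')" using w(2) by (auto simp: N0_def N1_def)
    obtain a b where a: "\<not> int p dvd a" and T: "[T' = T * a] (mod int p)" and A: "[A' = A * a ^ 2] (mod int p)"
      and E: "[E' = A * (b - tri a) + E * a] (mod int p)" using relE r unfolding we we' by blast
    have a0: "\<not> [0 = a] (mod int p)" using a by (simp add: cong_iff_dvd_diff)
    have a2: "\<not> [0 = a ^ 2] (mod int p)" using a by (simp add: cong_iff_dvd_diff prime_p_dvd_mult power2_eq_square)
    have na2: "\<not> [0 = n * a ^ 2] (mod int p)" using a np by (simp add: cong_iff_dvd_diff prime_p_dvd_mult power2_eq_square)
    have T01: "T \<in> {0, 1}" "T' \<in> {0, 1}" using w unfolding we we' by (auto simp: N0_def N1_def)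
    have TT: "T' = T" using T T01 a0 n01 by auto
    show "w = w'"
    proof (cases "T = 0")
      case True
      have w0: "(A, E) \<in> {(0, 0), (0, 1), (1, 0), (n, 0)}" "(A', E') \<in> {(0, 0), (0, 1), (1, 0), (n, 0)}"
        using w unfolding we we' TT True by (auto simp: N0_def N1_def)
      consider "A = 0" "E = 0" | "A = 0" "E = 1" | "A = 1" "E = 0" | "A = n" "E = 0" using w0(1) by auto
      then have "A' = A \<and> E' = E"
      proof cases
        case 1
        then have "[A' = 0] (mod int p)" "[E' = 0] (mod int p)" using A E by simp_all
        then show ?thesis using w0(2) n01 unfolding 1 by auto
      next
        case 2
        then have "[A' = 0] (mod int p)" "[E' = a] (mod int p)" using A E by simp_all
        then show ?thesis using w0(2) n01 a0 unfolding 2 by auto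
      next
        case 3
        then have "[A' = a ^ 2] (mod int p)" using A by simp
        then show ?thesis using w0(2) a2 sq1 unfolding 3 by auto
      next
        case 4
        then have "[A' = n * a ^ 2] (mod int p)" using A by simp
        then show ?thesis using w0(2) na2 sq2[OF a] unfolding 4 by auto
      qed
      then show ?thesis using TT we we' by simp
    next
      case False
      then have T1: "T = 1" using T01 by simp
      have a1: "[1 = a] (mod int p)" using T unfolding TT T1 by simp
      have "[A * 1 ^ 2 = A * a ^ 2] (mod int p)" by (intro cong_mult cong_pow cong_refl a1)
      then have "[A' = A] (mod int p)" using A unfolding cong_def by simp
      moreover have w1: "(A = 0 \<and> E \<in> {0..<int p}) \<or> (A \<in> {1..<int p} \<and> E = 0)" "(A' = 0 \<and> E' \<in> {0..<int p}) \<or> (A' \<in> {1..<int p} \<and> E' = 0)"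
        using w unfolding we we' TT T1 by (auto simp: N0_def N1_def)
      ultimately have AA: "A' = A" by (intro cong_range) auto
      have "E' = E"
      proof (cases "A = 0")
        case True
        have "[E * 1 = E * a] (mod int p)" by (rule cong_scalar_left[OF a1])
        then have "[E' = E] (mod int p)" using E unfolding True cong_def by simp
        then show ?thesis using w1 AA True by (intro cong_range) auto
      qed (use w1 AA in auto)
      then show ?thesis using TT AA we we' by simp
    qed
  qed (use n01 in \<open>auto simp: N0_def N1_def V_def\<close>)
  moreover have "card N0 + 2 * card N1 = 4 * p + 2"
  proof -
    have "n \<noteq> 1" using sq1[of 1] by auto
    moreover have "n \<noteq> 0" using n01 by auto
    ultimately have "card N0 = 4" by (simp add: N0_def)
    moreover have "card N1 = card ((\<lambda>E. (0, 1, 0, E) :: quad) ` {0..<int p}) + card ((\<lambda>A. (0, 1, A, 0) :: quad) ` {1..<int p})"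
      unfolding N1_def by (rule card_Un_disjoint) auto
    moreover have "card ((\<lambda>E. (0, 1, 0, E) :: quad) ` {0..<int p}) = p" by (subst card_image) (auto simp: inj_on_def)
    moreover have "nat (int p - 1) = p - 1" by simp
    then have "card ((\<lambda>A. (0, 1, A, 0) :: quad) ` {1..<int p}) = p - 1" by (subst card_image) (auto simp: inj_on_def)
    ultimately show ?thesis using pg by simp
  qed
  ultimately show ?thesis by simp
qed

text \<open>For \<open>p = 2\<close> the second circle power of \<open>e\<close> is
  \<open>(1 + tri 2) z = 0\<close>, so all exponents are 2-torsion. The only unit is 1, hence the
  parities of \<open>T\<close> and \<open>A\<close> are invariant, and that of \<open>E\<close> is
  invariant when \<open>A\<close> is even and can be cleared when \<open>A\<close> is odd. This
  gives 3 orbits for each parity of \<open>T\<close>, and \<open>3 + 2 * 3 = 9\<close>.\<close>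

lemma num_classes_1_1_two:
  assumes MK: "M = p * K" and p2: "p = 2"
  shows "num_classes 1 1 9"
proof -
  define V :: "quad set" where "V = {(S, T, A, E). 2 dvd S}"
  define N0 :: "quad set" where "N0 = {(0, 0, 0, 0), (0, 0, 0, 1), (0, 0, 1, 0)}"
  define N1 :: "quad set" where "N1 = {(0, 1, 0, 0), (0, 1, 0, 1), (0, 1, 1, 0)}"
  have ip: "int p = 2" using p2 by simp
  have c2: "[x = y] (mod int p) \<longleftrightarrow> (even x \<longleftrightarrow> even y)" for x y
    unfolding ip by (simp add: cong_iff_dvd_diff)
  have tri_2: "tri 2 = 1" by (simp add: tri_def)
  then have tri2: "tri (int p) = 1" unfolding ip .
  have "num_classes 1 1 (card N0 + 2 * card N1)"
  proof (rule num_classes_scale_quad[OF MK, where V = V])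
    fix w assume "qvalid 1 1 w"
    moreover obtain t1 t2 d1 d2 where w: "w = (t1, t2, d1, d2)" by (cases w)
    ultimately have t: "[t1 = 0] (mod int M)" "[int p * t1 = 0] (mod int M)" "[int p * t2 = t1] (mod int M)"
      "[int p * d1 = 0] (mod int M)" "[int p * d2 = int p * d1] (mod int M)" by (simp_all add: qvalid.simps tri_2 ip)
    have t3: "[int p * t2 = 0] (mod int M)" by (rule cong_trans[OF t(3,1)])
    have t5: "[int p * d2 = 0] (mod int M)" by (rule cong_trans[OF t(5,4)])
    obtain a where a: "t1 = int K * a" using torsion_multiple[OF MK t(2)] .
    obtain b where b: "t2 = int K * b" using torsion_multiple[OF MK t3] .
    obtain c where c: "d1 = int K * c" using torsion_multiple[OF MK t(4)] .
    obtain d where d: "d2 = int K * d" using torsion_multiple[OF MK t5] .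
    have "[a = 0] (mod int p)" using t(1) cong_K_iff[OF MK, of a 0] unfolding a by simp
    then have "(a, b, c, d) \<in> V" by (simp add: V_def c2)
    moreover have "w = scale_quad K (a, b, c, d)" by (simp add: w scale_quad_def a b c d)
    ultimately show "\<exists>w0\<in>V. w = scale_quad K w0" by blast
  next
    fix w0 assume "w0 \<in> V"
    then obtain a b c d where w: "w0 = (a, b, c, d)" "even a" by (auto simp: V_def)
    have pK: "[int p * (int K * x) = int p * (int K * y)] (mod int M)" for x y
      unfolding MK by (simp add: cong_iff_dvd_diff right_diff_distrib[symmetric] mult.assoc[symmetric])
    have K0: "[int K * a = 0] (mod int M)" using w(2) cong_K_iff[OF MK, of a 0] by (simp add: c2)
    moreover have "[int p * (int K * b) = int K * a] (mod int M)"
      using cong_trans[OF pK[of b 0]] cong_sym[OF K0] by simp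
    ultimately show "qvalid 1 1 (scale_quad K w0)" unfolding w scale_quad_def prod.case qvalid.simps tri2
      using pK[of a 0] pK[of c 0] pK[of d c] by (simp add: ip)
  next
    fix w0 assume "w0 \<in> V"
    then obtain S T A E where w0: "w0 = (S, T, A, E)" and S: "even S" by (auto simp: V_def)
    have "\<exists>w'\<in>N0 \<union> N1. qrel p 1 1 w0 w'"
    proof (cases "even A")
      case True
      have "qrel p 1 1 w0 (0, T mod 2, 0, E mod 2)" unfolding w0
        by (rule qrel_of_cong) (use S True in \<open>simp_all add: c2\<close>)
      moreover have "(0, T mod 2, 0, E mod 2) \<in> N0 \<union> N1" by (cases "even T"; cases "even E") (auto simp: N0_def N1_def mod2_eq_if)
      ultimately show ?thesis by blast
    next
      case False
      \<comment> \<open>The witness \<open>b = - E\<close> gives the last entry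
        \<open>- A E + E\<close>, which is even because \<open>A\<close> is odd.\<close>
      have "qrel p 1 1 w0 (0, T mod 2, 1, 0)" unfolding w0 qrel.simps c2 unfolding ip
        using S False by (intro exI[of _ 1] exI[of _ "- E"] exI[of _ 1] exI[of _ 0]) simp
      moreover have "(0, T mod 2, 1, 0) \<in> N0 \<union> N1" by (cases "even T") (auto simp: N0_def N1_def mod2_eq_if)
      ultimately show ?thesis by blast
    qed
    then show "\<exists>w'\<in>N0 \<union> N1. (qrel p 1 1)\<^sup>*\<^sup>* w0 w'" by blast
  next
    fix w w' assume w: "w \<in> N0 \<union> N1" "w' \<in> N0 \<union> N1" and r: "qrel p 1 1 w w'"
    obtain T A E where we: "w = (0, T, A, E)" using w(1) by (auto simp: N0_def N1_def)
    obtain T' A' E' where we': "w' = (0, T', A', E')" using w(2) by (auto simp: N0_def N1_def)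
    obtain a b c where det: "odd a" "odd c" and T: "[T' = T * a] (mod int p)" and A: "[A' = A * c] (mod int p)"
      and E: "[E' = A * (b - tri a) + E * a] (mod int p)"
      using r unfolding we we' qrel.simps by (auto simp: ip)
    have e: "even T' \<longleftrightarrow> even T" "even A' \<longleftrightarrow> even A" "even A \<Longrightarrow> even E' \<longleftrightarrow> even E"
      using T A E det unfolding c2 by simp_all
    show "w = w'" using w e unfolding we we' by (auto simp: N0_def N1_def)
  qed (use p_gt in \<open>auto simp: N0_def N1_def V_def c2\<close>)
  then show ?thesis by (simp add: N0_def N1_def)
qed

end

section \<open>The root of unity, and the final sums\<close>

lemma brace_params_exist:
  assumes p: "Factorial_Ring.prime p" and q: "Factorial_Ring.prime q" and qp: "q > p + 1"
  obtains \<zeta> where "brace_params p q (gcd (p ^ 2) (q - 1)) \<zeta>"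
proof -
  have q1: "q > 1" by (rule prime_gt_1_nat[OF q])
  define M where "M = gcd (p ^ 2) (q - 1)"
  define r where "r = (q - 1) div M"
  have M0: "M > 0" using q1 by (simp add: M_def)
  have Mr: "q - 1 = M * r" by (simp add: r_def M_def)
  have r0: "r > 0" using Mr q1 by (cases r) auto
  obtain g where g: "residue_primroot q g" using prime_primitive_root_exists[of q] q q1 by blast
  have gq: "coprime q g" "ord q g = q - 1" using g q by (auto simp: residue_primroot_def totient_prime)
  \<comment> \<open>For a primitive root \<open>g\<close> modulo \<open>q\<close>, the power with
    exponent \<open>r = (q - 1) / M\<close> has order exactly \<open>M\<close>.\<close>
  define \<zeta> where "\<zeta> = int g ^ r"
  have ge: "[g ^ a = g ^ b] (mod q) \<longleftrightarrow> [a = b] (mod q - 1)" for a b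
    using order_divides_expdiff[OF gq(1), of a b] gq(2) by simp
  have gi: "[int g ^ a = int g ^ b] (mod int q) \<longleftrightarrow> [a = b] (mod q - 1)" for a b
    using ge[of a b] by (metis cong_int_iff of_nat_power)
  have zeta: "[\<zeta> ^ k = \<zeta> ^ l] (mod int q) \<longleftrightarrow> [k = l] (mod M)" for k l
  proof -
    have "[\<zeta> ^ k = \<zeta> ^ l] (mod int q) \<longleftrightarrow> [r * k = r * l] (mod r * M)"
      unfolding \<zeta>_def power_mult[symmetric] gi Mr by (simp add: mult.commute)
    also have "\<dots> \<longleftrightarrow> [k = l] (mod M)" using r0 by (simp add: cong_def mult_mod_right[symmetric])
    finally show ?thesis .
  qed
  have root: "\<exists>k::nat. [x = \<zeta> ^ k] (mod int q)" if x: "[x ^ (p ^ 2) = 1] (mod int q)" for x :: int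
  proof -
    define y where "y = nat (x mod int q)"
    have yq: "int y = x mod int q" using q1 by (simp add: y_def)
    have xy: "[x = int y] (mod int q)" unfolding yq by (simp add: cong_def)
    have "[int y ^ (p ^ 2) = x ^ (p ^ 2)] (mod int q)" by (rule cong_pow[OF cong_sym[OF xy]])
    then have yp: "[int y ^ (p ^ 2) = 1] (mod int q)" using x by (rule cong_trans)
    have "\<not> q dvd y"
    proof
      assume "q dvd y"
      then have "int q dvd int y ^ (p ^ 2)" using prime_gt_0_nat[OF p]
        by (metis dvd_power dvd_trans of_nat_dvd_iff zero_less_power)
      then have "int q dvd 1" using cong_dvd_iff[OF yp] by blast
      then show False using q1 by simp
    qed
    moreover have "y < q" using q1 unfolding y_def by (simp add: nat_less_iff)
    ultimately have "y \<in> totatives q" using q prime_imp_coprime[OF q, of y]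
      by (auto simp: totatives_def coprime_commute intro!: Nat.gr0I)
    then obtain j where j: "y = g ^ j mod q"
      using residue_primroot_is_generator[OF q1 g] by (auto simp: bij_betw_def)
    have yj: "[int y = int g ^ j] (mod int q)"
      unfolding j by (simp add: cong_def zmod_int)
    have "[int g ^ (j * p ^ 2) = int g ^ 0] (mod int q)"
      using cong_trans[OF cong_sym[OF cong_pow[OF yj, of "p ^ 2"]] yp] by (simp add: power_mult)
    then have Mrj: "M * r dvd j * p ^ 2" unfolding gi Mr by (simp add: cong_0_iff)
    have "M dvd p ^ 2" by (simp add: M_def)
    then obtain s where s: "p ^ 2 = M * s" by (rule dvdE)
    have "M * r dvd M * (j * s)" using Mrj unfolding s by (simp only: mult.left_commute)
    then have "r dvd j * s" using M0 by (simp only: nat_mult_dvd_cancel1)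
    \<comment> \<open>With \<open>x = g ^ j\<close>, the root equation says that
      \<open>(q - 1) = M r\<close> divides \<open>j p^2 = j M s\<close>. As \<open>M\<close> is the
      greatest common divisor, \<open>r\<close> and \<open>s\<close> are coprime, so
      \<open>r\<close> divides \<open>j\<close> and \<open>x\<close> is a power of
      \<open>\<zeta>\<close>.\<close>
    moreover have "coprime r s"
    proof -
      have "gcd (M * s) (M * r) = M" using M_def s Mr by presburger
      then have "M * gcd s r = M * 1" by (simp only: gcd_mult_distrib_nat mult_1_right)
      then have "gcd s r = 1" using M0 by (metis mult_cancel1 less_irrefl)
      then show ?thesis by (simp only: coprime_iff_gcd_eq_1 gcd.commute)
    qed
    ultimately have "r dvd j" by (simp add: coprime_dvd_mult_left_iff)
    then obtain k where "j = r * k" by (rule dvdE)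
    then have "[x = \<zeta> ^ k] (mod int q)" using cong_trans[OF xy yj] by (simp add: \<zeta>_def power_mult)
    then show ?thesis by blast
  qed
  have "M dvd p ^ 2" by (simp add: M_def)
  then have "brace_params p q M \<zeta>"
    by (intro brace_params.intro p q qp M0 zeta root)
  then show thesis using that unfolding M_def by blast
qed

text \<open>The cases are \<open>M = 1\<close>, \<open>M = p\<close> and \<open>M = p^2\<close>. For
  \<open>M = 1\<close> each of the four braces \<open>P\<close> contributes 1; otherwise the totals
  are \<open>(2p + 4) + (4p + 2) + (2p + 2) + p (2p - 1)\<close> and
  \<open>(2p + 4) + (4p + 2) + (2p^2 + 4p + 1) + (2p - 1)^2\<close>.\<close>

lemma num_skew_braces_odd:
  assumes p: "Factorial_Ring.prime p" and q: "Factorial_Ring.prime q" and qp: "q > p + 1" and p2: "p > 2"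
  shows "\<not> [q = 1] (mod p) \<Longrightarrow> num_skew_braces (p ^ 2 * q) = 4"
    and "[q = 1] (mod p) \<Longrightarrow> \<not> [q = 1] (mod p ^ 2) \<Longrightarrow> num_skew_braces (p ^ 2 * q) = 2 * p ^ 2 + 7 * p + 8"
    and "[q = 1] (mod p ^ 2) \<Longrightarrow> num_skew_braces (p ^ 2 * q) = 6 * p ^ 2 + 6 * p + 8"
proof -
  obtain \<zeta> where bp: "brace_params p q (gcd (p ^ 2) (q - 1)) \<zeta>" using brace_params_exist[OF p q qp] .
  interpret brace_params p q "gcd (p ^ 2) (q - 1)" \<zeta> by (rule bp)
  have q1: "q > 1" by (rule prime_gt_1_nat[OF q])
  have cd: "[q = 1] (mod m) \<longleftrightarrow> m dvd q - 1" for m using q1 by (simp add: cong_altdef_nat)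
  show "num_skew_braces (p ^ 2 * q) = 4" if "\<not> [q = 1] (mod p)"
  proof -
    have "coprime p (q - 1)" using that p unfolding cd by (simp add: prime_imp_coprime)
    then have "gcd (p ^ 2) (q - 1) = 1" by simp
    note num_classes_trivial[OF this]
    then show ?thesis using num_skew_braces_sum[of 1 1 1 1] by simp
  qed
  have main: "num_skew_braces (p ^ 2 * q) = (2 * p + 4) + (4 * p + 2) +
      (if gcd (p ^ 2) (q - 1) = p then 2 + 2 * p else 2 * p ^ 2 + 4 * p + 1) + card unit_reps * (2 * p - 1)"
    if MK: "gcd (p ^ 2) (q - 1) = p * K" for K
  proof (rule num_skew_braces_sum)
    show "num_classes 0 0 (2 * p + 4)" by (rule num_classes_0_0[OF MK])
    show "num_classes 0 1 (4 * p + 2)" by (rule num_classes_0_1_odd[OF MK]) (use p2 in simp)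
    show "num_classes 1 0 (if gcd (p ^ 2) (q - 1) = p then 2 + 2 * p else 2 * p ^ 2 + 4 * p + 1)"
      by (rule num_classes_1_0[OF MK])
    have "[1 + tri (int p) = 1] (mod int p)" using tri_p_odd p2 by (simp add: cong_iff_dvd_diff)
    then show "num_classes 1 1 (card unit_reps * (2 * p - 1))" by (intro num_classes_1[OF MK]) auto
  qed
  \<comment> \<open>Writing \<open>p\<close> as a successor removes the truncated subtraction in
    \<open>2 * p - 1\<close> before the polynomials are compared.\<close>
  obtain m where m: "p = Suc m" using p2 by (cases p) auto
  show "num_skew_braces (p ^ 2 * q) = 2 * p ^ 2 + 7 * p + 8" if "[q = 1] (mod p)" "\<not> [q = 1] (mod p ^ 2)"
  proof -
    have "gcd (p ^ 2) (q - 1) dvd p ^ 2" by simp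
    then obtain i where i: "i \<le> 2" "gcd (p ^ 2) (q - 1) = p ^ i" using divides_primepow_nat[OF p] by blast
    have "p dvd gcd (p ^ 2) (q - 1)" using that(1) unfolding cd by simp
    moreover have "\<not> p ^ 2 dvd gcd (p ^ 2) (q - 1)" using that(2) unfolding cd by (meson dvd_trans gcd_dvd2)
    ultimately have "i \<noteq> 0" "i \<noteq> 2" unfolding i(2) using p2 by (intro notI; simp)+
    then have "i = 1" using i(1) by linarith
    then have M: "gcd (p ^ 2) (q - 1) = p * 1" using i(2) by simp
    have "card unit_reps = p" using card_unit_reps(2)[OF M] M by simp
    then show ?thesis using main[OF M] M by (simp add: m power2_eq_square algebra_simps)
  qed
  show "num_skew_braces (p ^ 2 * q) = 6 * p ^ 2 + 6 * p + 8" if "[q = 1] (mod p ^ 2)"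
  proof -
    have "p ^ 2 dvd q - 1" using that unfolding cd .
    then have "gcd (p ^ 2) (q - 1) = p ^ 2" by (simp add: gcd_nat.absorb1)
    then have M: "gcd (p ^ 2) (q - 1) = p * p" by (simp add: power2_eq_square)
    have np: "gcd (p ^ 2) (q - 1) \<noteq> p" using M p2 by simp
    then have "card unit_reps = 2 * p - 1" using card_unit_reps(2)[OF M] by simp
    then show ?thesis using main[OF M] np by (simp add: m power2_eq_square algebra_simps)
  qed
qed

lemma gcd_4_diff_one:
  fixes q :: nat
  shows "[q = 3] (mod 4) \<Longrightarrow> gcd (2 ^ 2) (q - 1) = 2"
    and "[q = 1] (mod 4) \<Longrightarrow> gcd (2 ^ 2) (q - 1) = 4"
proof -
  have red: "gcd (2 ^ 2) (q - 1) = gcd 4 ((q - 1) mod 4)"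
  proof -
    have "gcd 4 (q - 1) = gcd 4 ((q - 1) mod 4)" by (metis gcd_red_nat gcd.commute)
    then show ?thesis by simp
  qed
  show "gcd (2 ^ 2) (q - 1) = 2" if "[q = 3] (mod 4)"
  proof -
    have "q mod 4 = 3" using that by (simp add: cong_def)
    then have "q = 3 + 4 * (q div 4)" by (metis mod_mult_div_eq)
    then have "q - 1 = 2 + 4 * (q div 4)" by linarith
    then have "(q - 1) mod 4 = 2 mod 4" by (metis mod_mult_self2)
    then show ?thesis unfolding red by (simp add: gcd_non_0_nat)
  qed
  show "gcd (2 ^ 2) (q - 1) = 4" if "[q = 1] (mod 4)"
  proof -
    have "q mod 4 = 1" using that by (simp add: cong_def)
    then have "q = 1 + 4 * (q div 4)" by (metis mod_mult_div_eq)
    then have "q - 1 = 0 + 4 * (q div 4)" by linarith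
    then have "(q - 1) mod 4 = 0 mod 4" by (metis mod_mult_self2)
    then show ?thesis unfolding red by simp
  qed
qed

text \<open>Since \<open>tri 2 = 1\<close>, the values of \<open>\<kappa>\<close> exchange roles
  when \<open>\<epsilon> = 1\<close>: the cyclic count \<open>num_classes_1\<close> now belongs to
  \<open>\<kappa> = 0\<close>. In the order of the summands the totals are
  \<open>8 + 6 + 6 + 9\<close> for \<open>M = 2\<close> and \<open>8 + 9 + 17 + 9\<close> for
  \<open>M = 4\<close>.\<close>

lemma num_skew_braces_two:
  assumes q: "Factorial_Ring.prime q" and q5: "q \<ge> 5"
  shows "[q = 3] (mod 4) \<Longrightarrow> num_skew_braces (4 * q) = 29"
    and "[q = 1] (mod 4) \<Longrightarrow> num_skew_braces (4 * q) = 43"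
proof -
  obtain \<zeta> where bp: "brace_params 2 q (gcd (2 ^ 2) (q - 1)) \<zeta>"
    using brace_params_exist[OF two_is_prime_nat q] q5 by auto
  interpret brace_params 2 q "gcd (2 ^ 2) (q - 1)" \<zeta> by (rule bp)
  have main: "num_skew_braces (2 ^ 2 * q) = (2 * 2 + 4) + card unit_reps * (2 * 2 - 1) +
      (if gcd (2 ^ 2) (q - 1) = 2 then 2 + 2 * 2 else 2 * 2 ^ 2 + 4 * 2 + 1) + 9"
    if MK: "gcd (2 ^ 2) (q - 1) = 2 * K" for K
  proof (rule num_skew_braces_sum)
    show "num_classes 0 0 (2 * 2 + 4)" by (rule num_classes_0_0[OF MK])
    have "[0 + tri (int 2) = 1] (mod int 2)" by (simp add: tri_def)
    then show "num_classes 0 1 (card unit_reps * (2 * 2 - 1))" by (intro num_classes_1[OF MK]) auto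
    show "num_classes 1 0 (if gcd (2 ^ 2) (q - 1) = 2 then 2 + 2 * 2 else 2 * 2 ^ 2 + 4 * 2 + 1)"
      by (rule num_classes_1_0[OF MK])
    show "num_classes 1 1 9" by (rule num_classes_1_1_two[OF MK refl])
  qed
  show "num_skew_braces (4 * q) = 29" if "[q = 3] (mod 4)"
  proof -
    have "gcd (2 ^ 2) (q - 1) = 2" using that by (rule gcd_4_diff_one)
    then have M: "gcd (2 ^ 2) (q - 1) = 2 * 1" by simp
    have "card unit_reps = 2" using card_unit_reps(2)[OF M] M by simp
    then show ?thesis using main[OF M] M by simp
  qed
  show "num_skew_braces (4 * q) = 43" if "[q = 1] (mod 4)"
  proof -
    have "gcd (2 ^ 2) (q - 1) = 4" using that by (rule gcd_4_diff_one)
    then have M: "gcd (2 ^ 2) (q - 1) = 2 * 2" by simp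
    have "card unit_reps = 3" using card_unit_reps(2)[OF M] M by simp
    then show ?thesis using main[OF M] M by simp
  qed
qed

theorem theorem7p1:
  fixes p q :: nat
  assumes "Factorial_Ring.prime p" and "Factorial_Ring.prime q"
  shows
    "(q \<ge> 5 \<longrightarrow>
        ([q = 3] (mod 4) \<longrightarrow> num_skew_braces (4 * q) = 29) \<and>
        ([q = 1] (mod 4) \<longrightarrow> num_skew_braces (4 * q) = 43)) \<and>
     (q > p + 1 \<and> p + 1 > 3 \<longrightarrow>
        (\<not> [q = 1] (mod p) \<longrightarrow> num_skew_braces (p ^ 2 * q) = 4) \<and>
        ([q = 1] (mod p) \<and> \<not> [q = 1] (mod p ^ 2) \<longrightarrow>
          num_skew_braces (p ^ 2 * q) = 2 * p ^ 2 + 7 * p + 8) \<and>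
        ([q = 1] (mod p ^ 2) \<longrightarrow>
          num_skew_braces (p ^ 2 * q) = 6 * p ^ 2 + 6 * p + 8))"
  using num_skew_braces_two[OF assms(2)] num_skew_braces_odd[OF assms] by auto

end
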